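(* Let $M$ be a closed oriented hyperbolic surface with universal cover $\tilde M$, let $\lambda$ be an oriented geodesic lamination on $M$ with preimage $\tilde\lambda\subset\tilde M$, and let $\tilde v:\tilde M\to\mathbb{R}$ be a function such that (i) $\tilde v$ is equivariant under a homomorphism $\alpha:\pi_1(M)\to\mathbb{R}$, i.e. $\tilde v(\gamma z)=\tilde v(z)+\alpha(\gamma)$; (ii) $\tilde v$ is constant on each open plaque (connected component) of $\tilde M\setminus\tilde\lambda$; (iii) $\tilde v$ is locally bounded. Then $\tilde v$ defines a transverse cocycle $\nu$ for $\lambda$, given as follows: for an admissible transversal $f:[l,m]\to M$ which is positively transverse, $\nu(f)=\tilde v(S_m)-\tilde v(S_l)$, where $S_l,S_m$ are the plaques containing the endpoints $\tilde f(l),\tilde f(m)$ of a lift; for $f$ negatively transverse, $\nu(f)=-(\tilde v(S_m)-\tilde v(S_l))$; and for general $f$, $\nu(f)=\sum_i\nu(f_i)$ over the pieces $f_i$ of a good subdivision. Moreover, if $\nu$ is a transverse measure, then $\tilde v$ is locally of bounded variation.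
   Context: A geodesic lamination $\lambda$ is a closed subset that is a disjoint union of simple complete geodesics (leaves). A flow box is a bi-Lipschitz homeomorphism $F:[a,b]\times[c,d]\to R\subset M$, $F=F(t,s)$, with $F^{-1}(\lambda)=[a,b]\times K$ for some closed $K\subset(c,d)$ of Hausdorff dimension $0$. $\lambda$ is oriented if a neighborhood of it is covered by flow boxes that preserve orientation (product orientation $dt\wedge ds$ on the rectangle) and such that the given orientation of each leaf corresponds to increasing $t$ (oriented flow boxes). A continuous path $f:[l,m]\to M$ is an admissible transversal if $f(l),f(m)\notin\lambda$ and for each $k$ with $f(k)\in\lambda$ there are a flow box $F$ at $f(k)$ and $\eta>0$ such that $p_2\circ F^{-1}\circ f$ is a homeomorphism of $[k-\eta,k+\eta]$ onto its image ($p_2$ = projection to $[c,d]$). It is positively (negatively) transverse if for oriented flow boxes these functions are increasing (decreasing) near each such $k$. A good subdivision is $l=l_0<\dots<l_N=m$ with $f(l_i)\notin\lambda$ and the pieces $f_i=f|_{[l_{i-1},l_i]}$ alternately positively and negatively transverse; every admissible transversal has one. A transverse cocycle is a map $c$ from admissible transversals to $\mathbb{R}$ such that: $c(f)=c(f_1)+c(f_2)$ whenever $f$ is split into subarcs $f_1,f_2$ at a point not on $\lambda$; $c(f)=c(f')$ if $f$ is carried to $f'$ by a homotopy that preserves $\lambda$ and is transverse to $\lambda$; and $c(f)=c(f^-)$ where $f^-$ is $f$ reversed. A transverse measure is an assignment of a measure to the local leaf space $[c,d]$ of every flow box, supported in $K$ (possibly on a smaller set), preserved by coordinate changes; a transverse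 cocycle $c$ is a transverse measure iff $c(f)\ge0$ for every positively transverse $f$. *)

theory Defs
  imports "HOL-Complex_Analysis.Complex_Analysis"
begin

section \<open>Closed oriented hyperbolic surfaces\<close>

definition hyp_plane :: "complex set" where
  "hyp_plane = {z. 0 < Im z}"

definition hyp_dist :: "complex \<Rightarrow> complex \<Rightarrow> real" where
  "hyp_dist z w = arcosh (1 + (cmod (z - w))\<^sup>2 / (2 * Im z * Im w))"

text \<open>The deck group of \<open>p\<close>, acting on the universal cover; this is the fundamental group of the
  base. Elements are extensional functions, so that they are determined by their restriction to
  the half plane, and the group law is \<^term>\<open>compose hyp_plane\<close>.\<close>

definition deck_group :: "(complex \<Rightarrow> 'm) \<Rightarrow> (complex \<Rightarrow> complex) set" where
  "deck_group p = {\<gamma> \<in> extensional hyp_plane.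
     (\<exists>\<delta>. homeomorphism hyp_plane hyp_plane \<gamma> \<delta>) \<and> (\<forall>z\<in>hyp_plane. p (\<gamma> z) = p z)}"

text \<open>A closed oriented hyperbolic surface \<open>M\<close> together with its universal covering \<open>p\<close> by the
  hyperbolic plane. The metric of \<open>M\<close> is the quotient metric; this makes \<open>p\<close> a local isometry and
  the deck transformations hyperbolic isometries. Among isometries the holomorphic ones are those
  that preserve the orientation, so \<open>M\<close> is oriented by the standard orientation of the plane.\<close>

definition closed_oriented_hyperbolic_surface ::
    "(complex \<Rightarrow> 'm::metric_space) \<Rightarrow> 'm set \<Rightarrow> bool" where
  "closed_oriented_hyperbolic_surface p M \<longleftrightarrow>
     compact M \<and> covering_space hyp_plane p M \<and>
     (\<forall>z\<in>hyp_plane. \<forall>w\<in>hyp_plane.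
        dist (p z) (p w) = (INF w'\<in>{w'\<in>hyp_plane. p w' = p w}. hyp_dist z w')) \<and>
     (\<forall>\<gamma>\<in>deck_group p. \<gamma> holomorphic_on hyp_plane)"


section \<open>Geodesic laminations\<close>

text \<open>Unit speed complete geodesics of the surface. Simplicity means that the only coincidences
  \<open>g s = g t\<close> come from a period of \<open>g\<close>, so simple closed geodesics are included.\<close>

definition simple_complete_geodesic :: "(complex \<Rightarrow> 'm) \<Rightarrow> (real \<Rightarrow> 'm) \<Rightarrow> bool" where
  "simple_complete_geodesic p g \<longleftrightarrow>
     (\<exists>h. (\<forall>t. h t \<in> hyp_plane) \<and> (\<forall>s t. hyp_dist (h s) (h t) = \<bar>s - t\<bar>) \<and> (\<forall>t. g t = p (h t))) \<and>
     (\<forall>s t. g s = g t \<longrightarrow> (\<forall>u. g (s + u) = g (t + u)))"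

definition geodesic_lamination ::
    "(complex \<Rightarrow> 'm::metric_space) \<Rightarrow> 'm set \<Rightarrow> 'm set \<Rightarrow> bool" where
  "geodesic_lamination p M \<Lambda> \<longleftrightarrow>
     \<Lambda> \<subseteq> M \<and> closedin (top_of_set M) \<Lambda> \<and>
     (\<exists>\<L>. disjoint \<L> \<and> \<Union>\<L> = \<Lambda> \<and>
        (\<forall>L\<in>\<L>. \<exists>g. simple_complete_geodesic p g \<and> L = range g))"

text \<open>An orientation of the leaves of \<open>\<Lambda>\<close>, encoded as a set \<open>Or\<close> of unit speed parametrisations of
  the leaves: two of them whose images meet differ by a translation of the parameter, so the images
  are pairwise equal or disjoint, and each leaf gets exactly one direction.\<close>

definition leaf_orientation ::
    "(complex \<Rightarrow> 'm) \<Rightarrow> 'm set \<Rightarrow> (real \<Rightarrow> 'm) set \<Rightarrow> bool" where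
  "leaf_orientation p \<Lambda> Or \<longleftrightarrow>
     (\<forall>g\<in>Or. simple_complete_geodesic p g) \<and> (\<Union>g\<in>Or. range g) = \<Lambda> \<and>
     (\<forall>g\<in>Or. \<forall>h\<in>Or. range g \<inter> range h \<noteq> {} \<longrightarrow> (\<exists>a. \<forall>t. h t = g (t + a)))"

definition lamination_lift :: "(complex \<Rightarrow> 'm) \<Rightarrow> 'm set \<Rightarrow> complex set" where
  "lamination_lift p \<Lambda> = {z \<in> hyp_plane. p z \<in> \<Lambda>}"

definition plaque :: "(complex \<Rightarrow> 'm) \<Rightarrow> 'm set \<Rightarrow> complex \<Rightarrow> complex set" where
  "plaque p \<Lambda> z = connected_component_set (hyp_plane - lamination_lift p \<Lambda>) z"


section \<open>Hausdorff dimension\<close>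

definition hausdorff_content :: "real \<Rightarrow> real \<Rightarrow> 'a::metric_space set \<Rightarrow> ennreal" where
  "hausdorff_content s \<delta> A =
     (INF U\<in>{U :: nat \<Rightarrow> 'a set. A \<subseteq> (\<Union>i. U i) \<and> (\<forall>i. bounded (U i) \<and> diameter (U i) \<le> \<delta>)}.
        \<Sum>i. ennreal (diameter (U i) powr s))"

definition hausdorff_measure :: "real \<Rightarrow> 'a::metric_space set \<Rightarrow> ennreal" where
  "hausdorff_measure s A = (SUP \<delta>\<in>{0<..}. hausdorff_content s \<delta> A)"

definition hausdorff_dim :: "'a::metric_space set \<Rightarrow> ennreal" where
  "hausdorff_dim A = (INF s\<in>{s. 0 < s \<and> hausdorff_measure s A = 0}. ennreal s)"


section \<open>Flow boxes\<close>

text \<open>The map \<open>F(t,s)\<close> on \<open>[tmin,tmax] \<times> [smin,smax]\<close> is \<open>chart\<close>; \<open>slice\<close> is the set \<open>K\<close>.\<close>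

record 'm flow_box_data =
  tmin :: real
  tmax :: real
  smin :: real
  smax :: real
  slice :: "real set"
  chart :: "real \<times> real \<Rightarrow> 'm"

definition rect :: "'m flow_box_data \<Rightarrow> (real \<times> real) set" where
  "rect B = {tmin B..tmax B} \<times> {smin B..smax B}"

definition open_rect :: "'m flow_box_data \<Rightarrow> (real \<times> real) set" where
  "open_rect B = {tmin B<..<tmax B} \<times> {smin B<..<smax B}"

definition flow_box :: "'m::metric_space set \<Rightarrow> 'm set \<Rightarrow> 'm flow_box_data \<Rightarrow> bool" where
  "flow_box M \<Lambda> B \<longleftrightarrow>
     tmin B < tmax B \<and> smin B < smax B \<and> chart B ` rect B \<subseteq> M \<and>
     (\<exists>C>0. \<forall>x\<in>rect B. \<forall>y\<in>rect B.
        dist x y / C \<le> dist (chart B x) (chart B y) \<and> dist (chart B x) (chart B y) \<le> C * dist x y) \<and>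
     closed (slice B) \<and> slice B \<subseteq> {smin B<..<smax B} \<and> hausdorff_dim (slice B) = 0 \<and>
     {x \<in> rect B. chart B x \<in> \<Lambda>} = {tmin B..tmax B} \<times> slice B"

text \<open>A homeomorphism into the surface preserves orientation if it has local degree one. Here this
  is expressed in the plane, through a lift \<open>G\<close> to the universal cover: the image of the
  counterclockwise boundary of the rectangle winds once around the image of each interior point.
  (The plane of the parameters \<open>(t,s)\<close> is identified with \<open>complex\<close> by \<open>t + \<i> s\<close>.)\<close>

definition orientation_preserving_box :: "(complex \<Rightarrow> 'm) \<Rightarrow> 'm flow_box_data \<Rightarrow> bool" where
  "orientation_preserving_box p B \<longleftrightarrow>
     (\<exists>G. continuous_on (rect B) G \<and> G ` rect B \<subseteq> hyp_plane \<and> (\<forall>x\<in>rect B. p (G x) = chart B x) \<and>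
        (\<forall>x\<in>open_rect B.
           winding_number ((\<lambda>z. G (Re z, Im z)) \<circ>
               rectpath (Complex (tmin B) (smin B)) (Complex (tmax B) (smax B))) (G x) = 1))"

definition oriented_flow_box ::
    "(complex \<Rightarrow> 'm::metric_space) \<Rightarrow> 'm set \<Rightarrow> 'm set \<Rightarrow> (real \<Rightarrow> 'm) set \<Rightarrow> 'm flow_box_data \<Rightarrow> bool" where
  "oriented_flow_box p M \<Lambda> Or B \<longleftrightarrow>
     flow_box M \<Lambda> B \<and> orientation_preserving_box p B \<and>
     (\<forall>s\<in>slice B. \<exists>g\<in>Or. \<exists>\<theta>. continuous_on {tmin B..tmax B} \<theta> \<and> strict_mono_on {tmin B..tmax B} \<theta> \<and>
        (\<forall>t\<in>{tmin B..tmax B}. chart B (t, s) = g (\<theta> t)))"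

definition oriented_geodesic_lamination ::
    "(complex \<Rightarrow> 'm::metric_space) \<Rightarrow> 'm set \<Rightarrow> 'm set \<Rightarrow> (real \<Rightarrow> 'm) set \<Rightarrow> bool" where
  "oriented_geodesic_lamination p M \<Lambda> Or \<longleftrightarrow>
     geodesic_lamination p M \<Lambda> \<and> leaf_orientation p \<Lambda> Or \<and>
     (\<forall>x\<in>\<Lambda>. \<exists>B. oriented_flow_box p M \<Lambda> Or B \<and> x \<in> chart B ` open_rect B)"


section \<open>Transversals\<close>

text \<open>A path is a function of type \<open>real \<Rightarrow> 'm\<close> together with the endpoints \<open>l < m\<close> of its domain;
  only its values on \<open>{l..m}\<close> matter. The function \<open>transverse_coord B f\<close> is
  \<open>p\<^sub>2 \<circ> F\<^sup>-\<^sup>1 \<circ> f\<close>.\<close>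

definition transverse_coord :: "'m flow_box_data \<Rightarrow> (real \<Rightarrow> 'm) \<Rightarrow> real \<Rightarrow> real" where
  "transverse_coord B f = snd \<circ> inv_into (rect B) (chart B) \<circ> f"

definition crosses_box :: "'m::metric_space flow_box_data \<Rightarrow> (real \<Rightarrow> 'm) \<Rightarrow> real set \<Rightarrow> bool" where
  "crosses_box B f I \<longleftrightarrow>
     f ` I \<subseteq> chart B ` rect B \<and>
     (\<exists>h. homeomorphism I (transverse_coord B f ` I) (transverse_coord B f) h)"

definition admissible_transversal ::
    "'m::metric_space set \<Rightarrow> 'm set \<Rightarrow> real \<Rightarrow> real \<Rightarrow> (real \<Rightarrow> 'm) \<Rightarrow> bool" where
  "admissible_transversal M \<Lambda> l m f \<longleftrightarrow>
     l < m \<and> continuous_on {l..m} f \<and> f ` {l..m} \<subseteq> M \<and> f l \<notin> \<Lambda> \<and> f m \<notin> \<Lambda> \<and>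
     (\<forall>k\<in>{l..m}. f k \<in> \<Lambda> \<longrightarrow>
        (\<exists>B. \<exists>\<eta>>0. flow_box M \<Lambda> B \<and> f k \<in> chart B ` open_rect B \<and>
           {k - \<eta>..k + \<eta>} \<subseteq> {l..m} \<and> crosses_box B f {k - \<eta>..k + \<eta>}))"

definition positively_transverse ::
    "(complex \<Rightarrow> 'm::metric_space) \<Rightarrow> 'm set \<Rightarrow> 'm set \<Rightarrow> (real \<Rightarrow> 'm) set \<Rightarrow>
      real \<Rightarrow> real \<Rightarrow> (real \<Rightarrow> 'm) \<Rightarrow> bool" where
  "positively_transverse p M \<Lambda> Or l m f \<longleftrightarrow>
     admissible_transversal M \<Lambda> l m f \<and>
     (\<forall>k\<in>{l..m}. f k \<in> \<Lambda> \<longrightarrow>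
        (\<exists>B. \<exists>\<eta>>0. oriented_flow_box p M \<Lambda> Or B \<and> f k \<in> chart B ` open_rect B \<and>
           {k - \<eta>..k + \<eta>} \<subseteq> {l..m} \<and> crosses_box B f {k - \<eta>..k + \<eta>} \<and>
           strict_mono_on {k - \<eta>..k + \<eta>} (transverse_coord B f)))"

definition negatively_transverse ::
    "(complex \<Rightarrow> 'm::metric_space) \<Rightarrow> 'm set \<Rightarrow> 'm set \<Rightarrow> (real \<Rightarrow> 'm) set \<Rightarrow>
      real \<Rightarrow> real \<Rightarrow> (real \<Rightarrow> 'm) \<Rightarrow> bool" where
  "negatively_transverse p M \<Lambda> Or l m f \<longleftrightarrow>
     admissible_transversal M \<Lambda> l m f \<and>
     (\<forall>k\<in>{l..m}. f k \<in> \<Lambda> \<longrightarrow>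
        (\<exists>B. \<exists>\<eta>>0. oriented_flow_box p M \<Lambda> Or B \<and> f k \<in> chart B ` open_rect B \<and>
           {k - \<eta>..k + \<eta>} \<subseteq> {l..m} \<and> crosses_box B f {k - \<eta>..k + \<eta>} \<and>
           strict_antimono_on {k - \<eta>..k + \<eta>} (transverse_coord B f)))"

text \<open>The subdivision points are \<open>x 0 < \<dots> < x N\<close>; the pieces have alternating signs, and the first
  one may have either sign.\<close>

definition good_subdivision ::
    "(complex \<Rightarrow> 'm::metric_space) \<Rightarrow> 'm set \<Rightarrow> 'm set \<Rightarrow> (real \<Rightarrow> 'm) set \<Rightarrow>
      real \<Rightarrow> real \<Rightarrow> (real \<Rightarrow> 'm) \<Rightarrow> nat \<Rightarrow> (nat \<Rightarrow> real) \<Rightarrow> bool" where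
  "good_subdivision p M \<Lambda> Or l m f N x \<longleftrightarrow>
     0 < N \<and> x 0 = l \<and> x N = m \<and> (\<forall>i<N. x i < x (Suc i)) \<and> (\<forall>i\<le>N. f (x i) \<notin> \<Lambda>) \<and>
     (\<exists>r :: nat. \<forall>i<N.
        if even (i + r) then positively_transverse p M \<Lambda> Or (x i) (x (Suc i)) f
        else negatively_transverse p M \<Lambda> Or (x i) (x (Suc i)) f)"


section \<open>Transverse cocycles and transverse measures\<close>

text \<open>A homotopy through admissible transversals under which each point of the path stays on, or
  off, the lamination. All paths are rescaled affinely to the unit interval, so transversals with
  different domains can be compared; in particular paths that agree on \<open>{l..m}\<close> are homotopic.\<close>

definition transverse_homotopic ::
    "'m::metric_space set \<Rightarrow> 'm set \<Rightarrow> real \<Rightarrow> real \<Rightarrow> (real \<Rightarrow> 'm) \<Rightarrow>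
      real \<Rightarrow> real \<Rightarrow> (real \<Rightarrow> 'm) \<Rightarrow> bool" where
  "transverse_homotopic M \<Lambda> l m f l' m' f' \<longleftrightarrow>
     (\<exists>H :: real \<times> real \<Rightarrow> 'm.
        continuous_on ({0..1} \<times> {0..1}) H \<and>
        (\<forall>x\<in>{0..1}. H (0, x) = f (l + x * (m - l)) \<and> H (1, x) = f' (l' + x * (m' - l'))) \<and>
        (\<forall>u\<in>{0..1}. admissible_transversal M \<Lambda> 0 1 (\<lambda>x. H (u, x))) \<and>
        (\<forall>u\<in>{0..1}. \<forall>x\<in>{0..1}. H (u, x) \<in> \<Lambda> \<longleftrightarrow> H (0, x) \<in> \<Lambda>))"

definition transverse_cocycle ::
    "'m::metric_space set \<Rightarrow> 'm set \<Rightarrow> (real \<Rightarrow> real \<Rightarrow> (real \<Rightarrow> 'm) \<Rightarrow> real) \<Rightarrow> bool" where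
  "transverse_cocycle M \<Lambda> c \<longleftrightarrow>
     (\<forall>l k m f. admissible_transversal M \<Lambda> l m f \<and> l < k \<and> k < m \<and> f k \<notin> \<Lambda> \<longrightarrow>
        c l m f = c l k f + c k m f) \<and>
     (\<forall>l m f l' m' f'. admissible_transversal M \<Lambda> l m f \<and> admissible_transversal M \<Lambda> l' m' f' \<and>
        transverse_homotopic M \<Lambda> l m f l' m' f' \<longrightarrow> c l m f = c l' m' f') \<and>
     (\<forall>l m f. admissible_transversal M \<Lambda> l m f \<longrightarrow> c l m f = c l m (\<lambda>t. f (l + m - t)))"

text \<open>A finite Borel measure on the local leaf space of every flow box, supported in \<open>K\<close>. The
  coordinate change from \<open>B\<close> to \<open>B'\<close> is taken along a vertical line \<open>{t} \<times> A\<close> of \<open>B\<close>; injectivity is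
  needed because a leaf may pass through \<open>B\<close> several times while it stays in one horizontal of \<open>B'\<close>.
  Finite Borel measures are determined by their values on compact sets.\<close>

definition transverse_measure ::
    "'m::metric_space set \<Rightarrow> 'm set \<Rightarrow> ('m flow_box_data \<Rightarrow> real measure) \<Rightarrow> bool" where
  "transverse_measure M \<Lambda> \<mu> \<longleftrightarrow>
     (\<forall>B. flow_box M \<Lambda> B \<longrightarrow>
        sets (\<mu> B) = sets borel \<and> finite_measure (\<mu> B) \<and> emeasure (\<mu> B) (- slice B) = 0) \<and>
     (\<forall>B B' t A. let h = transverse_coord B' (\<lambda>s. chart B (t, s)) in
        flow_box M \<Lambda> B \<and> flow_box M \<Lambda> B' \<and> t \<in> {tmin B..tmax B} \<and> compact A \<and> A \<subseteq> slice B \<and>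
        chart B ` ({t} \<times> A) \<subseteq> chart B' ` rect B' \<and> inj_on h A \<longrightarrow>
        emeasure (\<mu> B) A = emeasure (\<mu> B') (h ` A))"

text \<open>A transverse measure is regarded as a cocycle by evaluating it on transversals. By additivity
  it is enough to say this for a transversal that crosses a single flow box.\<close>

definition is_transverse_measure ::
    "'m::metric_space set \<Rightarrow> 'm set \<Rightarrow> (real \<Rightarrow> real \<Rightarrow> (real \<Rightarrow> 'm) \<Rightarrow> real) \<Rightarrow> bool" where
  "is_transverse_measure M \<Lambda> c \<longleftrightarrow>
     transverse_cocycle M \<Lambda> c \<and>
     (\<exists>\<mu>. transverse_measure M \<Lambda> \<mu> \<and>
        (\<forall>B l m f. flow_box M \<Lambda> B \<and> admissible_transversal M \<Lambda> l m f \<and> crosses_box B f {l..m} \<longrightarrow>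
           c l m f = measure (\<mu> B) (transverse_coord B f ` {l..m})))"


section \<open>The function on the universal cover\<close>

definition period_homomorphism ::
    "(complex \<Rightarrow> 'm) \<Rightarrow> ((complex \<Rightarrow> complex) \<Rightarrow> real) \<Rightarrow> bool" where
  "period_homomorphism p \<alpha> \<longleftrightarrow>
     (\<forall>\<gamma>\<in>deck_group p. \<forall>\<delta>\<in>deck_group p. \<alpha> (compose hyp_plane \<gamma> \<delta>) = \<alpha> \<gamma> + \<alpha> \<delta>)"

definition locally_bounded_on :: "complex set \<Rightarrow> (complex \<Rightarrow> real) \<Rightarrow> bool" where
  "locally_bounded_on \<Omega> v \<longleftrightarrow> (\<forall>z\<in>\<Omega>. \<exists>U. open U \<and> z \<in> U \<and> bounded (v ` (U \<inter> \<Omega>)))"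

text \<open>Functions of locally bounded variation on an open subset of the plane: the distributional
  gradient is a Radon measure. \<open>D\<close> is the derivative of the test field \<open>\<phi>\<close>, so the factor of \<open>v z\<close>
  is the divergence of \<open>\<phi>\<close>. The notion is local and does not change if the Euclidean metric is
  replaced by another smooth metric such as the hyperbolic one.\<close>

definition locally_bounded_variation_on :: "complex set \<Rightarrow> (complex \<Rightarrow> real) \<Rightarrow> bool" where
  "locally_bounded_variation_on \<Omega> v \<longleftrightarrow>
     (\<forall>C. compact C \<and> C \<subseteq> \<Omega> \<longrightarrow>
        v absolutely_integrable_on C \<and>
        (\<exists>V. \<forall>(\<phi> :: complex \<Rightarrow> complex) D.
           (\<forall>z. (\<phi> has_derivative D z) (at z)) \<and>
           continuous_on UNIV (\<lambda>z. D z 1) \<and> continuous_on UNIV (\<lambda>z. D z \<i>) \<and>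
           (\<forall>z. z \<notin> C \<longrightarrow> \<phi> z = 0) \<and> (\<forall>z. cmod (\<phi> z) \<le> 1) \<longrightarrow>
           \<bar>LINT z:C|lebesgue. v z * (Re (D z 1) + Im (D z \<i>))\<bar> \<le> V))"

definition path_lift ::
    "(complex \<Rightarrow> 'm) \<Rightarrow> real \<Rightarrow> real \<Rightarrow> (real \<Rightarrow> 'm) \<Rightarrow> (real \<Rightarrow> complex) \<Rightarrow> bool" where
  "path_lift p l m f g \<longleftrightarrow>
     continuous_on {l..m} g \<and> g ` {l..m} \<subseteq> hyp_plane \<and> (\<forall>t\<in>{l..m}. p (g t) = f t)"

text \<open>The rules that give \<open>\<nu>\<close> in terms of \<open>v\<close>. The value of \<open>v\<close> on a plaque is its value at an
  arbitrary point of it; the rules are imposed for all lifts and all good subdivisions.\<close>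

definition induced_by ::
    "(complex \<Rightarrow> 'm::metric_space) \<Rightarrow> 'm set \<Rightarrow> 'm set \<Rightarrow> (real \<Rightarrow> 'm) set \<Rightarrow> (complex \<Rightarrow> real) \<Rightarrow>
      (real \<Rightarrow> real \<Rightarrow> (real \<Rightarrow> 'm) \<Rightarrow> real) \<Rightarrow> bool" where
  "induced_by p M \<Lambda> Or v \<nu> \<longleftrightarrow>
     (\<forall>l m f g. positively_transverse p M \<Lambda> Or l m f \<and> path_lift p l m f g \<longrightarrow>
        (\<forall>x\<in>plaque p \<Lambda> (g l). \<forall>y\<in>plaque p \<Lambda> (g m). \<nu> l m f = v y - v x)) \<and>
     (\<forall>l m f g. negatively_transverse p M \<Lambda> Or l m f \<and> path_lift p l m f g \<longrightarrow>
        (\<forall>x\<in>plaque p \<Lambda> (g l). \<forall>y\<in>plaque p \<Lambda> (g m). \<nu> l m f = - (v y - v x))) \<and>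
     (\<forall>l m f N x. admissible_transversal M \<Lambda> l m f \<and> good_subdivision p M \<Lambda> Or l m f N x \<longrightarrow>
        \<nu> l m f = (\<Sum>i<N. \<nu> (x i) (x (Suc i)) f))"

end

theory Submission
  imports Defs
begin

text \<open>Every geodesic of the half plane is straightened to the real axis by a holomorphic chart, so its
  left side is where the imaginary part of the chart is positive. A winding number argument shows that
  an oriented flow box maps increasing transverse coordinates from right to left across each leaf.
  Hence the sign of a crossing depends only on the transversal and not on the flow box, and it is
  locally constant in a homotopy that preserves the lamination. Since the slice of a flow box has
  dimension zero, every flow box becomes oriented near a given point after reflections of its
  coordinates, so every admissible transversal is a finite union of signed pieces. The signed sum of
  the jumps of \<open>v\<close> over the pieces does not depend on the subdivision and defines \<open>\<nu>\<close>.

  If \<open>\<nu>\<close> is a transverse measure, then \<open>v\<close> increases across the leaves, so near each point a superlevel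
  set of \<open>v\<close> is, up to a null set, one side of a leaf. It or its complement is convex, so Fubini's theorem
  bounds its perimeter in a rectangle by the perimeter of the rectangle, and integration over the
  levels bounds the variation of \<open>v\<close> on small rectangles. Bisection covers all rectangles.\<close>

text \<open>Flow boxes are only bi-Lipschitz, and the sign of a crossing is defined by the existence
  of some oriented box, so two boxes at one crossing cannot be compared by derivatives. Each is
  compared instead with the chart of a lifted leaf, where the sign of the imaginary part just after
  the crossing involves no box. The choice of lifts is harmless because deck transformations are
  holomorphic and injective and so keep winding numbers. In a homotopy no box has to follow the
  deformation: a continuous real function without zeros on an interval keeps its sign. Good
  subdivisions alternate in sign, and neither refining nor joining them preserves this. The sums are
  therefore studied on chains of signed pieces, where alternation is dropped. On the lamination
  itself \<open>v\<close> is constrained only by equivariance and local boundedness, so everything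
  about its levels holds up to the lamination. That this is a null set rests on the quotient metric:
  distances in the plane are locally bounded by distances in \<open>M\<close>, which makes lifts of
  bi-Lipschitz boxes locally Lipschitz. The number of leaves never enters the variation bound, since
  each level costs only one side of one leaf.\<close>

section \<open>Lifting maps through a covering of a metric space\<close>

lemma kuratowski_embedding:
  obtains e :: "'m::metric_space \<Rightarrow> ('m \<Rightarrow>\<^sub>C real)" where "\<And>x y. dist (e x) (e y) = dist x y"
proof -
  fix x0 :: 'm
  \<comment> \<open>Subtracting the distance to a base point keeps the function bounded, by
    \<open>dist x x0\<close>, even if the space is unbounded. Evaluation at \<open>y\<close>
    recovers the whole distance from \<open>x\<close> to \<open>y\<close>.\<close>
  define e where "e x = Bcontfun (\<lambda>z. dist x z - dist x0 z)" for x :: 'm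
  have bc: "(\<lambda>z. dist x z - dist x0 z) \<in> bcontfun" for x
  proof (rule bcontfun_normI)
    show "continuous_on UNIV (\<lambda>z. dist x z - dist x0 z)" by (intro continuous_intros)
    show "norm (dist x z - dist x0 z) \<le> dist x x0" for z
      by (metis abs_dist_diff_le dist_commute real_norm_def)
  qed
  have app: "e x z = dist x z - dist x0 z" for x z
    unfolding e_def by (simp add: Bcontfun_inverse bc)
  have "dist (e x) (e y) = dist x y" for x y
  proof (rule antisym)
    show "dist (e x) (e y) \<le> dist x y"
      by (rule dist_bound) (simp add: app dist_real_def, metis abs_dist_diff_le dist_commute)
    have "dist (e x y) (e y y) \<le> dist (e x) (e y)" by (rule dist_bounded)
    then show "dist x y \<le> dist (e x) (e y)" by (simp add: app dist_real_def)
  qed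
  then show ?thesis using that by blast
qed

lemma covering_space_postcompose_homeomorphism:
  assumes c: "covering_space C p S" and h: "homeomorphism S T e d"
  shows "covering_space C (e \<circ> p) T"
proof
  have pC: "p ` C = S" using c by (simp add: covering_space_def)
  show "continuous_on C (e \<circ> p)"
    using c h pC by (metis continuous_on_compose covering_space_imp_continuous homeomorphism_cont1)
  show "(e \<circ> p) ` C = T"
    using h pC by (metis homeomorphism_image1 image_comp)
  fix y assume y: "y \<in> T"
  then have "d y \<in> S" using h by (metis homeomorphism_image2 imageI)
  then obtain U v where U: "d y \<in> U" "openin (top_of_set S) U" and v: "\<Union>v = C \<inter> p -` U"
      "\<forall>u \<in> v. openin (top_of_set C) u" "pairwise disjnt v" "\<forall>u \<in> v. \<exists>q. homeomorphism u U p q"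
    using c unfolding covering_space_def by metis
  have US: "U \<subseteq> S" using U(2) by (rule openin_imp_subset)
  have op: "openin (top_of_set T) (e ` U)"
    using h U(2) by (metis homeomorphism_imp_open_map)
  have hU: "homeomorphism U (e ` U) e d"
    using h US by (metis homeomorphism_of_subsets order_refl homeomorphism_image1 image_mono)
  have eq: "\<Union>v = C \<inter> (e \<circ> p) -` (e ` U)"
  proof -
    have "inj_on e S" using h unfolding homeomorphism_def by (metis homeomorphism_apply1 inj_onI)
    then have "e (p x) \<in> e ` U \<longleftrightarrow> p x \<in> U" if "x \<in> C" for x
      using that pC US by (metis image_eqI inj_on_image_mem_iff)
    then have "C \<inter> (e \<circ> p) -` (e ` U) = C \<inter> p -` U" by (auto simp del: image_iff simp: comp_def)
    then show ?thesis using v(1) by simp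
  qed
  have "\<exists>q. homeomorphism u (e ` U) (e \<circ> p) q" if "u \<in> v" for u
    using v(4) that hU homeomorphism_compose by metis
  moreover have "y \<in> e ` U" using y h U(1) by (metis homeomorphism_apply2 imageI)
  ultimately show "\<exists>U. y \<in> U \<and> openin (top_of_set T) U \<and> (\<exists>v. \<Union>v = C \<inter> (e \<circ> p) -` U \<and>
      (\<forall>u \<in> v. openin (top_of_set C) u) \<and> pairwise disjnt v \<and> (\<forall>u \<in> v. \<exists>q. homeomorphism u U (e \<circ> p) q))"
    using op eq v by blast
qed

text \<open>The library lifts maps only between normed spaces; the Kuratowski embedding of the base
  removes this restriction.\<close>

lemma covering_space_lift_metric:
  fixes p :: "'a::real_normed_vector \<Rightarrow> 'b::metric_space"
    and f :: "'c::real_normed_vector \<Rightarrow> 'b"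
  assumes cov: "covering_space C p S" "a \<in> C" "z \<in> U"
      and U: "simply_connected U" "locally path_connected U"
      and contf: "continuous_on U f" and fim: "f ` U \<subseteq> S"
      and feq: "f z = p a"
  obtains g where "continuous_on U g" "g ` U \<subseteq> C" "g z = a" "\<And>y. y \<in> U \<Longrightarrow> p (g y) = f y"
proof -
  obtain e :: "'b \<Rightarrow> ('b \<Rightarrow>\<^sub>C real)" where e: "\<And>x y. dist (e x) (e y) = dist x y"
    using kuratowski_embedding by blast
  have inj: "inj e" by (rule injI) (metis e dist_eq_0_iff)
  have cont: "continuous_on A e" for A
    unfolding continuous_on_iff by (metis e)
  have conti: "continuous_on (e ` S) (inv e)"
    unfolding continuous_on_iff by (auto simp: inv_f_f[OF inj] e)
  have hom: "homeomorphism S (e ` S) e (inv e)"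
    by (rule homeomorphismI[OF cont conti]) (auto simp: inv_f_f[OF inj])
  have cov': "covering_space C (e \<circ> p) (e ` S)"
    by (rule covering_space_postcompose_homeomorphism[OF cov(1) hom])
  have 1: "continuous_on U (e \<circ> f)"
    by (intro continuous_on_compose contf cont)
  have 2: "(e \<circ> f) \<in> U \<rightarrow> e ` S" using fim by auto
  have 3: "(e \<circ> f) z = (e \<circ> p) a" using feq by simp
  show ?thesis
  proof (rule covering_space_lift_strong[OF cov' cov(2,3) U 1 2 3])
    fix g assume g: "continuous_on U g" "g \<in> U \<rightarrow> C" "g z = a"
      "\<And>y. y \<in> U \<Longrightarrow> (e \<circ> p) (g y) = (e \<circ> f) y"
    show ?thesis
    proof (rule that)
      show "continuous_on U g" "g ` U \<subseteq> C" "g z = a" using g by auto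
      show "p (g y) = f y" if "y \<in> U" for y using g(4)[OF that] inj by (simp add: inj_eq)
    qed
  qed
qed

section \<open>The hyperbolic plane\<close>

lemma convex_hyp_plane: "convex hyp_plane"
  unfolding hyp_plane_def by (rule convex_halfspace_Im_gt)

lemma open_hyp_plane: "open hyp_plane"
  unfolding hyp_plane_def by (rule open_halfspace_Im_gt)

lemma hyp_dist_arg_ge_1:
  assumes "z \<in> hyp_plane" "w \<in> hyp_plane"
  shows "1 \<le> 1 + (cmod (z - w))\<^sup>2 / (2 * Im z * Im w)"
  using assms by (simp add: hyp_plane_def)

lemma cosh_hyp_dist:
  assumes "z \<in> hyp_plane" "w \<in> hyp_plane"
  shows "cosh (hyp_dist z w) = 1 + (cmod (z - w))\<^sup>2 / (2 * Im z * Im w)"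
  unfolding hyp_dist_def using hyp_dist_arg_ge_1[OF assms] by (rule cosh_arcosh_real)

lemma hyp_dist_nonneg:
  assumes "z \<in> hyp_plane" "w \<in> hyp_plane"
  shows "0 \<le> hyp_dist z w"
  unfolding hyp_dist_def using hyp_dist_arg_ge_1[OF assms] by (rule arcosh_nonneg_real)

lemma hyp_dist_eq_iff:
  assumes "z \<in> hyp_plane" "w \<in> hyp_plane" "d \<ge> 0"
  shows "hyp_dist z w = d \<longleftrightarrow> cosh d = 1 + (cmod (z - w))\<^sup>2 / (2 * Im z * Im w)"
  using assms cosh_hyp_dist[OF assms(1,2)] hyp_dist_nonneg[OF assms(1,2)]
  by (metis arcosh_cosh_real)

lemma hyp_dist_mono_iff:
  assumes "z \<in> hyp_plane" "w \<in> hyp_plane" "z' \<in> hyp_plane" "w' \<in> hyp_plane"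
  shows "hyp_dist z w \<le> hyp_dist z' w' \<longleftrightarrow>
     (cmod (z - w))\<^sup>2 / (2 * Im z * Im w) \<le> (cmod (z' - w'))\<^sup>2 / (2 * Im z' * Im w')"
proof -
  have "hyp_dist z w \<le> hyp_dist z' w' \<longleftrightarrow> cosh (hyp_dist z w) \<le> cosh (hyp_dist z' w')"
    using hyp_dist_nonneg assms by (metis cosh_real_nonneg_le_iff)
  then show ?thesis by (simp add: cosh_hyp_dist assms)
qed

lemma continuous_on_hyp_dist:
  assumes "continuous_on A f" "continuous_on A g" "f ` A \<subseteq> hyp_plane" "g ` A \<subseteq> hyp_plane"
  shows "continuous_on A (\<lambda>x. hyp_dist (f x) (g x))"
proof -
  have 1: "\<forall>x\<in>A. 2 * Im (f x) * Im (g x) \<noteq> 0" using assms by (auto simp: hyp_plane_def image_subset_iff)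
  have "continuous_on A (\<lambda>x. 1 + (cmod (f x - g x))\<^sup>2 / (2 * Im (f x) * Im (g x)))"
    using 1 by (auto intro!: continuous_intros assms(1,2))
  moreover have "(\<lambda>x. 1 + (cmod (f x - g x))\<^sup>2 / (2 * Im (f x) * Im (g x))) ` A \<subseteq> {1..}"
    using hyp_dist_arg_ge_1 assms(3,4) by (force simp: image_subset_iff)
  ultimately show ?thesis unfolding hyp_dist_def
    using continuous_on_compose2[OF continuous_on_arcosh[OF order.refl]] by blast
qed

lemma hyp_dist_eq_0_iff:
  assumes "z \<in> hyp_plane" "w \<in> hyp_plane"
  shows "hyp_dist z w = 0 \<longleftrightarrow> z = w"
  using hyp_dist_eq_iff[OF assms, of 0] assms by (auto simp: hyp_plane_def)

text \<open>The Cayley transform identifies the hyperbolic distance with the pseudohyperbolic distance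
  \<open>|z - w| / |z - cnj w|\<close>, to which the Schwarz lemma applies.\<close>

lemma norm_diff_cnj:
  "(cmod (z - cnj w))\<^sup>2 = (cmod (z - w))\<^sup>2 + 4 * Im z * Im w"
  unfolding cmod_power2 by (simp add: power2_eq_square algebra_simps)

text \<open>With \<open>x = |z - w|^2 / (Im z * Im w)\<close>, the squared pseudohyperbolic distance
  is \<open>x / (x + 4)\<close> by \<open>norm_diff_cnj\<close>, and \<open>cosh\<close> of the
  hyperbolic distance is \<open>1 + x / 2\<close>. Both increase with \<open>x\<close>.\<close>

lemma hyp_dist_le_iff_pseudo:
  assumes "z \<in> hyp_plane" "w \<in> hyp_plane" "z' \<in> hyp_plane" "w' \<in> hyp_plane"
  shows "hyp_dist z w \<le> hyp_dist z' w' \<longleftrightarrow>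
     cmod ((z - w) / (z - cnj w)) \<le> cmod ((z' - w') / (z' - cnj w'))"
proof -
  let ?A = "(cmod (z - w))\<^sup>2" and ?B = "(cmod (z' - w'))\<^sup>2"
  have pos: "Im z * Im w > 0" "Im z' * Im w' > 0"
    using assms by (auto simp: hyp_plane_def)
  have "cmod ((z - w) / (z - cnj w)) \<le> cmod ((z' - w') / (z' - cnj w')) \<longleftrightarrow>
     (cmod ((z - w) / (z - cnj w)))\<^sup>2 \<le> (cmod ((z' - w') / (z' - cnj w')))\<^sup>2"
    by (simp add: power2_le_iff_abs_le)
  also have "\<dots> \<longleftrightarrow> ?A / (?A + 4 * (Im z * Im w)) \<le> ?B / (?B + 4 * (Im z' * Im w'))"
    by (simp add: norm_divide power_divide norm_diff_cnj mult_ac)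
  also have "\<dots> \<longleftrightarrow> ?A * (Im z' * Im w') \<le> ?B * (Im z * Im w)"
  proof -
    have "?A + 4 * (Im z * Im w) > 0" "?B + 4 * (Im z' * Im w') > 0"
      using pos by (auto intro!: add_nonneg_pos)
    then show ?thesis by (simp add: divide_simps) (auto simp: algebra_simps)
  qed
  also have "\<dots> \<longleftrightarrow> ?A / (2 * Im z * Im w) \<le> ?B / (2 * Im z' * Im w')"
    using pos by (simp add: divide_simps mult_ac)
  finally show ?thesis using hyp_dist_mono_iff[OF assms] by simp
qed

text \<open>The Schwarz lemma concerns maps of the disc that fix 0, so \<open>f\<close> is
  conjugated by Cayley transforms normalised at \<open>w\<close> and at \<open>f w\<close>.
  \<open>C\<close> is the inverse of the first one and sends 0 to \<open>w\<close>.\<close>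

lemma schwarz_pick:
  assumes hol: "f holomorphic_on hyp_plane" and im: "f ` hyp_plane \<subseteq> hyp_plane"
    and z: "z \<in> hyp_plane" and w: "w \<in> hyp_plane"
  shows "hyp_dist (f z) (f w) \<le> hyp_dist z w"
proof -
  define C where "C \<xi> = (w - cnj w * \<xi>) / (1 - \<xi>)" for \<xi> :: complex
  define g where "g \<xi> = (f (C \<xi>) - f w) / (f (C \<xi>) - cnj (f w))" for \<xi>
  have Imw: "Im w > 0" using w by (simp add: hyp_plane_def)
  have fw: "f w \<in> hyp_plane" using im w by auto
  have C: "C \<xi> \<in> hyp_plane" if "norm \<xi> < 1" for \<xi>
  proof -
    have ne: "1 - \<xi> \<noteq> 0" using that by auto
    have "Im (C \<xi>) = Im ((w - cnj w * \<xi>) * cnj (1 - \<xi>)) / (cmod (1 - \<xi>))\<^sup>2"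
      unfolding C_def complex_div_cnj[of "w - cnj w * \<xi>"]
      by (simp add: Im_divide_of_real flip: of_real_power)
    also have "Im ((w - cnj w * \<xi>) * cnj (1 - \<xi>)) = Im w * (1 - (cmod \<xi>)\<^sup>2)"
      unfolding cmod_power2 by (simp add: power2_eq_square algebra_simps)
    also have "\<dots> / (cmod (1 - \<xi>))\<^sup>2 > 0"
      using that ne Imw by (auto intro!: divide_pos_pos mult_pos_pos simp: power_less_one_iff abs_square_less_1)
    finally show ?thesis by (simp add: hyp_plane_def)
  qed
  have ps: "cmod ((u - a) / (u - cnj a)) < 1" "u - cnj a \<noteq> 0" if "u \<in> hyp_plane" "a \<in> hyp_plane" for u a
  proof -
    have 1: "Im (u - cnj a) > 0" using that by (simp add: hyp_plane_def)
    then show "u - cnj a \<noteq> 0" by auto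
    have "(cmod (u - a))\<^sup>2 < (cmod (u - cnj a))\<^sup>2"
      using that by (simp add: norm_diff_cnj hyp_plane_def)
    then have "cmod (u - a) < cmod (u - cnj a)" by (simp add: power_less_imp_less_base)
    then show "cmod ((u - a) / (u - cnj a)) < 1" by (simp add: norm_divide divide_simps)
  qed
  have holC: "C holomorphic_on ball 0 1"
    unfolding C_def by (intro holomorphic_intros) auto
  have "(f \<circ> C) holomorphic_on ball 0 1"
    by (rule holomorphic_on_compose_gen[OF holC hol]) (auto intro: C)
  then have holfC: "(\<lambda>\<xi>. f (C \<xi>)) holomorphic_on ball 0 1" by (simp add: o_def)
  have holg: "g holomorphic_on ball 0 1"
    unfolding g_def using C im fw ps(2) by (intro holomorphic_intros holfC) force
  have g0: "g 0 = 0" by (simp add: g_def C_def)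
  have g1: "norm (g \<xi>) < 1" if "norm \<xi> < 1" for \<xi>
    unfolding g_def using ps(1) C that im fw by blast
  define \<xi> where "\<xi> = (z - w) / (z - cnj w)"
  have \<xi>1: "norm \<xi> < 1" unfolding \<xi>_def using ps(1) z w by blast
  have nz: "z - cnj w \<noteq> 0" using ps(2) z w by blast
  have Cz: "C \<xi> = z"
  proof -
    have "1 - \<xi> \<noteq> 0" using \<xi>1 by auto
    moreover have "w - cnj w * \<xi> = z * (1 - \<xi>)"
      unfolding \<xi>_def using nz by (simp add: divide_simps) (simp add: algebra_simps)
    ultimately show ?thesis by (simp add: C_def)
  qed
  have "norm (g \<xi>) \<le> norm \<xi>"
    using Schwarz_Lemma(1)[OF holg g0 g1 \<xi>1] by simp
  then have "cmod ((f z - f w) / (f z - cnj (f w))) \<le> cmod ((z - w) / (z - cnj w))"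
    by (simp add: g_def Cz) (simp add: \<xi>_def)
  then show ?thesis using hyp_dist_le_iff_pseudo z w im by (simp add: image_subset_iff)
qed

section \<open>Geodesics of the hyperbolic plane\<close>

definition geodesic :: "(real \<Rightarrow> complex) \<Rightarrow> bool" where
  "geodesic h \<longleftrightarrow> (\<forall>t. h t \<in> hyp_plane) \<and> (\<forall>s t. hyp_dist (h s) (h t) = \<bar>s - t\<bar>)"

text \<open>The left side of \<open>h\<close> is where the imaginary part of the chart is positive. A side need not be
  convex in the Euclidean sense, but one of the two is: the sides are bounded by circles or lines.\<close>

definition geodesic_chart :: "(real \<Rightarrow> complex) \<Rightarrow> (complex \<Rightarrow> complex) \<Rightarrow> bool" where
  "geodesic_chart h \<Psi> \<longleftrightarrow> \<Psi> holomorphic_on hyp_plane \<and> inj_on \<Psi> hyp_plane \<and>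
     (\<forall>t. \<Psi> (h t) = of_real t) \<and> (\<forall>z\<in>hyp_plane. Im (\<Psi> z) = 0 \<longrightarrow> z \<in> range h) \<and>
     (convex {z\<in>hyp_plane. 0 < Im (\<Psi> z)} \<or> convex {z\<in>hyp_plane. Im (\<Psi> z) < 0})"

lemma isometry_real_line:
  fixes f :: "real \<Rightarrow> real"
  assumes f: "\<And>s t. \<bar>f s - f t\<bar> = \<bar>s - t\<bar>"
  obtains \<epsilon> where "\<epsilon> = 1 \<or> \<epsilon> = -1" "\<And>t. f t = \<epsilon> * t + f 0"
proof -
  define \<epsilon> where "\<epsilon> = f 1 - f 0"
  have e: "\<epsilon> = 1 \<or> \<epsilon> = -1" using f[of 1 0] by (auto simp: \<epsilon>_def)
  have "f t = \<epsilon> * t + f 0" for t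
    using f[of t 0] f[of t 1] e unfolding \<epsilon>_def by (elim disjE) (simp add: abs_if split: if_splits; linarith)+
  with e that show ?thesis by blast
qed

lemma tanh_artanh_real:
  fixes u :: real
  assumes "\<bar>u\<bar> < 1"
  shows "tanh (artanh u) = u"
proof -
  have q: "(1 + u) / (1 - u) > 0" using assms by simp
  have E: "exp (-2 * artanh u) = (1 - u) / (1 + u)"
    unfolding artanh_def using q by (simp add: exp_minus inverse_eq_divide)
  show ?thesis unfolding tanh_real_altdef E using assms by (simp add: divide_simps)
qed

lemma cosh_hyp_dist':
  assumes "z \<in> hyp_plane" "w \<in> hyp_plane"
  shows "(cmod z)\<^sup>2 + (cmod w)\<^sup>2 - 2 * Re z * Re w = 2 * Im z * Im w * cosh (hyp_dist z w)"
proof -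
  have "2 * Im z * Im w * cosh (hyp_dist z w) = 2 * Im z * Im w + (cmod (z - w))\<^sup>2"
    using assms unfolding cosh_hyp_dist[OF assms] hyp_plane_def by (simp add: field_simps)
  then show ?thesis unfolding cmod_power2 by (simp add: power2_eq_square algebra_simps)
qed

text \<open>This is the Gram determinant of three vectors of the hyperboloid with distances
  \<open>a\<close>, \<open>b\<close> and \<open>a + b\<close>: the diagonal entries are 1 and the
  others are the values of \<open>cosh\<close>.\<close>

lemma gram_det_cosh:
  fixes a b :: real
  shows "1 + 2 * cosh a * cosh (a + b) * cosh b - (cosh a)\<^sup>2 - (cosh (a + b))\<^sup>2 - (cosh b)\<^sup>2 = 0"
proof -
  have "(sinh a)\<^sup>2 = (cosh a)\<^sup>2 - 1" "(sinh b)\<^sup>2 = (cosh b)\<^sup>2 - 1"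
    by (simp_all add: cosh_square_eq)
  then show ?thesis unfolding cosh_add by algebra
qed

text \<open>In the hyperboloid model a point \<open>z\<close> is the vector \<open>(|z|\<^sup>2, Re z, 1) / Im z\<close>, and \<open>cosh\<close> of the
  distance is a bilinear form. The Gram determinant of three points of a geodesic vanishes, so they
  lie on a common plane.\<close>

lemma geodesic_coplanar:
  assumes "geodesic h"
  defines "n \<equiv> \<lambda>t. (cmod (h t))\<^sup>2" and "x \<equiv> \<lambda>t. Re (h t)"
  shows "n s * (x t - x u) - x s * (n t - n u) + (n t * x u - n u * x t) = 0"
proof -
  define y where "y t = Im (h t)" for t
  define a b c where "a = cosh (s - t)" and "b = cosh (s - u)" and "c = cosh (t - u)"
  have H: "h t \<in> hyp_plane" for t using assms by (simp add: geodesic_def)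
  have P: "n p + n q - 2 * x p * x q = 2 * y p * y q * cosh (p - q)" for p q
  proof -
    have "cosh (hyp_dist (h p) (h q)) = cosh (p - q)"
      using assms by (simp add: geodesic_def)
    then show ?thesis using cosh_hyp_dist'[OF H H, of p q] by (simp add: n_def x_def y_def)
  qed
  have N: "n p = (x p)\<^sup>2 + (y p)\<^sup>2" for p by (simp add: n_def x_def y_def cmod_power2)
  have G: "1 + 2 * a * b * c - a\<^sup>2 - b\<^sup>2 - c\<^sup>2 = 0"
    using gram_det_cosh[of "s - t" "t - u"] by (simp add: a_def b_def c_def)
  have 1: "n s + n t - 2 * x s * x t = 2 * y s * y t * a" using P[of s t] by (simp add: a_def)
  have 2: "n s + n u - 2 * x s * x u = 2 * y s * y u * b" using P[of s u] by (simp add: b_def)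
  have 3: "n t + n u - 2 * x t * x u = 2 * y t * y u * c" using P[of t u] by (simp add: c_def)
  define D where "D = n s * (x t - x u) - x s * (n t - n u) + (n t * x u - n u * x t)"
  define A B C where "A = n s + n t - 2 * x s * x t" and "B = n s + n u - 2 * x s * x u"
    and "C = n t + n u - 2 * x t * x u"
  \<comment> \<open>\<open>D\<close> is the determinant of the three vectors before division by the
    heights, and the bilinear form has determinant 1/4. Hence \<open>D^2\<close> is
    \<open>4 * (y s * y t * y u)^2\<close> times the Gram determinant.\<close>
  have "2 * D\<^sup>2 = 8 * (y s)\<^sup>2 * (y t)\<^sup>2 * (y u)\<^sup>2 + 2 * A * B * C
      - 2 * (y s)\<^sup>2 * C\<^sup>2 - 2 * (y t)\<^sup>2 * B\<^sup>2 - 2 * (y u)\<^sup>2 * A\<^sup>2"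
    unfolding D_def A_def B_def C_def using N[of s] N[of t] N[of u] by algebra
  also have "\<dots> = 8 * (y s)\<^sup>2 * (y t)\<^sup>2 * (y u)\<^sup>2 * (1 + 2 * a * b * c - a\<^sup>2 - b\<^sup>2 - c\<^sup>2)"
    using 1 2 3 unfolding A_def[symmetric] B_def[symmetric] C_def[symmetric]
    by (simp add: power2_eq_square algebra_simps)
  finally show ?thesis using G unfolding D_def by simp
qed

lemma geodesic_inj: "geodesic h \<Longrightarrow> inj h"
  by (rule injI) (metis abs_eq_0 geodesic_def hyp_dist_eq_0_iff eq_iff_diff_eq_0)

text \<open>The moebius map sends the endpoints of the geodesic to \<open>0\<close> and \<open>\<infinity>\<close>.\<close>

lemma geodesic_moebius:
  assumes h: "geodesic h"
  obtains \<mu> \<epsilon> a where "\<mu> holomorphic_on hyp_plane" "inj_on \<mu> hyp_plane" "\<mu> ` hyp_plane \<subseteq> hyp_plane"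
    "\<epsilon> = 1 \<or> \<epsilon> = -1" "\<And>t. \<mu> (h t) = \<i> * of_real (exp (\<epsilon> * t + a))"
    "convex {z\<in>hyp_plane. 0 < Re (\<mu> z)}"
proof -
  have H: "h t \<in> hyp_plane" for t using h by (simp add: geodesic_def)
  have dist: "hyp_dist (h s) (h t) = \<bar>s - t\<bar>" for s t using h by (simp add: geodesic_def)
  define n x y where "n t = (cmod (h t))\<^sup>2" and "x t = Re (h t)" and "y t = Im (h t)" for t
  have ypos: "y t > 0" for t using H by (simp add: y_def hyp_plane_def)
  have N: "n p = (x p)\<^sup>2 + (y p)\<^sup>2" for p by (simp add: n_def x_def y_def cmod_power2)
  have ch: "n p + n q - 2 * x p * x q = 2 * y p * y q * cosh (p - q)" for p q
    using cosh_hyp_dist'[OF H H, of p q] by (simp add: n_def x_def y_def dist)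
  have cop: "n s * (x t - x u) - x s * (n t - n u) + (n t * x u - n u * x t) = 0" for s t u
    using geodesic_coplanar[OF h] by (simp add: n_def x_def)
  have abs_eq: "\<bar>p - q\<bar> = \<bar>s - t\<bar>" if "cosh (p - q) = cosh (s - t)" for p q s t :: real
    using that by (metis abs_ge_zero arcosh_cosh_real cosh_real_abs)
  show thesis
  proof (cases "x 0 = x 1")
    case True
    define c where "c = x 0"
    have "h 0 \<noteq> h 1" using geodesic_inj[OF h] by (simp add: inj_eq)
    then have "y 0 \<noteq> y 1" using True by (auto simp: x_def y_def complex_eq_iff)
    then have "n 0 \<noteq> n 1" using True ypos[of 0] ypos[of 1] by (simp add: N)
    have xc: "x t = c" for t
    proof -
      have "(n 0 - n 1) * (c - x t) = 0" using cop[of 0 1 t] True by (simp add: c_def algebra_simps)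
      then show ?thesis using \<open>n 0 \<noteq> n 1\<close> by simp
    qed
    \<comment> \<open>On a vertical line the hyperbolic distance is the difference of the logarithms
      of the heights, so \<open>ln\<close> of the height is an isometry of the real line. Its slope
      is the direction \<open>\<epsilon>\<close>.\<close>
    have "\<bar>ln (y s) - ln (y t)\<bar> = \<bar>s - t\<bar>" for s t
    proof (rule abs_eq)
      have "cosh (ln (y s) - ln (y t)) = cosh (ln (y s / y t))"
        using ypos[of s] ypos[of t] by (simp add: ln_div)
      also have "\<dots> = (y s / y t + y t / y s) / 2"
        using ypos[of s] ypos[of t] by (simp add: cosh_ln_real)
      also have "\<dots> = cosh (s - t)"
        using ch[of s t] ypos[of s] ypos[of t] by (simp add: N xc field_simps power2_eq_square)
      finally show "cosh (ln (y s) - ln (y t)) = cosh (s - t)" .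
    qed
    then obtain \<epsilon> where e: "\<epsilon> = 1 \<or> \<epsilon> = -1" "\<And>t. ln (y t) = \<epsilon> * t + ln (y 0)"
      using isometry_real_line[of "\<lambda>t. ln (y t)"] by blast
    show thesis
    proof (rule that[of "\<lambda>z. z - of_real c" \<epsilon> "ln (y 0)"])
      have "Im (h t) = exp (\<epsilon> * t + ln (y 0))" for t using e(2)[of t] ypos y_def by (metis exp_ln)
      moreover have "Re (h t) = c" for t using xc[of t] by (simp add: x_def)
      ultimately show "h t - of_real c = \<i> * of_real (exp (\<epsilon> * t + ln (y 0)))" for t
        by (intro complex_eqI) simp_all
      have "{z\<in>hyp_plane. 0 < Re (z - of_real c)} = hyp_plane \<inter> {z. c < Re z}" by auto
      then show "convex {z\<in>hyp_plane. 0 < Re (z - of_real c)}"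
        by (simp add: convex_Int convex_hyp_plane convex_halfspace_Re_gt)
    qed (use e in \<open>auto intro!: holomorphic_intros inj_onI simp: hyp_plane_def\<close>)
  next
    case False
    \<comment> \<open>The relation of coplanarity now says that \<open>n - 2 * c * x\<close> is
      constant, which is the equation of a circle with centre \<open>c\<close> on the real
      axis.\<close>
    define c where "c = (n 0 - n 1) / (2 * (x 0 - x 1))"
    have lin: "n t - 2 * c * x t = n 0 - 2 * c * x 0" for t
    proof -
      have "2 * c * (x 0 - x 1) = n 0 - n 1" using False unfolding c_def by (simp add: field_simps)
      moreover note cop[of 0 1 t]
      ultimately have "(x 0 - x 1) * (n t - 2 * c * x t - (n 0 - 2 * c * x 0)) = 0" by algebra
      then show ?thesis using False by simp
    qed
    define r where "r = sqrt ((x 0 - c)\<^sup>2 + (y 0)\<^sup>2)"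
    have rpos: "r > 0" using ypos[of 0] by (simp add: r_def add_nonneg_pos)
    have circ: "(x t - c)\<^sup>2 + (y t)\<^sup>2 = r\<^sup>2" for t
    proof -
      have "r\<^sup>2 = (x 0 - c)\<^sup>2 + (y 0)\<^sup>2" unfolding r_def by (rule real_sqrt_pow2) simp
      then show ?thesis using lin[of t] unfolding N by (simp add: power2_eq_square algebra_simps)
    qed
    have xr: "\<bar>(x t - c) / r\<bar> < 1" for t
    proof -
      have "(x t - c)\<^sup>2 < r\<^sup>2" using circ[of t] ypos[of t] by (simp flip: circ[of t])
      then have "\<bar>x t - c\<bar> < r" using rpos by (metis abs_of_pos power2_less_imp_less power2_abs abs_ge_zero less_imp_le)
      then show ?thesis using rpos by simp
    qed
    \<comment> \<open>The arc length parameter of the half circle: the point at parameter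
      \<open>\<tau>\<close> has abscissa \<open>c + r * tanh \<tau>\<close> and height
      \<open>r / cosh \<tau>\<close>.\<close>
    define \<tau> where "\<tau> t = artanh ((x t - c) / r)" for t
    have tanh: "tanh (\<tau> t) = (x t - c) / r" for t unfolding \<tau>_def using xr by (rule tanh_artanh_real)
    have yt: "y t * cosh (\<tau> t) = r" for t
    proof -
      have "1 - (tanh (\<tau> t))\<^sup>2 = (y t / r)\<^sup>2"
        unfolding tanh using circ[of t] rpos by (simp add: field_simps)
      moreover have "(1 - (tanh (\<tau> t))\<^sup>2) * (cosh (\<tau> t))\<^sup>2 = 1"
      proof -
        have "(tanh (\<tau> t))\<^sup>2 * (cosh (\<tau> t))\<^sup>2 = (sinh (\<tau> t))\<^sup>2"
          by (simp add: tanh_def power_divide)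
        then show ?thesis by (simp only: left_diff_distrib cosh_square_eq) simp
      qed
      ultimately have "(y t / r * cosh (\<tau> t))\<^sup>2 = 1\<^sup>2" by (simp only: power_mult_distrib power_one)
      then have "y t / r * cosh (\<tau> t) = 1" 
        using ypos[of t] rpos by (subst (asm) power2_eq_iff_nonneg) auto
      then show ?thesis using rpos by (simp add: field_simps)
    qed
    have xt: "x t = c + r * tanh (\<tau> t)" for t using tanh rpos by simp
    have xt': "(x t - c) * cosh (\<tau> t) = r * sinh (\<tau> t)" for t
      by (simp add: xt tanh_def)
    have "\<bar>\<tau> s - \<tau> t\<bar> = \<bar>s - t\<bar>" for s t
    proof (rule abs_eq)
      have "y s * y t * cosh (s - t) = r\<^sup>2 - (x s - c) * (x t - c)"
        using ch[of s t] circ[of s] circ[of t] by (simp add: N power2_eq_square algebra_simps)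
      then have "(y s * cosh (\<tau> s)) * (y t * cosh (\<tau> t)) * cosh (s - t) =
          r\<^sup>2 * (cosh (\<tau> s) * cosh (\<tau> t)) - ((x s - c) * cosh (\<tau> s)) * ((x t - c) * cosh (\<tau> t))"
        by algebra
      then have "r\<^sup>2 * cosh (s - t) = r\<^sup>2 * (cosh (\<tau> s) * cosh (\<tau> t) - sinh (\<tau> s) * sinh (\<tau> t))"
        unfolding yt xt' by (simp add: power2_eq_square algebra_simps)
      then show "cosh (\<tau> s - \<tau> t) = cosh (s - t)" using rpos by (simp add: cosh_diff)
    qed
    then obtain \<epsilon> where e: "\<epsilon> = 1 \<or> \<epsilon> = -1" "\<And>t. \<tau> t = \<epsilon> * t + \<tau> 0"
      using isometry_real_line[of \<tau>] by blast
    define \<mu> where "\<mu> z = (z - of_real (c - r)) / (of_real (c + r) - z)" for z :: complex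
    have ne: "of_real (c + r) - z \<noteq> 0" if "z \<in> hyp_plane" for z :: complex
      using that by (auto simp: hyp_plane_def complex_eq_iff)
    show thesis
    proof (rule that[of \<mu> \<epsilon> "\<tau> 0"])
      show "\<mu> holomorphic_on hyp_plane" unfolding \<mu>_def by (intro holomorphic_intros ne)
      show "inj_on \<mu> hyp_plane"
      proof (rule inj_onI)
        fix z w assume zw: "z \<in> hyp_plane" "w \<in> hyp_plane" "\<mu> z = \<mu> w"
        then have "(z - of_real (c - r)) * (of_real (c + r) - w) = (w - of_real (c - r)) * (of_real (c + r) - z)"
          using ne by (simp add: \<mu>_def frac_eq_eq)
        then have "of_real (2 * r) * (z - w) = 0" by (simp add: algebra_simps)
        then show "z = w" using rpos by simp
      qed
      have mu: "\<mu> z = (z - of_real (c - r)) * cnj (of_real (c + r) - z) / of_real ((cmod (of_real (c + r) - z))\<^sup>2)" for z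
        unfolding \<mu>_def by (rule complex_div_cnj)
      have Im: "Im (\<mu> z) = 2 * r * Im z / (cmod (of_real (c + r) - z))\<^sup>2" for z
        unfolding mu Im_divide_of_real by (simp add: algebra_simps)
      have Re: "Re (\<mu> z) = (r\<^sup>2 - (cmod (z - of_real c))\<^sup>2) / (cmod (of_real (c + r) - z))\<^sup>2" for z
      proof -
        have "Re ((z - of_real (c - r)) * cnj (of_real (c + r) - z)) = r\<^sup>2 - (cmod (z - of_real c))\<^sup>2"
          unfolding cmod_power2 by (simp add: power2_eq_square algebra_simps)
        then show ?thesis unfolding mu Re_divide_of_real by (simp only:)
      qed
      show "\<mu> ` hyp_plane \<subseteq> hyp_plane"
        using rpos ne by (auto simp: hyp_plane_def Im)
      show "\<epsilon> = 1 \<or> \<epsilon> = -1" by (rule e(1))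
      show "\<mu> (h t) = \<i> * of_real (exp (\<epsilon> * t + \<tau> 0))" for t
      proof -
        have "h t - of_real (c - r) = \<i> * of_real (exp (\<tau> t)) * (of_real (c + r) - h t)"
        proof -
          define S where "S = cosh (\<tau> t)"
          have S: "S > 0" by (simp add: S_def cosh_real_pos)
          have yS: "y t = r / S" using yt[of t] S by (simp add: S_def field_simps)
          have E: "exp (\<tau> t) = S + sinh (\<tau> t)" by (simp add: S_def cosh_plus_sinh)
          have 1: "x t - c + r = exp (\<tau> t) * y t"
            using S by (simp add: xt yS E tanh_def field_simps flip: S_def)
          have E2: "(S - sinh (\<tau> t)) * exp (\<tau> t) = 1"
            unfolding E using cosh_square_eq[of "\<tau> t"] by (simp add: S_def power2_eq_square algebra_simps)
          have "exp (\<tau> t) * (c + r - x t) = exp (\<tau> t) * (r / S * (S - sinh (\<tau> t)))"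
            using S by (simp add: xt tanh_def field_simps flip: S_def)
          also have "\<dots> = r / S * ((S - sinh (\<tau> t)) * exp (\<tau> t))" by simp
          finally have 2: "exp (\<tau> t) * (c + r - x t) = y t" unfolding E2 yS by simp
          show ?thesis using 1 2 by (simp add: complex_eq_iff x_def y_def)
        qed
        then have "\<mu> (h t) = \<i> * of_real (exp (\<tau> t))" using ne[OF H, of t] by (simp add: \<mu>_def)
        then show ?thesis using e(2)[of t] by simp
      qed
      \<comment> \<open>The convex side is the inside of the half circle. The other side is not
        convex, which is why the disjunction about convexity in \<open>geodesic_chart\<close> cannot
        be strengthened to both sides.\<close>
      have "{z\<in>hyp_plane. 0 < Re (\<mu> z)} = hyp_plane \<inter> ball (of_real c) r"
      proof -
        have "0 < Re (\<mu> z) \<longleftrightarrow> z \<in> ball (of_real c) r" if "z \<in> hyp_plane" for z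
        proof -
          have "0 < Re (\<mu> z) \<longleftrightarrow> (cmod (z - of_real c))\<^sup>2 < r\<^sup>2"
            using ne[OF that] by (simp add: Re zero_less_divide_iff)
          also have "\<dots> \<longleftrightarrow> cmod (z - of_real c) < r"
            using rpos by (auto intro: power2_less_imp_less power_strict_mono)
          finally show ?thesis by (simp add: dist_norm norm_minus_commute)
        qed
        then show ?thesis by auto
      qed
      then show "convex {z\<in>hyp_plane. 0 < Re (\<mu> z)}" by (simp add: convex_Int convex_hyp_plane)
    qed
  qed
qed

text \<open>\<open>- \<i> * \<mu>\<close> takes the half plane into the right half plane and the
  geodesic to the positive reals. There \<open>Ln\<close> is injective with values in a horizontal
  strip and turns the exponential parametrisation into an affine one, which
  \<open>\<epsilon>\<close> and \<open>a\<close> normalise.\<close>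

lemma geodesic_chart_exists:
  assumes h: "geodesic h"
  shows "\<exists>\<Psi>. geodesic_chart h \<Psi>"
proof -
  obtain \<mu> \<epsilon> a where m: "\<mu> holomorphic_on hyp_plane" "inj_on \<mu> hyp_plane" "\<mu> ` hyp_plane \<subseteq> hyp_plane"
    "\<epsilon> = 1 \<or> \<epsilon> = -1" "\<And>t. \<mu> (h t) = \<i> * of_real (exp (\<epsilon> * t + a))"
    "convex {z\<in>hyp_plane. 0 < Re (\<mu> z)}"
    by (rule geodesic_moebius[OF h]) (rule that)
  define \<Psi> where "\<Psi> z = of_real \<epsilon> * (Ln (- \<i> * \<mu> z) - of_real a)" for z
  have re: "0 < Re (- \<i> * \<mu> z)" if "z \<in> hyp_plane" for z
    using m(3) that by (auto simp: hyp_plane_def)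
  then have nz: "- \<i> * \<mu> z \<noteq> 0" if "z \<in> hyp_plane" for z
    using that by (metis less_irrefl zero_complex.simps(1))
  have Im: "Im (\<Psi> z) = \<epsilon> * Im (Ln (- \<i> * \<mu> z))" for z by (simp add: \<Psi>_def)
  have sgn: "0 < Im (Ln (- \<i> * \<mu> z)) \<longleftrightarrow> Re (\<mu> z) < 0"
    "Im (Ln (- \<i> * \<mu> z)) < 0 \<longleftrightarrow> 0 < Re (\<mu> z)" if "z \<in> hyp_plane" for z
  proof -
    have E: "exp (Ln (- \<i> * \<mu> z)) = - \<i> * \<mu> z" using nz[OF that] by simp
    define L where "L = Ln (- \<i> * \<mu> z)"
    have L: "\<bar>Im L\<bar> < pi / 2" unfolding L_def using Re_Ln_pos_lt[OF nz[OF that]] re[OF that] by blast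
    have R: "Re (\<mu> z) = - (exp (Re L) * sin (Im L))"
    proof -
      have "Im (exp L) = - Re (\<mu> z)" using E by (simp add: L_def)
      then show ?thesis by (simp add: Im_exp)
    qed
    have s: "0 < sin (Im L)" if "0 < Im L" using that L by (intro sin_gt_zero) auto
    have s': "sin (Im L) < 0" if "Im L < 0" using that L sin_gt_zero[of "- Im L"] by auto
    show "0 < Im (Ln (- \<i> * \<mu> z)) \<longleftrightarrow> Re (\<mu> z) < 0" "Im (Ln (- \<i> * \<mu> z)) < 0 \<longleftrightarrow> 0 < Re (\<mu> z)"
      unfolding L_def[symmetric] R using s s'
      by (cases "Im L" "0::real" rule: linorder_cases; force simp: mult_less_0_iff zero_less_mult_iff)+
  qed
  have "geodesic_chart h \<Psi>" unfolding geodesic_chart_def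
  proof (intro conjI ballI allI impI)
    show "\<Psi> holomorphic_on hyp_plane" unfolding \<Psi>_def
      using re by (intro holomorphic_intros m(1)) (force simp: complex_nonpos_Reals_iff)
    show "inj_on \<Psi> hyp_plane"
    proof (rule inj_onI)
      fix z w assume zw: "z \<in> hyp_plane" "w \<in> hyp_plane" "\<Psi> z = \<Psi> w"
      then have "Ln (- \<i> * \<mu> z) = Ln (- \<i> * \<mu> w)" using m(4) by (auto simp: \<Psi>_def)
      then have "\<mu> z = \<mu> w" using nz zw 
        by (metis exp_Ln mult_left_cancel mult_eq_0_iff)
      then show "z = w" using m(2) zw by (auto dest: inj_onD)
    qed
    show "\<Psi> (h t) = of_real t" for t
    proof -
      have "- \<i> * \<mu> (h t) = of_real (exp (\<epsilon> * t + a))" by (simp add: m(5))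
      then have "Ln (- \<i> * \<mu> (h t)) = of_real (\<epsilon> * t + a)"
        by (simp only: Ln_of_real exp_gt_zero ln_exp)
      then show ?thesis using m(4) by (auto simp: \<Psi>_def)
    qed
    show "z \<in> range h" if z: "z \<in> hyp_plane" and 0: "Im (\<Psi> z) = 0" for z
    proof -
      define b where "b = Re (Ln (- \<i> * \<mu> z))"
      have "Ln (- \<i> * \<mu> z) = of_real b" using 0 m(4) by (auto simp: Im b_def complex_eq_iff)
      then have "- \<i> * \<mu> z = of_real (exp b)" using nz[OF z] by (metis exp_Ln exp_of_real)
      then have "\<mu> z = \<i> * of_real (exp b)" by (simp add: complex_eq_iff)
      also have "\<dots> = \<mu> (h (\<epsilon> * (b - a)))" using m(4) by (auto simp: m(5))
      finally have "z = h (\<epsilon> * (b - a))" using m(2) z h by (auto dest: inj_onD simp: geodesic_def)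
      then show ?thesis by blast
    qed
    \<comment> \<open>The set where \<open>Re \<mu>\<close> is positive is the lower half of the
      strip. Multiplication by \<open>\<epsilon> = -1\<close> turns the strip around, so the convex
      side may come to lie on the left or on the right.\<close>
    have "{z\<in>hyp_plane. 0 < Re (\<mu> z)} = {z\<in>hyp_plane. Im (\<Psi> z) < 0} \<or>
        {z\<in>hyp_plane. 0 < Re (\<mu> z)} = {z\<in>hyp_plane. 0 < Im (\<Psi> z)}"
      using m(4) sgn by (auto simp: Im)
    with m(6) show "convex {z\<in>hyp_plane. 0 < Im (\<Psi> z)} \<or> convex {z\<in>hyp_plane. Im (\<Psi> z) < 0}" by auto
  qed
  then show ?thesis by blast
qed

lemma geodesic_shift: "geodesic h \<Longrightarrow> geodesic (\<lambda>t. h (t + a))"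
  by (simp add: geodesic_def)

text \<open>A geodesic is given only by distances. It is continuous because it is the restriction to
  the real axis of the holomorphic inverse of its chart.\<close>

lemma continuous_on_geodesic:
  assumes h: "geodesic h"
  shows "continuous_on A h"
proof -
  obtain \<Psi> where P: "geodesic_chart h \<Psi>" using geodesic_chart_exists[OF h] by blast
  have "\<Psi> holomorphic_on hyp_plane" "inj_on \<Psi> hyp_plane" using P by (auto simp: geodesic_chart_def)
  then obtain g where g: "g holomorphic_on \<Psi> ` hyp_plane" "\<And>z. z \<in> hyp_plane \<Longrightarrow> g (\<Psi> z) = z"
    using holomorphic_has_inverse[OF _ open_hyp_plane] by metis
  have sub: "complex_of_real ` A \<subseteq> \<Psi> ` hyp_plane"
  proof safe
    fix t show "complex_of_real t \<in> \<Psi> ` hyp_plane"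
      using P h by (intro image_eqI[of _ _ "h t"]) (auto simp: geodesic_chart_def geodesic_def)
  qed
  have "continuous_on A complex_of_real" by (intro continuous_intros)
  then have "continuous_on A (\<lambda>t. g (of_real t))"
    by (rule continuous_on_compose2[OF holomorphic_on_imp_continuous_on[OF g(1)] _ sub])
  moreover have "g (of_real t) = h t" for t
    using g(2)[of "h t"] P h by (simp add: geodesic_chart_def geodesic_def)
  ultimately show ?thesis by simp
qed

text \<open>The hyperbolic circle of radius \<open>d\<close> about \<open>z\<close> is a Euclidean
  circle with centre \<open>c\<close> and radius \<open>Im z * sinh d\<close>. Its point farthest
  from \<open>z\<close> is the top, at height \<open>Im z * exp d\<close>.\<close>

lemma hyp_ball_subset_ball:
  assumes z: "z \<in> hyp_plane" and w: "w \<in> hyp_plane"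
  shows "cmod (z - w) \<le> Im z * (exp (hyp_dist z w) - 1)"
proof -
  define d where "d = hyp_dist z w"
  define c where "c = Complex (Re z) (Im z * cosh d)"
  have y: "Im z > 0" "Im w > 0" using z w by (auto simp: hyp_plane_def)
  have d: "d \<ge> 0" unfolding d_def by (rule hyp_dist_nonneg[OF z w])
  have "(cmod z)\<^sup>2 + (cmod w)\<^sup>2 - 2 * Re z * Re w = 2 * Im z * Im w * cosh d"
    unfolding d_def by (rule cosh_hyp_dist'[OF z w])
  then have "(cmod (w - c))\<^sup>2 = (Im z)\<^sup>2 * ((cosh d)\<^sup>2 - 1)"
    unfolding cmod_power2 c_def by (simp add: power2_eq_square algebra_simps)
  also have "(cosh d)\<^sup>2 - 1 = (sinh d)\<^sup>2" by (simp add: cosh_square_eq)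
  also have "(Im z)\<^sup>2 * (sinh d)\<^sup>2 = (Im z * sinh d)\<^sup>2" by (simp add: power_mult_distrib)
  finally have 1: "cmod (w - c) = Im z * sinh d"
    using y d by (simp add: power2_eq_iff_nonneg)
  have "z - c = Complex 0 (- (Im z * (cosh d - 1)))"
    by (simp add: c_def complex_eq_iff algebra_simps)
  then have 2: "cmod (z - c) = Im z * (cosh d - 1)"
    using y cosh_real_ge_1[of d] by (simp add: cmod_def)
  have "cmod (z - w) \<le> cmod (z - c) + cmod (w - c)"
    using norm_triangle_ineq4[of "z - c" "w - c"] by simp
  also have "\<dots> = Im z * (exp d - 1)"
    unfolding 1 2 cosh_plus_sinh[of d, symmetric] by (simp add: algebra_simps)
  finally show ?thesis by (simp add: d_def)
qed

section \<open>Lifting to the universal cover\<close>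

locale hyperbolic_surface =
  fixes p :: "complex \<Rightarrow> 'm::metric_space" and M :: "'m set"
  assumes surface: "closed_oriented_hyperbolic_surface p M"
begin

lemma covering: "covering_space hyp_plane p M"
  using surface by (simp add: closed_oriented_hyperbolic_surface_def)

lemma continuous_on_p: "A \<subseteq> hyp_plane \<Longrightarrow> continuous_on A p"
  using covering covering_space_imp_continuous continuous_on_subset by blast

lemma p_image: "p ` hyp_plane = M"
  using covering by (rule covering_space_imp_surjective)

lemma p_in: "z \<in> hyp_plane \<Longrightarrow> p z \<in> M"
  using p_image by blast

lemma lift_exists_at:
  fixes f :: "'c::real_normed_vector \<Rightarrow> 'm"
  assumes "convex U" "z \<in> U" "a \<in> hyp_plane" "continuous_on U f" "f ` U \<subseteq> M" "f z = p a"
  obtains g where "continuous_on U g" "g ` U \<subseteq> hyp_plane" "g z = a" "\<And>y. y \<in> U \<Longrightarrow> p (g y) = f y"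
proof -
  have U: "simply_connected U" "locally path_connected U"
    using assms(1) convex_imp_simply_connected convex_imp_locally_path_connected by auto
  show thesis
    by (rule covering_space_lift_metric[OF covering assms(3,2) U assms(4-6)]) (rule that)
qed

lemma lift_exists:
  fixes f :: "'c::real_normed_vector \<Rightarrow> 'm"
  assumes "convex U" "continuous_on U f" "f ` U \<subseteq> M"
  obtains g where "continuous_on U g" "g ` U \<subseteq> hyp_plane" "\<And>y. y \<in> U \<Longrightarrow> p (g y) = f y"
proof (cases "U = {}")
  case True
  then show thesis using that[of "\<lambda>_. 0"] by simp
next
  case False
  then obtain z where z: "z \<in> U" by blast
  then have "f z \<in> p ` hyp_plane" using assms(3) p_image by blast
  then obtain a where a: "a \<in> hyp_plane" "f z = p a" by blast
  show thesis
    by (rule lift_exists_at[OF assms(1) z a(1) assms(2,3) a(2)]) (rule that)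
qed

lemma lift_unique:
  fixes g1 g2 :: "'c::topological_space \<Rightarrow> complex"
  assumes "connected U" "a \<in> U" "g1 a = g2 a"
    "continuous_on U g1" "g1 ` U \<subseteq> hyp_plane" "continuous_on U g2" "g2 ` U \<subseteq> hyp_plane"
    "\<And>x. x \<in> U \<Longrightarrow> p (g1 x) = p (g2 x)" "x \<in> U"
  shows "g1 x = g2 x"
proof (rule covering_space_lift_unique[where ?g1.0=g1 and ?g2.0=g2 and a=a and T=U and f="\<lambda>x. p (g1 x)", OF covering assms(3)])
  show "continuous_on U (\<lambda>x. p (g1 x))"
    by (rule continuous_on_compose2[OF continuous_on_p[OF order.refl] assms(4,5)])
qed (use assms p_in in \<open>auto simp: image_subset_iff\<close>)

text \<open>The half plane is simply connected, so \<open>p\<close> lifts through itself with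
  \<open>z\<close> going to \<open>w\<close> and with \<open>w\<close> going to \<open>z\<close>.
  The two lifts are inverse to each other, since both composites lift \<open>p\<close> and fix a
  point.\<close>

lemma deck_exists:
  assumes z: "z \<in> hyp_plane" and w: "w \<in> hyp_plane" and zw: "p z = p w"
  obtains \<gamma> where "\<gamma> \<in> deck_group p" "\<gamma> z = w"
proof -
  have pM: "p ` hyp_plane \<subseteq> M" using p_image by blast
  obtain g where g: "continuous_on hyp_plane g" "g ` hyp_plane \<subseteq> hyp_plane" "g z = w"
      "\<And>y. y \<in> hyp_plane \<Longrightarrow> p (g y) = p y"
    by (rule lift_exists_at[OF convex_hyp_plane z w continuous_on_p[OF order.refl] pM zw]) (rule that)
  obtain g' where g': "continuous_on hyp_plane g'" "g' ` hyp_plane \<subseteq> hyp_plane" "g' w = z"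
      "\<And>y. y \<in> hyp_plane \<Longrightarrow> p (g' y) = p y"
    by (rule lift_exists_at[OF convex_hyp_plane w z continuous_on_p[OF order.refl] pM zw[symmetric]]) (rule that)
  have conn: "connected hyp_plane" by (rule convex_connected[OF convex_hyp_plane])
  have 1: "g' (g y) = y" if "y \<in> hyp_plane" for y
    by (rule lift_unique[OF conn z, of "\<lambda>y. g' (g y)" "\<lambda>y. y"])
      (use g g' that continuous_on_compose2[OF g'(1) g(1,2)] in \<open>auto simp: image_subset_iff\<close>)
  have 2: "g (g' y) = y" if "y \<in> hyp_plane" for y
    by (rule lift_unique[OF conn w, of "\<lambda>y. g (g' y)" "\<lambda>y. y"])
      (use g g' that continuous_on_compose2[OF g(1) g'(1,2)] in \<open>auto simp: image_subset_iff\<close>)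
  define \<gamma> where "\<gamma> = restrict g hyp_plane"
  have "homeomorphism hyp_plane hyp_plane \<gamma> g'"
  proof (rule homeomorphismI)
    show "continuous_on hyp_plane \<gamma>" using g(1) by (simp add: \<gamma>_def cong: continuous_on_cong)
  qed (use g g' 1 2 in \<open>auto simp: \<gamma>_def image_subset_iff\<close>)
  then have "\<gamma> \<in> deck_group p" using g(4) by (auto simp: deck_group_def \<gamma>_def)
  moreover have "\<gamma> z = w" using g(3) z by (simp add: \<gamma>_def)
  ultimately show thesis using that by blast
qed

lemma deck_inverse:
  assumes "\<gamma> \<in> deck_group p"
  obtains \<delta> where "\<delta> \<in> deck_group p" "\<And>z. z \<in> hyp_plane \<Longrightarrow> \<delta> (\<gamma> z) = z"
proof -
  obtain \<delta> where d: "homeomorphism hyp_plane hyp_plane \<gamma> \<delta>" using assms by (auto simp: deck_group_def)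
  have pg: "p (\<gamma> z) = p z" if "z \<in> hyp_plane" for z using assms that by (simp add: deck_group_def)
  have im: "\<delta> z \<in> hyp_plane" "\<gamma> (\<delta> z) = z" if "z \<in> hyp_plane" for z
    using d that unfolding homeomorphism_def by auto
  have "homeomorphism hyp_plane hyp_plane (restrict \<delta> hyp_plane) \<gamma>"
    by (rule homeomorphism_cong[OF homeomorphism_symD[OF d]]) auto
  moreover have "p (\<delta> z) = p z" if "z \<in> hyp_plane" for z using pg[of "\<delta> z"] im that by simp
  ultimately have "restrict \<delta> hyp_plane \<in> deck_group p" by (auto simp: deck_group_def)
  moreover have "restrict \<delta> hyp_plane (\<gamma> z) = z" if "z \<in> hyp_plane" for z
    using d that unfolding homeomorphism_def by auto
  ultimately show thesis using that by blast
qed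

lemma
  assumes g: "\<gamma> \<in> deck_group p"
  shows deck_holomorphic: "\<gamma> holomorphic_on hyp_plane"
    and deck_image: "\<gamma> ` hyp_plane = hyp_plane"
    and deck_inj: "inj_on \<gamma> hyp_plane"
    and deck_p: "z \<in> hyp_plane \<Longrightarrow> p (\<gamma> z) = p z"
proof -
  show "\<gamma> holomorphic_on hyp_plane" using surface g by (simp add: closed_oriented_hyperbolic_surface_def)
  obtain \<delta> where d: "homeomorphism hyp_plane hyp_plane \<gamma> \<delta>" using g by (auto simp: deck_group_def)
  then show "\<gamma> ` hyp_plane = hyp_plane" by (simp add: homeomorphism_def)
  show "inj_on \<gamma> hyp_plane" using d by (metis homeomorphism_apply1 inj_onI)
  show "z \<in> hyp_plane \<Longrightarrow> p (\<gamma> z) = p z" using g by (simp add: deck_group_def)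
qed

lemma deck_in: "\<gamma> \<in> deck_group p \<Longrightarrow> z \<in> hyp_plane \<Longrightarrow> \<gamma> z \<in> hyp_plane"
  using deck_image by blast

text \<open>The inequality of Schwarz and Pick holds for \<open>\<gamma>\<close> and for its
  inverse, which is again a deck transformation and therefore holomorphic.\<close>

lemma deck_isometry:
  assumes g: "\<gamma> \<in> deck_group p" and "z \<in> hyp_plane" "w \<in> hyp_plane"
  shows "hyp_dist (\<gamma> z) (\<gamma> w) = hyp_dist z w"
proof (rule antisym)
  show "hyp_dist (\<gamma> z) (\<gamma> w) \<le> hyp_dist z w"
    using schwarz_pick deck_holomorphic[OF g] deck_image[OF g] assms by simp
  obtain \<delta> where d: "\<delta> \<in> deck_group p" "\<And>z. z \<in> hyp_plane \<Longrightarrow> \<delta> (\<gamma> z) = z"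
    using deck_inverse[OF g] by blast
  have "hyp_dist (\<delta> (\<gamma> z)) (\<delta> (\<gamma> w)) \<le> hyp_dist (\<gamma> z) (\<gamma> w)"
    using schwarz_pick deck_holomorphic[OF d(1)] deck_image[OF d(1)] assms deck_in by simp
  then show "hyp_dist z w \<le> hyp_dist (\<gamma> z) (\<gamma> w)" using d(2) assms by simp
qed

lemma lifts_differ_by_deck:
  fixes g1 g2 :: "'c::topological_space \<Rightarrow> complex"
  assumes "connected U"
    "continuous_on U g1" "g1 ` U \<subseteq> hyp_plane" "continuous_on U g2" "g2 ` U \<subseteq> hyp_plane"
    "\<And>x. x \<in> U \<Longrightarrow> p (g1 x) = p (g2 x)" "U \<noteq> {}"
  obtains \<gamma> where "\<gamma> \<in> deck_group p" "\<And>x. x \<in> U \<Longrightarrow> g2 x = \<gamma> (g1 x)"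
proof -
  obtain a where a: "a \<in> U" using assms by blast
  obtain \<gamma> where g: "\<gamma> \<in> deck_group p" "\<gamma> (g1 a) = g2 a"
    using deck_exists[of "g1 a" "g2 a"] assms a by blast
  have "\<gamma> (g1 x) = g2 x" if "x \<in> U" for x
  proof (rule lift_unique[where ?g1.0="\<lambda>x. \<gamma> (g1 x)" and ?g2.0=g2, OF assms(1) a])
    show "continuous_on U (\<lambda>x. \<gamma> (g1 x))"
      by (rule continuous_on_compose2[OF holomorphic_on_imp_continuous_on[OF deck_holomorphic[OF g(1)]] assms(2,3)])
    show "(\<lambda>x. \<gamma> (g1 x)) ` U \<subseteq> hyp_plane" using deck_in[OF g(1)] assms(3) by auto
    show "p (\<gamma> (g1 x)) = p (g2 x)" if "x \<in> U" for x
      using assms(3,6) that deck_p[OF g(1)] by auto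
  qed (use assms g that in auto)
  then show thesis using that[OF g(1)] by simp
qed

lemma p_inj_ball:
  assumes "z \<in> hyp_plane"
  obtains r where "r > 0" "ball z r \<subseteq> hyp_plane" "inj_on p (ball z r)"
proof -
  obtain T u q where T: "z \<in> T" "openin (top_of_set hyp_plane) T" "homeomorphism T u p q"
    by (rule covering_space_local_homeomorphism[OF covering assms])
  have "open T" "T \<subseteq> hyp_plane" using T(2) open_hyp_plane
    by (auto simp: openin_open_eq openin_imp_subset)
  then obtain r where "r > 0" "ball z r \<subseteq> T" using T(1) open_contains_ball by blast
  moreover have "inj_on p T" using T(3) by (metis homeomorphism_apply1 inj_onI)
  ultimately show thesis using that \<open>T \<subseteq> hyp_plane\<close> by (meson inj_on_subset order_trans)
qed

text \<open>Two points of a small ball are closer to each other than to other points of their fibres, so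
  the quotient distance is bounded below by the distance in the plane.\<close>

lemma p_expanding_ball:
  assumes z0: "z0 \<in> hyp_plane"
  obtains r c where "r > 0" "c > 0" "ball z0 r \<subseteq> hyp_plane"
    "\<And>z w. z \<in> ball z0 r \<Longrightarrow> w \<in> ball z0 r \<Longrightarrow> cmod (z - w) \<le> c * dist (p z) (p w)"
proof -
  obtain R where R: "R > 0" "ball z0 R \<subseteq> hyp_plane" "inj_on p (ball z0 R)"
    using p_inj_ball[OF z0] by blast
  \<comment> \<open>Two points of the ball of radius \<open>r\<close> are less than
    \<open>2 * r\<close> apart. Another point of the fibre of \<open>w\<close> lies outside the ball
    of radius \<open>3 * r\<close> by injectivity, hence is at least as far from \<open>z\<close> as
    \<open>w\<close> is.\<close>
  define r where "r = R / 3"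
  define Y where "Y = Im z0 + r"
  have r: "r > 0" "R = 3 * r" using R by (auto simp: r_def)
  have Y: "Y > 0" using r z0 by (simp add: Y_def hyp_plane_def)
  have sub: "ball z0 r \<subseteq> ball z0 R" using r by auto
  have "cmod (z - w) \<le> (Y + 2 * r) * dist (p z) (p w)" if z: "z \<in> ball z0 r" and w: "w \<in> ball z0 r" for z w
  proof -
    have zH: "z \<in> hyp_plane" "w \<in> hyp_plane" using z w sub R by auto
    define D where "D = cmod (z - w)"
    have D2: "D \<le> 2 * r" using norm_triangle_ineq4[of "z - z0" "w - z0"] z w
      by (simp add: D_def dist_norm norm_minus_commute)
    have "\<bar>Im (z - z0)\<bar> \<le> cmod (z - z0)" by (rule abs_Im_le_cmod)
    then have Imz: "Im z \<le> Y" using z by (simp add: Y_def dist_norm norm_minus_commute)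
    have "ln (1 + D / Y) \<le> hyp_dist z w'" if w': "w' \<in> hyp_plane" "p w' = p w" for w'
    proof -
      have "D \<le> cmod (z - w')"
      proof (cases "w' \<in> ball z0 R")
        case True
        then have "w' = w" using inj_onD[OF R(3) w'(2)] w sub by blast
        then show ?thesis by (simp add: D_def)
      next
        case False
        then have "3 * r \<le> cmod (z0 - w')" using r by (simp add: dist_norm)
        moreover have "cmod (z0 - w') \<le> cmod (z0 - z) + cmod (z - w')"
          using norm_triangle_ineq[of "z0 - z" "z - w'"] by simp
        ultimately show ?thesis using D2 z by (simp add: dist_norm)
      qed
      also have "\<dots> \<le> Im z * (exp (hyp_dist z w') - 1)"
        by (rule hyp_ball_subset_ball[OF zH(1) w'(1)])
      also have "\<dots> \<le> Y * (exp (hyp_dist z w') - 1)"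
        using Imz hyp_dist_nonneg[OF zH(1) w'(1)] by (intro mult_right_mono) auto
      finally have "1 + D / Y \<le> exp (hyp_dist z w')" using Y by (simp add: field_simps)
      moreover have "0 < 1 + D / Y" using Y by (simp add: D_def add_pos_nonneg)
      ultimately show ?thesis by (metis exp_le_cancel_iff exp_ln)
    qed
    then have "ln (1 + D / Y) \<le> (INF w'\<in>{w'\<in>hyp_plane. p w' = p w}. hyp_dist z w')"
      using zH by (intro cINF_greatest) auto
    also have "\<dots> = dist (p z) (p w)" using surface zH by (simp add: closed_oriented_hyperbolic_surface_def)
    finally have 1: "ln (1 + D / Y) \<le> dist (p z) (p w)" .
    have D0: "D \<ge> 0" by (simp add: D_def)
    \<comment> \<open>The logarithmic bound becomes a linear one on the small ball:
      \<open>D \<le> 2 * r\<close> makes the denominator uniform, and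
      \<open>ln u \<le> u - 1\<close> at the reciprocal of \<open>1 + D / Y\<close> does the rest.
      This is the origin of the factor \<open>Y + 2 * r\<close>.\<close>
    have "D / (Y + 2 * r) \<le> D / (Y + D)" using D0 D2 Y by (intro divide_left_mono) auto
    also have "\<dots> = 1 - 1 / (1 + D / Y)" using Y D0 by (simp add: field_simps)
    also have "\<dots> \<le> ln (1 + D / Y)"
    proof -
      have pos: "0 < 1 / (1 + D / Y)" using Y D0 by (simp add: add_pos_nonneg)
      have "ln (1 / (1 + D / Y)) \<le> 1 / (1 + D / Y) - 1" by (rule ln_le_minus_one[OF pos])
      moreover have "ln (1 / (1 + D / Y)) = - ln (1 + D / Y)"
        using Y D0 by (simp add: ln_div add_pos_nonneg)
      ultimately show ?thesis by simp
    qed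
    finally have "D / (Y + 2 * r) \<le> dist (p z) (p w)" using 1 by simp
    then show ?thesis using Y r by (simp add: D_def field_simps)
  qed
  then show thesis using that[of r "Y + 2 * r"] r Y sub R by auto
qed

end

section \<open>Winding numbers of images of rectangles\<close>

text \<open>The homotopy multiplies the loop by a factor that never vanishes and has equal values at
  both ends of the loop. It serves to deform a difference quotient to a derivative, and a constant
  factor to 1.\<close>

lemma winding_number_scale_homotopy:
  fixes Q :: "real \<times> real \<Rightarrow> complex"
  assumes g: "path \<gamma>" "pathfinish \<gamma> = pathstart \<gamma>" "0 \<notin> path_image \<gamma>"
    and Q: "continuous_on ({0..1} \<times> {0..1}) Q" "\<And>\<tau> u. \<tau> \<in> {0..1} \<Longrightarrow> u \<in> {0..1} \<Longrightarrow> Q (\<tau>, u) \<noteq> 0"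
      "\<And>\<tau>. \<tau> \<in> {0..1} \<Longrightarrow> Q (\<tau>, 1) = Q (\<tau>, 0)"
  shows "winding_number (\<lambda>u. Q (0, u) * \<gamma> u) 0 = winding_number (\<lambda>u. Q (1, u) * \<gamma> u) 0"
proof (rule winding_number_homotopic_loops)
  show "homotopic_loops (- {0}) (\<lambda>u. Q (0, u) * \<gamma> u) (\<lambda>u. Q (1, u) * \<gamma> u)"
    unfolding homotopic_loops
  proof (intro exI[of _ "\<lambda>x. Q x * \<gamma> (snd x)"] conjI)
    have "continuous_on ({0..1::real} \<times> {0..1}) (\<lambda>x. \<gamma> (snd x))"
      using g(1) unfolding path_def
      by (rule continuous_on_compose2) (auto intro!: continuous_intros)
    then show "continuous_on ({0..1::real} \<times> {0..1}) (\<lambda>x. Q x * \<gamma> (snd x))"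
      by (intro continuous_intros Q(1))
    show "(\<lambda>x. Q x * \<gamma> (snd x)) \<in> {0..1} \<times> {0..1} \<rightarrow> - {0}"
      using Q(2) g(3) by (auto simp: path_image_def)
    show "\<forall>t\<in>{0..1}. pathfinish ((\<lambda>x. Q x * \<gamma> (snd x)) \<circ> Pair t) = pathstart ((\<lambda>x. Q x * \<gamma> (snd x)) \<circ> Pair t)"
      using Q(3) g(2) by (simp add: pathfinish_def pathstart_def)
  qed auto
qed

text \<open>\<open>\<Psi> w - \<Psi> z\<close> is \<open>q w * (w - z)\<close>, where
  \<open>q\<close> has no zeros because \<open>\<Psi>\<close> is injective. Convexity lets the
  argument of \<open>q\<close> be contracted along segments to \<open>z\<close>; the remaining
  constant is joined to 1 by an exponential path.\<close>

lemma winding_number_holomorphic_image: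
  assumes S: "open S" "convex S" and hol: "\<Psi> holomorphic_on S" and inj: "inj_on \<Psi> S"
    and g: "path \<gamma>" "pathfinish \<gamma> = pathstart \<gamma>" "path_image \<gamma> \<subseteq> S" "z \<in> S" "z \<notin> path_image \<gamma>"
  shows "winding_number (\<Psi> \<circ> \<gamma>) (\<Psi> z) = winding_number \<gamma> z"
proof -
  define q where "q w = (if w = z then deriv \<Psi> z else (\<Psi> w - \<Psi> z) / (w - z))" for w
  have qnz: "q w \<noteq> 0" if "w \<in> S" for w
    using that inj g(4) holomorphic_injective_imp_regular[OF hol S(1) inj g(4)]
    by (auto simp: q_def dest: inj_onD)
  have fac: "\<Psi> w - \<Psi> z = q w * (w - z)" for w by (simp add: q_def)
  have qc: "continuous_on S q"
  proof -
    have "q holomorphic_on S" unfolding q_def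
      by (rule pole_lemma_open[OF hol S(1)])
    then show ?thesis by (rule holomorphic_on_imp_continuous_on)
  qed
  define \<delta> where "\<delta> u = \<gamma> u - z" for u
  have gS: "\<gamma> u \<in> S" if "u \<in> {0..1}" for u using g(3) that by (auto simp: path_image_def)
  have d: "path \<delta>" "pathfinish \<delta> = pathstart \<delta>" "0 \<notin> path_image \<delta>"
    using g(1,2,5) unfolding \<delta>_def path_def pathfinish_def pathstart_def path_image_def
    by (auto intro!: continuous_intros)
  have cg: "continuous_on ({0..1::real} \<times> {0..1}) (\<lambda>x. \<gamma> (snd x))"
    using g(1) unfolding path_def
    by (rule continuous_on_compose2) (auto intro!: continuous_intros)
  have inS: "z + of_real \<tau> * (\<gamma> u - z) \<in> S" if "\<tau> \<in> {0..1}" "u \<in> {0..1}" for \<tau> u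
  proof -
    have "(1 - \<tau>) *\<^sub>R z + \<tau> *\<^sub>R \<gamma> u \<in> S" using that gS g(4) by (intro convexD[OF S(2)]) auto
    moreover have "(1 - \<tau>) *\<^sub>R z + \<tau> *\<^sub>R \<gamma> u = z + of_real \<tau> * (\<gamma> u - z)"
      by (simp add: scaleR_conv_of_real algebra_simps)
    ultimately show ?thesis by simp
  qed
  have cin: "continuous_on ({0..1::real} \<times> {0..1}) (\<lambda>x. z + of_real (fst x) * (\<gamma> (snd x) - z))"
    by (intro continuous_intros cg)
  have inS': "(\<lambda>x. z + of_real (fst x) * (\<gamma> (snd x) - z)) ` ({0..1::real} \<times> {0..1}) \<subseteq> S"
    using inS by auto
  have "winding_number (\<Psi> \<circ> \<gamma>) (\<Psi> z) = winding_number (\<lambda>u. \<Psi> (\<gamma> u) - \<Psi> z) 0"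
    by (subst winding_number_offset) (simp add: o_def)
  also have "(\<lambda>u. \<Psi> (\<gamma> u) - \<Psi> z) = (\<lambda>u. q (z + of_real 1 * (\<gamma> u - z)) * \<delta> u)"
    by (simp add: fac \<delta>_def)
  also have "winding_number \<dots> 0 = winding_number (\<lambda>u. q (z + of_real 0 * (\<gamma> u - z)) * \<delta> u) 0"
  proof -
    define Q where "Q x = q (z + of_real (fst x) * (\<gamma> (snd x) - z))" for x :: "real \<times> real"
    have "continuous_on ({0..1} \<times> {0..1}) Q" unfolding Q_def
      by (rule continuous_on_compose2[OF qc cin inS'])
    from winding_number_scale_homotopy[OF d this]
    show ?thesis using qnz inS g(2) by (simp add: Q_def pathfinish_def pathstart_def)
  qed
  also have "\<dots> = winding_number (\<lambda>u. q z * \<delta> u) 0" by simp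
  also have "\<dots> = winding_number \<delta> 0"
  proof -
    define Q where "Q x = exp (of_real (fst x) * Ln (q z))" for x :: "real \<times> real"
    have "continuous_on ({0..1} \<times> {0..1}) Q" unfolding Q_def
      by (intro continuous_intros)
    from winding_number_scale_homotopy[OF d this]
    show ?thesis using qnz[OF g(4)] by (simp add: Q_def)
  qed
  also have "\<dots> = winding_number \<gamma> z" unfolding winding_number_offset[of \<gamma> z] by (simp add: \<delta>_def[abs_def])
  finally show ?thesis .
qed

text \<open>The break points 1/2, 3/4 and 7/8 come from the nesting of the joins in
  \<open>rectpath\<close> to the right.\<close>

lemma rectpath_side:
  shows "u \<le> 1/2 \<Longrightarrow> Im (rectpath a b u) = Im a"
    and "\<not> u \<le> 1/2 \<Longrightarrow> u \<le> 3/4 \<Longrightarrow> Re (rectpath a b u) = Re b"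
    and "\<not> u \<le> 3/4 \<Longrightarrow> u \<le> 7/8 \<Longrightarrow> Im (rectpath a b u) = Im b"
    and "\<not> u \<le> 7/8 \<Longrightarrow> Re (rectpath a b u) = Re a"
  by (auto simp: rectpath_def Let_def joinpaths_def linepath_def algebra_simps)

lemma path_image_rectpath_in:
  assumes "Re a \<le> Re b" "Im a \<le> Im b" "u \<in> {0..1}"
  shows "rectpath a b u \<in> cbox a b - box a b"
  using assms path_image_rectpath_cbox_minus_box[OF assms(1,2)] by (auto simp: path_image_def)

text \<open>The two boundaries are parametrised side by side, so corresponding points are both
  below, right of, above or left of \<open>z\<close>, and the segment between them avoids
  \<open>z\<close>. Injectivity of \<open>F\<close> carries the homotopy to the complement of
  \<open>F z\<close>.\<close>

lemma winding_number_image_subrectangle: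
  assumes F: "continuous_on (cbox a b) F" "inj_on F (cbox a b)"
    and sub: "cbox a' b' \<subseteq> cbox a b" and z: "z \<in> box a' b'"
  shows "winding_number (F \<circ> rectpath a b) (F z) = winding_number (F \<circ> rectpath a' b') (F z)"
proof -
  have zc: "Re a' < Re z" "Re z < Re b'" "Im a' < Im z" "Im z < Im b'"
    using z by (auto simp: in_box_complex_iff)
  have "a' \<in> cbox a' b'" "b' \<in> cbox a' b'" using zc by (auto simp: in_cbox_complex_iff)
  then have ab: "Re a \<le> Re a'" "Im a \<le> Im a'" "Re b' \<le> Re b" "Im b' \<le> Im b"
    using subsetD[OF sub, of a'] subsetD[OF sub, of b'] by (auto simp: in_cbox_complex_iff)
  have "homotopic_loops (cbox a b - {z}) (rectpath a b) (rectpath a' b')"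
  proof (rule homotopic_loops_linear)
    fix u :: real assume u: "u \<in> {0..1}"
    have "rectpath a b u \<in> cbox a b"
      using path_image_rectpath_in[of a b u] ab zc u by auto
    moreover have "rectpath a' b' u \<in> cbox a b"
      using path_image_rectpath_in[of a' b' u] zc u sub by auto
    ultimately have 1: "closed_segment (rectpath a b u) (rectpath a' b' u) \<subseteq> cbox a b"
      by (intro closed_segment_subset) auto
    have "z \<notin> closed_segment (rectpath a b u) (rectpath a' b' u)"
    proof
      assume "z \<in> closed_segment (rectpath a b u) (rectpath a' b' u)"
      then obtain \<tau> where t: "0 \<le> \<tau>" "\<tau> \<le> 1" "z = (1 - \<tau>) *\<^sub>R rectpath a b u + \<tau> *\<^sub>R rectpath a' b' u"
        by (auto simp: in_segment)
      have Re: "Re z = (1 - \<tau>) * Re (rectpath a b u) + \<tau> * Re (rectpath a' b' u)"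
        and Im: "Im z = (1 - \<tau>) * Im (rectpath a b u) + \<tau> * Im (rectpath a' b' u)"
        by (simp_all add: t(3))
      consider "u \<le> 1/2" | "\<not> u \<le> 1/2" "u \<le> 3/4" | "\<not> u \<le> 3/4" "u \<le> 7/8" | "\<not> u \<le> 7/8"
        by linarith
      then show False
      proof cases
        case 1
        then have "Im z = (1 - \<tau>) * Im a + \<tau> * Im a'" by (simp add: Im rectpath_side)
        also have "\<dots> \<le> (1 - \<tau>) * Im a' + \<tau> * Im a'" using ab t by (intro add_right_mono mult_left_mono) auto
        also have "\<dots> = Im a'" by (simp add: algebra_simps)
        finally show False using zc by simp
      next
        case 2
        then have "Re z = (1 - \<tau>) * Re b + \<tau> * Re b'" by (simp add: Re rectpath_side)
        moreover have "(1 - \<tau>) * Re b' + \<tau> * Re b' \<le> (1 - \<tau>) * Re b + \<tau> * Re b'" using ab t by (intro add_right_mono mult_left_mono) auto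
        moreover have "(1 - \<tau>) * Re b' + \<tau> * Re b' = Re b'" by (simp add: algebra_simps)
        ultimately show False using zc by simp
      next
        case 3
        then have "Im z = (1 - \<tau>) * Im b + \<tau> * Im b'" by (simp add: Im rectpath_side)
        moreover have "(1 - \<tau>) * Im b' + \<tau> * Im b' \<le> (1 - \<tau>) * Im b + \<tau> * Im b'" using ab t by (intro add_right_mono mult_left_mono) auto
        moreover have "(1 - \<tau>) * Im b' + \<tau> * Im b' = Im b'" by (simp add: algebra_simps)
        ultimately show False using zc by simp
      next
        case 4
        then have "Re z = (1 - \<tau>) * Re a + \<tau> * Re a'" by (simp add: Re rectpath_side)
        also have "\<dots> \<le> (1 - \<tau>) * Re a' + \<tau> * Re a'" using ab t by (intro add_right_mono mult_left_mono) auto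
        also have "\<dots> = Re a'" by (simp add: algebra_simps)
        finally show False using zc by simp
      qed
    qed
    with 1 show "closed_segment (rectpath a b u) (rectpath a' b' u) \<subseteq> cbox a b - {z}" by blast
  qed auto
  then have "homotopic_loops (- {F z}) (F \<circ> rectpath a b) (F \<circ> rectpath a' b')"
  proof (rule homotopic_loops_continuous_image)
    show "continuous_on (cbox a b - {z}) F" using F(1) by (rule continuous_on_subset) auto
    have "z \<in> cbox a b" using z sub box_subset_cbox by blast
    then show "F \<in> (cbox a b - {z}) \<rightarrow> - {F z}" using F(2) by (auto dest: inj_onD)
  qed
  then show ?thesis by (rule winding_number_homotopic_loops)
qed

text \<open>A reflection or a half turn moves the corner at which \<open>rectpath\<close> starts. A
  sum over the four sides does not depend on this corner, so symmetries of the rectangle can be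
  treated one side at a time.\<close>

lemma winding_number_rectangle_sides:
  fixes F :: "complex \<Rightarrow> complex"
  assumes F: "continuous_on (cbox a b) F" and ab: "Re a \<le> Re b" "Im a \<le> Im b"
    and y: "y \<notin> F ` (cbox a b - box a b)"
  defines "a2 \<equiv> Complex (Re b) (Im a)" and "a4 \<equiv> Complex (Re a) (Im b)"
  shows "winding_number (F \<circ> rectpath a b) y = winding_number (F \<circ> linepath a a2) y +
     winding_number (F \<circ> linepath a2 b) y + winding_number (F \<circ> linepath b a4) y + winding_number (F \<circ> linepath a4 a) y"
proof -
  let ?l1 = "linepath a a2" and ?l2 = "linepath a2 b" and ?l3 = "linepath b a4" and ?l4 = "linepath a4 a"
  have im: "path_image (rectpath a b) = path_image ?l1 \<union> path_image ?l2 \<union> path_image ?l3 \<union> path_image ?l4"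
    by (simp add: rectpath_def Let_def path_image_join Un_assoc a2_def a4_def)
  have bd: "path_image (rectpath a b) = cbox a b - box a b"
    by (rule path_image_rectpath_cbox_minus_box[OF ab])
  have sub: "path_image l \<subseteq> cbox a b - box a b" if "l \<in> {?l1,?l2,?l3,?l4}" for l
    using that unfolding bd[symmetric] im by auto
  have P: "path (F \<circ> l)" "y \<notin> path_image (F \<circ> l)" if "l \<in> {?l1,?l2,?l3,?l4}" for l
  proof -
    have "path l" using that by auto
    then show "path (F \<circ> l)"
      using sub[OF that] F by (intro path_continuous_image) (auto intro: continuous_on_subset)
    show "y \<notin> path_image (F \<circ> l)" using sub[OF that] y by (auto simp: path_image_compose)
  qed
  show ?thesis
    unfolding rectpath_def Let_def path_compose_join a2_def[symmetric] a4_def[symmetric]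
    using P by (simp add: winding_number_join path_image_join pathfinish_compose pathstart_compose)
qed

lemma winding_number_image_flip_Im:
  fixes F :: "complex \<Rightarrow> complex"
  assumes F: "continuous_on (cbox a b) F" and ab: "Re a \<le> Re b" "Im a \<le> Im b"
    and y: "y \<notin> F ` (cbox a b - box a b)"
  shows "winding_number ((F \<circ> cnj) \<circ> rectpath (cnj (Complex (Re a) (Im b))) (cnj (Complex (Re b) (Im a)))) y =
     - winding_number (F \<circ> rectpath a b) y"
proof -
  define a2 a4 where "a2 = Complex (Re b) (Im a)" and "a4 = Complex (Re a) (Im b)"
  have box: "cnj z \<in> cbox a b \<longleftrightarrow> z \<in> cbox (cnj a4) (cnj a2)" "cnj z \<in> box a b \<longleftrightarrow> z \<in> box (cnj a4) (cnj a2)" for z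
    by (auto simp: in_cbox_complex_iff in_box_complex_iff a2_def a4_def)
  have F': "continuous_on (cbox (cnj a4) (cnj a2)) (F \<circ> cnj)"
    using box(1) by (intro continuous_on_compose continuous_intros continuous_on_subset[OF F]) auto
  have y': "y \<notin> (F \<circ> cnj) ` (cbox (cnj a4) (cnj a2) - box (cnj a4) (cnj a2))"
    using y box by auto
  have sides: "winding_number ((F \<circ> cnj) \<circ> linepath (cnj u) (cnj v)) y = - winding_number (F \<circ> linepath v u) y"
    if "path_image (linepath v u) \<subseteq> cbox a b - box a b" for u v
  proof -
    have "(F \<circ> cnj) \<circ> linepath (cnj u) (cnj v) = F \<circ> linepath u v"
      by (auto simp: linepath_def fun_eq_iff)
    also have "\<dots> = reversepath (F \<circ> linepath v u)"
      by (simp flip: path_compose_reversepath)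
    finally have 1: "(F \<circ> cnj) \<circ> linepath (cnj u) (cnj v) = reversepath (F \<circ> linepath v u)" .
    have "path (F \<circ> linepath v u)"
      using that F by (intro path_continuous_image) (auto intro: continuous_on_subset)
    moreover have "y \<notin> path_image (F \<circ> linepath v u)" using that y by (auto simp: path_image_compose)
    ultimately show ?thesis unfolding 1 by (rule winding_number_reversepath)
  qed
  have im: "path_image (rectpath a b) = path_image (linepath a a2) \<union> path_image (linepath a2 b) \<union>
      path_image (linepath b a4) \<union> path_image (linepath a4 a)"
    by (simp add: rectpath_def Let_def path_image_join Un_assoc a2_def a4_def)
  have bd: "path_image (rectpath a b) = cbox a b - box a b"
    by (rule path_image_rectpath_cbox_minus_box[OF ab])
  have sub: "path_image (linepath a a2) \<subseteq> cbox a b - box a b" "path_image (linepath a2 b) \<subseteq> cbox a b - box a b"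
    "path_image (linepath b a4) \<subseteq> cbox a b - box a b" "path_image (linepath a4 a) \<subseteq> cbox a b - box a b"
    unfolding bd[symmetric] im by auto
  have c: "Complex (Re (cnj a2)) (Im (cnj a4)) = cnj b" "Complex (Re (cnj a4)) (Im (cnj a2)) = cnj a"
    by (auto simp: a2_def a4_def complex_eq_iff)
  have "Re (cnj a4) \<le> Re (cnj a2)" "Im (cnj a4) \<le> Im (cnj a2)" using ab by (auto simp: a2_def a4_def)
  from winding_number_rectangle_sides[OF F' this y'] winding_number_rectangle_sides[OF F ab y]
  show ?thesis unfolding c a2_def[symmetric] a4_def[symmetric]
    unfolding sides[OF sub(1)] sides[OF sub(2)] sides[OF sub(3)] sides[OF sub(4)] by simp
qed

text \<open>The image of the open rectangle is one of the components of the complement of the Jordan curve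
  that bounds it.\<close>

lemma winding_number_image_pm1:
  fixes F :: "complex \<Rightarrow> complex"
  assumes F: "continuous_on (cbox a b) F" "inj_on F (cbox a b)" and ab: "Re a < Re b" "Im a < Im b"
  obtains w where "w = 1 \<or> w = -1" "\<And>z. z \<in> box a b \<Longrightarrow> winding_number (F \<circ> rectpath a b) (F z) = w"
proof -
  let ?J = "F \<circ> rectpath a b"
  have bd: "path_image (rectpath a b) = cbox a b - box a b"
    using ab by (intro path_image_rectpath_cbox_minus_box) auto
  have rp: "simple_path (rectpath a b)" using ab by (intro simple_path_rectpath) auto
  have J: "simple_path ?J"
    using F bd by (intro simple_path_continuous_image rp) (auto intro: continuous_on_subset inj_on_subset)
  have Jl: "pathfinish ?J = pathstart ?J" by (simp add: pathfinish_compose pathstart_compose)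
  have Jim: "path_image ?J = F ` (cbox a b - box a b)" by (simp add: path_image_compose bd)
  note jordan = Jordan_inside_outside[OF J Jl]
  have opn: "open (F ` box a b)"
    using F box_subset_cbox by (intro invariance_of_domain) (auto intro: continuous_on_subset inj_on_subset)
  have disj: "F ` box a b \<inter> path_image ?J = {}"
    unfolding Jim using F(2) box_subset_cbox[of a b] by (fastforce dest: inj_onD)
  have un: "F ` cbox a b = F ` box a b \<union> path_image ?J"
    unfolding Jim using box_subset_cbox[of a b] by (simp flip: image_Un add: Un_absorb1 Un_commute)
  have cpt: "compact (F ` cbox a b)" using F(1) by (intro compact_continuous_image) auto
  \<comment> \<open>If the open rectangle had an image point outside the curve, the connected
    outside would lie in the compact image of the closed rectangle, but the outside is
    unbounded.\<close>
  have ins: "F ` box a b \<subseteq> inside (path_image ?J)"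
  proof (rule ccontr)
    assume "\<not> ?thesis"
    then have ne: "outside (path_image ?J) \<inter> F ` box a b \<noteq> {}"
      using disj inside_Un_outside[of "path_image ?J"] by blast
    have 1: "outside (path_image ?J) \<subseteq> F ` box a b \<union> - (F ` cbox a b)"
      using un outside_no_overlap[of "path_image ?J"] by blast
    have "- (F ` cbox a b) \<inter> outside (path_image ?J) = {}"
    proof (rule ccontr)
      assume 2: "\<not> ?thesis"
      have "connected (outside (path_image ?J))" using jordan by blast
      moreover have "open (- (F ` cbox a b))" using cpt by (simp add: compact_imp_closed open_Compl)
      moreover have "F ` box a b \<inter> - (F ` cbox a b) \<inter> outside (path_image ?J) = {}" using un by blast
      ultimately show False
        using connectedD[OF _ opn, of "outside (path_image ?J)" "- (F ` cbox a b)"] 1 2 ne by blast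
    qed
    then have "outside (path_image ?J) \<subseteq> F ` cbox a b" by blast
    then have "bounded (outside (path_image ?J))" using cpt compact_imp_bounded bounded_subset by blast
    then show False using jordan by blast
  qed
  show thesis
  proof (rule simple_closed_path_winding_number_inside[OF J])
    assume "\<And>z. z \<in> inside (path_image ?J) \<Longrightarrow> winding_number ?J z = 1"
    then show thesis using that[of 1] ins by blast
  next
    assume "\<And>z. z \<in> inside (path_image ?J) \<Longrightarrow> winding_number ?J z = -1"
    then show thesis using that[of "-1"] ins by blast
  qed
qed

lemma connected_real_nonzero_sgn:
  fixes f :: "'a::topological_space \<Rightarrow> real"
  assumes "connected S" "continuous_on S f" "\<And>x. x \<in> S \<Longrightarrow> f x \<noteq> 0" "x \<in> S" "y \<in> S"
  shows "0 < f x \<longleftrightarrow> 0 < f y"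
proof -
  have conn: "connected (f ` S)" by (rule connected_continuous_image[OF assms(2,1)])
  have False if "u \<in> S" "v \<in> S" "0 < f u" "\<not> 0 < f v" for u v
  proof -
    have "0 \<in> f ` S" using connected_contains_Icc[OF conn, of "f v" "f u"] that by auto
    then show False using assms(3) by auto
  qed
  then show ?thesis using assms(4,5) by blast
qed

text \<open>If a map of winding number one sends the horizontal line through \<open>z0\<close> increasingly to the real
  axis and nothing else to it, then the upper half of the rectangle goes up: otherwise the image of
  the boundary would be homotopic to a clockwise loop.\<close>

lemma orientation_preserving_upper_half:
  fixes F :: "complex \<Rightarrow> complex"
  assumes F: "continuous_on (cbox a b) F" "inj_on F (cbox a b)" and z0: "z0 \<in> box a b"
    and wn: "winding_number (F \<circ> rectpath a b) (F z0) = 1"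
    and real: "\<And>z. z \<in> cbox a b \<Longrightarrow> Im (F z) = 0 \<longleftrightarrow> Im z = Im z0"
    and mono: "\<And>z w. z \<in> cbox a b \<Longrightarrow> w \<in> cbox a b \<Longrightarrow> Im z = Im z0 \<Longrightarrow> Im w = Im z0 \<Longrightarrow>
      Re z < Re w \<Longrightarrow> Re (F z) < Re (F w)"
    and z: "z \<in> cbox a b"
  shows "Im z0 < Im z \<longleftrightarrow> 0 < Im (F z)" "Im z < Im z0 \<longleftrightarrow> Im (F z) < 0"
proof -
  have zc: "Re a < Re z0" "Re z0 < Re b" "Im a < Im z0" "Im z0 < Im b"
    using z0 by (auto simp: in_box_complex_iff)
  have zc0: "z0 \<in> cbox a b" using z0 box_subset_cbox by blast
  have cF: "continuous_on S (\<lambda>z. Im (F z))" if "S \<subseteq> cbox a b" for S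
    by (intro continuous_intros continuous_on_subset[OF F(1) that])
  define U L where "U = cbox a b \<inter> {z. Im z0 < Im z}" and "L = cbox a b \<inter> {z. Im z < Im z0}"
  have conn: "connected U" "connected L" unfolding U_def L_def
    by (intro convex_connected convex_Int convex_box convex_halfspace_Im_gt convex_halfspace_Im_lt)+
  have U: "0 < Im (F z) \<longleftrightarrow> 0 < Im (F w)" if "z \<in> U" "w \<in> U" for z w
    by (rule connected_real_nonzero_sgn[OF conn(1) cF _ that]) (auto simp: U_def real)
  have L: "0 < Im (F z) \<longleftrightarrow> 0 < Im (F w)" if "z \<in> L" "w \<in> L" for z w
    by (rule connected_real_nonzero_sgn[OF conn(2) cF _ that]) (auto simp: L_def real)
  have b: "b \<in> U" "a \<in> L" using zc by (auto simp: U_def L_def in_cbox_complex_iff)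
  have opn: "open (F ` box a b)"
    using F box_subset_cbox by (intro invariance_of_domain) (auto intro: continuous_on_subset inj_on_subset)
  obtain e where e: "e > 0" "ball (F z0) e \<subseteq> F ` box a b"
    using opn z0 open_contains_ball by (metis imageI)
  have F0: "Im (F z0) = 0" using real[OF zc0] by simp
  \<comment> \<open>The image is open around \<open>F z0\<close>, hence reaches both sides of the
    real axis. So the two halves of the rectangle cannot go to the same side.\<close>
  have "\<exists>w\<in>cbox a b. 0 < Im (F w)" "\<exists>w\<in>cbox a b. Im (F w) < 0"
  proof -
    have "F z0 + of_real (e/2) * \<i> \<in> F ` box a b" "F z0 - of_real (e/2) * \<i> \<in> F ` box a b"
      using e by (auto simp: dist_norm norm_mult subset_iff)
    then obtain w1 w2 where "w1 \<in> box a b" "F w1 = F z0 + of_real (e/2) * \<i>"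
        "w2 \<in> box a b" "F w2 = F z0 - of_real (e/2) * \<i>" by (metis imageE)
    then show "\<exists>w\<in>cbox a b. 0 < Im (F w)" "\<exists>w\<in>cbox a b. Im (F w) < 0"
      using e(1) F0 box_subset_cbox[of a b] by force+
  qed
  then obtain w1 w2 where w: "w1 \<in> cbox a b" "0 < Im (F w1)" "w2 \<in> cbox a b" "Im (F w2) < 0" by blast
  have UL: "w \<in> U \<or> w \<in> L" if "w \<in> cbox a b" "Im (F w) \<noteq> 0" for w
    using that real[OF that(1)] by (auto simp: U_def L_def)
  have opp: "0 < Im (F b) \<longleftrightarrow> \<not> 0 < Im (F a)"
  proof -
    have "w1 \<in> U \<Longrightarrow> 0 < Im (F b)" "w1 \<in> L \<Longrightarrow> 0 < Im (F a)" "w2 \<in> U \<Longrightarrow> \<not> 0 < Im (F b)" "w2 \<in> L \<Longrightarrow> \<not> 0 < Im (F a)"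
      using U[of w1 b] U[of w2 b] L[of w1 a] L[of w2 a] w b by auto
    moreover have "w1 \<in> U \<or> w1 \<in> L" "w2 \<in> U \<or> w2 \<in> L" using UL w by auto
    ultimately show ?thesis by blast
  qed
  have "0 < Im (F b)"
  proof (rule ccontr)
    assume neg: "\<not> 0 < Im (F b)"
    have U': "Im (F w) < 0" if "w \<in> U" for w
      using U[OF that b(1)] neg real[of w] that by (force simp: U_def)
    have L': "0 < Im (F w)" if "w \<in> L" for w using L[OF that b(2)] neg opp by simp
    \<comment> \<open>If the upper half went down, the image loop \<open>g\<close> and the reflected
      boundary \<open>h\<close> would never point in opposite directions: off the line their
      imaginary parts have the same sign, and on it their real parts do, by monotonicity. They would
      then have the same winding number, but \<open>h\<close> has winding number -1.\<close>
    define g h where "g u = F (rectpath a b u) - F z0" and "h u = cnj (rectpath a b u) - cnj z0" for u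
    have rpin: "rectpath a b u \<in> cbox a b - box a b" if "u \<in> {0..1}" for u
      using that zc by (intro path_image_rectpath_in) auto
    have bd: "path_image (rectpath a b) = cbox a b - box a b"
      using zc by (intro path_image_rectpath_cbox_minus_box) auto
    have pF: "path (F \<circ> rectpath a b)"
      using F(1) bd by (intro path_continuous_image) (auto intro: continuous_on_subset)
    have "winding_number h 0 = winding_number g 0"
    proof (rule winding_number_loops_linear_eq)
      show "path g" using pF unfolding path_def g_def o_def by (intro continuous_intros)
      show "path h" using path_rectpath[of a b] unfolding path_def h_def by (intro continuous_intros)
      show "pathfinish g = pathstart g" "pathfinish h = pathstart h"
        using pathfinish_rectpath[of a b] pathstart_rectpath[of a b]
        by (simp_all add: g_def h_def pathfinish_def pathstart_def)
      fix u :: real assume u: "u \<in> {0..1}"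
      define w where "w = rectpath a b u"
      have w: "w \<in> cbox a b" "w \<noteq> z0" using rpin[OF u] z0 by (auto simp: w_def)
      show "0 \<notin> closed_segment (g u) (h u)"
      proof
        assume "0 \<in> closed_segment (g u) (h u)"
        then obtain \<tau> where t: "0 \<le> \<tau>" "\<tau> \<le> 1" "0 = (1 - \<tau>) *\<^sub>R g u + \<tau> *\<^sub>R h u"
          by (auto simp: in_segment)
        have im0: "(1 - \<tau>) * Im (F w) + \<tau> * (Im z0 - Im w) = 0"
          using arg_cong[OF t(3), of Im] F0 by (simp add: g_def h_def w_def algebra_simps)
        have re0: "(1 - \<tau>) * (Re (F w) - Re (F z0)) + \<tau> * (Re w - Re z0) = 0"
          using arg_cong[OF t(3), of Re] by (simp add: g_def h_def w_def algebra_simps)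
        have conv: False if "x > 0 \<and> y > 0 \<or> x < 0 \<and> y < 0" "(1 - \<tau>) * x + \<tau> * y = 0" for x y :: real
        proof (cases "\<tau> = 0")
          case False
          then have "\<tau> > 0" using t by simp
          from that(1) show False
          proof
            assume "x > 0 \<and> y > 0"
            then have "0 \<le> (1 - \<tau>) * x" "0 < \<tau> * y" using t \<open>\<tau> > 0\<close> by auto
            then show False using that(2) by linarith
          next
            assume "x < 0 \<and> y < 0"
            then have "(1 - \<tau>) * x \<le> 0" "\<tau> * y < 0" using t \<open>\<tau> > 0\<close> by (auto simp: mult_le_0_iff mult_less_0_iff)
            then show False using that(2) by linarith
          qed
        qed (use that in auto)
        consider "Im z0 < Im w" | "Im w < Im z0" | "Im w = Im z0" by linarith
        then show False
        proof cases
          case 1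
          then have "w \<in> U" using w by (simp add: U_def)
          from conv[OF _ im0] U'[OF this] 1 show False by simp
        next
          case 2
          then have "w \<in> L" using w by (simp add: L_def)
          from conv[OF _ im0] L'[OF this] 2 show False by simp
        next
          case 3
          then have "Re w \<noteq> Re z0" using w(2) by (auto simp: complex_eq_iff)
          then have "Re (F w) - Re (F z0) > 0 \<and> Re w - Re z0 > 0 \<or> Re (F w) - Re (F z0) < 0 \<and> Re w - Re z0 < 0"
            using mono[OF w(1) zc0 3] mono[OF zc0 w(1) _ 3] by fastforce
          from conv[OF this re0] show False .
        qed
      qed
    qed
    also have "winding_number g 0 = 1"
      using wn unfolding winding_number_offset[of "F \<circ> rectpath a b"] by (simp add: g_def[abs_def] o_def)
    also have "winding_number h 0 = winding_number (cnj \<circ> rectpath a b) (cnj z0)"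
      unfolding winding_number_offset[of "cnj \<circ> rectpath a b"] by (simp add: h_def[abs_def] o_def)
    also have "\<dots> = - cnj (winding_number (rectpath a b) z0)"
      using bd z0 by (intro winding_number_cnj) auto
    also have "winding_number (rectpath a b) z0 = 1" by (rule winding_number_rectpath[OF z0])
    finally show False by simp
  qed
  then have 1: "0 < Im (F w)" if "w \<in> U" for w using U[OF that b(1)] by simp
  have 2: "Im (F w) < 0" if "w \<in> L" for w
    using L[OF that b(2)] opp \<open>0 < Im (F b)\<close> real[of w] that by (force simp: L_def)
  have "z \<in> U \<or> z \<in> L \<or> Im z = Im z0" using z by (auto simp: U_def L_def)
  then consider "z \<in> U" | "z \<in> L" | "Im z = Im z0" by blast
  then show "Im z0 < Im z \<longleftrightarrow> 0 < Im (F z)" "Im z < Im z0 \<longleftrightarrow> Im (F z) < 0"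
    using 1[of z] 2[of z] real[OF z] by (cases; auto simp: U_def L_def)+
qed

section \<open>Lifts of leaves and of flow boxes\<close>

lemma rect_iff: "(t, s) \<in> rect B \<longleftrightarrow> t \<in> {tmin B..tmax B} \<and> s \<in> {smin B..smax B}"
  by (simp add: rect_def)

lemma open_rect_iff: "(t, s) \<in> open_rect B \<longleftrightarrow> t \<in> {tmin B<..<tmax B} \<and> s \<in> {smin B<..<smax B}"
  by (simp add: open_rect_def)

lemma open_rect_subset: "open_rect B \<subseteq> rect B"
  by (auto simp: open_rect_def rect_def)

lemma open_open_rect: "open (open_rect B)"
  unfolding open_rect_def by (intro open_Times) auto

lemma convex_rect: "convex (rect B)"
  unfolding rect_def by (intro convex_Times) auto

lemma flow_box_bilipschitz:
  assumes "flow_box M \<Lambda> B"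
  obtains C where "C > 0"
    "\<And>x y. x \<in> rect B \<Longrightarrow> y \<in> rect B \<Longrightarrow> dist x y \<le> C * dist (chart B x) (chart B y)"
    "\<And>x y. x \<in> rect B \<Longrightarrow> y \<in> rect B \<Longrightarrow> dist (chart B x) (chart B y) \<le> C * dist x y"
proof -
  have "\<exists>C>0. \<forall>x\<in>rect B. \<forall>y\<in>rect B.
     dist x y / C \<le> dist (chart B x) (chart B y) \<and> dist (chart B x) (chart B y) \<le> C * dist x y"
    using assms by (simp add: flow_box_def)
  then obtain C where C: "C > 0" "\<forall>x\<in>rect B. \<forall>y\<in>rect B.
     dist x y / C \<le> dist (chart B x) (chart B y) \<and> dist (chart B x) (chart B y) \<le> C * dist x y" by blast
  show thesis
  proof (rule that[OF C(1)])
    fix x y assume "x \<in> rect B" "y \<in> rect B"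
    then have "dist x y / C \<le> dist (chart B x) (chart B y)" "dist (chart B x) (chart B y) \<le> C * dist x y"
      using C(2) by auto
    then show "dist x y \<le> C * dist (chart B x) (chart B y)" "dist (chart B x) (chart B y) \<le> C * dist x y"
      using C(1) by (auto simp: field_simps)
  qed
qed

lemma flow_box_inj:
  assumes "flow_box M \<Lambda> B"
  shows "inj_on (chart B) (rect B)"
proof (rule inj_onI)
  obtain C where C: "C > 0" "\<And>x y. x \<in> rect B \<Longrightarrow> y \<in> rect B \<Longrightarrow> dist x y \<le> C * dist (chart B x) (chart B y)"
    by (rule flow_box_bilipschitz[OF assms]) (rule that)
  fix x y assume xy: "x \<in> rect B" "y \<in> rect B" "chart B x = chart B y"
  then show "x = y" using C(2)[OF xy(1,2)] by simp
qed

lemma flow_box_continuous: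
  assumes "flow_box M \<Lambda> B"
  shows "continuous_on (rect B) (chart B)"
proof -
  obtain C where C: "C > 0" "\<And>x y. x \<in> rect B \<Longrightarrow> y \<in> rect B \<Longrightarrow> dist (chart B x) (chart B y) \<le> C * dist x y"
    by (rule flow_box_bilipschitz[OF assms]) (rule that)
  show ?thesis
    by (rule lipschitz_on_continuous_on[of C]) (use C in \<open>auto intro: lipschitz_onI\<close>)
qed

lemma flow_box_continuous_inv:
  assumes "flow_box M \<Lambda> B"
  shows "continuous_on (chart B ` rect B) (inv_into (rect B) (chart B))"
proof -
  obtain C where C: "C > 0" "\<And>x y. x \<in> rect B \<Longrightarrow> y \<in> rect B \<Longrightarrow> dist x y \<le> C * dist (chart B x) (chart B y)"
    by (rule flow_box_bilipschitz[OF assms]) (rule that)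
  note inv = inv_into_f_f[OF flow_box_inj[OF assms]]
  show ?thesis
  proof (rule lipschitz_on_continuous_on[of C], rule lipschitz_onI)
    fix y y' assume "y \<in> chart B ` rect B" "y' \<in> chart B ` rect B"
    then show "dist (inv_into (rect B) (chart B) y) (inv_into (rect B) (chart B) y') \<le> C * dist y y'"
      using C(2) by (auto simp: inv)
  qed (use C in auto)
qed

lemma flow_box_leaf_iff:
  assumes "flow_box M \<Lambda> B" "(t, s) \<in> rect B"
  shows "chart B (t, s) \<in> \<Lambda> \<longleftrightarrow> s \<in> slice B"
proof -
  have "{x \<in> rect B. chart B x \<in> \<Lambda>} = {tmin B..tmax B} \<times> slice B"
    using assms(1) by (simp add: flow_box_def)
  then have "(t, s) \<in> {x \<in> rect B. chart B x \<in> \<Lambda>} \<longleftrightarrow> (t, s) \<in> {tmin B..tmax B} \<times> slice B" by simp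
  then show ?thesis using assms(2) by (simp add: rect_iff)
qed

lemma flow_box_slice: "flow_box M \<Lambda> B \<Longrightarrow> s \<in> slice B \<Longrightarrow> smin B < s \<and> s < smax B"
  unfolding flow_box_def by auto

lemma transverse_coord_chart:
  assumes "flow_box M \<Lambda> B" "x \<in> rect B" "f \<tau> = chart B x"
  shows "transverse_coord B f \<tau> = snd x"
  using assms inv_into_f_f[OF flow_box_inj[OF assms(1)]] by (simp add: transverse_coord_def)

abbreviation lo :: "'m flow_box_data \<Rightarrow> complex" where "lo B \<equiv> Complex (tmin B) (smin B)"
abbreviation hi :: "'m flow_box_data \<Rightarrow> complex" where "hi B \<equiv> Complex (tmax B) (smax B)"

lemma rect_cbox: "(Re z, Im z) \<in> rect B \<longleftrightarrow> z \<in> cbox (lo B) (hi B)"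
  by (auto simp: rect_def in_cbox_complex_iff)

lemma open_rect_box: "(Re z, Im z) \<in> open_rect B \<longleftrightarrow> z \<in> box (lo B) (hi B)"
  by (auto simp: open_rect_def in_box_complex_iff)

lemma continuous_on_ReIm:
  fixes G :: "real \<times> real \<Rightarrow> 'a::topological_space"
  assumes "continuous_on S G" "(\<lambda>z. (Re z, Im z)) ` T \<subseteq> S"
  shows "continuous_on T (\<lambda>z. G (Re z, Im z))"
  by (rule continuous_on_compose2[OF assms(1) _ assms(2)]) (intro continuous_intros)

section \<open>Crossings with a sign\<close>

text \<open>The factor \<open>e\<close>, always 1 or -1, makes increasing and decreasing crossings a
  single notion, so that later arguments need not be given twice.\<close>

definition crossing ::
    "(complex \<Rightarrow> 'm::metric_space) \<Rightarrow> 'm set \<Rightarrow> 'm set \<Rightarrow> (real \<Rightarrow> 'm) set \<Rightarrow>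
      real \<Rightarrow> real \<Rightarrow> real \<Rightarrow> (real \<Rightarrow> 'm) \<Rightarrow> real \<Rightarrow> bool" where
  "crossing p M \<Lambda> Or e l m f k \<longleftrightarrow>
     (\<exists>B. \<exists>\<eta>>0. oriented_flow_box p M \<Lambda> Or B \<and> f k \<in> chart B ` open_rect B \<and>
        {k - \<eta>..k + \<eta>} \<subseteq> {l..m} \<and> crosses_box B f {k - \<eta>..k + \<eta>} \<and>
        strict_mono_on {k - \<eta>..k + \<eta>} (\<lambda>\<tau>. e * transverse_coord B f \<tau>))"

definition signed_transverse ::
    "(complex \<Rightarrow> 'm::metric_space) \<Rightarrow> 'm set \<Rightarrow> 'm set \<Rightarrow> (real \<Rightarrow> 'm) set \<Rightarrow>
      real \<Rightarrow> real \<Rightarrow> real \<Rightarrow> (real \<Rightarrow> 'm) \<Rightarrow> bool" where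
  "signed_transverse p M \<Lambda> Or e l m f \<longleftrightarrow>
     admissible_transversal M \<Lambda> l m f \<and> (\<forall>k\<in>{l..m}. f k \<in> \<Lambda> \<longrightarrow> crossing p M \<Lambda> Or e l m f k)"

lemma positively_transverse_iff:
  "positively_transverse p M \<Lambda> Or l m f \<longleftrightarrow> signed_transverse p M \<Lambda> Or 1 l m f"
  by (simp add: positively_transverse_def signed_transverse_def crossing_def)

lemma negatively_transverse_iff:
  "negatively_transverse p M \<Lambda> Or l m f \<longleftrightarrow> signed_transverse p M \<Lambda> Or (-1) l m f"
  by (simp add: negatively_transverse_def signed_transverse_def crossing_def monotone_on_def)

locale oriented_lamination = hyperbolic_surface p M
  for p :: "complex \<Rightarrow> 'm::metric_space" and M :: "'m set" +
  fixes \<Lambda> :: "'m set" and Or :: "(real \<Rightarrow> 'm) set"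
  assumes lamination: "oriented_geodesic_lamination p M \<Lambda> Or"
begin

abbreviation lift_\<Lambda> :: "complex set" where "lift_\<Lambda> \<equiv> lamination_lift p \<Lambda>"

section \<open>Lifts of leaves\<close>

definition leaf_lift :: "(real \<Rightarrow> complex) \<Rightarrow> bool" where
  "leaf_lift h \<longleftrightarrow> geodesic h \<and> (\<lambda>t. p (h t)) \<in> Or"

lemma orientation: "leaf_orientation p \<Lambda> Or"
  using lamination by (simp add: oriented_geodesic_lamination_def)

lemma lamination_subset: "\<Lambda> \<subseteq> M"
  using lamination by (simp add: oriented_geodesic_lamination_def geodesic_lamination_def)

lemma leaf_lift_hyp: "leaf_lift h \<Longrightarrow> h t \<in> hyp_plane"
  by (simp add: leaf_lift_def geodesic_def)

lemma leaf_lift_in: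
  assumes "leaf_lift h"
  shows "h t \<in> lift_\<Lambda>" "p (h t) \<in> \<Lambda>"
proof -
  have "(\<lambda>t. p (h t)) \<in> Or" using assms by (simp add: leaf_lift_def)
  then show "p (h t) \<in> \<Lambda>" using orientation unfolding leaf_orientation_def by blast
  then show "h t \<in> lift_\<Lambda>" using leaf_lift_hyp[OF assms] by (simp add: lamination_lift_def)
qed

lemma leaf_lift_deck:
  assumes h: "leaf_lift h" and g: "\<gamma> \<in> deck_group p"
  shows "leaf_lift (\<lambda>t. \<gamma> (h t))"
  using h deck_isometry[OF g] deck_in[OF g] deck_p[OF g]
  by (simp add: leaf_lift_def geodesic_def)

lemma leaf_lift_at:
  assumes "g \<in> Or" "z \<in> hyp_plane" "p z = g t"
  obtains h where "leaf_lift h" "h t = z" "\<And>s. p (h s) = g s"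
proof -
  have "simple_complete_geodesic p g" using orientation assms(1) by (simp add: leaf_orientation_def)
  then obtain h where h: "geodesic h" "\<forall>s. g s = p (h s)"
    unfolding simple_complete_geodesic_def geodesic_def by blast
  have "(\<lambda>s. p (h s)) = g" using h(2) by auto
  then have lh: "leaf_lift h" using assms(1) h(1) by (simp add: leaf_lift_def)
  obtain \<gamma> where g: "\<gamma> \<in> deck_group p" "\<gamma> (h t) = z"
    using deck_exists[OF leaf_lift_hyp[OF lh] assms(2)] h(2) assms(3) by metis
  show thesis
    using that[of "\<lambda>t. \<gamma> (h t)"] leaf_lift_deck[OF lh g(1)] g(2) deck_p[OF g(1) leaf_lift_hyp[OF lh]] h(2)
    by simp
qed

lemma leaf_lift_through:
  assumes "z \<in> lift_\<Lambda>"
  obtains h where "leaf_lift h" "z \<in> range h"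
proof -
  have z: "z \<in> hyp_plane" "p z \<in> \<Lambda>" using assms by (auto simp: lamination_lift_def)
  then obtain g t where g: "g \<in> Or" "p z = g t" using orientation unfolding leaf_orientation_def by blast
  show thesis by (rule leaf_lift_at[OF g(1) z(1) g(2)]) (metis that rangeI)
qed

text \<open>The orientation gives some translation between the two parametrisations in
  \<open>M\<close>, which for a closed leaf may differ from \<open>a - b\<close> by a period.
  Simplicity replaces it by \<open>a - b\<close>, and then the lifts agree at \<open>b\<close> and
  hence everywhere.\<close>

lemma leaf_lift_unique:
  assumes h: "leaf_lift h" and k: "leaf_lift k" and eq: "h a = k b"
  shows "k t = h (t + (a - b))"
proof -
  define g g' where "g t = p (h t)" and "g' t = p (k t)" for t
  have Or: "g \<in> Or" "g' \<in> Or" using h k unfolding g_def g'_def leaf_lift_def by auto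
  have "g a = g' b" using eq by (simp add: g_def g'_def)
  then have "range g \<inter> range g' \<noteq> {}" by (metis disjoint_iff rangeI)
  moreover have "\<forall>g\<in>Or. \<forall>h\<in>Or. range g \<inter> range h \<noteq> {} \<longrightarrow> (\<exists>a. \<forall>t. h t = g (t + a))"
    using orientation by (simp add: leaf_orientation_def)
  ultimately have "\<exists>c. \<forall>t. g' t = g (t + c)" using Or by simp
  then obtain c where c: "\<And>t. g' t = g (t + c)" by auto
  have simple: "\<forall>s t. g s = g t \<longrightarrow> (\<forall>u. g (s + u) = g (t + u))"
    using orientation Or(1) by (simp add: leaf_orientation_def simple_complete_geodesic_def)
  have "g (b + c) = g a" using c[of b] \<open>g a = g' b\<close> by simp
  then have "g (b + c + (t - b)) = g (a + (t - b))" for t using simple by blast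
  then have per: "g' t = g (t + (a - b))" for t using c by (simp add: algebra_simps)
  show ?thesis
  proof (rule lift_unique[where U=UNIV and a=b and ?g1.0=k and ?g2.0="\<lambda>t. h (t + (a - b))"])
    show "continuous_on UNIV k" "continuous_on UNIV (\<lambda>t. h (t + (a - b)))"
      using h k by (auto simp: leaf_lift_def intro!: continuous_on_geodesic geodesic_shift)
    show "p (k t) = p (h (t + (a - b)))" for t using per[of t] by (simp add: g_def g'_def)
  qed (use eq leaf_lift_hyp[OF h] leaf_lift_hyp[OF k] in auto)
qed

lemma closed_leaf_lift:
  assumes h: "leaf_lift h" and g: "continuous_on U g" "g ` U \<subseteq> hyp_plane"
  shows "closedin (top_of_set U) {u\<in>U. g u \<in> range h}"
proof -
  obtain \<Psi> where P: "geodesic_chart h \<Psi>" using geodesic_chart_exists h by (auto simp: leaf_lift_def)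
  have "g u \<in> range h \<longleftrightarrow> Im (\<Psi> (g u)) = 0" if "u \<in> U" for u
    using P that g(2) by (auto simp: geodesic_chart_def)
  then have "{u\<in>U. g u \<in> range h} = {u\<in>U. Im (\<Psi> (g u)) = 0}" by auto
  moreover have "continuous_on U (\<lambda>u. \<Psi> (g u))"
    using P g by (intro continuous_on_compose2[OF holomorphic_on_imp_continuous_on, of \<Psi> hyp_plane])
      (auto simp: geodesic_chart_def)
  then have "continuous_on U (\<lambda>u. Im (\<Psi> (g u)))" by (intro continuous_intros)
  ultimately show ?thesis by (simp add: continuous_closedin_preimage_constant)
qed

section \<open>Lifts of flow boxes\<close>

definition box_lift :: "'m flow_box_data \<Rightarrow> (real \<times> real \<Rightarrow> complex) \<Rightarrow> bool" where
  "box_lift B G \<longleftrightarrow> continuous_on (rect B) G \<and> G ` rect B \<subseteq> hyp_plane \<and> (\<forall>x\<in>rect B. p (G x) = chart B x)"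

lemma box_lift_exists:
  assumes "flow_box M \<Lambda> B" "x \<in> rect B" "z \<in> hyp_plane" "p z = chart B x"
  obtains G where "box_lift B G" "G x = z"
proof -
  have im: "chart B ` rect B \<subseteq> M" using assms(1) by (simp add: flow_box_def)
  show thesis
  proof (rule lift_exists_at[OF convex_rect assms(2,3) flow_box_continuous[OF assms(1)] im assms(4)[symmetric]])
    fix g assume "continuous_on (rect B) g" "g ` rect B \<subseteq> hyp_plane" "g x = z"
      "\<And>y. y \<in> rect B \<Longrightarrow> p (g y) = chart B y"
    then show thesis by (intro that[of g]) (simp_all add: box_lift_def)
  qed
qed

lemma box_lift_inj:
  assumes "flow_box M \<Lambda> B" "box_lift B G"
  shows "inj_on G (rect B)"
  using flow_box_inj[OF assms(1)] assms(2) unfolding box_lift_def inj_on_def by metis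

lemma box_lift_leaf_iff:
  assumes "flow_box M \<Lambda> B" "box_lift B G" "(t, s) \<in> rect B"
  shows "G (t, s) \<in> lift_\<Lambda> \<longleftrightarrow> s \<in> slice B"
  using flow_box_leaf_iff[OF assms(1,3)] assms(2,3)
  by (auto simp: lamination_lift_def box_lift_def)

lemma box_lift_complex:
  assumes "flow_box M \<Lambda> B" "box_lift B G"
  shows "continuous_on (cbox (lo B) (hi B)) (\<lambda>z. G (Re z, Im z))"
    and "inj_on (\<lambda>z. G (Re z, Im z)) (cbox (lo B) (hi B))"
proof -
  show "continuous_on (cbox (lo B) (hi B)) (\<lambda>z. G (Re z, Im z))"
    using assms(2) rect_cbox by (intro continuous_on_ReIm) (auto simp: box_lift_def)
  show "inj_on (\<lambda>z. G (Re z, Im z)) (cbox (lo B) (hi B))"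
  proof (rule inj_onI)
    fix z w assume "z \<in> cbox (lo B) (hi B)" "w \<in> cbox (lo B) (hi B)" "G (Re z, Im z) = G (Re w, Im w)"
    then have "(Re z, Im z) = (Re w, Im w)"
      using box_lift_inj[OF assms] rect_cbox by (metis inj_onD)
    then show "z = w" by (simp add: complex_eq_iff)
  qed
qed

text \<open>Orientation is defined through some lift. Any other lift differs from it by a deck
  transformation, which is holomorphic and injective and therefore keeps the winding number.\<close>

lemma oriented_box_winding_number:
  assumes B: "flow_box M \<Lambda> B" "orientation_preserving_box p B" and G: "box_lift B G" and x: "x \<in> open_rect B"
  shows "winding_number ((\<lambda>z. G (Re z, Im z)) \<circ> rectpath (lo B) (hi B)) (G x) = 1"
proof -
  obtain G0 where G0: "box_lift B G0" and wn: "\<And>x. x \<in> open_rect B \<Longrightarrow>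
      winding_number ((\<lambda>z. G0 (Re z, Im z)) \<circ> rectpath (lo B) (hi B)) (G0 x) = 1"
    using B(2) unfolding orientation_preserving_box_def box_lift_def by blast
  have xr: "x \<in> rect B" using x open_rect_subset by blast
  obtain \<gamma> where g: "\<gamma> \<in> deck_group p" "\<And>x. x \<in> rect B \<Longrightarrow> G x = \<gamma> (G0 x)"
    using lifts_differ_by_deck[of "rect B" G0 G] G G0 xr convex_connected[OF convex_rect]
    unfolding box_lift_def by (metis empty_iff)
  have ab: "Re (lo B) \<le> Re (hi B)" "Im (lo B) \<le> Im (hi B)" using B(1) by (auto simp: flow_box_def)
  define \<gamma>0 where "\<gamma>0 = (\<lambda>z. G0 (Re z, Im z)) \<circ> rectpath (lo B) (hi B)"
  have bd: "path_image (rectpath (lo B) (hi B)) = cbox (lo B) (hi B) - box (lo B) (hi B)"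
    by (rule path_image_rectpath_cbox_minus_box[OF ab])
  have "winding_number (\<gamma> \<circ> \<gamma>0) (\<gamma> (G0 x)) = winding_number \<gamma>0 (G0 x)"
  proof (rule winding_number_holomorphic_image[OF open_hyp_plane convex_hyp_plane
        deck_holomorphic[OF g(1)] deck_inj[OF g(1)]])
    show "path \<gamma>0" unfolding \<gamma>0_def using bd
      by (intro path_continuous_image continuous_on_subset[OF box_lift_complex(1)[OF B(1) G0]]) auto
    show "pathfinish \<gamma>0 = pathstart \<gamma>0" by (simp add: \<gamma>0_def pathfinish_compose pathstart_compose)
    show "path_image \<gamma>0 \<subseteq> hyp_plane" unfolding \<gamma>0_def path_image_compose bd
      using G0 rect_cbox by (auto simp: box_lift_def)
    show "G0 x \<in> hyp_plane" using G0 xr by (auto simp: box_lift_def)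
    show "G0 x \<notin> path_image \<gamma>0"
    proof
      assume "G0 x \<in> path_image \<gamma>0"
      then obtain z where z: "z \<in> cbox (lo B) (hi B)" "z \<notin> box (lo B) (hi B)" "G0 x = G0 (Re z, Im z)"
        unfolding \<gamma>0_def path_image_compose bd by auto
      then have "x = (Re z, Im z)"
        using inj_onD[OF box_lift_inj[OF B(1) G0] z(3) xr] rect_cbox by blast
      then show False using x z open_rect_box by auto
    qed
  qed
  also have "\<dots> = 1" using wn[OF x] by (simp add: \<gamma>0_def)
  finally have 1: "winding_number (\<gamma> \<circ> \<gamma>0) (G x) = 1" using g(2)[OF xr] by simp
  have "winding_number ((\<lambda>z. G (Re z, Im z)) \<circ> rectpath (lo B) (hi B)) (G x) = winding_number (\<gamma> \<circ> \<gamma>0) (G x)"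
  proof (rule winding_number_cong)
    fix u :: real assume "0 \<le> u" "u \<le> 1"
    then have "rectpath (lo B) (hi B) u \<in> cbox (lo B) (hi B)"
      using path_image_rectpath_in[OF ab, of u] by auto
    then show "((\<lambda>z. G (Re z, Im z)) \<circ> rectpath (lo B) (hi B)) u = (\<gamma> \<circ> \<gamma>0) u"
      using g(2) unfolding rect_cbox[symmetric] by (simp add: \<gamma>0_def)
  qed
  with 1 show ?thesis by simp
qed

text \<open>The orientation of the box only gives a parametrised leaf in \<open>M\<close>. It is
  lifted from the point \<open>G (t1, s)\<close>, so it must lie on \<open>h\<close>, and the
  difference of the two parameters is a translation, which keeps the direction.\<close>

lemma oriented_box_horizontal:
  assumes B: "oriented_flow_box p M \<Lambda> Or B" and G: "box_lift B G" and s: "s \<in> slice B"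
    and h: "leaf_lift h" "t1 \<in> {tmin B..tmax B}" "G (t1, s) \<in> range h"
  obtains \<theta> where "continuous_on {tmin B..tmax B} \<theta>" "strict_mono_on {tmin B..tmax B} \<theta>"
    "\<And>t. t \<in> {tmin B..tmax B} \<Longrightarrow> G (t, s) = h (\<theta> t)"
proof -
  have fb: "flow_box M \<Lambda> B" using B by (simp add: oriented_flow_box_def)
  have sr: "(t, s) \<in> rect B" if "t \<in> {tmin B..tmax B}" for t
    using flow_box_slice[OF fb s] that by (simp add: rect_iff)
  obtain g \<theta> where g: "g \<in> Or" "continuous_on {tmin B..tmax B} \<theta>" "strict_mono_on {tmin B..tmax B} \<theta>"
      "\<forall>t\<in>{tmin B..tmax B}. chart B (t, s) = g (\<theta> t)"
    using B s unfolding oriented_flow_box_def by blast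
  have G': "continuous_on (rect B) G" "G ` rect B \<subseteq> hyp_plane" "\<And>x. x \<in> rect B \<Longrightarrow> p (G x) = chart B x"
    using G by (auto simp: box_lift_def)
  have z: "G (t1, s) \<in> hyp_plane" using G'(2) sr[OF h(2)] by blast
  have pz: "p (G (t1, s)) = g (\<theta> t1)" using G'(3) sr[OF h(2)] g(4) h(2) by simp
  obtain k where k: "leaf_lift k" "k (\<theta> t1) = G (t1, s)" "\<And>s. p (k s) = g s"
    by (rule leaf_lift_at[OF g(1) z pz]) (rule that)
  have "G (t, s) = k (\<theta> t)" if "t \<in> {tmin B..tmax B}" for t
  proof (rule lift_unique[where U="{tmin B..tmax B}" and a=t1 and ?g1.0="\<lambda>t. G (t, s)" and ?g2.0="\<lambda>t. k (\<theta> t)"])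
    show "continuous_on {tmin B..tmax B} (\<lambda>t. G (t, s))"
      by (rule continuous_on_compose2[OF G'(1)]) (use sr in \<open>auto intro!: continuous_intros\<close>)
    show "continuous_on {tmin B..tmax B} (\<lambda>t. k (\<theta> t))"
      by (rule continuous_on_compose2[OF continuous_on_geodesic[of k UNIV] g(2)])
        (use k in \<open>auto simp: leaf_lift_def\<close>)
  qed (use h(2) that k leaf_lift_hyp G' sr g(4) in auto)
  moreover obtain a where "G (t1, s) = h a" using h(3) by blast
  then have "h a = k (\<theta> t1)" using k(2) by simp
  then have "k t = h (t + (a - \<theta> t1))" for t by (rule leaf_lift_unique[OF h(1) k(1)])
  ultimately have eq: "G (t, s) = h (\<theta> t + (a - \<theta> t1))" if "t \<in> {tmin B..tmax B}" for t using that by simp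
  show thesis
  proof (rule that[of "\<lambda>t. \<theta> t + (a - \<theta> t1)"])
    show "continuous_on {tmin B..tmax B} (\<lambda>t. \<theta> t + (a - \<theta> t1))" by (intro continuous_intros g(2))
    show "strict_mono_on {tmin B..tmax B} (\<lambda>t. \<theta> t + (a - \<theta> t1))"
      using g(3) by (simp add: monotone_on_def)
  qed (rule eq)
qed

lemma dist_Pair_le_real:
  fixes a b c d :: real
  shows "dist (a, b) (c, d) \<le> \<bar>a - c\<bar> + \<bar>b - d\<bar>"
  unfolding dist_Pair_Pair dist_real_def using sqrt_sum_squares_le_sum_abs[of "\<bar>a - c\<bar>" "\<bar>b - d\<bar>"] by simp

text \<open>Near a point of the lamination an oriented flow box distinguishes the two sides of each leaf.
  Leaves are unit speed geodesics, so a leaf of a nearby slice can enter a small neighborhood of the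
  point only within that slice.\<close>

lemma oriented_box_sides:
  assumes B: "oriented_flow_box p M \<Lambda> Or B" and G: "box_lift B G" and x0: "(t0, s0) \<in> open_rect B"
  obtains \<epsilon> where "\<epsilon> > 0" "{t0 - \<epsilon>..t0 + \<epsilon>} \<times> {s0 - \<epsilon>..s0 + \<epsilon>} \<subseteq> open_rect B"
    "\<And>s h \<Psi> t s'. s \<in> slice B \<Longrightarrow> \<bar>s - s0\<bar> < \<epsilon> \<Longrightarrow> leaf_lift h \<Longrightarrow> G (t0, s) \<in> range h \<Longrightarrow>
       geodesic_chart h \<Psi> \<Longrightarrow> \<bar>t - t0\<bar> \<le> \<epsilon> \<Longrightarrow> \<bar>s' - s0\<bar> \<le> \<epsilon> \<Longrightarrow>
       (s < s' \<longleftrightarrow> 0 < Im (\<Psi> (G (t, s')))) \<and> (s' < s \<longleftrightarrow> Im (\<Psi> (G (t, s'))) < 0)"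
proof -
  have fb: "flow_box M \<Lambda> B" and ob: "orientation_preserving_box p B" using B by (auto simp: oriented_flow_box_def)
  have G': "continuous_on (rect B) G" "G ` rect B \<subseteq> hyp_plane" using G by (auto simp: box_lift_def)
  define D where "D xy = hyp_dist (G (fst xy)) (G (snd xy))" for xy
  have "continuous_on (rect B \<times> rect B) D" unfolding D_def
  proof (rule continuous_on_hyp_dist)
    show "continuous_on (rect B \<times> rect B) (\<lambda>x. G (fst x))" "continuous_on (rect B \<times> rect B) (\<lambda>x. G (snd x))"
      by (rule continuous_on_compose2[OF G'(1)]; auto intro!: continuous_intros)+
  qed (use G'(2) in auto)
  then have cD: "\<exists>d>0. \<forall>xy\<in>rect B \<times> rect B. dist xy z < d \<longrightarrow> \<bar>D xy - D z\<bar> < e"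
    if "z \<in> rect B \<times> rect B" "e > 0" for z e
    using that unfolding continuous_on_iff dist_real_def by blast
  have t0: "tmin B < t0" "t0 < tmax B" "smin B < s0" "s0 < smax B" using x0 by (auto simp: open_rect_iff)
  have rc: "(t0, s0) \<in> rect B" "(tmin B, s0) \<in> rect B" "(tmax B, s0) \<in> rect B"
    using t0 by (auto simp: rect_iff)
  have Dpos: "D (x, y) > 0" if "x \<in> rect B" "y \<in> rect B" "x \<noteq> y" for x y
  proof -
    have "G x \<noteq> G y" using box_lift_inj[OF fb G] that by (auto dest: inj_onD)
    then have "D (x, y) \<noteq> 0" using hyp_dist_eq_0_iff G'(2) that by (auto simp: D_def image_subset_iff)
    moreover have "D (x, y) \<ge> 0" using hyp_dist_nonneg G'(2) that by (auto simp: D_def image_subset_iff)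
    ultimately show ?thesis by simp
  qed
  \<comment> \<open>Half the distance from the centre to the nearer end of its horizontal. By
    continuity, horizontals of nearby slices extend by more than \<open>r\<close> of arc length on
    both sides of \<open>t0\<close>, while points of the small square are within \<open>r\<close> of
    \<open>(t0, s)\<close>.\<close>
  define r where "r = min (D ((tmax B, s0), (t0, s0))) (D ((tmin B, s0), (t0, s0))) / 2"
  have l: "r > 0" unfolding r_def using Dpos rc t0 by simp
  obtain d1 where d1: "d1 > 0" "\<forall>xy\<in>rect B \<times> rect B. dist xy ((tmax B, s0), (t0, s0)) < d1 \<longrightarrow>
      \<bar>D xy - D ((tmax B, s0), (t0, s0))\<bar> < r" using cD[of "((tmax B, s0), (t0, s0))" r] rc l by auto
  obtain d2 where d2: "d2 > 0" "\<forall>xy\<in>rect B \<times> rect B. dist xy ((tmin B, s0), (t0, s0)) < d2 \<longrightarrow>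
      \<bar>D xy - D ((tmin B, s0), (t0, s0))\<bar> < r" using cD[of "((tmin B, s0), (t0, s0))" r] rc l by auto
  obtain d3 where d3: "d3 > 0" "\<forall>xy\<in>rect B \<times> rect B. dist xy ((t0, s0), (t0, s0)) < d3 \<longrightarrow>
      \<bar>D xy - D ((t0, s0), (t0, s0))\<bar> < r" using cD[of "((t0, s0), (t0, s0))" r] rc l by auto
  have D0: "D ((t0, s0), (t0, s0)) = 0" using hyp_dist_eq_0_iff G'(2) rc by (auto simp: D_def image_subset_iff)
  define S where "S = {d1, d2, d3, t0 - tmin B, tmax B - t0, s0 - smin B, smax B - s0}"
  \<comment> \<open>\<open>dist2\<close> below bounds distances of pairs by sums of coordinate
    differences, each at most \<open>\<epsilon>\<close>; the factor 4 leaves room for them.\<close>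
  define \<epsilon> where "\<epsilon> = Min S / 4"
  have "0 < Min S" using d1(1) d2(1) d3(1) t0 unfolding S_def by (subst Min_gr_iff) auto
  then have em0: "0 < 4 * \<epsilon>" by (simp add: \<epsilon>_def)
  have emS: "4 * \<epsilon> \<le> x" if "x \<in> S" for x
    using Min_le[OF _ that] by (simp add: \<epsilon>_def S_def del: Min_insert Min_insert2)
  have em: "0 < 4 * \<epsilon>" "4 * \<epsilon> \<le> d1" "4 * \<epsilon> \<le> d2" "4 * \<epsilon> \<le> d3"
      "4 * \<epsilon> \<le> t0 - tmin B" "4 * \<epsilon> \<le> tmax B - t0" "4 * \<epsilon> \<le> s0 - smin B" "4 * \<epsilon> \<le> smax B - s0"
    by (rule em0, (rule emS, simp add: S_def)+)
  have e: "\<epsilon> > 0" using em by simp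
  have sub: "{t0 - \<epsilon>..t0 + \<epsilon>} \<times> {s0 - \<epsilon>..s0 + \<epsilon>} \<subseteq> open_rect B"
    unfolding open_rect_def using em by auto
  have dist2: "dist ((a, b), (c, d)) ((a', b'), (c', d')) \<le> \<bar>a - a'\<bar> + \<bar>b - b'\<bar> + (\<bar>c - c'\<bar> + \<bar>d - d'\<bar>)"
    for a b c d a' b' c' d' :: real
  proof -
    have "dist ((a, b), (c, d)) ((a', b'), (c', d')) \<le> dist (a, b) (a', b') + dist (c, d) (c', d')"
      unfolding dist_Pair_Pair[of "(a,b)"] using sqrt_sum_squares_le_sum_abs[of "dist (a,b) (a',b')"  "dist (c,d) (c',d')"] by simp
    then show ?thesis using dist_Pair_le_real[of a b a' b'] dist_Pair_le_real[of c d c' d'] by linarith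
  qed
  show thesis
  proof (rule that[OF e sub])
    fix s h \<Psi> t s'
    assume s: "s \<in> slice B" "\<bar>s - s0\<bar> < \<epsilon>" and h: "leaf_lift h" "G (t0, s) \<in> range h"
      and P: "geodesic_chart h \<Psi>" and t: "\<bar>t - t0\<bar> \<le> \<epsilon>" and s': "\<bar>s' - s0\<bar> \<le> \<epsilon>"
    obtain \<theta> where th: "continuous_on {tmin B..tmax B} \<theta>" "strict_mono_on {tmin B..tmax B} \<theta>"
        "\<And>t. t \<in> {tmin B..tmax B} \<Longrightarrow> G (t, s) = h (\<theta> t)"
      by (rule oriented_box_horizontal[OF B G s(1) h(1) _ h(2)]) (use t0 that in auto)
    have geo: "hyp_dist (h a) (h b) = \<bar>a - b\<bar>" for a b using h(1) by (simp add: leaf_lift_def geodesic_def)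
    have srect: "(t, s) \<in> rect B" if "t \<in> {tmin B..tmax B}" for t
      using flow_box_slice[OF fb s(1)] that by (simp add: rect_iff)
    have th1: "\<theta> (tmin B) < \<theta> t0" "\<theta> t0 < \<theta> (tmax B)"
      using th(2) t0 by (auto simp: monotone_on_def)
    have up: "\<theta> (tmax B) - \<theta> t0 > r"
    proof -
      have "\<bar>D ((tmax B, s), (t0, s)) - D ((tmax B, s0), (t0, s0))\<bar> < r"
      proof (rule d1(2)[rule_format])
        show "((tmax B, s), (t0, s)) \<in> rect B \<times> rect B" using srect t0 by simp
        show "dist ((tmax B, s), (t0, s)) ((tmax B, s0), (t0, s0)) < d1"
          using dist2[of "tmax B" s t0 s "tmax B" s0 t0 s0] s(2) em e by linarith
      qed
      then have "D ((tmax B, s), (t0, s)) > r" unfolding r_def by linarith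
      then show ?thesis using th1 th(3) t0 by (simp add: D_def geo)
    qed
    have dn: "\<theta> t0 - \<theta> (tmin B) > r"
    proof -
      have "\<bar>D ((tmin B, s), (t0, s)) - D ((tmin B, s0), (t0, s0))\<bar> < r"
      proof (rule d2(2)[rule_format])
        show "((tmin B, s), (t0, s)) \<in> rect B \<times> rect B" using srect t0 by simp
        show "dist ((tmin B, s), (t0, s)) ((tmin B, s0), (t0, s0)) < d2"
          using dist2[of "tmin B" s t0 s "tmin B" s0 t0 s0] s(2) em e by linarith
      qed
      then have "D ((tmin B, s), (t0, s)) > r" unfolding r_def by linarith
      then show ?thesis using th1 th(3) t0 by (simp add: D_def geo)
    qed
    define a b where "a = Complex (t0 - \<epsilon>) (s0 - \<epsilon>)" and "b = Complex (t0 + \<epsilon>) (s0 + \<epsilon>)"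
    have cb: "z \<in> cbox a b \<longleftrightarrow> \<bar>Re z - t0\<bar> \<le> \<epsilon> \<and> \<bar>Im z - s0\<bar> \<le> \<epsilon>" for z
      by (auto simp: a_def b_def in_cbox_complex_iff)
    have rc': "(Re z, Im z) \<in> rect B" if "z \<in> cbox a b" for z
      using that em unfolding cb rect_iff by (auto simp: abs_le_iff)
    have cbsub: "cbox a b \<subseteq> cbox (lo B) (hi B)" using rc' rect_cbox by blast
    define F where "F z = \<Psi> (G (Re z, Im z))" for z
    have hol: "\<Psi> holomorphic_on hyp_plane" "inj_on \<Psi> hyp_plane" using P by (auto simp: geodesic_chart_def)
    note GC = box_lift_complex[OF fb G]
    have GH: "G (Re z, Im z) \<in> hyp_plane" if "z \<in> cbox a b" for z using rc'[OF that] G'(2) by blast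
    \<comment> \<open>A point of the leaf in the small square has a parameter within
      \<open>r\<close> of \<open>\<theta> t0\<close>. By the intermediate value theorem this
      parameter occurs on the horizontal itself, so injectivity of the box lift puts the point
      there. No other passage of the leaf can come this close.\<close>
    have real: "Im (F z) = 0 \<longleftrightarrow> Im z = s" if z: "z \<in> cbox a b" for z
    proof
      assume "Im (F z) = 0"
      then obtain \<tau> where tau: "G (Re z, Im z) = h \<tau>"
        using P GH[OF z] unfolding geodesic_chart_def F_def by blast
      have "\<bar>D ((Re z, Im z), (t0, s)) - D ((t0, s0), (t0, s0))\<bar> < r"
      proof (rule d3(2)[rule_format])
        show "((Re z, Im z), (t0, s)) \<in> rect B \<times> rect B" using srect[of t0] t0 rc'[OF z] by simp
        show "dist ((Re z, Im z), (t0, s)) ((t0, s0), (t0, s0)) < d3"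
          using dist2[of "Re z" "Im z" t0 s t0 s0 t0 s0] s(2) em e z[unfolded cb] by linarith
      qed
      then have "D ((Re z, Im z), (t0, s)) < r" unfolding D0 by simp
      then have "\<bar>\<tau> - \<theta> t0\<bar> < r" using th(3)[of t0] t0 by (simp add: D_def tau geo)
      then have "\<theta> (tmin B) \<le> \<tau>" "\<tau> \<le> \<theta> (tmax B)" using up dn by linarith+
      then obtain t' where t': "t' \<in> {tmin B..tmax B}" "\<theta> t' = \<tau>"
        using IVT'[of \<theta> "tmin B" \<tau> "tmax B"] th(1) t0 by auto
      then have "G (Re z, Im z) = G (t', s)" using th(3) tau by simp
      then have "(Re z, Im z) = (t', s)"
        using box_lift_inj[OF fb G] rc'[OF z] srect[OF t'(1)] by (metis inj_onD)
      then show "Im z = s" by simp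
    next
      assume "Im z = s"
      then have "G (Re z, Im z) = h (\<theta> (Re z))" using th(3) rc'[OF z] by (simp add: rect_iff)
      then show "Im (F z) = 0" using P by (simp add: F_def geodesic_chart_def)
    qed
    have ReF: "Re (F z) = \<theta> (Re z)" if "z \<in> cbox a b" "Im z = s" for z
      using th(3)[of "Re z"] rc'[OF that(1)] that(2) P by (simp add: F_def geodesic_chart_def rect_iff)
    define z0 where "z0 = Complex t0 s"
    have z0: "z0 \<in> box a b" using s e by (auto simp: z0_def a_def b_def in_box_complex_iff)
    have z0': "z0 \<in> box (lo B) (hi B)" "(t0, s) \<in> open_rect B"
      using t0 flow_box_slice[OF fb s(1)] by (auto simp: z0_def in_box_complex_iff open_rect_iff)
    have Fcont: "continuous_on (cbox a b) F" unfolding F_def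
      using GH by (intro continuous_on_compose2[OF holomorphic_on_imp_continuous_on[OF hol(1)]]
          continuous_on_subset[OF GC(1) cbsub]) auto
    have Finj: "inj_on F (cbox a b)"
      using GH inj_on_subset[OF GC(2) cbsub] hol(2) unfolding F_def inj_on_def by metis
    have bd: "path_image (rectpath a b) = cbox a b - box a b"
      using e by (intro path_image_rectpath_cbox_minus_box) (auto simp: a_def b_def)
    \<comment> \<open>The orientation of \<open>B\<close> concerns the boundary of the whole
      rectangle in the half plane. Neither the chart nor the passage to the small square changes the
      winding number.\<close>
    have wn: "winding_number (F \<circ> rectpath a b) (F z0) = 1"
    proof -
      define \<gamma>0 where "\<gamma>0 = (\<lambda>z. G (Re z, Im z)) \<circ> rectpath a b"
      have "winding_number (\<Psi> \<circ> \<gamma>0) (\<Psi> (G (Re z0, Im z0))) = winding_number \<gamma>0 (G (Re z0, Im z0))"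
      proof (rule winding_number_holomorphic_image[OF open_hyp_plane convex_hyp_plane hol])
        show "path \<gamma>0" unfolding \<gamma>0_def using bd cbsub
          by (intro path_continuous_image continuous_on_subset[OF GC(1)]) auto
        show "pathfinish \<gamma>0 = pathstart \<gamma>0" by (simp add: \<gamma>0_def pathfinish_compose pathstart_compose)
        show "path_image \<gamma>0 \<subseteq> hyp_plane" unfolding \<gamma>0_def path_image_compose bd using GH by auto
        have z0c: "z0 \<in> cbox a b" using z0 box_subset_cbox by blast
        then show "G (Re z0, Im z0) \<in> hyp_plane" by (rule GH)
        show "G (Re z0, Im z0) \<notin> path_image \<gamma>0" unfolding \<gamma>0_def path_image_compose bd
          using inj_onD[OF inj_on_subset[OF GC(2) cbsub], of z0] z0 z0c by blast
      qed
      also have "\<dots> = winding_number ((\<lambda>z. G (Re z, Im z)) \<circ> rectpath (lo B) (hi B)) (G (Re z0, Im z0))"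
        unfolding \<gamma>0_def by (rule winding_number_image_subrectangle[OF GC cbsub z0, symmetric])
      also have "\<dots> = 1"
        using oriented_box_winding_number[OF fb ob G z0'(2)] by (simp add: z0_def)
      finally show ?thesis by (simp add: \<gamma>0_def F_def o_def)
    qed
    have mono: "Re (F z) < Re (F w)" if "z \<in> cbox a b" "w \<in> cbox a b" "Im z = Im z0" "Im w = Im z0" "Re z < Re w" for z w
      using ReF[of z] ReF[of w] that th(2) rc'[OF that(1)] rc'[OF that(2)]
      by (auto simp: z0_def monotone_on_def rect_iff)
    have zz: "Complex t s' \<in> cbox a b" using t s' by (simp add: cb)
    have real': "Im (F z) = 0 \<longleftrightarrow> Im z = Im z0" if "z \<in> cbox a b" for z
      using real[OF that] by (simp add: z0_def)
    from orientation_preserving_upper_half[OF Fcont Finj z0 wn real' mono zz]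
    show "(s < s' \<longleftrightarrow> 0 < Im (\<Psi> (G (t, s')))) \<and> (s' < s \<longleftrightarrow> Im (\<Psi> (G (t, s'))) < 0)"
      by (simp add: z0_def F_def)
  qed
qed

section \<open>The side to which a crossing leads\<close>

text \<open>Near \<open>k\<close> the lifted path is the box lift of its box coordinates, so the
  monotone coordinate decides the side of the leaf. The conclusion no longer mentions the box, which
  is the point of the lemma; times after \<open>k\<close> suffice to recover the sign.\<close>

lemma crossing_side:
  assumes cr: "crossing p M \<Lambda> Or e l m f k" and g: "path_lift p l m f g"
    and f: "continuous_on {l..m} f"
    and h: "leaf_lift h" "g k \<in> range h" and P: "geodesic_chart h \<Psi>" and e: "e = 1 \<or> e = -1"
  obtains \<delta> where "\<delta> > 0" "k + \<delta> \<le> m" "\<And>\<tau>. k < \<tau> \<Longrightarrow> \<tau> \<le> k + \<delta> \<Longrightarrow> 0 < e * Im (\<Psi> (g \<tau>))"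
proof -
  obtain B \<eta> where B: "\<eta> > 0" "oriented_flow_box p M \<Lambda> Or B" "f k \<in> chart B ` open_rect B"
      "{k - \<eta>..k + \<eta>} \<subseteq> {l..m}" "f ` {k - \<eta>..k + \<eta>} \<subseteq> chart B ` rect B"
      "strict_mono_on {k - \<eta>..k + \<eta>} (\<lambda>\<tau>. e * transverse_coord B f \<tau>)"
    using cr unfolding crossing_def crosses_box_def by blast
  define I where "I = {k - \<eta>..k + \<eta>}"
  have fb: "flow_box M \<Lambda> B" using B by (simp add: oriented_flow_box_def)
  obtain t0 s0 where x0: "(t0, s0) \<in> open_rect B" "f k = chart B (t0, s0)" using B(3) by auto
  have x0': "(t0, s0) \<in> rect B" using x0 open_rect_subset by blast
  have kI: "k \<in> I" "k \<in> {l..m}" using B by (auto simp: I_def)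
  have g': "continuous_on {l..m} g" "g ` {l..m} \<subseteq> hyp_plane" "\<And>t. t \<in> {l..m} \<Longrightarrow> p (g t) = f t"
    using g by (auto simp: path_lift_def)
  have gk: "g k \<in> hyp_plane" "p (g k) = chart B (t0, s0)" using g' kI x0 by auto
  obtain G where G: "box_lift B G" "G (t0, s0) = g k" by (rule box_lift_exists[OF fb x0' gk]) (rule that)
  define c where "c \<tau> = inv_into (rect B) (chart B) (f \<tau>)" for \<tau>
  have c_rect: "c \<tau> \<in> rect B" "chart B (c \<tau>) = f \<tau>" if "\<tau> \<in> I" for \<tau>
  proof -
    have "f \<tau> \<in> chart B ` rect B" using B(5) that unfolding I_def by blast
    then show "c \<tau> \<in> rect B" "chart B (c \<tau>) = f \<tau>"
      unfolding c_def by (rule inv_into_into, rule f_inv_into_f)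
  qed
  have fI: "continuous_on I f" using f B(4) continuous_on_subset I_def by blast
  have cc: "continuous_on I c" unfolding c_def
    using continuous_on_compose2[OF flow_box_continuous_inv[OF fb] fI] B(5) by (simp add: I_def)
  have ck: "c k = (t0, s0)" using inv_into_f_f[OF flow_box_inj[OF fb] x0'] x0 by (simp add: c_def)
  have gG: "g \<tau> = G (c \<tau>)" if "\<tau> \<in> I" for \<tau>
  proof (rule lift_unique[where U=I and a=k])
    show "continuous_on I (\<lambda>\<tau>. G (c \<tau>))"
      using G(1) c_rect by (intro continuous_on_compose2[OF _ cc, of "rect B" G]) (auto simp: box_lift_def)
    show "continuous_on I g" using g'(1) B(4) continuous_on_subset I_def by blast
    show "g k = G (c k)" using G ck by simp
    show "p (g x) = p (G (c x))" if "x \<in> I" for x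
      using c_rect[OF that] G(1) g'(3)[of x] that B(4) by (auto simp: box_lift_def I_def)
  qed (use that kI g'(2) B(4) G(1) c_rect in \<open>auto simp: I_def box_lift_def\<close>)
  obtain \<epsilon> where eps: "\<epsilon> > 0" "\<And>s h \<Psi> t s'. s \<in> slice B \<Longrightarrow> \<bar>s - s0\<bar> < \<epsilon> \<Longrightarrow> leaf_lift h \<Longrightarrow> G (t0, s) \<in> range h \<Longrightarrow>
       geodesic_chart h \<Psi> \<Longrightarrow> \<bar>t - t0\<bar> \<le> \<epsilon> \<Longrightarrow> \<bar>s' - s0\<bar> \<le> \<epsilon> \<Longrightarrow>
       (s < s' \<longleftrightarrow> 0 < Im (\<Psi> (G (t, s')))) \<and> (s' < s \<longleftrightarrow> Im (\<Psi> (G (t, s'))) < 0)"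
    by (rule oriented_box_sides[OF B(2) G(1) x0(1)]) (rule that)
  have "chart B (t0, s0) \<in> \<Lambda>" using h leaf_lift_in(2)[OF h(1)] gk by (metis rangeE)
  then have s0: "s0 \<in> slice B" using flow_box_leaf_iff[OF fb x0'] by simp
  obtain d where d: "d > 0" "\<forall>\<tau>\<in>I. dist \<tau> k < d \<longrightarrow> dist (c \<tau>) (c k) < \<epsilon>"
    using cc kI(1) eps(1) unfolding continuous_on_iff by blast
  define \<delta> where "\<delta> = min \<eta> (d / 2)"
  show thesis
  proof (rule that[of \<delta>])
    show "\<delta> > 0" using B(1) d(1) by (simp add: \<delta>_def)
    show "k + \<delta> \<le> m" using B(1,4) by (auto simp: \<delta>_def)
    fix \<tau> assume t: "k < \<tau>" "\<tau> \<le> k + \<delta>"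
    then have tI: "\<tau> \<in> I" using B(1) by (auto simp: I_def \<delta>_def)
    have "dist \<tau> k < d" using t d(1) by (auto simp: \<delta>_def dist_real_def)
    then have "dist (c \<tau>) (c k) < \<epsilon>" using d(2) tI by blast
    then have "\<bar>fst (c \<tau>) - t0\<bar> < \<epsilon>" "\<bar>snd (c \<tau>) - s0\<bar> < \<epsilon>"
      using dist_fst_le[of "c \<tau>" "c k"] dist_snd_le[of "c \<tau>" "c k"] by (auto simp: ck dist_real_def)
    then have sides: "s0 < snd (c \<tau>) \<longleftrightarrow> 0 < Im (\<Psi> (g \<tau>))" "snd (c \<tau>) < s0 \<longleftrightarrow> Im (\<Psi> (g \<tau>)) < 0"
      using eps(2)[of s0 h \<Psi> "fst (c \<tau>)" "snd (c \<tau>)"] eps(1) s0 h P G(2) gG[OF tI] by auto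
    have coord: "transverse_coord B f u = snd (c u)" for u
      by (simp add: transverse_coord_def c_def)
    have "e * s0 < e * snd (c \<tau>)"
      using B(6) t(1) kI(1) tI ck unfolding I_def[symmetric] monotone_on_def coord by fastforce
    then show "0 < e * Im (\<Psi> (g \<tau>))" using e sides by auto
  qed
qed

lemma path_lift_exists:
  assumes "continuous_on {l..m} f" "f ` {l..m} \<subseteq> M"
  obtains g where "path_lift p l m f g"
proof (rule lift_exists[OF _ assms])
  fix g assume "continuous_on {l..m} g" "g ` {l..m} \<subseteq> hyp_plane" "\<And>y. y \<in> {l..m} \<Longrightarrow> p (g y) = f y"
  then show thesis by (intro that[of g]) (simp add: path_lift_def)
qed simp

text \<open>Both signs agree with the sign of \<open>Im \<Psi>\<close> at one common time just after
  the crossing.\<close>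

lemma crossing_sign_unique:
  assumes c: "crossing p M \<Lambda> Or e l m f k" "crossing p M \<Lambda> Or e' l m f k"
    and f: "continuous_on {l..m} f" "f ` {l..m} \<subseteq> M" "f k \<in> \<Lambda>" "k \<in> {l..m}"
    and e: "e = 1 \<or> e = -1" "e' = 1 \<or> e' = -1"
  shows "e = e'"
proof -
  obtain g where g: "path_lift p l m f g" by (rule path_lift_exists[OF f(1,2)])
  have "g k \<in> lift_\<Lambda>" using g f by (auto simp: path_lift_def lamination_lift_def)
  then obtain h where h: "leaf_lift h" "g k \<in> range h" by (rule leaf_lift_through)
  obtain \<Psi> where P: "geodesic_chart h \<Psi>" using geodesic_chart_exists h by (auto simp: leaf_lift_def)
  obtain \<delta> where d: "\<delta> > 0" "k + \<delta> \<le> m" "\<And>\<tau>. k < \<tau> \<Longrightarrow> \<tau> \<le> k + \<delta> \<Longrightarrow> 0 < e * Im (\<Psi> (g \<tau>))"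
    by (rule crossing_side[OF c(1) g f(1) h P e(1)]) (rule that)
  obtain \<delta>' where d': "\<delta>' > 0" "k + \<delta>' \<le> m" "\<And>\<tau>. k < \<tau> \<Longrightarrow> \<tau> \<le> k + \<delta>' \<Longrightarrow> 0 < e' * Im (\<Psi> (g \<tau>))"
    by (rule crossing_side[OF c(2) g f(1) h P e(2)]) (rule that)
  have "0 < e * Im (\<Psi> (g (k + min \<delta> \<delta>')))" "0 < e' * Im (\<Psi> (g (k + min \<delta> \<delta>')))"
    using d d' by auto
  then show ?thesis using e by auto
qed

end

section \<open>Sets of Hausdorff dimension zero\<close>

lemma hausdorff_content_mono: "A \<subseteq> B \<Longrightarrow> hausdorff_content s \<delta> A \<le> hausdorff_content s \<delta> B"
  unfolding hausdorff_content_def by (rule INF_superset_mono) auto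

lemma hausdorff_dim_le:
  assumes "\<And>s \<delta>. s > 0 \<Longrightarrow> hausdorff_content s \<delta> A \<le> hausdorff_content s \<delta> B"
  shows "hausdorff_dim A \<le> hausdorff_dim B"
  unfolding hausdorff_dim_def
proof (rule INF_superset_mono)
  have "hausdorff_measure s A \<le> hausdorff_measure s B" if "s > 0" for s
    unfolding hausdorff_measure_def by (rule SUP_mono') (rule assms[OF that])
  then show "{s. 0 < s \<and> hausdorff_measure s B = 0} \<subseteq> {s. 0 < s \<and> hausdorff_measure s A = 0}"
    by (metis (mono_tags, lifting) Collect_mono le_zero_eq)
qed simp

lemma hausdorff_dim_mono: "A \<subseteq> B \<Longrightarrow> hausdorff_dim A \<le> hausdorff_dim B"
  by (rule hausdorff_dim_le) (rule hausdorff_content_mono)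

text \<open>This is applied to reflections and translates of slices, which thereby again have
  dimension zero.\<close>

lemma hausdorff_dim_image_le:
  fixes f :: "'a::metric_space \<Rightarrow> 'b::metric_space"
  assumes f: "\<And>x y. dist (f x) (f y) \<le> dist x y"
  shows "hausdorff_dim (f ` A) \<le> hausdorff_dim A"
proof (rule hausdorff_dim_le)
  fix s \<delta> :: real assume s: "s > 0"
  have bd: "bounded (f ` U) \<and> diameter (f ` U) \<le> diameter U" if U: "bounded U" for U
  proof
    obtain x e where "\<forall>y\<in>U. dist x y \<le> e" using U by (auto simp: bounded_def)
    then have "\<forall>y\<in>f ` U. dist (f x) y \<le> e" using f order_trans by blast
    then show "bounded (f ` U)" unfolding bounded_def by blast
    show "diameter (f ` U) \<le> diameter U"
    proof (cases "U = {}")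
      case False
      have "(SUP (x, y)\<in>f ` U \<times> f ` U. dist x y) \<le> diameter U"
      proof (rule cSUP_least)
        show "f ` U \<times> f ` U \<noteq> {}" using False by simp
        fix z assume "z \<in> f ` U \<times> f ` U"
        then obtain a b where ab: "a \<in> U" "b \<in> U" "z = (f a, f b)" by blast
        then show "(case z of (x, y) \<Rightarrow> dist x y) \<le> diameter U"
          using f[of a b] diameter_bounded_bound[OF U ab(1,2)] by simp
      qed
      then show ?thesis using False by (simp add: diameter_def)
    qed simp
  qed
  show "hausdorff_content s \<delta> (f ` A) \<le> hausdorff_content s \<delta> A"
    unfolding hausdorff_content_def
  proof (rule INF_mono)
    fix U assume "U \<in> {U. A \<subseteq> (\<Union>i. U i) \<and> (\<forall>i::nat. bounded (U i) \<and> diameter (U i) \<le> \<delta>)}"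
    then have U: "A \<subseteq> (\<Union>i. U i)" "\<And>i. bounded (U i)" "\<And>i. diameter (U i) \<le> \<delta>" by auto
    show "\<exists>V\<in>{U. f ` A \<subseteq> (\<Union>i. U i) \<and> (\<forall>i::nat. bounded (U i) \<and> diameter (U i) \<le> \<delta>)}.
        (\<Sum>i. ennreal (diameter (V i) powr s)) \<le> (\<Sum>i. ennreal (diameter (U i) powr s))"
    proof (intro bexI[of _ "\<lambda>i. f ` U i"] suminf_le ennreal_leI powr_mono2)
      show "(\<lambda>i. f ` U i) \<in> {U. f ` A \<subseteq> (\<Union>i. U i) \<and> (\<forall>i::nat. bounded (U i) \<and> diameter (U i) \<le> \<delta>)}"
      proof -
        have "f ` A \<subseteq> (\<Union>i. f ` U i)" using image_mono[OF U(1), of f] by (simp add: image_UN)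
        moreover have "diameter (f ` U i) \<le> \<delta>" for i
          using bd[OF U(2)[of i]] U(3)[of i] by simp
        ultimately show ?thesis using bd[OF U(2)] by simp
      qed
    qed (use s bd[OF U(2)] in \<open>auto intro: diameter_ge_0 U(2)\<close>)
  qed
qed

text \<open>Some exponent \<open>s < 1\<close> has measure zero. For diameters at most 1 the
  diameter is bounded by its power with exponent \<open>s\<close>, so a cover with a small sum of
  these powers has small length.\<close>

lemma hausdorff_dim_0_negligible:
  fixes A :: "real set"
  assumes "hausdorff_dim A = 0"
  shows "negligible A"
proof -
  have "(INF s\<in>{s. 0 < s \<and> hausdorff_measure s A = 0}. ennreal s) < 1"
    using assms by (simp add: hausdorff_dim_def)
  then obtain s where s: "0 < s" "hausdorff_measure s A = 0" "ennreal s < 1"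
    by (auto simp: INF_less_iff)
  then have s1: "s < 1" using ennreal_less_iff[of s 1] by simp
  have c0: "hausdorff_content s 1 A = 0"
    using s(2) SUP_upper[of "1::real" "{0<..}" "\<lambda>\<delta>. hausdorff_content s \<delta> A"]
    unfolding hausdorff_measure_def by simp
  show ?thesis unfolding negligible_outer_le
  proof (intro allI impI)
    fix e :: real assume e: "e > 0"
    have "hausdorff_content s 1 A < ennreal (e / 2)" using c0 e by simp
    then obtain U where U: "A \<subseteq> (\<Union>i. U i)" "\<And>i::nat. bounded (U i)" "\<And>i. diameter (U i) \<le> 1"
        "(\<Sum>i. ennreal (diameter (U i) powr s)) < ennreal (e / 2)"
      unfolding hausdorff_content_def by (auto simp: INF_less_iff)
    \<comment> \<open>A set lies in the interval of radius equal to its diameter about any of its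
      points, which costs the factor 2 and explains the bound \<open>e / 2\<close> above. For an
      empty \<open>U i\<close> the point is arbitrary and the interval degenerates.\<close>
    define x where "x i = (SOME x. x \<in> U i)" for i
    define V where "V i = {x i - diameter (U i)..x i + diameter (U i)}" for i
    have UV: "U i \<subseteq> V i" for i
    proof
      fix y assume y: "y \<in> U i"
      then have "x i \<in> U i" unfolding x_def by (rule someI)
      then have "dist (x i) y \<le> diameter (U i)" using diameter_bounded_bound[OF U(2)] y by blast
      then show "y \<in> V i" by (auto simp: V_def dist_real_def)
    qed
    have em: "emeasure lborel (V i) \<le> 2 * ennreal (diameter (U i) powr s)" for i
    proof -
      have d: "0 \<le> diameter (U i)" by (rule diameter_ge_0[OF U(2)])
      have "diameter (U i) \<le> diameter (U i) powr s"
      proof (cases "diameter (U i) = 0")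
        case False
        then have "diameter (U i) powr 1 \<le> diameter (U i) powr s"
          using d U(3)[of i] s1 by (intro powr_mono') auto
        then show ?thesis using d False by simp
      qed simp
      moreover have "emeasure lborel (V i) = ennreal (2 * diameter (U i))"
        unfolding V_def using d by simp
      ultimately have "emeasure lborel (V i) \<le> ennreal (2 * diameter (U i) powr s)"
        by (simp add: ennreal_leI)
      also have "\<dots> = 2 * ennreal (diameter (U i) powr s)" by (simp add: ennreal_mult)
      finally show ?thesis .
    qed
    define T where "T = (\<Union>i. V i)"
    have "emeasure lborel T \<le> (\<Sum>i. emeasure lborel (V i))"
      unfolding T_def by (rule emeasure_subadditive_countably) (auto simp: V_def)
    also have "\<dots> \<le> (\<Sum>i. 2 * ennreal (diameter (U i) powr s))" by (intro suminf_le em) auto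
    also have "\<dots> = 2 * (\<Sum>i. ennreal (diameter (U i) powr s))" by simp
    also have "\<dots> \<le> 2 * ennreal (e / 2)" using U(4) by (intro mult_left_mono) auto
    also have "\<dots> = ennreal e" using e by (simp flip: ennreal_mult ennreal_numeral)
    finally have T: "emeasure lborel T \<le> ennreal e" .
    have Tb: "T \<in> sets borel" unfolding T_def V_def by auto
    have "T \<in> lmeasurable" using T Tb by (intro fmeasurableI) (auto simp: le_less_trans)
    moreover have "measure lebesgue T \<le> e"
      using T Tb e by (simp add: measure_def enn2real_leI)
    moreover have "A \<subseteq> T" using U(1) UV unfolding T_def by blast
    ultimately show "\<exists>T. A \<subseteq> T \<and> T \<in> lmeasurable \<and> measure lebesgue T \<le> e" by blast
  qed
qed

text \<open>A connected set with two real points contains an interval, which is not a null set. This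
  is how dimension zero is used: a path in the lamination cannot change its slice
  coordinate.\<close>

lemma negligible_real_connected_const:
  fixes \<phi> :: "'a::topological_space \<Rightarrow> real"
  assumes K: "negligible K" and S: "connected S" "continuous_on S \<phi>" "\<phi> ` S \<subseteq> K" "x \<in> S" "y \<in> S"
  shows "\<phi> x = \<phi> y"
proof -
  have conn: "connected (\<phi> ` S)" by (rule connected_continuous_image[OF S(2,1)])
  have False if "u \<in> S" "v \<in> S" "\<phi> u < \<phi> v" for u v
  proof -
    have "{\<phi> u..\<phi> v} \<subseteq> \<phi> ` S" using that by (intro connected_contains_Icc[OF conn]) auto
    then have "negligible {\<phi> u..\<phi> v}" using K S(3) negligible_subset by blast
    then show False using that(3) negligible_interval(1)[of "\<phi> u" "\<phi> v"] by (auto simp: box_real)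
  qed
  then show ?thesis using S(4,5) by (meson linorder_neqE_linordered_idom)
qed

lemma flow_box_slice_negligible: "flow_box M \<Lambda> B \<Longrightarrow> negligible (slice B)"
  by (rule hausdorff_dim_0_negligible) (simp add: flow_box_def)

text \<open>The difference \<open>f y - f x\<close> has no zero on the triangle
  \<open>x < y\<close>, which is convex and therefore connected.\<close>

lemma inj_continuous_strict_monotone:
  fixes f :: "real \<Rightarrow> real"
  assumes f: "continuous_on {a..b} f" "inj_on f {a..b}" and ab: "a < b"
  obtains e where "e = 1 \<or> e = -1" "strict_mono_on {a..b} (\<lambda>x. e * f x)"
proof -
  define S where "S = {a..b} \<times> {a..b} \<inter> {z. 0 < snd z - fst z}"
  have "convex {z :: real \<times> real. 0 < snd z - fst z}"
  proof (rule convexI)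
    fix z w :: "real \<times> real" and u v :: real
    assume a: "z \<in> {z. 0 < snd z - fst z}" "w \<in> {z. 0 < snd z - fst z}" "0 \<le> u" "0 \<le> v" "u + v = 1"
    have "0 < u * (snd z - fst z) + v * (snd w - fst w)"
    proof (cases "u = 0")
      case False
      then have "0 < u * (snd z - fst z)" "0 \<le> v * (snd w - fst w)" using a by auto
      then show ?thesis by simp
    qed (use a in auto)
    then show "u *\<^sub>R z + v *\<^sub>R w \<in> {z. 0 < snd z - fst z}" by (simp add: algebra_simps)
  qed
  then have conn: "connected S" unfolding S_def
    by (intro convex_connected convex_Int convex_Times convex_real_interval)
  have cS: "continuous_on S (\<lambda>z. f (snd z) - f (fst z))"
    by (intro continuous_on_diff continuous_on_compose2[OF f(1)] continuous_intros) (auto simp: S_def)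
  have nz: "f (snd z) - f (fst z) \<noteq> 0" if "z \<in> S" for z
    using that f(2) by (auto simp: S_def dest: inj_onD)
  have sg: "0 < f (snd z) - f (fst z) \<longleftrightarrow> 0 < f b - f a" if "z \<in> S" for z
    using connected_real_nonzero_sgn[OF conn cS nz that, of "(a, b)"] ab by (simp add: S_def)
  show thesis
  proof (cases "0 < f b - f a")
    case True
    then show thesis using sg by (intro that[of 1]) (force simp: monotone_on_def S_def)+
  next
    case False
    have "f y < f x" if "x \<in> {a..b}" "y \<in> {a..b}" "x < y" for x y
      using sg[of "(x, y)"] nz[of "(x, y)"] False that by (auto simp: S_def)
    then show thesis by (intro that[of "-1"]) (auto simp: monotone_on_def)
  qed
qed

section \<open>Restricting and reflecting flow boxes\<close>

lemma winding_number_image_rotate: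
  fixes F :: "complex \<Rightarrow> complex"
  assumes F: "continuous_on (cbox a b) F" and ab: "Re a \<le> Re b" "Im a \<le> Im b"
    and y: "y \<notin> F ` (cbox a b - box a b)"
  shows "winding_number ((F \<circ> uminus) \<circ> rectpath (- b) (- a)) y = winding_number (F \<circ> rectpath a b) y"
proof -
  have box: "- z \<in> cbox a b \<longleftrightarrow> z \<in> cbox (- b) (- a)" "- z \<in> box a b \<longleftrightarrow> z \<in> box (- b) (- a)" for z
    by (auto simp: in_cbox_complex_iff in_box_complex_iff)
  have F': "continuous_on (cbox (- b) (- a)) (F \<circ> uminus)"
    using box(1) by (intro continuous_on_compose continuous_intros continuous_on_subset[OF F]) auto
  have y': "y \<notin> (F \<circ> uminus) ` (cbox (- b) (- a) - box (- b) (- a))"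
    using y box by auto
  have l: "(F \<circ> uminus) \<circ> linepath (- u) (- v) = F \<circ> linepath u v" for u v
    by (auto simp: linepath_def fun_eq_iff algebra_simps)
  have c: "Complex (Re (- a)) (Im (- b)) = - Complex (Re a) (Im b)" "Complex (Re (- b)) (Im (- a)) = - Complex (Re b) (Im a)"
    by (auto simp: complex_eq_iff)
  have ab': "Re (- b) \<le> Re (- a)" "Im (- b) \<le> Im (- a)" using ab by auto
  show ?thesis
    unfolding winding_number_rectangle_sides[OF F' ab' y'] winding_number_rectangle_sides[OF F ab y] c l by simp
qed

text \<open>\<open>a\<close> and \<open>b\<close> are signs. The reflections are taken at the
  origin, so the new rectangle is centred at \<open>(a * t0, b * s0)\<close>.\<close>

definition subbox :: "'m flow_box_data \<Rightarrow> real \<Rightarrow> real \<Rightarrow> real \<Rightarrow> real \<Rightarrow> real \<Rightarrow> real \<Rightarrow> 'm flow_box_data" where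
  "subbox B a b t0 s0 d e =
     \<lparr>tmin = a * t0 - d, tmax = a * t0 + d, smin = b * s0 - e, smax = b * s0 + e,
      slice = {s. b * s \<in> slice B \<and> \<bar>s - b * s0\<bar> \<le> e}, chart = (\<lambda>x. chart B (a * fst x, b * snd x))\<rparr>"

lemma subbox_simps [simp]:
  "tmin (subbox B a b t0 s0 d e) = a * t0 - d" "tmax (subbox B a b t0 s0 d e) = a * t0 + d"
  "smin (subbox B a b t0 s0 d e) = b * s0 - e" "smax (subbox B a b t0 s0 d e) = b * s0 + e"
  "slice (subbox B a b t0 s0 d e) = {s. b * s \<in> slice B \<and> \<bar>s - b * s0\<bar> \<le> e}"
  "chart (subbox B a b t0 s0 d e) x = chart B (a * fst x, b * snd x)"
  by (simp_all add: subbox_def)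

lemma sign_mult_abs:
  fixes a t u :: real
  assumes "a = 1 \<or> a = -1"
  shows "\<bar>a * t - u\<bar> = \<bar>t - a * u\<bar>" "a * (a * t) = t"
  using assms by auto

lemma subbox_rect:
  assumes "a = 1 \<or> a = -1" "b = 1 \<or> b = -1"
  shows "x \<in> rect (subbox B a b t0 s0 d e) \<longleftrightarrow> \<bar>a * fst x - t0\<bar> \<le> d \<and> \<bar>b * snd x - s0\<bar> \<le> e"
    and "x \<in> open_rect (subbox B a b t0 s0 d e) \<longleftrightarrow> \<bar>a * fst x - t0\<bar> < d \<and> \<bar>b * snd x - s0\<bar> < e"
  unfolding sign_mult_abs[OF assms(1)] sign_mult_abs[OF assms(2)]
  by (auto simp: rect_def open_rect_def mem_Times_iff)

lemma flow_box_subbox: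
  assumes B: "flow_box M \<Lambda> B" and a: "a = 1 \<or> a = -1" and b: "b = 1 \<or> b = -1"
    and d: "0 < d" "0 < e" and sub: "{t0 - d..t0 + d} \<times> {s0 - e..s0 + e} \<subseteq> rect B"
    and off: "s0 - e \<notin> slice B" "s0 + e \<notin> slice B"
  shows "flow_box M \<Lambda> (subbox B a b t0 s0 d e)"
proof -
  let ?B = "subbox B a b t0 s0 d e"
  define \<rho> where "\<rho> x = (a * fst x, b * snd x)" for x :: "real \<times> real"
  have \<rho>: "\<rho> x \<in> rect B" if "x \<in> rect ?B" for x
    using that sub unfolding subbox_rect[OF a b] \<rho>_def by (auto simp: abs_le_iff)
  have dist: "dist (\<rho> x) (\<rho> y) = dist x y" for x y
    using a b by (auto simp: \<rho>_def dist_prod_def dist_real_def power2_commute)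
  have chart: "chart ?B x = chart B (\<rho> x)" for x by (simp add: \<rho>_def)
  obtain C where C: "C > 0" "\<And>x y. x \<in> rect B \<Longrightarrow> y \<in> rect B \<Longrightarrow> dist x y \<le> C * dist (chart B x) (chart B y)"
    "\<And>x y. x \<in> rect B \<Longrightarrow> y \<in> rect B \<Longrightarrow> dist (chart B x) (chart B y) \<le> C * dist x y"
    by (rule flow_box_bilipschitz[OF B]) (rule that)
  have 1: "dist x y / C \<le> dist (chart ?B x) (chart ?B y) \<and> dist (chart ?B x) (chart ?B y) \<le> C * dist x y"
    if "x \<in> rect ?B" "y \<in> rect ?B" for x y
    using C(2,3)[OF \<rho>[OF that(1)] \<rho>[OF that(2)]] C(1) unfolding chart dist by (simp add: field_simps)
  have 2: "closed (slice ?B)"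
  proof -
    have "slice ?B = (\<lambda>s. b * s) -` slice B \<inter> {b * s0 - e..b * s0 + e}" by auto
    moreover have "closed ((\<lambda>s. b * s) -` slice B)"
      using B by (intro closed_vimage continuous_intros) (simp add: flow_box_def)
    ultimately show ?thesis by auto
  qed
  \<comment> \<open>The slice has to lie in the open interval. It was cut off by a closed condition,
    so its ends must be excluded by the choice of \<open>e\<close>.\<close>
  have 3: "slice ?B \<subseteq> {smin ?B<..<smax ?B}"
  proof
    fix s assume s: "s \<in> slice ?B"
    have "b * (b * s0 - e) \<notin> slice B" "b * (b * s0 + e) \<notin> slice B" using b off by (auto simp: add.commute)
    then have "s \<noteq> b * s0 - e" "s \<noteq> b * s0 + e" using s by auto
    then show "s \<in> {smin ?B<..<smax ?B}" using s by auto
  qed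
  have 4: "hausdorff_dim (slice ?B) = 0"
  proof -
    have "slice ?B \<subseteq> (\<lambda>s. b * s) ` slice B"
    proof
      fix s assume "s \<in> slice ?B"
      then have "b * s \<in> slice B" "s = b * (b * s)" using b by auto
      then show "s \<in> (\<lambda>s. b * s) ` slice B" by blast
    qed
    then have "hausdorff_dim (slice ?B) \<le> hausdorff_dim ((\<lambda>s. b * s) ` slice B)" by (rule hausdorff_dim_mono)
    also have "\<dots> \<le> hausdorff_dim (slice B)"
      using b by (intro hausdorff_dim_image_le) (auto simp: dist_real_def)
    also have "\<dots> = 0" using B by (simp add: flow_box_def)
    finally show ?thesis by simp
  qed
  have 5: "{x \<in> rect ?B. chart ?B x \<in> \<Lambda>} = {tmin ?B..tmax ?B} \<times> slice ?B"
  proof -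
    have "chart ?B x \<in> \<Lambda> \<longleftrightarrow> snd x \<in> slice ?B" if x: "x \<in> rect ?B" for x
    proof -
      have "chart ?B x \<in> \<Lambda> \<longleftrightarrow> b * snd x \<in> slice B"
        using flow_box_leaf_iff[OF B] \<rho>[OF x] unfolding chart \<rho>_def by blast
      then show ?thesis using x by (auto simp: rect_def)
    qed
    moreover have "x \<in> rect ?B" if "x \<in> {tmin ?B..tmax ?B} \<times> slice ?B" for x
      using that by (auto simp: rect_def)
    ultimately show ?thesis by (fastforce simp: rect_def)
  qed
  have 6: "chart ?B ` rect ?B \<subseteq> M"
  proof -
    have "chart B ` rect B \<subseteq> M" using B by (simp add: flow_box_def)
    then show ?thesis using \<rho> unfolding image_subset_iff chart by blast
  qed
  show ?thesis unfolding flow_box_def using d 2 3 4 5 6 1 C(1) by auto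
qed

text \<open>One reflection reverses the boundary and two make a half turn, so the orientation
  changes by the sign \<open>a * b\<close>. A reflection in \<open>t\<close> alone is a conjugation
  followed by a half turn.\<close>

lemma winding_number_subbox:
  fixes G :: "real \<times> real \<Rightarrow> complex"
  assumes a: "a = 1 \<or> a = -1" and b: "b = 1 \<or> b = -1" and d: "0 < d" "0 < e"
    and G: "continuous_on ({t0 - d..t0 + d} \<times> {s0 - e..s0 + e}) G" "inj_on G ({t0 - d..t0 + d} \<times> {s0 - e..s0 + e})"
    and x: "x \<in> {t0 - d<..<t0 + d} \<times> {s0 - e<..<s0 + e}"
  shows "winding_number ((\<lambda>z. G (a * Re z, b * Im z)) \<circ>
            rectpath (Complex (a * t0 - d) (b * s0 - e)) (Complex (a * t0 + d) (b * s0 + e))) (G x) =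
         of_real (a * b) * winding_number ((\<lambda>z. G (Re z, Im z)) \<circ>
            rectpath (Complex (t0 - d) (s0 - e)) (Complex (t0 + d) (s0 + e))) (G x)"
proof -
  define F where "F z = G (Re z, Im z)" for z
  define lo' hi' where "lo' = Complex (t0 - d) (s0 - e)" and "hi' = Complex (t0 + d) (s0 + e)"
  have cb: "z \<in> cbox lo' hi' \<longleftrightarrow> (Re z, Im z) \<in> {t0 - d..t0 + d} \<times> {s0 - e..s0 + e}" for z
    by (auto simp: lo'_def hi'_def in_cbox_complex_iff)
  have cF: "continuous_on (cbox lo' hi') F" unfolding F_def
    by (rule continuous_on_ReIm[OF G(1)]) (auto simp: cb)
  have ord: "Re lo' \<le> Re hi'" "Im lo' \<le> Im hi'" using d by (auto simp: lo'_def hi'_def)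
  have y: "G x \<notin> F ` (cbox lo' hi' - box lo' hi')"
  proof
    assume "G x \<in> F ` (cbox lo' hi' - box lo' hi')"
    then obtain z where z: "z \<in> cbox lo' hi'" "z \<notin> box lo' hi'" "G x = G (Re z, Im z)" by (auto simp: F_def)
    moreover have "x \<in> {t0 - d..t0 + d} \<times> {s0 - e..s0 + e}" using x by auto
    ultimately have "x = (Re z, Im z)" using inj_onD[OF G(2)] cb by blast
    then show False using x z(2) by (auto simp: lo'_def hi'_def in_box_complex_iff)
  qed
  have flip: "winding_number ((F \<circ> cnj) \<circ> rectpath (Complex (t0 - d) (- s0 - e)) (Complex (t0 + d) (- s0 + e))) (G x)
      = - winding_number (F \<circ> rectpath lo' hi') (G x)"
  proof -
    have "cnj (Complex (Re lo') (Im hi')) = Complex (t0 - d) (- s0 - e)"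
      "cnj (Complex (Re hi') (Im lo')) = Complex (t0 + d) (- s0 + e)"
      by (auto simp: lo'_def hi'_def complex_eq_iff)
    then show ?thesis using winding_number_image_flip_Im[OF cF ord y] by simp
  qed
  have rot: "winding_number ((F \<circ> uminus) \<circ> rectpath (Complex (- t0 - d) (- s0 - e)) (Complex (- t0 + d) (- s0 + e))) (G x)
      = winding_number (F \<circ> rectpath lo' hi') (G x)"
  proof -
    have "- hi' = Complex (- t0 - d) (- s0 - e)" "- lo' = Complex (- t0 + d) (- s0 + e)"
      by (auto simp: lo'_def hi'_def complex_eq_iff)
    then show ?thesis using winding_number_image_rotate[OF cF ord y] by simp
  qed
  have rotflip: "winding_number (((F \<circ> cnj) \<circ> uminus) \<circ> rectpath (Complex (- t0 - d) (s0 - e)) (Complex (- t0 + d) (s0 + e))) (G x)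
      = - winding_number (F \<circ> rectpath lo' hi') (G x)"
  proof -
    define l2 h2 where "l2 = Complex (t0 - d) (- s0 - e)" and "h2 = Complex (t0 + d) (- s0 + e)"
    have box: "cnj z \<in> cbox lo' hi' \<longleftrightarrow> z \<in> cbox l2 h2" "cnj z \<in> box lo' hi' \<longleftrightarrow> z \<in> box l2 h2" for z
      by (auto simp: in_cbox_complex_iff in_box_complex_iff lo'_def hi'_def l2_def h2_def)
    have c2: "continuous_on (cbox l2 h2) (F \<circ> cnj)"
      using box(1) by (intro continuous_on_compose continuous_intros continuous_on_subset[OF cF]) auto
    have y2: "G x \<notin> (F \<circ> cnj) ` (cbox l2 h2 - box l2 h2)" using y box by auto
    have ord2: "Re l2 \<le> Re h2" "Im l2 \<le> Im h2" using d by (auto simp: l2_def h2_def)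
    have "- h2 = Complex (- t0 - d) (s0 - e)" "- l2 = Complex (- t0 + d) (s0 + e)"
      by (auto simp: l2_def h2_def complex_eq_iff)
    then show ?thesis using winding_number_image_rotate[OF c2 ord2 y2] flip by (simp add: l2_def h2_def)
  qed
  have F1: "(\<lambda>z. G (Re z, Im z)) = F" "(\<lambda>z. G (Re z, - Im z)) = F \<circ> cnj" "(\<lambda>z. G (- Re z, - Im z)) = F \<circ> uminus"
    "(\<lambda>z. G (- Re z, Im z)) = (F \<circ> cnj) \<circ> uminus"
    by (auto simp: F_def fun_eq_iff)
  show ?thesis using a b flip rot rotflip unfolding lo'_def hi'_def
    by (elim disjE) (simp_all add: F1)
qed

section \<open>Orienting a small piece of a flow box\<close>

context oriented_lamination
begin

lemma box_lift_open_map: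
  assumes "flow_box M \<Lambda> B" "box_lift B G" "open R" "R \<subseteq> open_rect B"
  shows "open (G ` R)"
proof -
  define R' where "R' = (\<lambda>z. (Re z, Im z)) -` R"
  have "open R'" unfolding R'_def by (intro open_vimage assms(3) continuous_intros)
  moreover have "R' \<subseteq> cbox (lo B) (hi B)"
    using assms(4) open_rect_subset rect_cbox unfolding R'_def by blast
  ultimately have "open ((\<lambda>z. G (Re z, Im z)) ` R')"
    using box_lift_complex[OF assms(1,2)]
    by (intro invariance_of_domain) (auto intro: continuous_on_subset inj_on_subset)
  moreover have "(\<lambda>z. G (Re z, Im z)) ` R' = G ` R"
  proof safe
    fix t s assume "(t, s) \<in> R"
    then show "G (t, s) \<in> (\<lambda>z. G (Re z, Im z)) ` R'"
      by (intro image_eqI[of _ _ "Complex t s"]) (auto simp: R'_def)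
  qed (auto simp: R'_def)
  ultimately show ?thesis by simp
qed

text \<open>Horizontal lines of a flow box in the lamination stay in horizontal lines of an oriented one,
  because the slices are totally disconnected. So a small piece of the given box is oriented after
  reflections of its two coordinates; this does not change its vertical foliation.\<close>

lemma oriented_subbox:
  assumes B: "flow_box M \<Lambda> B" and x0: "(t0, s0) \<in> open_rect B" "s0 \<in> slice B"
  obtains a b d e where "a = 1 \<or> a = -1" "b = 1 \<or> b = -1" "0 < d" "0 < e"
    "{t0 - d..t0 + d} \<times> {s0 - e..s0 + e} \<subseteq> open_rect B"
    "oriented_flow_box p M \<Lambda> Or (subbox B a b t0 s0 d e)"
proof -
  have x0r: "(t0, s0) \<in> rect B" using x0 open_rect_subset by blast
  have x0L: "chart B (t0, s0) \<in> \<Lambda>" using flow_box_leaf_iff[OF B x0r] x0(2) by simp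
  have x0M: "chart B (t0, s0) \<in> M" using x0L lamination_subset by blast
  obtain B' where B': "oriented_flow_box p M \<Lambda> Or B'" "chart B (t0, s0) \<in> chart B' ` open_rect B'"
    using lamination x0L by (auto simp: oriented_geodesic_lamination_def)
  have fb': "flow_box M \<Lambda> B'" using B' by (simp add: oriented_flow_box_def)
  obtain y0 where y0: "y0 \<in> open_rect B'" "chart B (t0, s0) = chart B' y0" using B'(2) by blast
  have y0r: "y0 \<in> rect B'" using y0 open_rect_subset by blast
  obtain z0 where z0: "z0 \<in> hyp_plane" "p z0 = chart B (t0, s0)" using x0M p_image by (metis imageE)
  have z0': "p z0 = chart B' y0" using z0(2) y0(2) by simp
  obtain G where G: "box_lift B G" "G (t0, s0) = z0" by (rule box_lift_exists[OF B x0r z0]) (rule that)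
  obtain G' where G': "box_lift B' G'" "G' y0 = z0" by (rule box_lift_exists[OF fb' y0r z0(1) z0']) (rule that)
  have Gc: "continuous_on (rect B) G" using G by (simp add: box_lift_def)
  have opn: "open (G' ` open_rect B')" by (rule box_lift_open_map[OF fb' G'(1) open_open_rect order.refl])
  obtain r0 where r0: "r0 > 0" "\<And>x. x \<in> rect B \<Longrightarrow> dist x (t0, s0) < r0 \<Longrightarrow> G x \<in> G' ` open_rect B'"
  proof -
    have "G (t0, s0) = G' y0" using G(2) G'(2) by simp
    then have "G (t0, s0) \<in> G' ` open_rect B'" using y0(1) by (metis imageI)
    then obtain e where e: "e > 0" "ball (G (t0, s0)) e \<subseteq> G' ` open_rect B'" using opn open_contains_ball by blast
    obtain r where r: "r > 0" "\<forall>x\<in>rect B. dist x (t0, s0) < r \<longrightarrow> dist (G x) (G (t0, s0)) < e"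
      using Gc x0r e(1) unfolding continuous_on_iff by blast
    show thesis
    proof (rule that[OF r(1)])
      fix x assume "x \<in> rect B" "dist x (t0, s0) < r"
      then have "G x \<in> ball (G (t0, s0)) e" using r(2) by (simp add: dist_commute)
      then show "G x \<in> G' ` open_rect B'" using e(2) by blast
    qed
  qed
  obtain r1 where r1: "r1 > 0" "ball (t0, s0) r1 \<subseteq> open_rect B"
    using open_open_rect x0(1) open_contains_ball by blast
  define d where "d = min r0 r1 / 4"
  have d: "d > 0" "4 * d \<le> r0" "4 * d \<le> r1" using r0(1) r1(1) by (simp_all add: d_def)
  define R where "R = {t0 - d..t0 + d} \<times> {s0 - d..s0 + d}"
  have dR: "dist x (t0, s0) < 4 * d" if "x \<in> R" for x
  proof -
    have "dist (fst x, snd x) (t0, s0) \<le> \<bar>fst x - t0\<bar> + \<bar>snd x - s0\<bar>" by (rule dist_Pair_le_real)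
    also have "\<dots> \<le> d + d" using that by (intro add_mono) (auto simp: R_def abs_le_iff)
    finally show ?thesis using d(1) by simp
  qed
  have Rsub: "R \<subseteq> open_rect B" using dR r1(2) d by (force simp: dist_commute)
  then have RB: "R \<subseteq> rect B" using open_rect_subset by blast
  have RG: "G x \<in> G' ` open_rect B'" if "x \<in> R" for x using r0(2)[of x] dR[OF that] that RB d by force
  define c where "c x = inv_into (rect B') (chart B') (chart B x)" for x
  have cB: "c x \<in> open_rect B'" "chart B' (c x) = chart B x" if x: "x \<in> R" for x
  proof -
    obtain y where y: "y \<in> open_rect B'" "G x = G' y" using RG[OF x] by blast
    have yr: "y \<in> rect B'" using y open_rect_subset by blast
    have "chart B x = chart B' y" using G(1) G'(1) y(2) yr x RB unfolding box_lift_def by (metis subsetD)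
    then have "c x = y" using inv_into_f_f[OF flow_box_inj[OF fb'] yr] by (simp add: c_def)
    then show "c x \<in> open_rect B'" "chart B' (c x) = chart B x" using y \<open>chart B x = chart B' y\<close> by auto
  qed
  have cont_c: "continuous_on R c" unfolding c_def
  proof (rule continuous_on_compose2[OF flow_box_continuous_inv[OF fb'] continuous_on_subset[OF flow_box_continuous[OF B] RB]])
    show "chart B ` R \<subseteq> chart B' ` rect B'"
    proof (rule image_subsetI)
      fix x assume x: "x \<in> R"
      have "c x \<in> rect B'" using cB(1)[OF x] open_rect_subset by blast
      then show "chart B x \<in> chart B' ` rect B'" unfolding cB(2)[OF x, symmetric] by (rule imageI)
    qed
  qed
  have inj_c: "inj_on c R"
  proof (rule inj_onI)
    fix x y assume xy: "x \<in> R" "y \<in> R" "c x = c y"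
    then have "chart B x = chart B y" using cB(2)[OF xy(1)] cB(2)[OF xy(2)] by metis
    then show "x = y" using inj_onD[OF flow_box_inj[OF B]] xy RB by blast
  qed
  have ts: "(t, s) \<in> R \<longleftrightarrow> t \<in> {t0 - d..t0 + d} \<and> s \<in> {s0 - d..s0 + d}" for t s by (auto simp: R_def)
  have slice': "snd (c (t, s)) \<in> slice B'" if "(t, s) \<in> R" "s \<in> slice B" for t s
  proof -
    have "chart B' (c (t, s)) \<in> \<Lambda>" using cB(2)[OF that(1)] flow_box_leaf_iff[OF B, of t s] that RB by auto
    then show ?thesis
      using flow_box_leaf_iff[OF fb', of "fst (c (t, s))" "snd (c (t, s))"] cB(1)[OF that(1)] open_rect_subset by auto
  qed
  have horiz: "continuous_on {t0 - d..t0 + d} (\<lambda>t. c (t, s))" if "s \<in> {s0 - d..s0 + d}" for s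
    by (rule continuous_on_compose2[OF cont_c]) (use that in \<open>auto simp: ts intro!: continuous_intros\<close>)
  have const: "snd (c (t, s)) = snd (c (t0, s))" if s: "s \<in> slice B" "s \<in> {s0 - d..s0 + d}" and t: "t \<in> {t0 - d..t0 + d}" for t s
  proof (rule negligible_real_connected_const[OF flow_box_slice_negligible[OF fb'], where S="{t0 - d..t0 + d}" and \<phi>="\<lambda>t. snd (c (t, s))"])
    show "continuous_on {t0 - d..t0 + d} (\<lambda>t. snd (c (t, s)))" by (intro continuous_intros horiz s)
    show "(\<lambda>t. snd (c (t, s))) ` {t0 - d..t0 + d} \<subseteq> slice B'" using slice' s ts by auto
  qed (use t d in auto)
  have mono: "\<exists>u. (u = 1 \<or> u = -1) \<and> strict_mono_on {t0 - d..t0 + d} (\<lambda>t. u * fst (c (t, s)))"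
    if s: "s \<in> slice B" "s \<in> {s0 - d..s0 + d}" for s
  proof -
    have "inj_on (\<lambda>t. fst (c (t, s))) {t0 - d..t0 + d}"
    proof (rule inj_onI)
      fix t t' assume t: "t \<in> {t0 - d..t0 + d}" "t' \<in> {t0 - d..t0 + d}" "fst (c (t, s)) = fst (c (t', s))"
      then have "c (t, s) = c (t', s)" using const[OF s t(1)] const[OF s t(2)] by (simp add: prod_eq_iff)
      then show "t = t'" using inj_onD[OF inj_c] t s ts by blast
    qed
    moreover have "continuous_on {t0 - d..t0 + d} (\<lambda>t. fst (c (t, s)))" by (intro continuous_intros horiz s)
    moreover have "t0 - d < t0 + d" using d by simp
    ultimately show ?thesis using inj_continuous_strict_monotone by blast
  qed
  have s0d: "s0 \<in> {s0 - d..s0 + d}" using d by simp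
  obtain a where a: "a = 1 \<or> a = -1" "strict_mono_on {t0 - d..t0 + d} (\<lambda>t. a * fst (c (t, s0)))"
    using mono[OF x0(2) s0d] by blast
  \<comment> \<open>The signed width of a horizontal in the first coordinate of \<open>B'\<close>.
    It is continuous in \<open>s\<close> and positive at \<open>s0\<close>, so all leaves of nearby
    slices run in the direction \<open>a\<close> of the leaf through the centre.\<close>
  define w where "w s = a * fst (c (t0 + d, s)) - a * fst (c (t0 - d, s))" for s
  have w0: "w s0 > 0" using a(2) d by (simp add: w_def monotone_on_def)
  have cw: "continuous_on {s0 - d..s0 + d} w" unfolding w_def
    by (intro continuous_intros continuous_on_compose2[OF cont_c]) (use d in \<open>auto simp: ts\<close>)
  obtain e0 where e0: "e0 > 0" "\<And>s. s \<in> {s0 - d..s0 + d} \<Longrightarrow> \<bar>s - s0\<bar> < e0 \<Longrightarrow> w s > 0"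
  proof -
    obtain e where e: "e > 0" "\<forall>s\<in>{s0 - d..s0 + d}. dist s s0 < e \<longrightarrow> dist (w s) (w s0) < w s0"
      using cw s0d w0 unfolding continuous_on_iff by blast
    show thesis
    proof (rule that[OF e(1)])
      fix s assume "s \<in> {s0 - d..s0 + d}" "\<bar>s - s0\<bar> < e"
      then have "dist (w s) (w s0) < w s0" using e(2) by (simp add: dist_real_def)
      then show "w s > 0" by (simp add: dist_real_def)
    qed
  qed
  \<comment> \<open>Heights for which an edge of the small box meets the slice form two congruent
    copies of the slice, hence a null set.\<close>
  have "\<exists>e. 0 < e \<and> e < min d e0 \<and> s0 - e \<notin> slice B \<and> s0 + e \<notin> slice B"
  proof (rule ccontr)
    assume "\<not> ?thesis"
    then have "{0<..<min d e0} \<subseteq> (\<lambda>s. s0 - s) ` slice B \<union> (\<lambda>s. s - s0) ` slice B"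
      by (force intro: image_eqI[where x="s0 - e" for e] image_eqI[where x="s0 + e" for e])
    moreover have "negligible ((\<lambda>s. s0 - s) ` slice B \<union> (\<lambda>s. s - s0) ` slice B)"
    proof (rule negligible_Un)
      have dim0: "hausdorff_dim (slice B) = 0" using B by (simp add: flow_box_def)
      have "hausdorff_dim ((\<lambda>s. s0 - s) ` slice B) \<le> hausdorff_dim (slice B)"
        "hausdorff_dim ((\<lambda>s. s - s0) ` slice B) \<le> hausdorff_dim (slice B)"
        by (rule hausdorff_dim_image_le; simp add: dist_real_def)+
      then show "negligible ((\<lambda>s. s0 - s) ` slice B)" "negligible ((\<lambda>s. s - s0) ` slice B)"
        using dim0 by (auto intro: hausdorff_dim_0_negligible)
    qed
    ultimately have "negligible (box 0 (min d e0))" unfolding box_real by (rule negligible_subset[rotated])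
    then show False using d e0 negligible_interval(2)[of 0 "min d e0"] by (auto simp: box_real)
  qed
  then obtain e where e: "0 < e" "e < d" "e < e0" "s0 - e \<notin> slice B" "s0 + e \<notin> slice B" by auto
  have sub: "{t0 - d..t0 + d} \<times> {s0 - e..s0 + e} \<subseteq> R" using e by (auto simp: R_def)
  have subB: "{t0 - d..t0 + d} \<times> {s0 - e..s0 + e} \<subseteq> rect B" using sub RB by blast
  have G1: "continuous_on ({t0 - d..t0 + d} \<times> {s0 - e..s0 + e}) G" "inj_on G ({t0 - d..t0 + d} \<times> {s0 - e..s0 + e})"
    using continuous_on_subset[OF Gc subB] inj_on_subset[OF box_lift_inj[OF B G(1)] subB] by auto
  define F where "F z = G (Re z, Im z)" for z
  define l1 h1 where "l1 = Complex (t0 - d) (s0 - e)" and "h1 = Complex (t0 + d) (s0 + e)"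
  have cb: "z \<in> cbox l1 h1 \<longleftrightarrow> (Re z, Im z) \<in> {t0 - d..t0 + d} \<times> {s0 - e..s0 + e}" for z
    by (auto simp: l1_def h1_def in_cbox_complex_iff)
  have Fc: "continuous_on (cbox l1 h1) F" unfolding F_def
    by (rule continuous_on_ReIm[OF G1(1)]) (auto simp: cb)
  have Fi: "inj_on F (cbox l1 h1)"
  proof (rule inj_onI)
    fix z w assume "z \<in> cbox l1 h1" "w \<in> cbox l1 h1" "F z = F w"
    then have "(Re z, Im z) = (Re w, Im w)" using inj_onD[OF G1(2)] cb unfolding F_def by blast
    then show "z = w" by (simp add: complex_eq_iff)
  qed
  have ord: "Re l1 < Re h1" "Im l1 < Im h1" using d e by (auto simp: l1_def h1_def)
  obtain v :: complex where v: "v = 1 \<or> v = -1" "\<And>z. z \<in> box l1 h1 \<Longrightarrow> winding_number (F \<circ> rectpath l1 h1) (F z) = v"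
    by (rule winding_number_image_pm1[OF Fc Fi ord]) (rule that)
  \<comment> \<open>The direction of the leaves has already fixed \<open>a\<close>. The reflection
    in \<open>s\<close> is the remaining freedom, and it is used to make the box preserve
    orientation, that is \<open>a * b * v = 1\<close>.\<close>
  define b where "b = a * Re v"
  have b: "b = 1 \<or> b = -1" using a(1) v(1) by (auto simp: b_def)
  have abv: "of_real (a * b) * v = 1" using a(1) v(1) by (auto simp: b_def)
  let ?B = "subbox B a b t0 s0 d e"
  have fb: "flow_box M \<Lambda> ?B" by (rule flow_box_subbox[OF B a(1) b d(1) e(1) subB e(4,5)])
  have op: "orientation_preserving_box p ?B"
    unfolding orientation_preserving_box_def
  proof (intro exI[of _ "\<lambda>x. G (a * fst x, b * snd x)"] conjI ballI)
    have rin: "(a * fst x, b * snd x) \<in> {t0 - d..t0 + d} \<times> {s0 - e..s0 + e}" if "x \<in> rect ?B" for x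
      using that unfolding subbox_rect[OF a(1) b] by (auto simp: abs_le_iff)
    show "continuous_on (rect ?B) (\<lambda>x. G (a * fst x, b * snd x))"
      by (rule continuous_on_compose2[OF G1(1)]) (use rin in \<open>auto intro!: continuous_intros\<close>)
    show "(\<lambda>x. G (a * fst x, b * snd x)) ` rect ?B \<subseteq> hyp_plane"
      using G(1) rin subB unfolding box_lift_def image_subset_iff by (meson subsetD)
    show "p (G (a * fst x, b * snd x)) = chart ?B x" if "x \<in> rect ?B" for x
    proof -
      have "(a * fst x, b * snd x) \<in> rect B" using rin[OF that] subB by blast
      then show ?thesis using G(1) by (simp add: box_lift_def)
    qed
    show "winding_number ((\<lambda>z. G (a * fst (Re z, Im z), b * snd (Re z, Im z))) \<circ>
        rectpath (Complex (tmin ?B) (smin ?B)) (Complex (tmax ?B) (smax ?B))) (G (a * fst x, b * snd x)) = 1"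
      if x: "x \<in> open_rect ?B" for x
    proof -
      define y where "y = (a * fst x, b * snd x)"
      have y: "y \<in> {t0 - d<..<t0 + d} \<times> {s0 - e<..<s0 + e}"
        using x unfolding subbox_rect[OF a(1) b] y_def by (auto simp: abs_less_iff)
      have "Complex (fst y) (snd y) \<in> box l1 h1" using y by (auto simp: l1_def h1_def in_box_complex_iff)
      from v(2)[OF this] have "winding_number (F \<circ> rectpath l1 h1) (G y) = v" by (simp add: F_def)
      with winding_number_subbox[OF a(1) b d(1) e(1) G1 y] abv
      show ?thesis unfolding y_def[symmetric] by (simp add: F_def[abs_def] l1_def h1_def)
    qed
  qed
  have ori: "\<exists>g\<in>Or. \<exists>\<theta>. continuous_on {tmin ?B..tmax ?B} \<theta> \<and> strict_mono_on {tmin ?B..tmax ?B} \<theta> \<and>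
        (\<forall>t\<in>{tmin ?B..tmax ?B}. chart ?B (t, s) = g (\<theta> t))" if s: "s \<in> slice ?B" for s
  proof -
    define s' where "s' = b * s"
    have "\<bar>s' - s0\<bar> \<le> e" using s sign_mult_abs(1)[OF b, of s s0] by (simp add: s'_def)
    then have s': "s' \<in> slice B" "s' \<in> {s0 - d..s0 + d}" "\<bar>s' - s0\<bar> < e0"
      using s e by (auto simp: s'_def abs_le_iff)
    obtain u where u: "u = 1 \<or> u = -1" "strict_mono_on {t0 - d..t0 + d} (\<lambda>t. u * fst (c (t, s')))"
      using mono[OF s'(1,2)] by blast
    have "w s' > 0" using e0(2) s' by blast
    moreover have "u * fst (c (t0 - d, s')) < u * fst (c (t0 + d, s'))" using u(2) d by (simp add: monotone_on_def)
    ultimately have "u = a" using u(1) a(1) by (auto simp: w_def)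
    define \<tau> where "\<tau> t = fst (c (a * t, s'))" for t
    have tin: "a * t \<in> {t0 - d..t0 + d}" if "t \<in> {tmin ?B..tmax ?B}" for t
      using that a(1) by auto
    have \<tau>c: "continuous_on {tmin ?B..tmax ?B} \<tau>" unfolding \<tau>_def
      by (intro continuous_intros continuous_on_compose2[OF horiz[OF s'(2)]]) (use tin in auto)
    have \<tau>m: "strict_mono_on {tmin ?B..tmax ?B} \<tau>"
      using u(2) a(1) unfolding \<open>u = a\<close> \<tau>_def by (auto simp: monotone_on_def)
    define \<sigma> where "\<sigma> = snd (c (t0, s'))"
    have "(t0, s') \<in> R" using s'(2) d by (simp add: ts)
    then have "\<sigma> \<in> slice B'" unfolding \<sigma>_def using slice' s'(1) by blast
    then obtain g \<theta> where g: "g \<in> Or" "continuous_on {tmin B'..tmax B'} \<theta>" "strict_mono_on {tmin B'..tmax B'} \<theta>"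
        "\<forall>t\<in>{tmin B'..tmax B'}. chart B' (t, \<sigma>) = g (\<theta> t)"
      using B'(1) unfolding oriented_flow_box_def by blast
    have \<tau>in: "\<tau> t \<in> {tmin B'..tmax B'}" if "t \<in> {tmin ?B..tmax ?B}" for t
      using cB(1)[of "(a * t, s')"] tin[OF that] s'(2) ts by (auto simp: \<tau>_def open_rect_def mem_Times_iff)
    show ?thesis
    proof (intro bexI[OF _ g(1)] exI[of _ "\<lambda>t. \<theta> (\<tau> t)"] conjI ballI)
      show "continuous_on {tmin ?B..tmax ?B} (\<lambda>t. \<theta> (\<tau> t))"
        by (rule continuous_on_compose2[OF g(2) \<tau>c]) (use \<tau>in in auto)
      show "strict_mono_on {tmin ?B..tmax ?B} (\<lambda>t. \<theta> (\<tau> t))"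
      proof (rule monotone_onI)
        fix x y assume xy: "x \<in> {tmin ?B..tmax ?B}" "y \<in> {tmin ?B..tmax ?B}" "x < y"
        have "\<tau> x < \<tau> y" using monotone_onD[OF \<tau>m xy] .
        then show "\<theta> (\<tau> x) < \<theta> (\<tau> y)" using monotone_onD[OF g(3) \<tau>in[OF xy(1)] \<tau>in[OF xy(2)]] by simp
      qed
      fix t assume t: "t \<in> {tmin ?B..tmax ?B}"
      have inR: "(a * t, s') \<in> R" using tin[OF t] s'(2) by (simp add: ts)
      have "chart ?B (t, s) = chart B' (c (a * t, s'))" using cB(2)[OF inR] by (simp add: s'_def)
      also have "c (a * t, s') = (\<tau> t, \<sigma>)"
        using const[OF s'(1,2) tin[OF t]] by (simp add: \<tau>_def \<sigma>_def prod_eq_iff)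
      finally show "chart ?B (t, s) = g (\<theta> (\<tau> t))" using g(4) \<tau>in[OF t] by simp
    qed
  qed
  show thesis
  proof (rule that[OF a(1) b d(1) e(1)])
    show "{t0 - d..t0 + d} \<times> {s0 - e..s0 + e} \<subseteq> open_rect B" using sub Rsub by blast
    show "oriented_flow_box p M \<Lambda> Or ?B" unfolding oriented_flow_box_def using fb op ori by blast
  qed
qed

section \<open>Every crossing has a sign\<close>

lemma crosses_box_subset:
  assumes "crosses_box B f I" "J \<subseteq> I"
  shows "crosses_box B f J"
proof -
  obtain h where h: "homeomorphism I (transverse_coord B f ` I) (transverse_coord B f) h" and I: "f ` I \<subseteq> chart B ` rect B"
    using assms(1) by (auto simp: crosses_box_def)
  have "homeomorphism J (transverse_coord B f ` J) (transverse_coord B f) h"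
    using h assms(2) by (intro homeomorphism_of_subsets[OF h]) auto
  then show ?thesis using I assms(2) by (auto simp: crosses_box_def)
qed

lemma crosses_box_scale:
  assumes "crosses_box B f I" "b \<noteq> 0" "f ` I \<subseteq> chart B' ` rect B'"
    "\<And>\<tau>. \<tau> \<in> I \<Longrightarrow> transverse_coord B' f \<tau> = b * transverse_coord B f \<tau>"
  shows "crosses_box B' f I"
proof -
  let ?T = "transverse_coord B f" and ?T' = "transverse_coord B' f"
  obtain h where h: "homeomorphism I (?T ` I) ?T h" using assms(1) by (auto simp: crosses_box_def)
  have "homeomorphism I (?T' ` I) ?T' (\<lambda>s. h (s / b))"
  proof (rule homeomorphismI)
    have "continuous_on I (\<lambda>\<tau>. b * ?T \<tau>)" using h by (intro continuous_intros) (simp add: homeomorphism_def)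
    then show "continuous_on I ?T'" using assms(4) by (simp cong: continuous_on_cong)
    have "continuous_on (?T ` I) h" using h by (simp add: homeomorphism_def)
    then show "continuous_on (?T' ` I) (\<lambda>s. h (s / b))"
      by (rule continuous_on_compose2) (use assms in \<open>auto intro!: continuous_intros\<close>)
  qed (use h assms in \<open>auto simp: homeomorphism_def\<close>)
  then show ?thesis using assms(3) by (auto simp: crosses_box_def)
qed

text \<open>The given box need not be oriented, but an oriented subbox has the same transverse
  coordinate up to the factor \<open>b\<close>. This coordinate is injective along the path, hence
  monotone with some sign \<open>u\<close>, and the crossing has the sign
  \<open>u * b\<close>.\<close>

lemma admissible_crossing:
  assumes f: "admissible_transversal M \<Lambda> l m f" and k: "k \<in> {l..m}" "f k \<in> \<Lambda>"
  shows "crossing p M \<Lambda> Or 1 l m f k \<or> crossing p M \<Lambda> Or (-1) l m f k"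
proof -
  have "\<exists>B. \<exists>\<eta>>0. flow_box M \<Lambda> B \<and> f k \<in> chart B ` open_rect B \<and>
           {k - \<eta>..k + \<eta>} \<subseteq> {l..m} \<and> crosses_box B f {k - \<eta>..k + \<eta>}"
    using f k by (simp add: admissible_transversal_def)
  then obtain B \<eta> where B: "\<eta> > 0" "flow_box M \<Lambda> B" "f k \<in> chart B ` open_rect B"
      "{k - \<eta>..k + \<eta>} \<subseteq> {l..m}" "crosses_box B f {k - \<eta>..k + \<eta>}" by blast
  define I where "I = {k - \<eta>..k + \<eta>}"
  obtain t0 s0 where x0: "(t0, s0) \<in> open_rect B" "f k = chart B (t0, s0)" using B(3) by auto
  have x0r: "(t0, s0) \<in> rect B" using x0 open_rect_subset by blast
  have s0: "s0 \<in> slice B" using flow_box_leaf_iff[OF B(2) x0r] k(2) x0(2) by simp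
  obtain a b d e where ab: "a = 1 \<or> a = -1" "b = 1 \<or> b = -1" "0 < d" "0 < e"
    "{t0 - d..t0 + d} \<times> {s0 - e..s0 + e} \<subseteq> open_rect B"
    "oriented_flow_box p M \<Lambda> Or (subbox B a b t0 s0 d e)"
    by (rule oriented_subbox[OF B(2) x0(1) s0]) (rule that)
  let ?B = "subbox B a b t0 s0 d e"
  have fb': "flow_box M \<Lambda> ?B" using ab(6) by (simp add: oriented_flow_box_def)
  define c where "c \<tau> = inv_into (rect B) (chart B) (f \<tau>)" for \<tau>
  have fI: "f ` I \<subseteq> chart B ` rect B" using B(5) by (simp add: crosses_box_def I_def)
  have cI: "c \<tau> \<in> rect B" "chart B (c \<tau>) = f \<tau>" if "\<tau> \<in> I" for \<tau>
  proof -
    have "f \<tau> \<in> chart B ` rect B" using fI that by blast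
    then show "c \<tau> \<in> rect B" "chart B (c \<tau>) = f \<tau>"
      unfolding c_def by (rule inv_into_into, rule f_inv_into_f)
  qed
  have "continuous_on I f" using f B(4) continuous_on_subset unfolding admissible_transversal_def I_def by blast
  then have cc: "continuous_on I c" unfolding c_def
    by (rule continuous_on_compose2[OF flow_box_continuous_inv[OF B(2)]]) (rule fI)
  have kI: "k \<in> I" using B(1) by (simp add: I_def)
  have ck: "c k = (t0, s0)" using inv_into_f_f[OF flow_box_inj[OF B(2)] x0r] x0(2) by (simp add: c_def)
  define r where "r = min d e"
  have r: "r > 0" "r \<le> d" "r \<le> e" using ab(3,4) by (auto simp: r_def)
  obtain \<delta> where \<delta>: "\<delta> > 0" "\<forall>\<tau>\<in>I. dist \<tau> k < \<delta> \<longrightarrow> dist (c \<tau>) (c k) < r"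
    using cc kI r(1) unfolding continuous_on_iff by blast
  define \<eta>' where "\<eta>' = min \<eta> (\<delta> / 2)"
  have \<eta>': "\<eta>' > 0" "\<eta>' \<le> \<eta>" "\<eta>' < \<delta>" using B(1) \<delta>(1) by (auto simp: \<eta>'_def)
  define J where "J = {k - \<eta>'..k + \<eta>'}"
  have JI: "J \<subseteq> I" using \<eta>' by (auto simp: I_def J_def)
  have near: "\<bar>fst (c \<tau>) - t0\<bar> < d" "\<bar>snd (c \<tau>) - s0\<bar> < e" if "\<tau> \<in> J" for \<tau>
  proof -
    have "dist \<tau> k < \<delta>" using that \<eta>' by (auto simp: J_def dist_real_def abs_less_iff)
    then have "dist (c \<tau>) (c k) < r" using \<delta>(2) that JI by blast
    then show "\<bar>fst (c \<tau>) - t0\<bar> < d" "\<bar>snd (c \<tau>) - s0\<bar> < e"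
      using dist_fst_le[of "c \<tau>" "c k"] dist_snd_le[of "c \<tau>" "c k"] r by (auto simp: ck dist_real_def)
  qed
  define y where "y \<tau> = (a * fst (c \<tau>), b * snd (c \<tau>))" for \<tau>
  have y: "y \<tau> \<in> open_rect ?B" "chart ?B (y \<tau>) = f \<tau>" if "\<tau> \<in> J" for \<tau>
  proof -
    show "y \<tau> \<in> open_rect ?B"
      using near[OF that] unfolding subbox_rect[OF ab(1,2)] by (simp add: y_def sign_mult_abs(2)[OF ab(1)] sign_mult_abs(2)[OF ab(2)])
    show "chart ?B (y \<tau>) = f \<tau>"
      using cI(2) that JI by (auto simp: y_def sign_mult_abs(2)[OF ab(1)] sign_mult_abs(2)[OF ab(2)])
  qed
  have yr: "y \<tau> \<in> rect ?B" if "\<tau> \<in> J" for \<tau> using y(1)[OF that] open_rect_subset by blast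
  have coord: "transverse_coord ?B f \<tau> = b * transverse_coord B f \<tau>" if "\<tau> \<in> J" for \<tau>
    using transverse_coord_chart[where f=f and \<tau>=\<tau>, OF fb' yr[OF that] y(2)[OF that, symmetric]]
    by (simp add: y_def transverse_coord_def c_def)
  have crJ: "crosses_box B f J" using crosses_box_subset[OF B(5)] JI by (simp add: I_def)
  have cr: "crosses_box ?B f J"
  proof (rule crosses_box_scale[where b=b, OF crJ])
    show "f ` J \<subseteq> chart ?B ` rect ?B" using yr y(2) by (metis image_eqI image_subsetI)
  qed (use ab(2) coord in auto)
  obtain hh where hh: "homeomorphism J (transverse_coord B f ` J) (transverse_coord B f) hh"
    using crJ by (auto simp: crosses_box_def)
  have "continuous_on {k - \<eta>'..k + \<eta>'} (transverse_coord B f)" "inj_on (transverse_coord B f) {k - \<eta>'..k + \<eta>'}"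
    using hh unfolding J_def homeomorphism_def by (auto intro: inj_on_inverseI)
  moreover have "k - \<eta>' < k + \<eta>'" using \<eta>' by simp
  ultimately obtain u where u: "u = 1 \<or> u = -1"
      "strict_mono_on {k - \<eta>'..k + \<eta>'} (\<lambda>\<tau>. u * transverse_coord B f \<tau>)"
    by (rule inj_continuous_strict_monotone) (rule that)
  note u = u[folded J_def]
  have "strict_mono_on J (\<lambda>\<tau>. (u * b) * transverse_coord ?B f \<tau>)"
  proof (rule monotone_onI)
    fix x y assume xy: "x \<in> J" "y \<in> J" "x < y"
    have "u * transverse_coord B f x < u * transverse_coord B f y" using monotone_onD[OF u(2) xy] .
    then show "(u * b) * transverse_coord ?B f x < (u * b) * transverse_coord ?B f y"
      using coord xy(1,2) ab(2) by auto
  qed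
  moreover have "f k \<in> chart ?B ` open_rect ?B"
    using y[of k] \<eta>' by (intro image_eqI[of _ _ "y k"]) (auto simp: J_def)
  moreover have "J \<subseteq> {l..m}" using JI B(4) by (auto simp: I_def)
  ultimately have "crossing p M \<Lambda> Or (u * b) l m f k"
    unfolding crossing_def using ab(6) cr \<eta>'(1) unfolding J_def by blast
  then show ?thesis using u(1) ab(2) by auto
qed

text \<open>The box at \<open>k\<close> also serves nearby times. This makes the sign locally
  constant in time, as the compactness argument for subdivisions requires.\<close>

lemma crossing_open:
  assumes f: "continuous_on {l..m} f" and c: "crossing p M \<Lambda> Or e l m f k"
  obtains \<delta> where "\<delta> > 0" "\<And>k'. \<bar>k' - k\<bar> < \<delta> \<Longrightarrow> crossing p M \<Lambda> Or e l m f k'"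
proof -
  obtain B \<eta> where B: "\<eta> > 0" "oriented_flow_box p M \<Lambda> Or B" "f k \<in> chart B ` open_rect B"
      "{k - \<eta>..k + \<eta>} \<subseteq> {l..m}" "crosses_box B f {k - \<eta>..k + \<eta>}"
      "strict_mono_on {k - \<eta>..k + \<eta>} (\<lambda>\<tau>. e * transverse_coord B f \<tau>)"
    using c unfolding crossing_def by blast
  have fb: "flow_box M \<Lambda> B" using B(2) by (simp add: oriented_flow_box_def)
  define I where "I = {k - \<eta>..k + \<eta>}"
  define c where "c \<tau> = inv_into (rect B) (chart B) (f \<tau>)" for \<tau>
  have fI: "f ` I \<subseteq> chart B ` rect B" using B(5) by (simp add: crosses_box_def I_def)
  have "continuous_on I f" using f B(4) continuous_on_subset unfolding I_def by blast
  then have cc: "continuous_on I c" unfolding c_def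
    by (rule continuous_on_compose2[OF flow_box_continuous_inv[OF fb]]) (rule fI)
  have kI: "k \<in> I" using B(1) by (simp add: I_def)
  obtain x0 where x0: "x0 \<in> open_rect B" "f k = chart B x0" using B(3) by blast
  have ck: "c k = x0" using inv_into_f_f[OF flow_box_inj[OF fb], of x0] x0 open_rect_subset by (auto simp: c_def)
  obtain r where r: "r > 0" "ball x0 r \<subseteq> open_rect B" using open_open_rect x0(1) open_contains_ball by blast
  obtain d where d: "d > 0" "\<forall>\<tau>\<in>I. dist \<tau> k < d \<longrightarrow> dist (c \<tau>) (c k) < r"
    using cc kI r(1) unfolding continuous_on_iff by blast
  show thesis
  proof (rule that[of "min d (\<eta> / 2)"])
    show "0 < min d (\<eta> / 2)" using d(1) B(1) by simp
    fix k' assume k': "\<bar>k' - k\<bar> < min d (\<eta> / 2)"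
    have k'2: "\<bar>k' - k\<bar> < \<eta> / 2" using k' by simp
    have k'I: "k' \<in> I" unfolding I_def atLeastAtMost_iff using k'2 by linarith
    have sub: "{k' - \<eta> / 2..k' + \<eta> / 2} \<subseteq> I"
      unfolding I_def atLeastatMost_subset_iff using k'2 by linarith
    have "dist (c k') (c k) < r" using d(2) k'I k' by (simp add: dist_real_def)
    then have "c k' \<in> open_rect B" using r(2) ck by (auto simp: dist_commute)
    moreover have "f k' = chart B (c k')" unfolding c_def
      using f_inv_into_f[of "f k'" "chart B" "rect B"] fI k'I by auto
    ultimately have "f k' \<in> chart B ` open_rect B" by blast
    moreover have "crosses_box B f {k' - \<eta> / 2..k' + \<eta> / 2}"
      using crosses_box_subset[OF B(5)] sub by (simp add: I_def)
    moreover have "strict_mono_on {k' - \<eta> / 2..k' + \<eta> / 2} (\<lambda>\<tau>. e * transverse_coord B f \<tau>)"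
      using B(6) sub unfolding I_def by (rule monotone_on_subset)
    ultimately show "crossing p M \<Lambda> Or e l m f k'"
      unfolding crossing_def using B(1,2,4) sub unfolding I_def
      by (intro exI[of _ B] exI[of _ "\<eta> / 2"]) auto
  qed
qed

section \<open>Signs under homotopy\<close>

text \<open>The times spent on the leaf form a closed set, because the leaf is a zero set of its
  chart. They form an open set because, inside an oriented box, the slice coordinate is constant and
  its horizontal belongs to one leaf.\<close>

lemma path_in_lamination_stays:
  fixes c :: "real \<Rightarrow> complex"
  assumes c: "continuous_on {a..b} c" "c ` {a..b} \<subseteq> lift_\<Lambda>" and h: "leaf_lift h"
    and u: "u \<in> {a..b}" "c u \<in> range h" and v: "v \<in> {a..b}"
  shows "c v \<in> range h"
proof -
  let ?S = "{u\<in>{a..b}. c u \<in> range h}"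
  have cH: "c ` {a..b} \<subseteq> hyp_plane" using c(2) by (auto simp: lamination_lift_def)
  have 1: "closedin (top_of_set {a..b}) ?S" by (rule closed_leaf_lift[OF h c(1) cH])
  have "\<exists>e>0. \<forall>u'\<in>{a..b}. dist u' u < e \<longrightarrow> u' \<in> ?S" if "u \<in> ?S" for u
  proof -
    have u: "u \<in> {a..b}" "c u \<in> range h" using that by auto
    have "c u \<in> lift_\<Lambda>" using c(2) u(1) by blast
    then have cu: "c u \<in> hyp_plane" "p (c u) \<in> \<Lambda>" by (auto simp: lamination_lift_def)
    obtain B where B: "oriented_flow_box p M \<Lambda> Or B" "p (c u) \<in> chart B ` open_rect B"
      using lamination cu(2) by (auto simp: oriented_geodesic_lamination_def)
    have fb: "flow_box M \<Lambda> B" using B(1) by (simp add: oriented_flow_box_def)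
    obtain t0 s0 where x0: "(t0, s0) \<in> open_rect B" "p (c u) = chart B (t0, s0)" using B(2) by auto
    have x0r: "(t0, s0) \<in> rect B" using x0 open_rect_subset by blast
    obtain G where G: "box_lift B G" "G (t0, s0) = c u" by (rule box_lift_exists[OF fb x0r cu(1) x0(2)]) (rule that)
    have opn: "open (G ` open_rect B)" by (rule box_lift_open_map[OF fb G(1) open_open_rect order.refl])
    have "c u \<in> G ` open_rect B" using G(2) x0(1) by (metis imageI)
    then obtain r where r: "r > 0" "ball (c u) r \<subseteq> G ` open_rect B" using opn open_contains_ball by blast
    obtain e where e: "e > 0" "\<forall>u'\<in>{a..b}. dist u' u < e \<longrightarrow> dist (c u') (c u) < r"
      using c(1) u(1) r(1) unfolding continuous_on_iff by blast
    define J where "J = {a..b} \<inter> ball u e"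
    have uJ: "u \<in> J" using u e by (simp add: J_def)
    have connJ: "connected J" unfolding J_def by (intro convex_connected convex_Int) auto
    have JG: "c u' \<in> G ` rect B" if "u' \<in> J" for u'
    proof -
      have "c u' \<in> ball (c u) r" using e(2) that by (auto simp: J_def dist_commute)
      then show ?thesis using r(2) open_rect_subset by blast
    qed
    define y where "y u' = inv_into (rect B) G (c u')" for u'
    have y: "y u' \<in> rect B" "G (y u') = c u'" if "u' \<in> J" for u'
      using inv_into_into[OF JG[OF that]] f_inv_into_f[OF JG[OF that]] by (simp_all add: y_def)
    have "compact (rect B)" unfolding rect_def by (intro compact_Times) auto
    moreover have "continuous_on (rect B) G" using G(1) by (simp add: box_lift_def)
    ultimately have "continuous_on (G ` rect B) (inv_into (rect B) G)"
      using inv_into_f_f[OF box_lift_inj[OF fb G(1)]] by (intro continuous_on_inv) auto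
    moreover have "continuous_on J c" using c(1) unfolding J_def by (rule continuous_on_subset) auto
    ultimately have yc: "continuous_on J y" unfolding y_def
      by (rule continuous_on_compose2) (use JG in auto)
    have ysl: "snd (y u') \<in> slice B" if "u' \<in> J" for u'
    proof -
      have "G (fst (y u'), snd (y u')) \<in> lift_\<Lambda>" using y(2)[OF that] c(2) that by (auto simp: J_def)
      then show ?thesis using box_lift_leaf_iff[OF fb G(1), of "fst (y u')" "snd (y u')"] y(1)[OF that] by simp
    qed
    have yu: "y u = (t0, s0)" using inv_into_f_f[OF box_lift_inj[OF fb G(1)] x0r] G(2) by (simp add: y_def)
    have "snd (y u') = s0" if "u' \<in> J" for u'
    proof -
      have "snd (y u') = snd (y u)"
        by (rule negligible_real_connected_const[OF flow_box_slice_negligible[OF fb] connJ, of "\<lambda>u. snd (y u)"])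
          (use yc ysl that uJ in \<open>auto intro!: continuous_intros\<close>)
      then show ?thesis by (simp add: yu)
    qed
    moreover have s0: "s0 \<in> slice B" using ysl[OF uJ] yu by simp
    have t0: "t0 \<in> {tmin B..tmax B}" using x0r by (simp add: rect_iff)
    have Gr: "G (t0, s0) \<in> range h" using G(2) u(2) by simp
    obtain \<theta> where th: "\<And>t. t \<in> {tmin B..tmax B} \<Longrightarrow> G (t, s0) = h (\<theta> t)"
      by (rule oriented_box_horizontal[OF B(1) G(1) s0 h t0 Gr]) (rule that)
    ultimately have "c u' \<in> range h" if "u' \<in> J" for u'
    proof -
      have "c u' = G (fst (y u'), s0)" using y(2)[OF that] \<open>\<And>u'. u' \<in> J \<Longrightarrow> snd (y u') = s0\<close>[OF that]
        by (metis prod.collapse)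
      also have "\<dots> = h (\<theta> (fst (y u')))" using y(1)[OF that] by (intro th) (auto simp: rect_def)
      finally show ?thesis by simp
    qed
    then show ?thesis using e(1) by (intro exI[of _ e]) (auto simp: J_def dist_commute)
  qed
  then have 2: "openin (top_of_set {a..b}) ?S" unfolding openin_euclidean_subtopology_iff by auto
  have "connected {a..b}" by simp
  then have "?S = {} \<or> ?S = {a..b}" using 1 2 connected_clopen by blast
  then show ?thesis using u v by auto
qed

text \<open>A single parameter \<open>y\<close> just after \<open>x\<close> is followed through the
  homotopy. If its track met the leaf, the point would be in the lamination for all times and so
  stay on the leaf, contrary to the strict side at \<open>u0\<close>. So the side never changes, and
  only the crossings at \<open>u0\<close> and \<open>u\<close> need boxes.\<close>

lemma crossing_homotopy:
  fixes H :: "real \<times> real \<Rightarrow> 'm"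
  assumes H: "continuous_on ({0..1} \<times> {0..1}) H"
    and adm: "\<And>u. u \<in> {0..1} \<Longrightarrow> admissible_transversal M \<Lambda> 0 1 (\<lambda>x. H (u, x))"
    and pres: "\<And>u x. u \<in> {0..1} \<Longrightarrow> x \<in> {0..1} \<Longrightarrow> H (u, x) \<in> \<Lambda> \<longleftrightarrow> H (0, x) \<in> \<Lambda>"
    and c: "crossing p M \<Lambda> Or e 0 1 (\<lambda>x. H (u0, x)) x" and e: "e = 1 \<or> e = -1"
    and x: "x \<in> {0..1}" "H (0, x) \<in> \<Lambda>" and u: "u0 \<in> {0..1}" "u \<in> {0..1}"
  shows "crossing p M \<Lambda> Or e 0 1 (\<lambda>x. H (u, x)) x"
proof -
  have HM: "H ` ({0..1} \<times> {0..1}) \<subseteq> M" using adm by (auto simp: admissible_transversal_def image_subset_iff)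
  have cs: "convex ({0..1::real} \<times> {0..1::real})" by (intro convex_Times) auto
  obtain K where K: "continuous_on ({0..1} \<times> {0..1}) K" "K ` ({0..1} \<times> {0..1}) \<subseteq> hyp_plane"
      "\<And>y. y \<in> {0..1} \<times> {0..1} \<Longrightarrow> p (K y) = H y"
    by (rule lift_exists[OF cs H HM]) (rule that)
  have Kx: "continuous_on {0..1} (\<lambda>x. K (u, x))" "continuous_on {0..1} (\<lambda>u. K (u, x))"
    if "u \<in> {0..1}" "x \<in> {0..1}" for u x
    by (rule continuous_on_compose2[OF K(1)]; use that in \<open>auto intro!: continuous_intros\<close>)+
  have pl: "path_lift p 0 1 (\<lambda>x. H (u, x)) (\<lambda>x. K (u, x))" if "u \<in> {0..1}" for u
    using Kx[OF that] K(2,3) that by (auto simp: path_lift_def image_subset_iff)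
  have Hc: "continuous_on {0..1} (\<lambda>x. H (u, x))" if "u \<in> {0..1}" for u
    using adm[OF that] by (simp add: admissible_transversal_def)
  have Lx: "(\<lambda>u. K (u, x)) ` {0..1} \<subseteq> lift_\<Lambda>" if "x \<in> {0..1}" "H (0, x) \<in> \<Lambda>" for x
  proof (rule image_subsetI)
    fix u :: real assume u: "u \<in> {0..1}"
    have "H (u, x) \<in> \<Lambda>" using pres[OF u that(1)] that(2) by blast
    moreover have "K (u, x) \<in> hyp_plane" "p (K (u, x)) = H (u, x)" using K(2,3) u that(1) by auto
    ultimately show "K (u, x) \<in> lift_\<Lambda>" by (simp add: lamination_lift_def)
  qed
  have "K (u0, x) \<in> lift_\<Lambda>" using Lx[OF x] u(1) by blast
  then obtain h where h: "leaf_lift h" "K (u0, x) \<in> range h" by (rule leaf_lift_through)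
  obtain \<Psi> where P: "geodesic_chart h \<Psi>" using geodesic_chart_exists h by (auto simp: leaf_lift_def)
  have hu: "K (u, x) \<in> range h"
    using path_in_lamination_stays[OF Kx(2)[OF u(1) x(1)] Lx[OF x] h(1) u(1) h(2) u(2)] .
  obtain e' where e': "e' = 1 \<or> e' = -1" "crossing p M \<Lambda> Or e' 0 1 (\<lambda>x. H (u, x)) x"
    using admissible_crossing[OF adm[OF u(2)] x(1)] pres[OF u(2) x(1)] x(2) by blast
  obtain \<delta> where d: "\<delta> > 0" "x + \<delta> \<le> 1" "\<And>\<tau>. x < \<tau> \<Longrightarrow> \<tau> \<le> x + \<delta> \<Longrightarrow> 0 < e * Im (\<Psi> (K (u0, \<tau>)))"
    by (rule crossing_side[OF c pl[OF u(1)] Hc[OF u(1)] h P e]) (rule that)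
  obtain \<delta>' where d': "\<delta>' > 0" "x + \<delta>' \<le> 1" "\<And>\<tau>. x < \<tau> \<Longrightarrow> \<tau> \<le> x + \<delta>' \<Longrightarrow> 0 < e' * Im (\<Psi> (K (u, \<tau>)))"
    by (rule crossing_side[OF e'(2) pl[OF u(2)] Hc[OF u(2)] h(1) hu P e'(1)]) (rule that)
  define y where "y = x + min \<delta> \<delta>'"
  have y: "x < y" "y \<le> x + \<delta>" "y \<le> x + \<delta>'" "y \<in> {0..1}" using d d' x by (auto simp: y_def)
  have pos: "0 < e * Im (\<Psi> (K (u0, y)))" "0 < e' * Im (\<Psi> (K (u, y)))" using d(3) d'(3) y by auto
  have KH: "K (w, y) \<in> hyp_plane" if "w \<in> {0..1}" for w using K(2) that y(4) by auto
  have nz: "Im (\<Psi> (K (w, y))) \<noteq> 0" if w: "w \<in> {0..1}" for w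
  proof
    assume "Im (\<Psi> (K (w, y))) = 0"
    then have wh: "K (w, y) \<in> range h" using P KH[OF w] by (simp add: geodesic_chart_def)
    then obtain t where "K (w, y) = h t" by blast
    moreover have "p (K (w, y)) = H (w, y)" using K(3) w y(4) by simp
    ultimately have "H (w, y) \<in> \<Lambda>" using leaf_lift_in(2)[OF h(1), of t] by simp
    then have "H (0, y) \<in> \<Lambda>" using pres[OF w y(4)] by simp
    then have "K (u0, y) \<in> range h"
      using path_in_lamination_stays[OF Kx(2)[OF u(1) y(4)] Lx[OF y(4)] h(1) w wh u(1)] by simp
    then have "Im (\<Psi> (K (u0, y))) = 0" using P by (auto simp: geodesic_chart_def)
    then show False using pos(1) by simp
  qed
  have hol: "continuous_on hyp_plane \<Psi>" using P holomorphic_on_imp_continuous_on by (auto simp: geodesic_chart_def)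
  have "continuous_on {0..1} (\<lambda>w. \<Psi> (K (w, y)))"
    by (rule continuous_on_compose2[OF hol Kx(2)[OF u(1) y(4)]]) (use KH in auto)
  then have cI: "continuous_on {0..1} (\<lambda>w. Im (\<Psi> (K (w, y))))" by (intro continuous_intros)
  have "0 < Im (\<Psi> (K (u0, y))) \<longleftrightarrow> 0 < Im (\<Psi> (K (u, y)))"
    by (rule connected_real_nonzero_sgn[OF _ cI nz u]) auto
  then have "e' = e" using pos e e'(1) by (auto simp: zero_less_mult_iff)
  then show ?thesis using e'(2) by simp
qed

end

section \<open>Reparametrisation and subdivision of transversals\<close>

lemma transverse_coord_cong: "f \<tau> = f' \<tau>' \<Longrightarrow> transverse_coord B f \<tau> = transverse_coord B f' \<tau>'"
  by (simp add: transverse_coord_def)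

lemma affine_image_interval:
  fixes d :: real
  assumes "d \<noteq> 0"
  shows "x \<in> {k - \<eta> / \<bar>d\<bar>..k + \<eta> / \<bar>d\<bar>} \<longleftrightarrow> c + d * x \<in> {c + d * k - \<eta>..c + d * k + \<eta>}"
proof -
  have "x \<in> {k - \<eta> / \<bar>d\<bar>..k + \<eta> / \<bar>d\<bar>} \<longleftrightarrow> \<bar>x - k\<bar> \<le> \<eta> / \<bar>d\<bar>" by (auto simp: abs_le_iff)
  also have "\<dots> \<longleftrightarrow> \<bar>d\<bar> * \<bar>x - k\<bar> \<le> \<eta>" using assms by (simp add: field_simps)
  also have "\<bar>d\<bar> * \<bar>x - k\<bar> = \<bar>(c + d * x) - (c + d * k)\<bar>"
    by (simp add: abs_mult[symmetric] algebra_simps)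
  finally show ?thesis by (auto simp: abs_le_iff)
qed

lemma crosses_box_affine:
  fixes d :: real
  assumes cr: "crosses_box B f I" and d: "d \<noteq> 0"
    and I: "\<And>x. x \<in> J \<longleftrightarrow> c + d * x \<in> I" and f: "\<And>x. x \<in> J \<Longrightarrow> f' x = f (c + d * x)"
  shows "crosses_box B f' J"
proof -
  obtain h where h: "homeomorphism I (transverse_coord B f ` I) (transverse_coord B f) h"
      and fI: "f ` I \<subseteq> chart B ` rect B" using cr by (auto simp: crosses_box_def)
  have T: "transverse_coord B f' x = transverse_coord B f (c + d * x)" if "x \<in> J" for x
    by (rule transverse_coord_cong) (rule f[OF that])
  have AI: "c + d * x \<in> I" if "x \<in> J" for x using I that by simp
  have "homeomorphism J (transverse_coord B f' ` J) (transverse_coord B f') (\<lambda>s. (h s - c) / d)"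
  proof (rule homeomorphismI)
    have "continuous_on I (transverse_coord B f)" using h by (simp add: homeomorphism_def)
    then have "continuous_on J (\<lambda>x. transverse_coord B f (c + d * x))"
      by (rule continuous_on_compose2) (use AI in \<open>auto intro!: continuous_intros\<close>)
    then show "continuous_on J (transverse_coord B f')" using T by (simp cong: continuous_on_cong)
    have "continuous_on (transverse_coord B f ` I) h" using h by (simp add: homeomorphism_def)
    then have "continuous_on (transverse_coord B f' ` J) h"
      by (rule continuous_on_subset) (use T AI in auto)
    then show "continuous_on (transverse_coord B f' ` J) (\<lambda>s. (h s - c) / d)"
      using d by (intro continuous_intros) auto
    have hT: "h (transverse_coord B f u) = u" if "u \<in> I" for u using h that by (simp add: homeomorphism_def)
    show inv: "(h (transverse_coord B f' x) - c) / d = x" if "x \<in> J" for x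
      using T[OF that] hT[OF AI[OF that]] d by simp
    then show "(\<lambda>s. (h s - c) / d) ` (transverse_coord B f' ` J) \<subseteq> J" by auto
    show "transverse_coord B f' ((h s - c) / d) = s" if "s \<in> transverse_coord B f' ` J" for s
      using that inv by auto
  qed auto
  moreover have "f' ` J \<subseteq> chart B ` rect B" using f AI fI by auto
  ultimately show ?thesis by (auto simp: crosses_box_def)
qed

text \<open>A decreasing change of parameter reverses the direction of the crossing, hence the
  factor \<open>sgn d\<close>.\<close>

lemma crossing_affine:
  fixes d :: real
  assumes cr: "crossing p M \<Lambda> Or e l m f (c + d * k)" and d: "d \<noteq> 0"
    and I: "\<And>x. x \<in> {l'..m'} \<longleftrightarrow> c + d * x \<in> {l..m}" and f: "\<And>x. x \<in> {l'..m'} \<Longrightarrow> f' x = f (c + d * x)"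
  shows "crossing p M \<Lambda> Or (sgn d * e) l' m' f' k"
proof -
  obtain B \<eta> where B: "\<eta> > 0" "oriented_flow_box p M \<Lambda> Or B" "f (c + d * k) \<in> chart B ` open_rect B"
      "{c + d * k - \<eta>..c + d * k + \<eta>} \<subseteq> {l..m}" "crosses_box B f {c + d * k - \<eta>..c + d * k + \<eta>}"
      "strict_mono_on {c + d * k - \<eta>..c + d * k + \<eta>} (\<lambda>\<tau>. e * transverse_coord B f \<tau>)"
    using cr unfolding crossing_def by blast
  define \<eta>' where "\<eta>' = \<eta> / \<bar>d\<bar>"
  have \<eta>': "\<eta>' > 0" using B(1) d by (simp add: \<eta>'_def)
  note J = affine_image_interval[OF d, of _ k \<eta> c, folded \<eta>'_def]
  have sub: "{k - \<eta>'..k + \<eta>'} \<subseteq> {l'..m'}" using J I B(4) by blast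
  have f': "f' x = f (c + d * x)" if "x \<in> {k - \<eta>'..k + \<eta>'}" for x using f sub that by blast
  have kk: "k \<in> {k - \<eta>'..k + \<eta>'}" using \<eta>' by simp
  have mono: "strict_mono_on {k - \<eta>'..k + \<eta>'} (\<lambda>\<tau>. sgn d * e * transverse_coord B f' \<tau>)"
  proof (rule monotone_onI)
    fix x y assume xy: "x \<in> {k - \<eta>'..k + \<eta>'}" "y \<in> {k - \<eta>'..k + \<eta>'}" "x < y"
    have T: "transverse_coord B f' z = transverse_coord B f (c + d * z)" if "z \<in> {k - \<eta>'..k + \<eta>'}" for z
      by (rule transverse_coord_cong) (rule f'[OF that])
    have Ax: "c + d * x \<in> {c + d * k - \<eta>..c + d * k + \<eta>}" "c + d * y \<in> {c + d * k - \<eta>..c + d * k + \<eta>}"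
      using J xy by blast+
    show "sgn d * e * transverse_coord B f' x < sgn d * e * transverse_coord B f' y"
    proof (cases "d > 0")
      case True
      then have "c + d * x < c + d * y" using xy(3) by simp
      from monotone_onD[OF B(6) Ax this] show ?thesis using True by (simp add: T[OF xy(1)] T[OF xy(2)])
    next
      case False
      then have "d < 0" using d by simp
      then have "c + d * y < c + d * x" using xy(3) by simp
      from monotone_onD[OF B(6) Ax(2) Ax(1) this] show ?thesis using \<open>d < 0\<close> by (simp add: T[OF xy(1)] T[OF xy(2)])
    qed
  qed
  have "crosses_box B f' {k - \<eta>'..k + \<eta>'}"
    by (rule crosses_box_affine[OF B(5) d J f'])
  then show ?thesis unfolding crossing_def using B(2,3) \<eta>' sub mono f'[OF kk] by auto
qed

text \<open>The end points are compared as a set, so that the same statement covers increasing and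
  decreasing changes of parameter.\<close>

lemma admissible_affine:
  fixes d :: real
  assumes adm: "admissible_transversal M \<Lambda> l m f" and d: "d \<noteq> 0"
    and I: "\<And>x. x \<in> {l'..m'} \<longleftrightarrow> c + d * x \<in> {l..m}" and f: "\<And>x. x \<in> {l'..m'} \<Longrightarrow> f' x = f (c + d * x)"
    and lm: "l' < m'" "{c + d * l', c + d * m'} = {l, m}"
  shows "admissible_transversal M \<Lambda> l' m' f'"
  unfolding admissible_transversal_def
proof (intro conjI ballI impI)
  have A: "c + d * x \<in> {l..m}" if "x \<in> {l'..m'}" for x using I that by blast
  have fc: "continuous_on {l..m} f" and fM: "f ` {l..m} \<subseteq> M" and off: "f l \<notin> \<Lambda>" "f m \<notin> \<Lambda>"
    using adm by (auto simp: admissible_transversal_def)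
  show "l' < m'" by (rule lm)
  have "continuous_on {l'..m'} (\<lambda>x. f (c + d * x))"
    by (rule continuous_on_compose2[OF fc]) (use A in \<open>auto intro!: continuous_intros\<close>)
  then show "continuous_on {l'..m'} f'" by (rule continuous_on_eq) (rule f[symmetric])
  show "f' ` {l'..m'} \<subseteq> M" using f A fM by auto
  have "c + d * l' = l \<or> c + d * l' = m" "c + d * m' = l \<or> c + d * m' = m" using lm(2) by auto
  then show "f' l' \<notin> \<Lambda>" "f' m' \<notin> \<Lambda>" using f[of l'] f[of m'] off lm(1) by auto
  fix k assume k: "k \<in> {l'..m'}" "f' k \<in> \<Lambda>"
  have "\<forall>k\<in>{l..m}. f k \<in> \<Lambda> \<longrightarrow> (\<exists>B. \<exists>\<eta>>0. flow_box M \<Lambda> B \<and> f k \<in> chart B ` open_rect B \<and>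
           {k - \<eta>..k + \<eta>} \<subseteq> {l..m} \<and> crosses_box B f {k - \<eta>..k + \<eta>})"
    using adm by (simp add: admissible_transversal_def)
  moreover have "f (c + d * k) \<in> \<Lambda>" using k f by simp
  ultimately obtain B \<eta> where B: "\<eta> > 0" "flow_box M \<Lambda> B" "f (c + d * k) \<in> chart B ` open_rect B"
      "{c + d * k - \<eta>..c + d * k + \<eta>} \<subseteq> {l..m}" "crosses_box B f {c + d * k - \<eta>..c + d * k + \<eta>}"
    using A[OF k(1)] by blast
  define \<eta>' where "\<eta>' = \<eta> / \<bar>d\<bar>"
  have \<eta>': "\<eta>' > 0" using B(1) d by (simp add: \<eta>'_def)
  note J = affine_image_interval[OF d, of _ k \<eta> c, folded \<eta>'_def]
  have sub: "{k - \<eta>'..k + \<eta>'} \<subseteq> {l'..m'}" using J I B(4) by blast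
  have f': "f' x = f (c + d * x)" if "x \<in> {k - \<eta>'..k + \<eta>'}" for x using f sub that by blast
  have "crosses_box B f' {k - \<eta>'..k + \<eta>'}" by (rule crosses_box_affine[OF B(5) d J f'])
  moreover have "f' k \<in> chart B ` open_rect B" using B(3) f k(1) by simp
  ultimately show "\<exists>B. \<exists>\<eta>>0. flow_box M \<Lambda> B \<and> f' k \<in> chart B ` open_rect B \<and>
           {k - \<eta>..k + \<eta>} \<subseteq> {l'..m'} \<and> crosses_box B f' {k - \<eta>..k + \<eta>}"
    using B(2) \<eta>' sub by blast
qed

lemma signed_affine:
  fixes d :: real
  assumes s: "signed_transverse p M \<Lambda> Or e l m f" and d: "d \<noteq> 0"
    and I: "\<And>x. x \<in> {l'..m'} \<longleftrightarrow> c + d * x \<in> {l..m}" and f: "\<And>x. x \<in> {l'..m'} \<Longrightarrow> f' x = f (c + d * x)"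
    and lm: "l' < m'" "{c + d * l', c + d * m'} = {l, m}"
  shows "signed_transverse p M \<Lambda> Or (sgn d * e) l' m' f'"
  unfolding signed_transverse_def
proof (intro conjI ballI impI)
  have adm: "admissible_transversal M \<Lambda> l m f" using s by (simp add: signed_transverse_def)
  show "admissible_transversal M \<Lambda> l' m' f'"
    by (rule admissible_affine[where f=f and l=l and m=m and c=c and d=d, OF adm d]) (erule f | rule I lm)+
  fix k assume k: "k \<in> {l'..m'}" "f' k \<in> \<Lambda>"
  then have "c + d * k \<in> {l..m}" "f (c + d * k) \<in> \<Lambda>" using I f by auto
  then have "crossing p M \<Lambda> Or e l m f (c + d * k)" using s by (simp add: signed_transverse_def)
  then show "crossing p M \<Lambda> Or (sgn d * e) l' m' f' k"
    by (rule crossing_affine[where f=f and l=l and m=m and c=c and d=d, OF _ d]) (erule f | rule I)+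
qed

context oriented_lamination
begin

lemma admissibleD:
  assumes "admissible_transversal M \<Lambda> l m f"
  shows "l < m" "continuous_on {l..m} f" "f ` {l..m} \<subseteq> M" "f l \<notin> \<Lambda>" "f m \<notin> \<Lambda>"
  using assms by (auto simp: admissible_transversal_def)

lemma crosses_subinterval:
  assumes "{k - \<eta>..k + \<eta>} \<subseteq> {l..m}" "crosses_box B f {k - \<eta>..k + \<eta>}" "\<eta> > (0::real)" "a < k" "k < b"
  obtains \<eta>' where "0 < \<eta>'" "\<eta>' \<le> \<eta>" "{k - \<eta>'..k + \<eta>'} \<subseteq> {a..b}" "crosses_box B f {k - \<eta>'..k + \<eta>'}"
proof (rule that[of "min \<eta> (min (k - a) (b - k))"])
  show "crosses_box B f {k - min \<eta> (min (k - a) (b - k))..k + min \<eta> (min (k - a) (b - k))}"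
    by (rule crosses_box_subset[OF assms(2)]) auto
qed (use assms in auto)

text \<open>Crossing is a local notion, so \<open>{a..b}\<close> may be any interval with
  \<open>k\<close> inside. The lemma thus also enlarges the domain, which is used to join pieces and
  to extend them to \<open>{0..1}\<close>.\<close>

lemma crossing_restrict:
  assumes c: "crossing p M \<Lambda> Or e l m f k" and ab: "a < k" "k < b"
  shows "crossing p M \<Lambda> Or e a b f k"
proof -
  obtain B \<eta> where B: "\<eta> > 0" "oriented_flow_box p M \<Lambda> Or B" "f k \<in> chart B ` open_rect B"
      "{k - \<eta>..k + \<eta>} \<subseteq> {l..m}" "crosses_box B f {k - \<eta>..k + \<eta>}"
      "strict_mono_on {k - \<eta>..k + \<eta>} (\<lambda>\<tau>. e * transverse_coord B f \<tau>)"
    using c unfolding crossing_def by blast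
  obtain \<eta>' where h: "0 < \<eta>'" "\<eta>' \<le> \<eta>" "{k - \<eta>'..k + \<eta>'} \<subseteq> {a..b}" "crosses_box B f {k - \<eta>'..k + \<eta>'}"
    by (rule crosses_subinterval[OF B(4,5,1) ab]) (rule that)
  have "strict_mono_on {k - \<eta>'..k + \<eta>'} (\<lambda>\<tau>. e * transverse_coord B f \<tau>)"
    by (rule monotone_on_subset[OF B(6)]) (use h(2) in auto)
  then show ?thesis unfolding crossing_def using B(2,3) h by blast
qed

lemma off_lamination_interior:
  fixes a b k :: real
  assumes "f a \<notin> \<Lambda>" "f b \<notin> \<Lambda>" "k \<in> {a..b}" "f k \<in> \<Lambda>"
  shows "a < k" "k < b"
proof -
  have "a \<noteq> k" "k \<noteq> b" using assms by auto
  then show "a < k" "k < b" using assms(3) by auto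
qed

lemma admissible_restrict:
  assumes adm: "admissible_transversal M \<Lambda> l m f" and ab: "l \<le> a" "a < b" "b \<le> m" "f a \<notin> \<Lambda>" "f b \<notin> \<Lambda>"
  shows "admissible_transversal M \<Lambda> a b f"
  unfolding admissible_transversal_def
proof (intro conjI ballI impI)
  have sub: "{a..b} \<subseteq> {l..m}" using ab by auto
  show "continuous_on {a..b} f" using admissibleD(2)[OF adm] sub by (rule continuous_on_subset)
  show "f ` {a..b} \<subseteq> M" using admissibleD(3)[OF adm] sub by blast
  fix k assume k: "k \<in> {a..b}" "f k \<in> \<Lambda>"
  have "k \<in> {l..m}" using k sub by blast
  then have "\<exists>B. \<exists>\<eta>>0. flow_box M \<Lambda> B \<and> f k \<in> chart B ` open_rect B \<and>
           {k - \<eta>..k + \<eta>} \<subseteq> {l..m} \<and> crosses_box B f {k - \<eta>..k + \<eta>}"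
    using adm k(2) unfolding admissible_transversal_def by simp
  then obtain B \<eta> where B: "\<eta> > 0" "flow_box M \<Lambda> B" "f k \<in> chart B ` open_rect B"
      "{k - \<eta>..k + \<eta>} \<subseteq> {l..m}" "crosses_box B f {k - \<eta>..k + \<eta>}" by blast
  obtain \<eta>' where h: "0 < \<eta>'" "\<eta>' \<le> \<eta>" "{k - \<eta>'..k + \<eta>'} \<subseteq> {a..b}" "crosses_box B f {k - \<eta>'..k + \<eta>'}"
    by (rule crosses_subinterval[OF B(4,5,1) off_lamination_interior[OF ab(4,5) k]]) (rule that)
  then show "\<exists>B. \<exists>\<eta>>0. flow_box M \<Lambda> B \<and> f k \<in> chart B ` open_rect B \<and>
           {k - \<eta>..k + \<eta>} \<subseteq> {a..b} \<and> crosses_box B f {k - \<eta>..k + \<eta>}"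
    using B(2,3) by blast
qed (use ab in auto)

lemma signed_restrict:
  assumes s: "signed_transverse p M \<Lambda> Or e l m f" and ab: "l \<le> a" "a < b" "b \<le> m" "f a \<notin> \<Lambda>" "f b \<notin> \<Lambda>"
  shows "signed_transverse p M \<Lambda> Or e a b f"
  unfolding signed_transverse_def
proof (intro conjI ballI impI)
  show "admissible_transversal M \<Lambda> a b f"
    using admissible_restrict[OF _ ab] s by (simp add: signed_transverse_def)
  fix k assume k: "k \<in> {a..b}" "f k \<in> \<Lambda>"
  then have "crossing p M \<Lambda> Or e l m f k" using s ab by (simp add: signed_transverse_def)
  then show "crossing p M \<Lambda> Or e a b f k"
    by (rule crossing_restrict) (use off_lamination_interior[OF ab(4,5) k] in auto)
qed

lemma signedD:
  assumes "signed_transverse p M \<Lambda> Or e l m f"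
  shows "admissible_transversal M \<Lambda> l m f" "l < m" "continuous_on {l..m} f" "f ` {l..m} \<subseteq> M" "f l \<notin> \<Lambda>" "f m \<notin> \<Lambda>"
  using assms by (auto simp: signed_transverse_def admissible_transversal_def)

lemma signed_join:
  assumes adm: "admissible_transversal M \<Lambda> l m f" and s: "signed_transverse p M \<Lambda> Or e a b f" "signed_transverse p M \<Lambda> Or e b c f"
    and lm: "l \<le> a" "c \<le> m"
  shows "signed_transverse p M \<Lambda> Or e a c f"
  unfolding signed_transverse_def
proof (intro conjI ballI impI)
  have ac: "a < c" "f a \<notin> \<Lambda>" "f c \<notin> \<Lambda>" using signedD[OF s(1)] signedD[OF s(2)] by auto
  show "admissible_transversal M \<Lambda> a c f" by (rule admissible_restrict[OF adm lm(1) ac(1) lm(2) ac(2,3)])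
  fix k assume k: "k \<in> {a..c}" "f k \<in> \<Lambda>"
  have "crossing p M \<Lambda> Or e a b f k \<or> crossing p M \<Lambda> Or e b c f k"
    using s k by (cases "k \<le> b") (auto simp: signed_transverse_def)
  then show "crossing p M \<Lambda> Or e a c f k"
    using crossing_restrict off_lamination_interior[OF ac(2,3) k] by blast
qed

lemma lamination_closed_preimage:
  assumes "continuous_on S f" "f ` S \<subseteq> M"
  shows "closedin (top_of_set S) {x\<in>S. f x \<in> \<Lambda>}"
proof -
  have "closedin (top_of_set M) \<Lambda>"
    using lamination by (simp add: oriented_geodesic_lamination_def geodesic_lamination_def)
  then have "closedin (top_of_set S) (S \<inter> f -` \<Lambda>)"
    using assms by (intro continuous_closedin_preimage_gen) auto
  moreover have "S \<inter> f -` \<Lambda> = {x\<in>S. f x \<in> \<Lambda>}" by auto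
  ultimately show ?thesis by simp
qed

section \<open>Existence of good subdivisions\<close>

text \<open>Every time has a neighbourhood in which all crossings have one sign. The Lebesgue number
  of this cover is a length below which every piece is signed.\<close>

lemma signed_locally:
  assumes adm: "admissible_transversal M \<Lambda> l m f"
  obtains \<delta> where "\<delta> > 0" "\<And>a b. l \<le> a \<Longrightarrow> a < b \<Longrightarrow> b \<le> m \<Longrightarrow> b - a < \<delta> \<Longrightarrow> f a \<notin> \<Lambda> \<Longrightarrow> f b \<notin> \<Lambda> \<Longrightarrow>
    \<exists>e. (e = 1 \<or> e = -1) \<and> signed_transverse p M \<Lambda> Or e a b f"
proof -
  note fa = admissibleD[OF adm]
  have loc: "\<exists>r>0. \<exists>e. (e = 1 \<or> e = -1) \<and> (\<forall>k'\<in>{l..m}. \<bar>k' - k\<bar> < r \<longrightarrow> f k' \<in> \<Lambda> \<longrightarrow> crossing p M \<Lambda> Or e l m f k')"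
    if k: "k \<in> {l..m}" for k
  proof (cases "f k \<in> \<Lambda>")
    case True
    obtain e where e: "e = 1 \<or> e = -1" "crossing p M \<Lambda> Or e l m f k"
      using admissible_crossing[OF adm k True] by blast
    obtain r where "r > 0" "\<And>k'. \<bar>k' - k\<bar> < r \<Longrightarrow> crossing p M \<Lambda> Or e l m f k'"
      by (rule crossing_open[OF fa(2) e(2)]) (rule that)
    then show ?thesis using e(1) by blast
  next
    case False
    have "openin (top_of_set {l..m}) ({l..m} - {x\<in>{l..m}. f x \<in> \<Lambda>})"
      using lamination_closed_preimage[OF fa(2,3)] by (simp add: openin_diff)
    then obtain r where "r > 0" "\<forall>x\<in>{l..m}. dist x k < r \<longrightarrow> x \<in> {l..m} - {x\<in>{l..m}. f x \<in> \<Lambda>}"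
      using k False unfolding openin_euclidean_subtopology_iff by blast
    \<comment> \<open>There is no crossing nearby, so the sign 1 is an arbitrary choice.\<close>
    then show ?thesis by (intro exI[of _ r] conjI exI[of _ 1]) (auto simp: dist_real_def)
  qed
  define \<C> where "\<C> = {ball k r | k r e. r > 0 \<and> k \<in> {l..m} \<and> (e = 1 \<or> e = -1) \<and>
      (\<forall>k'\<in>{l..m}. \<bar>k' - k\<bar> < r \<longrightarrow> f k' \<in> \<Lambda> \<longrightarrow> crossing p M \<Lambda> Or e l m f k')}"
  have cov: "{l..m} \<subseteq> \<Union>\<C>"
  proof
    fix k assume k: "k \<in> {l..m}"
    obtain r e where "r > 0" "e = 1 \<or> e = -1"
        "\<forall>k'\<in>{l..m}. \<bar>k' - k\<bar> < r \<longrightarrow> f k' \<in> \<Lambda> \<longrightarrow> crossing p M \<Lambda> Or e l m f k'" using loc[OF k] by blast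
    then have "ball k r \<in> \<C>" "k \<in> ball k r" using k unfolding \<C>_def by auto
    then show "k \<in> \<Union>\<C>" by blast
  qed
  have ne: "\<C> \<noteq> {}" using cov fa(1) by force
  have op: "open U" if "U \<in> \<C>" for U using that by (auto simp: \<C>_def)
  obtain \<delta> where d: "\<delta> > 0" "\<And>T. T \<subseteq> {l..m} \<Longrightarrow> diameter T < \<delta> \<Longrightarrow> \<exists>U\<in>\<C>. T \<subseteq> U"
    by (rule Lebesgue_number_lemma[OF _ ne cov op]) (auto intro: that)
  show thesis
  proof (rule that[OF d(1)])
    fix a b assume ab: "l \<le> a" "a < b" "b \<le> m" "b - a < \<delta>" "f a \<notin> \<Lambda>" "f b \<notin> \<Lambda>"
    have "{a..b} \<subseteq> {l..m}" "diameter {a..b} < \<delta>" using ab by auto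
    then obtain U where U: "U \<in> \<C>" "{a..b} \<subseteq> U" using d(2) by blast
    then obtain k r e where k: "U = ball k r" "e = 1 \<or> e = -1"
        "\<forall>k'\<in>{l..m}. \<bar>k' - k\<bar> < r \<longrightarrow> f k' \<in> \<Lambda> \<longrightarrow> crossing p M \<Lambda> Or e l m f k'" unfolding \<C>_def by blast
    have "signed_transverse p M \<Lambda> Or e a b f" unfolding signed_transverse_def
    proof (intro conjI ballI impI)
      show "admissible_transversal M \<Lambda> a b f" by (rule admissible_restrict[OF adm ab(1-3,5,6)])
      fix k' assume k': "k' \<in> {a..b}" "f k' \<in> \<Lambda>"
      have "k' \<in> ball k r" using U(2) k' k(1) by blast
      then have "\<bar>k' - k\<bar> < r" by (simp add: dist_real_def abs_minus_commute)
      then have "crossing p M \<Lambda> Or e l m f k'" using k(3) k' ab by auto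
      then show "crossing p M \<Lambda> Or e a b f k'"
        by (rule crossing_restrict) (use off_lamination_interior[OF ab(5,6) k'] in auto)
    qed
    then show "\<exists>e. (e = 1 \<or> e = -1) \<and> signed_transverse p M \<Lambda> Or e a b f" using k(2) by blast
  qed
qed

text \<open>Otherwise the path stays in the lamination for an interval of time, its slice coordinate
  is constant there, and this contradicts the homeomorphism onto the image. The lemma supplies the
  points at which a transversal may be cut.\<close>

lemma admissible_off_dense:
  assumes adm: "admissible_transversal M \<Lambda> l m f" and ab: "l \<le> a" "a < b" "b \<le> m"
  obtains s where "a < s" "s < b" "f s \<notin> \<Lambda>"
proof (rule ccontr)
  assume "\<not> thesis"
  then have all: "f s \<in> \<Lambda>" if "a < s" "s < b" for s using that \<open>\<And>s. a < s \<Longrightarrow> s < b \<Longrightarrow> f s \<notin> \<Lambda> \<Longrightarrow> thesis\<close> by blast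
  define k where "k = (a + b) / 2"
  have k: "a < k" "k < b" using ab by (auto simp: k_def)
  have "\<exists>B. \<exists>\<eta>>0. flow_box M \<Lambda> B \<and> f k \<in> chart B ` open_rect B \<and>
           {k - \<eta>..k + \<eta>} \<subseteq> {l..m} \<and> crosses_box B f {k - \<eta>..k + \<eta>}"
    using adm all[OF k] k ab by (simp add: admissible_transversal_def)
  then obtain B \<eta> where B: "\<eta> > 0" "flow_box M \<Lambda> B" "{k - \<eta>..k + \<eta>} \<subseteq> {l..m}" "crosses_box B f {k - \<eta>..k + \<eta>}" by blast
  obtain \<eta>' where h: "0 < \<eta>'" "\<eta>' \<le> \<eta>" "{k - \<eta>'..k + \<eta>'} \<subseteq> {(a + k) / 2..(k + b) / 2}" "crosses_box B f {k - \<eta>'..k + \<eta>'}"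
    by (rule crosses_subinterval[OF B(3,4,1), of "(a + k) / 2" "(k + b) / 2"]) (use k that in auto)
  define J where "J = {k - \<eta>'..k + \<eta>'}"
  obtain g where g: "homeomorphism J (transverse_coord B f ` J) (transverse_coord B f) g" "f ` J \<subseteq> chart B ` rect B"
    using h(4) by (auto simp: crosses_box_def J_def)
  have sl: "transverse_coord B f ` J \<subseteq> slice B"
  proof (rule image_subsetI)
    fix \<tau> assume t: "\<tau> \<in> J"
    then have "\<tau> \<in> {(a + k) / 2..(k + b) / 2}" using h(3) by (auto simp: J_def)
    then have "f \<tau> \<in> \<Lambda>" using all[of \<tau>] k by auto
    moreover obtain x where x: "x \<in> rect B" "f \<tau> = chart B x" using g(2) t by blast
    ultimately have "snd x \<in> slice B" using flow_box_leaf_iff[OF B(2), of "fst x" "snd x"] by simp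
    then show "transverse_coord B f \<tau> \<in> slice B" using transverse_coord_chart[where f=f and \<tau>=\<tau>, OF B(2) x] by simp
  qed
  have "transverse_coord B f (k - \<eta>') = transverse_coord B f (k + \<eta>')"
    by (rule negligible_real_connected_const[OF flow_box_slice_negligible[OF B(2)] _ _ sl])
      (use g(1) h(1) in \<open>auto simp: J_def homeomorphism_def\<close>)
  then have "g (transverse_coord B f (k - \<eta>')) = g (transverse_coord B f (k + \<eta>'))" by simp
  then have "k - \<eta>' = k + \<eta>'" using g(1) h(1) by (simp add: homeomorphism_def J_def)
  then show False using h(1) by simp
qed

lemma good_subdivision_single:
  assumes "signed_transverse p M \<Lambda> Or e l m f" "e = 1 \<or> e = -1"
  shows "\<exists>N x. good_subdivision p M \<Lambda> Or l m f N x"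
proof (intro exI)
  show "good_subdivision p M \<Lambda> Or l m f 1 (\<lambda>i. if i = 0 then l else m)"
    unfolding good_subdivision_def positively_transverse_iff negatively_transverse_iff
    using assms signedD[OF assms(1)]
    by (auto simp: le_Suc_eq intro!: exI[of _ "if e = 1 then 0 else Suc 0"])
qed

text \<open>Signs must go on alternating, so a new piece with the sign of the last one is merged
  with it, and only a piece of the opposite sign adds a subdivision point.\<close>

lemma good_subdivision_append:
  assumes adm: "admissible_transversal M \<Lambda> l m f" and g: "good_subdivision p M \<Lambda> Or l k f N x"
    and s: "signed_transverse p M \<Lambda> Or e k b f" "e = 1 \<or> e = -1" and b: "b \<le> m"
  shows "\<exists>N x. good_subdivision p M \<Lambda> Or l b f N x"
proof -
  obtain r where r: "\<And>i. i < N \<Longrightarrow> signed_transverse p M \<Lambda> Or (if even (i + r) then 1 else -1) (x i) (x (Suc i)) f"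
  proof -
    have "\<exists>r :: nat. \<forall>i<N. if even (i + r) then positively_transverse p M \<Lambda> Or (x i) (x (Suc i)) f
        else negatively_transverse p M \<Lambda> Or (x i) (x (Suc i)) f"
      using g by (simp add: good_subdivision_def)
    then obtain r where r: "\<forall>i<N. if even (i + r) then positively_transverse p M \<Lambda> Or (x i) (x (Suc i)) f
        else negatively_transverse p M \<Lambda> Or (x i) (x (Suc i)) f" by blast
    show thesis
    proof (rule that[of r])
      fix i assume "i < N"
      then show "signed_transverse p M \<Lambda> Or (if even (i + r) then 1 else -1) (x i) (x (Suc i)) f"
        using r by (auto simp: positively_transverse_iff negatively_transverse_iff split: if_splits)
    qed
  qed
  have x: "0 < N" "x 0 = l" "x N = k" "\<And>i. i < N \<Longrightarrow> x i < x (Suc i)" "\<And>i. i \<le> N \<Longrightarrow> f (x i) \<notin> \<Lambda>"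
    using g by (auto simp: good_subdivision_def)
  have kb: "k < b" "f b \<notin> \<Lambda>" using signedD[OF s(1)] by auto
  obtain n where n: "N = Suc n" using x(1) by (cases N) auto
  have xl: "l \<le> x i" if "i \<le> N" for i using that
  proof (induction i)
    case (Suc i)
    then show ?case using x(4)[of i] by simp
  qed (simp add: x)
  have good: "good_subdivision p M \<Lambda> Or l b f N' y"
    if "0 < N'" "y 0 = l" "y N' = b" "\<And>i. i \<le> N' \<Longrightarrow> f (y i) \<notin> \<Lambda>"
      "\<And>i. i < N' \<Longrightarrow> signed_transverse p M \<Lambda> Or (if even (i + r) then 1 else -1) (y i) (y (Suc i)) f" for N' y
    unfolding good_subdivision_def positively_transverse_iff negatively_transverse_iff
  proof (intro conjI allI impI exI[of _ r])
    show "y i < y (Suc i)" if "i < N'" for i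
      using signedD(2) \<open>\<And>i. i < N' \<Longrightarrow> signed_transverse p M \<Lambda> Or (if even (i + r) then 1 else -1) (y i) (y (Suc i)) f\<close>[OF that]
      by blast
    show "if even (i + r) then signed_transverse p M \<Lambda> Or 1 (y i) (y (Suc i)) f
        else signed_transverse p M \<Lambda> Or (- 1) (y i) (y (Suc i)) f" if "i < N'" for i
      using \<open>\<And>i. i < N' \<Longrightarrow> signed_transverse p M \<Lambda> Or (if even (i + r) then 1 else -1) (y i) (y (Suc i)) f\<close>[OF that]
      by (cases "even (i + r)") (simp_all only: if_True if_False)
  qed (use that in auto)
  show ?thesis
  proof (cases "e = (if even (n + r) then 1 else -1)")
    case True
    have "signed_transverse p M \<Lambda> Or e (x n) b f"
    proof (rule signed_join[OF adm])
      show "signed_transverse p M \<Lambda> Or e (x n) k f" using r[of n] x(3) n True by simp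
    qed (use s b xl[of n] n in auto)
    then have last: "signed_transverse p M \<Lambda> Or (if even (n + r) then 1 else -1) (x n) b f" unfolding True .
    have "good_subdivision p M \<Lambda> Or l b f N (x(N := b))"
    proof (rule good)
      show "f ((x(N := b)) i) \<notin> \<Lambda>" if "i \<le> N" for i using x(5)[OF that] kb(2) by simp
      show "signed_transverse p M \<Lambda> Or (if even (i + r) then 1 else -1) ((x(N := b)) i) ((x(N := b)) (Suc i)) f"
        if i: "i < N" for i
      proof (cases "i = n")
        case True
        then show ?thesis using last n by (simp del: even_add)
      next
        case False
        then have eq: "(x(N := b)) i = x i" "(x(N := b)) (Suc i) = x (Suc i)" using i n by auto
        show ?thesis unfolding eq by (rule r[OF i])
      qed
    qed (use x in auto)
    then show ?thesis by blast
  next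
    case False
    then have e: "e = (if even (N + r) then 1 else -1)" using s(2) n by (auto split: if_splits)
    have "good_subdivision p M \<Lambda> Or l b f (Suc N) (x(Suc N := b))"
    proof (rule good)
      show "f ((x(Suc N := b)) i) \<notin> \<Lambda>" if "i \<le> Suc N" for i
        using x(5)[of i] kb(2) that by (cases "i = Suc N") auto
      show "signed_transverse p M \<Lambda> Or (if even (i + r) then 1 else -1) ((x(Suc N := b)) i) ((x(Suc N := b)) (Suc i)) f"
        if i: "i < Suc N" for i
      proof (cases "i = N")
        case True
        then show ?thesis using s(1) e x(3) by (simp del: even_add)
      next
        case False
        then have eq: "(x(Suc N := b)) i = x i" "(x(Suc N := b)) (Suc i) = x (Suc i)" and "i < N" using i by auto
        show ?thesis unfolding eq by (rule r[OF \<open>i < N\<close>])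
      qed
    qed (use x in auto)
    then show ?thesis by blast
  qed
qed

text \<open>Induction on the length in units of \<open>\<delta> / 2\<close>. The cut is made off the
  lamination between \<open>t - \<delta>\<close> and \<open>t - \<delta> / 2\<close>, so the last
  piece is shorter than \<open>\<delta>\<close> and the rest is shorter by at least
  \<open>\<delta> / 2\<close>.\<close>

lemma good_subdivision_exists:
  assumes adm: "admissible_transversal M \<Lambda> l m f"
  shows "\<exists>N x. good_subdivision p M \<Lambda> Or l m f N x"
proof -
  obtain \<delta> where d: "\<delta> > 0" "\<And>a b. l \<le> a \<Longrightarrow> a < b \<Longrightarrow> b \<le> m \<Longrightarrow> b - a < \<delta> \<Longrightarrow> f a \<notin> \<Lambda> \<Longrightarrow> f b \<notin> \<Lambda> \<Longrightarrow>
    \<exists>e. (e = 1 \<or> e = -1) \<and> signed_transverse p M \<Lambda> Or e a b f"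
    by (rule signed_locally[OF adm]) (rule that)
  note fa = admissibleD[OF adm]
  have "\<exists>N x. good_subdivision p M \<Lambda> Or l t f N x"
    if "l < t" "t \<le> m" "f t \<notin> \<Lambda>" "t - l < real (Suc n) * (\<delta> / 2)" for n t
    using that
  proof (induction n arbitrary: t)
    case 0
    then obtain e where "e = 1 \<or> e = -1" "signed_transverse p M \<Lambda> Or e l t f"
      using d(2)[of l t] d(1) fa(4) by auto
    then show ?case using good_subdivision_single by blast
  next
    case (Suc n)
    show ?case
    proof (cases "t - l < \<delta>")
      case True
      then obtain e where "e = 1 \<or> e = -1" "signed_transverse p M \<Lambda> Or e l t f"
        using d(2)[of l t] Suc fa(4) by auto
      then show ?thesis using good_subdivision_single by blast
    next
      case False
      obtain s where s: "t - \<delta> < s" "s < t - \<delta> / 2" "f s \<notin> \<Lambda>"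
        by (rule admissible_off_dense[OF adm, of "t - \<delta>" "t - \<delta> / 2"]) (use False Suc.prems d(1) that in auto)
      have "s - l < real (Suc n) * (\<delta> / 2)" using Suc.prems(4) s(2) by (simp add: algebra_simps)
      then obtain N x where N: "good_subdivision p M \<Lambda> Or l s f N x"
        using Suc.IH[of s] s False Suc.prems d(1) by auto
      obtain e where e: "e = 1 \<or> e = -1" "signed_transverse p M \<Lambda> Or e s t f"
        using d(2)[of s t] s False Suc.prems d(1) by auto
      show ?thesis by (rule good_subdivision_append[OF adm N e(2,1) Suc.prems(2)])
    qed
  qed
  moreover obtain n where "m - l < real n * (\<delta> / 2)" using reals_Archimedean3[of "\<delta> / 2"] d(1) half_gt_zero by blast
  then have "m - l < real (Suc n) * (\<delta> / 2)" using d(1) by (simp add: algebra_simps)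
  ultimately show ?thesis using fa by blast
qed

end

section \<open>The cocycle of an equivariant function\<close>

locale plaque_function = oriented_lamination p M \<Lambda> Or
  for p :: "complex \<Rightarrow> 'm::metric_space" and M \<Lambda> Or +
  fixes v :: "complex \<Rightarrow> real" and \<alpha> :: "(complex \<Rightarrow> complex) \<Rightarrow> real"
  assumes equivariant: "\<forall>\<gamma>\<in>deck_group p. \<forall>z\<in>hyp_plane. v (\<gamma> z) = v z + \<alpha> \<gamma>"
    and plaque_constant: "\<forall>S\<in>components (hyp_plane - lamination_lift p \<Lambda>). v constant_on S"
begin

lemma v_connected:
  assumes "connected S" "S \<subseteq> hyp_plane - lift_\<Lambda>" "x \<in> S" "y \<in> S"
  shows "v x = v y"
proof -
  let ?C = "connected_component_set (hyp_plane - lift_\<Lambda>) x"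
  have "?C \<in> components (hyp_plane - lift_\<Lambda>)" using assms(2,3) by (intro componentsI) auto
  moreover have "S \<subseteq> ?C" using assms by (intro connected_component_maximal) auto
  ultimately show ?thesis using plaque_constant assms(3,4) unfolding constant_on_def by (metis subsetD)
qed

lemma v_plaque: "x \<in> plaque p \<Lambda> z \<Longrightarrow> v x = v z"
  unfolding plaque_def
  by (rule v_connected[OF connected_connected_component connected_component_subset])
    (auto simp: connected_component_in(1) intro: connected_component_refl dest: connected_component_in)

section \<open>Jumps and chains of signed pieces\<close>

text \<open>The lift is an arbitrary choice: another one changes both values of \<open>v\<close> by
  the same constant \<open>\<alpha> \<gamma>\<close>, which cancels.\<close>

definition jump :: "real \<Rightarrow> real \<Rightarrow> (real \<Rightarrow> 'm) \<Rightarrow> real" where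
  "jump l m f = (let g = SOME g. path_lift p l m f g in v (g m) - v (g l))"

lemma jump_eq:
  assumes g: "path_lift p l m f g" and lm: "l \<le> m"
  shows "jump l m f = v (g m) - v (g l)"
proof -
  define g' where "g' = (SOME g. path_lift p l m f g)"
  have g': "path_lift p l m f g'" unfolding g'_def by (rule someI[of "path_lift p l m f", OF g])
  obtain \<gamma> where c: "\<gamma> \<in> deck_group p" "\<And>x. x \<in> {l..m} \<Longrightarrow> g' x = \<gamma> (g x)"
  proof (rule lifts_differ_by_deck[of "{l..m}" g g'])
    show "continuous_on {l..m} g" "continuous_on {l..m} g'" "g ` {l..m} \<subseteq> hyp_plane" "g' ` {l..m} \<subseteq> hyp_plane"
      "\<And>x. x \<in> {l..m} \<Longrightarrow> p (g x) = p (g' x)" using g g' by (auto simp: path_lift_def)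
  qed (use lm that in auto)
  have "g l \<in> hyp_plane" "g m \<in> hyp_plane" using g lm by (auto simp: path_lift_def)
  then have "v (g' m) = v (g m) + \<alpha> \<gamma>" "v (g' l) = v (g l) + \<alpha> \<gamma>" using equivariant c lm by auto
  then show ?thesis unfolding jump_def g'_def[symmetric] by (simp add: Let_def)
qed

lemma path_lift_subset: "path_lift p l m f g \<Longrightarrow> l \<le> a \<Longrightarrow> b \<le> m \<Longrightarrow> path_lift p a b f g"
  unfolding path_lift_def by (auto intro: continuous_on_subset)

lemma jump_add:
  assumes "continuous_on {l..m} f" "f ` {l..m} \<subseteq> M" "l \<le> k" "k \<le> m"
  shows "jump l m f = jump l k f + jump k m f"
proof -
  obtain g where g: "path_lift p l m f g" by (rule path_lift_exists[OF assms(1,2)])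
  show ?thesis
    using jump_eq[OF g] jump_eq[OF path_lift_subset[OF g, of l k]] jump_eq[OF path_lift_subset[OF g, of k m]] assms(3,4)
    by simp
qed

lemma jump_off:
  assumes f: "continuous_on {l..m} f" "f ` {l..m} \<subseteq> M" and off: "\<And>k. k \<in> {l..m} \<Longrightarrow> f k \<notin> \<Lambda>" and lm: "l \<le> m"
  shows "jump l m f = 0"
proof -
  obtain g where g: "path_lift p l m f g" by (rule path_lift_exists[OF f])
  have "g ` {l..m} \<subseteq> hyp_plane - lift_\<Lambda>"
    using g off by (auto simp: path_lift_def lamination_lift_def)
  moreover have "connected (g ` {l..m})" using g by (intro connected_continuous_image) (auto simp: path_lift_def)
  ultimately have "v (g m) = v (g l)" using v_connected[of "g ` {l..m}"] lm by auto
  then show ?thesis using jump_eq[OF g lm] by simp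
qed

text \<open>A piece with both signs cannot cross the lamination, since crossings have only one sign.
  Its lift then stays in one plaque and the jump vanishes.\<close>

lemma signed_jump_unique:
  assumes s: "signed_transverse p M \<Lambda> Or e l m f" "signed_transverse p M \<Lambda> Or e' l m f"
    and e: "e = 1 \<or> e = -1" "e' = 1 \<or> e' = -1"
  shows "e * jump l m f = e' * jump l m f"
proof (cases "e = e'")
  case False
  note d = signedD[OF s(1)]
  have "jump l m f = 0"
  proof (rule jump_off[OF d(3,4)])
    fix k assume k: "k \<in> {l..m}"
    show "f k \<notin> \<Lambda>"
    proof
      assume "f k \<in> \<Lambda>"
      then have "crossing p M \<Lambda> Or e l m f k" "crossing p M \<Lambda> Or e' l m f k"
        using s k by (auto simp: signed_transverse_def)
      then show False using crossing_sign_unique[OF _ _ d(3,4) \<open>f k \<in> \<Lambda>\<close> k e] False by blast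
    qed
  qed (use d in auto)
  then show ?thesis by simp
qed simp

text \<open>A subdivision into signed pieces without alternation, together with the sum
  \<open>S\<close> of the signed jumps. The number of pieces is kept for induction, and the empty
  chain has equal end points.\<close>

inductive chain :: "(real \<Rightarrow> 'm) \<Rightarrow> nat \<Rightarrow> real \<Rightarrow> real \<Rightarrow> real \<Rightarrow> bool" for f where
  chain_Nil: "chain f 0 a a 0"
| chain_Cons: "signed_transverse p M \<Lambda> Or e a k f \<Longrightarrow> e = 1 \<or> e = -1 \<Longrightarrow> chain f n k b S \<Longrightarrow>
    chain f (Suc n) a b (e * jump a k f + S)"

lemma chain_le: "chain f n a b S \<Longrightarrow> a \<le> b \<and> (n = 0 \<longleftrightarrow> a = b)"
  by (induction rule: chain.induct) (auto dest: signedD(2))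

lemma chain_append: "chain f n a b S \<Longrightarrow> chain f n' b c S' \<Longrightarrow> chain f (n + n') a c (S + S')"
proof (induction rule: chain.induct)
  case (chain_Cons e a k n b S)
  then have "chain f (Suc (n + n')) a c (e * jump a k f + (S + S'))" by (intro chain.chain_Cons) auto
  then show ?case by (simp add: add.assoc)
qed simp

lemma chain_single:
  assumes "signed_transverse p M \<Lambda> Or e a b f" "e = 1 \<or> e = -1"
  shows "chain f 1 a b (e * jump a b f)"
  using chain_Cons[OF assms chain_Nil] by simp

text \<open>Two subdivisions are compared by cutting the longer of the two first pieces.\<close>

lemma chain_unique:
  assumes "chain f n a b S" "chain f n' a b S'"
  shows "S = S'"
  using assms
proof (induction "n + n'" arbitrary: n n' a S S' rule: less_induct)
  case less
  have cut: "S = S'"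
    if c: "signed_transverse p M \<Lambda> Or e a k f" "e = 1 \<or> e = -1" "chain f n1 k b S1"
      "signed_transverse p M \<Lambda> Or e' a k' f" "e' = 1 \<or> e' = -1" "chain f n1' k' b S1'" "k < k'"
      "S = e * jump a k f + S1" "S' = e' * jump a k' f + S1'" "n1 + Suc n1' < n + n'"
    for e e' k k' n1 n1' S S' S1 S1'
  proof -
    note d = signedD[OF c(1)] and d' = signedD[OF c(4)]
    have 1: "signed_transverse p M \<Lambda> Or e' a k f" "signed_transverse p M \<Lambda> Or e' k k' f"
      using d d' c(7) by (auto intro!: signed_restrict[OF c(4)])
    \<comment> \<open>The longer piece is replaced by its remainder while the shorter one
      disappears, so the total number of pieces drops by one.\<close>
    have "chain f (Suc n1') k b (e' * jump k k' f + S1')" by (rule chain_Cons[OF 1(2) c(5,6)])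
    then have "S1 = e' * jump k k' f + S1'" using less.hyps[OF _ c(3)] c(10) by blast
    moreover have "jump a k' f = jump a k f + jump k k' f" using d d' c(7) by (intro jump_add) auto
    moreover have "e * jump a k f = e' * jump a k f" by (rule signed_jump_unique[OF c(1) 1(1) c(2,5)])
    ultimately show ?thesis using c(8,9) by (simp add: algebra_simps)
  qed
  from less.prems(1) show ?case
  proof cases
    case chain_Nil
    then have "n' = 0" using chain_le[OF less.prems(2)] by simp
    with less.prems(2) show ?thesis using chain_Nil by (auto elim: chain.cases)
  next
    case (chain_Cons e k n1 S1)
    note c1 = chain_Cons
    from less.prems(2) show ?thesis
    proof cases
      case chain_Nil
      then show ?thesis using chain_le[OF less.prems(1)] c1 by simp
    next
      case (chain_Cons e' k' n1' S1')
      note c2 = chain_Cons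
      consider "k < k'" | "k' < k" | "k = k'" by linarith
      then show ?thesis
      proof cases
        case 1
        then show ?thesis using cut[OF c1(3-5) c2(3-5) _ c1(2) c2(2)] c1(1) c2(1) by simp
      next
        case 2
        then show ?thesis using cut[OF c2(3-5) c1(3-5) _ c2(2) c1(2)] c1(1) c2(1) by simp
      next
        case 3
        have "S1 = S1'" using less.hyps[of n1 n1' k S1 S1'] c1 c2 3 by simp
        then show ?thesis using signed_jump_unique[of e a k f e'] c1 c2 3 by simp
      qed
    qed
  qed
qed

text \<open>The values \<open>\<nu> i\<close> enter only through the two sign rules, so the lemma
  applies both to a given solution of the rules and to the function that is constructed to satisfy
  them.\<close>

lemma good_subdivision_chain:
  assumes g: "good_subdivision p M \<Lambda> Or l m f N x"
    and pos: "\<And>i. i < N \<Longrightarrow> positively_transverse p M \<Lambda> Or (x i) (x (Suc i)) f \<Longrightarrow> \<nu> i = jump (x i) (x (Suc i)) f"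
    and neg: "\<And>i. i < N \<Longrightarrow> negatively_transverse p M \<Lambda> Or (x i) (x (Suc i)) f \<Longrightarrow> \<nu> i = - jump (x i) (x (Suc i)) f"
  shows "chain f N l m (\<Sum>i<N. \<nu> i)"
proof -
  have x: "x 0 = l" "x N = m" using g by (auto simp: good_subdivision_def)
  have piece: "\<exists>e. (e = 1 \<or> e = -1) \<and> signed_transverse p M \<Lambda> Or e (x i) (x (Suc i)) f \<and> \<nu> i = e * jump (x i) (x (Suc i)) f"
    if "i < N" for i
  proof -
    have "positively_transverse p M \<Lambda> Or (x i) (x (Suc i)) f \<or> negatively_transverse p M \<Lambda> Or (x i) (x (Suc i)) f"
      using g that unfolding good_subdivision_def by metis
    then show ?thesis
    proof
      assume "positively_transverse p M \<Lambda> Or (x i) (x (Suc i)) f"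
      then show ?thesis using pos[OF that] by (intro exI[of _ 1]) (simp add: positively_transverse_iff)
    next
      assume "negatively_transverse p M \<Lambda> Or (x i) (x (Suc i)) f"
      then show ?thesis using neg[OF that] by (intro exI[of _ "-1"]) (simp add: negatively_transverse_iff)
    qed
  qed
  have "chain f j l (x j) (\<Sum>i<j. \<nu> i)" if "j \<le> N" for j using that
  proof (induction j)
    case 0
    then show ?case using chain_Nil[of f l] x by simp
  next
    case (Suc j)
    then obtain e where e: "e = 1 \<or> e = -1" "signed_transverse p M \<Lambda> Or e (x j) (x (Suc j)) f" "\<nu> j = e * jump (x j) (x (Suc j)) f"
      using piece[of j] by auto
    have "chain f (j + 1) l (x (Suc j)) ((\<Sum>i<j. \<nu> i) + \<nu> j)"
      unfolding e(3) using Suc by (intro chain_append[OF _ chain_single[OF e(2,1)]]) simp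
    then show ?case by simp
  qed
  then show ?thesis using x by blast
qed

section \<open>The rules for the cocycle and their solution\<close>

lemma induced_signed:
  assumes ind: "induced_by p M \<Lambda> Or v \<nu>"
  shows "positively_transverse p M \<Lambda> Or l m f \<Longrightarrow> \<nu> l m f = jump l m f"
    and "negatively_transverse p M \<Lambda> Or l m f \<Longrightarrow> \<nu> l m f = - jump l m f"
proof -
  have lift: "\<exists>g. path_lift p l m f g \<and> g l \<in> plaque p \<Lambda> (g l) \<and> g m \<in> plaque p \<Lambda> (g m) \<and> jump l m f = v (g m) - v (g l)"
    if "admissible_transversal M \<Lambda> l m f"
  proof -
    note d = admissibleD[OF that]
    obtain g where g: "path_lift p l m f g" by (rule path_lift_exists[OF d(2,3)])
    have "g l \<in> hyp_plane - lift_\<Lambda>" "g m \<in> hyp_plane - lift_\<Lambda>"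
      using g d by (auto simp: path_lift_def lamination_lift_def)
    then show ?thesis using g jump_eq[OF g] d(1) by (auto simp: plaque_def connected_component_refl)
  qed
  show "\<nu> l m f = jump l m f" if "positively_transverse p M \<Lambda> Or l m f"
  proof -
    have "admissible_transversal M \<Lambda> l m f" using that by (simp add: positively_transverse_def)
    then obtain g where g: "path_lift p l m f g" "g l \<in> plaque p \<Lambda> (g l)" "g m \<in> plaque p \<Lambda> (g m)" "jump l m f = v (g m) - v (g l)"
      using lift by blast
    have "\<forall>l m f g. positively_transverse p M \<Lambda> Or l m f \<and> path_lift p l m f g \<longrightarrow>
        (\<forall>x\<in>plaque p \<Lambda> (g l). \<forall>y\<in>plaque p \<Lambda> (g m). \<nu> l m f = v y - v x)"
      using ind unfolding induced_by_def by (rule conjunct1)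
    then show ?thesis using that g by simp
  qed
  show "\<nu> l m f = - jump l m f" if "negatively_transverse p M \<Lambda> Or l m f"
  proof -
    have "admissible_transversal M \<Lambda> l m f" using that by (simp add: negatively_transverse_def)
    then obtain g where g: "path_lift p l m f g" "g l \<in> plaque p \<Lambda> (g l)" "g m \<in> plaque p \<Lambda> (g m)" "jump l m f = v (g m) - v (g l)"
      using lift by blast
    have "\<forall>l m f g. negatively_transverse p M \<Lambda> Or l m f \<and> path_lift p l m f g \<longrightarrow>
        (\<forall>x\<in>plaque p \<Lambda> (g l). \<forall>y\<in>plaque p \<Lambda> (g m). \<nu> l m f = - (v y - v x))"
      using conjunct2[OF ind[unfolded induced_by_def]] by (rule conjunct1)
    then show ?thesis using that g by simp
  qed
qed

text \<open>With \<open>chain_unique\<close> this determines every solution of the rules on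
  admissible transversals. The cocycle properties thus become statements about chains.\<close>

lemma induced_chain:
  assumes ind: "induced_by p M \<Lambda> Or v \<nu>" and adm: "admissible_transversal M \<Lambda> l m f"
  shows "\<exists>n. chain f n l m (\<nu> l m f)"
proof -
  obtain N x where g: "good_subdivision p M \<Lambda> Or l m f N x" using good_subdivision_exists[OF adm] by blast
  have "\<forall>l m f N x. admissible_transversal M \<Lambda> l m f \<and> good_subdivision p M \<Lambda> Or l m f N x \<longrightarrow>
        \<nu> l m f = (\<Sum>i<N. \<nu> (x i) (x (Suc i)) f)"
    using conjunct2[OF ind[unfolded induced_by_def]] by (rule conjunct2)
  then have "\<nu> l m f = (\<Sum>i<N. \<nu> (x i) (x (Suc i)) f)" using g adm by blast
  then show ?thesis using good_subdivision_chain[OF g, of "\<lambda>i. \<nu> (x i) (x (Suc i)) f"] induced_signed[OF ind] by auto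
qed

lemma induced_exists: "\<exists>\<nu>. induced_by p M \<Lambda> Or v \<nu>"
proof
  \<comment> \<open>Where no chain exists the description has an arbitrary value; each rule concerns
    a path that has a chain.\<close>
  define \<nu> where "\<nu> l m f = (THE S. \<exists>n. chain f n l m S)" for l m f
  have nu: "\<nu> l m f = S" if "chain f n l m S" for n l m f S
    unfolding \<nu>_def using that chain_unique by blast
  have pos: "\<nu> l m f = jump l m f" if "positively_transverse p M \<Lambda> Or l m f" for l m f
    using nu[OF chain_single[of 1 l m f]] that by (simp add: positively_transverse_iff)
  have neg: "\<nu> l m f = - jump l m f" if "negatively_transverse p M \<Lambda> Or l m f" for l m f
    using nu[OF chain_single[of "-1" l m f]] that by (simp add: negatively_transverse_iff)
  show "induced_by p M \<Lambda> Or v \<nu>" unfolding induced_by_def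
  proof (intro conjI allI impI ballI; (elim conjE)?)
    fix l m f g x y assume a: "positively_transverse p M \<Lambda> Or l m f" "path_lift p l m f g"
      "x \<in> plaque p \<Lambda> (g l)" "y \<in> plaque p \<Lambda> (g m)"
    have "l < m" using a(1) by (simp add: positively_transverse_def admissible_transversal_def)
    then show "\<nu> l m f = v y - v x" using pos[OF a(1)] jump_eq[OF a(2)] v_plaque a(3,4) by simp
  next
    fix l m f g x y assume a: "negatively_transverse p M \<Lambda> Or l m f" "path_lift p l m f g"
      "x \<in> plaque p \<Lambda> (g l)" "y \<in> plaque p \<Lambda> (g m)"
    have "l < m" using a(1) by (simp add: negatively_transverse_def admissible_transversal_def)
    then show "\<nu> l m f = - (v y - v x)" using neg[OF a(1)] jump_eq[OF a(2)] v_plaque a(3,4) by simp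
  next
    fix l m f N x assume "good_subdivision p M \<Lambda> Or l m f N x"
    then show "\<nu> l m f = (\<Sum>i<N. \<nu> (x i) (x (Suc i)) f)"
      by (intro nu[OF good_subdivision_chain[where x=x and \<nu>="\<lambda>i. \<nu> (x i) (x (Suc i)) f"]] pos neg)
  qed
qed

section \<open>Invariance under reparametrisation, reversal and homotopy\<close>

lemma jump_affine_pos:
  fixes d :: real
  assumes f: "continuous_on {c + d * a..c + d * b} f" "f ` {c + d * a..c + d * b} \<subseteq> M" and d: "d > 0" and ab: "a \<le> b"
    and f': "\<And>x. x \<in> {a..b} \<Longrightarrow> f' x = f (c + d * x)"
  shows "jump a b f' = jump (c + d * a) (c + d * b) f"
proof -
  obtain g where g: "path_lift p (c + d * a) (c + d * b) f g" by (rule path_lift_exists[OF f])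
  have A: "c + d * x \<in> {c + d * a..c + d * b}" if "x \<in> {a..b}" for x using that d by auto
  have gc: "continuous_on {c + d * a..c + d * b} g" using g by (simp add: path_lift_def)
  have "path_lift p a b f' (\<lambda>x. g (c + d * x))" unfolding path_lift_def
  proof (intro conjI ballI)
    show "continuous_on {a..b} (\<lambda>x. g (c + d * x))"
      by (rule continuous_on_compose2[OF gc]) (use A in \<open>auto intro!: continuous_intros\<close>)
  qed (use g A f' in \<open>auto simp: path_lift_def\<close>)
  then show ?thesis using jump_eq[OF g] jump_eq[of a b f' "\<lambda>x. g (c + d * x)"] ab d by simp
qed

lemma jump_reverse:
  fixes c :: real
  assumes f: "continuous_on {a..b} f" "f ` {a..b} \<subseteq> M" and ab: "a \<le> b"
  shows "jump (c - b) (c - a) (\<lambda>t. f (c - t)) = - jump a b f"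
proof -
  obtain g where g: "path_lift p a b f g" by (rule path_lift_exists[OF f])
  have gc: "continuous_on {a..b} g" using g by (simp add: path_lift_def)
  have "path_lift p (c - b) (c - a) (\<lambda>t. f (c - t)) (\<lambda>t. g (c - t))" unfolding path_lift_def
  proof (intro conjI ballI)
    show "continuous_on {c - b..c - a} (\<lambda>t. g (c - t))"
      by (rule continuous_on_compose2[OF gc]) (auto intro!: continuous_intros)
  qed (use g in \<open>auto simp: path_lift_def\<close>)
  then show ?thesis using jump_eq[OF g ab] jump_eq[of "c - b" "c - a" _ "\<lambda>t. g (c - t)"] ab by simp
qed

lemma chain_affine:
  fixes d :: real
  assumes "chain f n A B S" "d > 0" "A = c + d * a" "B = c + d * b" "\<And>x. x \<in> {a..b} \<Longrightarrow> f' x = f (c + d * x)"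
  shows "chain f' n a b S"
  using assms
proof (induction arbitrary: a rule: chain.induct)
  case (chain_Nil A)
  then show ?case using chain.chain_Nil by auto
next
  case (chain_Cons e A k n B S)
  note d = signedD[OF chain_Cons.hyps(1)]
  define k' where "k' = (k - c) / d"
  have k': "k = c + d * k'" using \<open>d > 0\<close> by (simp add: k'_def)
  have kB: "k \<le> B" using chain_le[OF chain_Cons.hyps(3)] by simp
  have ak: "a < k'" "k' \<le> b" using d(2) kB chain_Cons.prems(1-3) k' by (auto simp: )
  have f': "f' x = f (c + d * x)" if "x \<in> {a..k'}" for x using that ak chain_Cons.prems(4) by auto
  have "signed_transverse p M \<Lambda> Or (sgn d * e) a k' f'"
    by (rule signed_affine[OF chain_Cons.hyps(1)]) (use chain_Cons.prems(1,2) k' ak f' in auto)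
  then have 1: "signed_transverse p M \<Lambda> Or e a k' f'" using chain_Cons.prems(1) by simp
  have 2: "chain f' n k' b S" using ak by (intro chain_Cons.IH chain_Cons.prems k') auto
  have "jump a k' f' = jump A k f" unfolding k' chain_Cons.prems(2)
    by (rule jump_affine_pos) (use d k' chain_Cons.prems ak f' in auto)
  then show ?case using chain.chain_Cons[OF 1 chain_Cons.hyps(2) 2] by simp
qed

text \<open>Reversal changes the sign of each crossing and the sign of each jump, so every summand
  is kept. The signs in the definition of the cocycle serve exactly this purpose.\<close>

lemma chain_reverse:
  assumes "chain f n a b S"
  shows "chain (\<lambda>t. f (c - t)) n (c - b) (c - a) S"
  using assms
proof (induction rule: chain.induct)
  case (chain_Nil a)
  then show ?case using chain.chain_Nil by auto
next
  case (chain_Cons e a k n b S)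
  note d = signedD[OF chain_Cons.hyps(1)]
  have "signed_transverse p M \<Lambda> Or (sgn (-1) * e) (c - k) (c - a) (\<lambda>t. f (c - t))"
    by (rule signed_affine[OF chain_Cons.hyps(1), where c=c]) (use d in auto)
  then have 1: "signed_transverse p M \<Lambda> Or (- e) (c - k) (c - a) (\<lambda>t. f (c - t))" by simp
  have "jump (c - k) (c - a) (\<lambda>t. f (c - t)) = - jump a k f" by (rule jump_reverse) (use d in auto)
  then have "chain (\<lambda>t. f (c - t)) 1 (c - k) (c - a) (e * jump a k f)"
    using chain_single[OF 1] chain_Cons.hyps(2) by auto
  from chain_append[OF chain_Cons.IH this] show ?case by (simp add: add.commute)
qed

text \<open>The same subdivision works for all stages. Its points stay off the lamination, so in a
  lift of the homotopy they move inside their plaques and the jumps do not change; the signs are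
  kept by \<open>crossing_homotopy\<close>.\<close>

lemma chain_homotopy:
  fixes H :: "real \<times> real \<Rightarrow> 'm"
  assumes H: "continuous_on ({0..1} \<times> {0..1}) H"
    and adm: "\<And>u. u \<in> {0..1} \<Longrightarrow> admissible_transversal M \<Lambda> 0 1 (\<lambda>x. H (u, x))"
    and pres: "\<And>u x. u \<in> {0..1} \<Longrightarrow> x \<in> {0..1} \<Longrightarrow> H (u, x) \<in> \<Lambda> \<longleftrightarrow> H (0, x) \<in> \<Lambda>"
    and ch: "chain (\<lambda>x. H (0, x)) n a b S" and ab: "0 \<le> a" "b \<le> 1"
  shows "chain (\<lambda>x. H (1, x)) n a b S"
proof -
  have HM: "H ` ({0..1} \<times> {0..1}) \<subseteq> M" using adm by (auto simp: admissible_transversal_def image_subset_iff)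
  have cs: "convex ({0..1::real} \<times> {0..1::real})" by (intro convex_Times) auto
  obtain K where K: "continuous_on ({0..1} \<times> {0..1}) K" "K ` ({0..1} \<times> {0..1}) \<subseteq> hyp_plane"
      "\<And>y. y \<in> {0..1} \<times> {0..1} \<Longrightarrow> p (K y) = H y"
    by (rule lift_exists[OF cs H HM]) (rule that)
  have pl: "path_lift p a b (\<lambda>x. H (u, x)) (\<lambda>x. K (u, x))" if "u \<in> {0..1}" "0 \<le> a" "b \<le> 1" for u a b
    unfolding path_lift_def
  proof (intro conjI ballI)
    show "continuous_on {a..b} (\<lambda>x. K (u, x))"
      by (rule continuous_on_compose2[OF K(1)]) (use that in \<open>auto intro!: continuous_intros\<close>)
  qed (use K(2,3) that in \<open>auto simp: image_subset_iff\<close>)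
  have end_const: "v (K (1, x)) = v (K (0, x))" if x: "x \<in> {0..1}" "H (0, x) \<notin> \<Lambda>" for x
  proof (rule v_connected[where S="(\<lambda>u. K (u, x)) ` {0..1}"])
    show "connected ((\<lambda>u. K (u, x)) ` {0..1})"
      by (intro connected_continuous_image continuous_on_compose2[OF K(1)]) (use x in \<open>auto intro!: continuous_intros\<close>)
    show "(\<lambda>u. K (u, x)) ` {0..1} \<subseteq> hyp_plane - lift_\<Lambda>"
    proof (rule image_subsetI)
      fix u :: real assume u: "u \<in> {0..1}"
      have "H (u, x) \<notin> \<Lambda>" using pres[OF u x(1)] x(2) by blast
      moreover have "K (u, x) \<in> hyp_plane" "p (K (u, x)) = H (u, x)" using K(2,3) u x(1) by auto
      ultimately show "K (u, x) \<in> hyp_plane - lift_\<Lambda>" by (simp add: lamination_lift_def)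
    qed
  qed auto
  show ?thesis using ch ab
  proof (induction rule: chain.induct)
    case (chain_Nil a)
    then show ?case using chain.chain_Nil by auto
  next
    case (chain_Cons e a k n b S)
    note d = signedD[OF chain_Cons.hyps(1)]
    have kb: "k \<le> b" using chain_le[OF chain_Cons.hyps(3)] by simp
    have k1: "k \<in> {0..1}" "a \<in> {0..1}" "k \<le> 1" using d(2) kb chain_Cons.prems by auto
    have off: "H (1, a) \<notin> \<Lambda>" "H (1, k) \<notin> \<Lambda>" using pres[of 1] d(5,6) k1 by auto
    have 1: "signed_transverse p M \<Lambda> Or e a k (\<lambda>x. H (1, x))" unfolding signed_transverse_def
    proof (intro conjI ballI impI)
      show "admissible_transversal M \<Lambda> a k (\<lambda>x. H (1, x))"
        by (rule admissible_restrict[OF adm[of 1] chain_Cons.prems(1) d(2) k1(3)]) (use off in auto)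
      fix x assume x: "x \<in> {a..k}" "H (1, x) \<in> \<Lambda>"
      have x01: "x \<in> {0..1}" using x(1) k1 by auto
      have x0: "H (0, x) \<in> \<Lambda>" using pres[OF _ x01, of 1] x(2) by simp
      have c0: "crossing p M \<Lambda> Or e a k (\<lambda>x. H (0, x)) x"
        using chain_Cons.hyps(1) x(1) x0 by (simp add: signed_transverse_def)
      have ax: "a < x" "x < k" using off_lamination_interior[of "\<lambda>x. H (1, x)", OF off x] by auto
      have c01: "crossing p M \<Lambda> Or e 0 1 (\<lambda>x. H (0, x)) x"
        by (rule crossing_restrict[OF c0]) (use ax k1 in auto)
      have "crossing p M \<Lambda> Or e 0 1 (\<lambda>x. H (1, x)) x"
        by (rule crossing_homotopy[OF H adm pres c01 chain_Cons.hyps(2) x01 x0]) auto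
      then show "crossing p M \<Lambda> Or e a k (\<lambda>x. H (1, x)) x" by (rule crossing_restrict) (use ax in auto)
    qed
    have "jump a k (\<lambda>x. H (1, x)) = v (K (1, k)) - v (K (1, a))"
      by (rule jump_eq[OF pl]) (use k1 chain_Cons.prems d(2) in auto)
    also have "\<dots> = v (K (0, k)) - v (K (0, a))" using end_const[of k] end_const[of a] k1 d(5,6) by simp
    also have "\<dots> = jump a k (\<lambda>x. H (0, x))"
      by (rule jump_eq[OF pl, symmetric]) (use k1 chain_Cons.prems d(2) in auto)
    finally have j: "jump a k (\<lambda>x. H (1, x)) = jump a k (\<lambda>x. H (0, x))" .
    have "chain (\<lambda>x. H (1, x)) n k b S" using chain_Cons.IH k1 chain_Cons.prems by simp
    from chain.chain_Cons[OF 1 chain_Cons.hyps(2) this] show ?case unfolding j .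
  qed
qed

lemma induced_transverse_cocycle:
  assumes ind: "induced_by p M \<Lambda> Or v \<nu>"
  shows "transverse_cocycle M \<Lambda> \<nu>"
  unfolding transverse_cocycle_def
proof (intro conjI allI impI; (elim conjE)?)
  fix l k m f assume a: "admissible_transversal M \<Lambda> l m f" "l < k" "k < m" "f k \<notin> \<Lambda>"
  have "admissible_transversal M \<Lambda> l k f" "admissible_transversal M \<Lambda> k m f"
    using a admissibleD[OF a(1)] by (auto intro!: admissible_restrict[OF a(1)])
  then obtain n n' where "chain f n l k (\<nu> l k f)" "chain f n' k m (\<nu> k m f)"
    using induced_chain[OF ind] by blast
  then have "chain f (n + n') l m (\<nu> l k f + \<nu> k m f)" by (rule chain_append)
  then show "\<nu> l m f = \<nu> l k f + \<nu> k m f" using induced_chain[OF ind a(1)] chain_unique by blast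
next
  fix l m f l' m' f'
  assume a: "admissible_transversal M \<Lambda> l m f" "admissible_transversal M \<Lambda> l' m' f'"
    and h: "transverse_homotopic M \<Lambda> l m f l' m' f'"
  obtain H :: "real \<times> real \<Rightarrow> 'm" where H: "continuous_on ({0..1} \<times> {0..1}) H"
      "\<forall>x\<in>{0..1}. H (0, x) = f (l + x * (m - l)) \<and> H (1, x) = f' (l' + x * (m' - l'))"
      "\<forall>u\<in>{0..1}. admissible_transversal M \<Lambda> 0 1 (\<lambda>x. H (u, x))"
      "\<forall>u\<in>{0..1}. \<forall>x\<in>{0..1}. H (u, x) \<in> \<Lambda> \<longleftrightarrow> H (0, x) \<in> \<Lambda>"
    using h unfolding transverse_homotopic_def by blast
  note d = admissibleD[OF a(1)] and d' = admissibleD[OF a(2)]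
  obtain n n' where n: "chain f n l m (\<nu> l m f)" "chain f' n' l' m' (\<nu> l' m' f')"
    using induced_chain[OF ind] a by blast
  have "chain (\<lambda>x. H (0, x)) n 0 1 (\<nu> l m f)"
    by (rule chain_affine[OF n(1), where c=l and d="m - l"]) (use d(1) H(2) in \<open>auto simp: mult.commute\<close>)
  then have "chain (\<lambda>x. H (1, x)) n 0 1 (\<nu> l m f)"
    using chain_homotopy[OF H(1) H(3)[rule_format] H(4)[rule_format]] by simp
  moreover have "chain (\<lambda>x. H (1, x)) n' 0 1 (\<nu> l' m' f')"
    by (rule chain_affine[OF n(2), where c=l' and d="m' - l'"]) (use d'(1) H(2) in \<open>auto simp: mult.commute\<close>)
  ultimately show "\<nu> l m f = \<nu> l' m' f'" by (rule chain_unique)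
next
  fix l m f assume a: "admissible_transversal M \<Lambda> l m f"
  note d = admissibleD[OF a]
  have a': "admissible_transversal M \<Lambda> l m (\<lambda>t. f (l + m - t))"
    by (rule admissible_affine[OF a, where c="l + m" and d="-1"]) (use d(1) in auto)
  obtain n n' where n: "chain f n l m (\<nu> l m f)" "chain (\<lambda>t. f (l + m - t)) n' l m (\<nu> l m (\<lambda>t. f (l + m - t)))"
    using induced_chain[OF ind] a a' by blast
  have "chain (\<lambda>t. f (l + m - t)) n l m (\<nu> l m f)"
    using chain_reverse[OF n(1), of "l + m"] by simp
  then show "\<nu> l m f = \<nu> l m (\<lambda>t. f (l + m - t))" using n(2) by (rule chain_unique)
qed

end

section \<open>Perimeter of convex sets and the layer cake decomposition\<close>

text \<open>The integral is a difference of two values of \<open>\<psi>\<close>. A bounded convex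
  set of reals may lack its end points, so it is first replaced by its closure, from which it
  differs by a null set.\<close>

lemma interval_derivative_integral_bound:
  fixes \<psi> g :: "real \<Rightarrow> real"
  assumes der: "\<And>x. (\<psi> has_real_derivative g x) (at x)" and bd: "\<And>x. \<bar>\<psi> x\<bar> \<le> 1"
    and I: "convex I" "bounded I"
  shows "\<bar>integral I g\<bar> \<le> 2"
proof (cases "I = {}")
  case False
  have "compact (closure I)" "connected (closure I)"
    using I by (auto simp: compact_closure convex_connected connected_imp_connected_closure)
  then obtain a b where ab: "closure I = {a..b}" using connected_compact_interval_1 by (metis box_real(2))
  have "a \<le> b" using ab False closure_eq_empty[of I] by (metis atLeastatMost_empty_iff)
  then have "(g has_integral \<psi> b - \<psi> a) {a..b}"
    using der by (intro fundamental_theorem_of_calculus)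
      (auto simp flip: has_real_derivative_iff_has_vector_derivative intro: has_field_derivative_at_within)
  then have 1: "integral (closure I) g = \<psi> b - \<psi> a" using ab by (simp add: integral_unique)
  have neg: "negligible (closure I - I)"
    using negligible_convex_frontier[OF I(1)] by (rule negligible_subset) (auto simp: frontier_def interior_subset[THEN subsetD])
  have "integral I g = integral (closure I) g"
  proof (rule integral_spike_set)
    show "negligible {x \<in> I - closure I. g x \<noteq> 0}" using closure_subset[of I] by (auto intro: negligible_subset[of "{}"])
    show "negligible {x \<in> closure I - I. g x \<noteq> 0}" by (rule negligible_subset[OF neg]) auto
  qed
  also have "\<dots> = \<psi> b - \<psi> a" by (rule 1)
  finally show ?thesis using bd[of a] bd[of b] by auto
qed simp

text \<open>This opens the complex plane to Fubini's theorem in the coordinates \<open>Re\<close>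
  and \<open>Im\<close>.\<close>

lemma lborel_complex: "(lborel :: complex measure) = distr (lborel \<Otimes>\<^sub>M lborel) borel (\<lambda>(x, y). Complex x y)"
proof (rule lborel_eqI)
  have m: "(\<lambda>(x, y). Complex x y) \<in> borel_measurable (lborel \<Otimes>\<^sub>M lborel)"
  proof -
    have "continuous_on UNIV (\<lambda>z :: real \<times> real. Complex (fst z) (snd z))"
      unfolding Complex_eq by (intro continuous_intros)
    then have "(\<lambda>z :: real \<times> real. Complex (fst z) (snd z)) \<in> borel_measurable borel"
      by (rule borel_measurable_continuous_onI)
    then show ?thesis by (simp add: lborel_prod case_prod_unfold)
  qed
  fix l u :: complex assume lu: "\<And>b. b \<in> Basis \<Longrightarrow> l \<bullet> b \<le> u \<bullet> b"
  have le: "Re l \<le> Re u" "Im l \<le> Im u" using lu[of 1] lu[of \<i>] by (auto simp: Basis_complex_def inner_complex_def)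
  have "emeasure (distr (lborel \<Otimes>\<^sub>M lborel) borel (\<lambda>(x, y). Complex x y)) (box l u) =
      emeasure (lborel \<Otimes>\<^sub>M lborel) ((\<lambda>(x, y). Complex x y) -` box l u \<inter> space (lborel \<Otimes>\<^sub>M lborel))"
    by (rule emeasure_distr[OF m]) simp
  also have "(\<lambda>(x, y). Complex x y) -` box l u \<inter> space (lborel \<Otimes>\<^sub>M lborel) = {Re l<..<Re u} \<times> {Im l<..<Im u}"
    by (auto simp: in_box_complex_iff space_pair_measure)
  also have "emeasure (lborel \<Otimes>\<^sub>M lborel) ({Re l<..<Re u} \<times> {Im l<..<Im u}) =
      emeasure lborel {Re l<..<Re u} * emeasure lborel {Im l<..<Im u}"
    by (rule lborel.emeasure_pair_measure_Times) auto
  also have "\<dots> = ennreal (\<Prod>b\<in>Basis. (u - l) \<bullet> b)"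
    using le by (simp add: Basis_complex_def inner_complex_def ennreal_mult)
  finally show "emeasure (distr (lborel \<Otimes>\<^sub>M lborel) borel (\<lambda>(x, y). Complex x y)) (box l u) = ennreal (\<Prod>b\<in>Basis. (u - l) \<bullet> b)" .
qed simp

lemma complex_integral_slice_bound:
  fixes F :: "complex \<Rightarrow> real"
  assumes F: "integrable lborel F" and cd: "c \<le> d"
    and sl: "(\<forall>y. \<bar>LINT x|lborel. F (Complex x y)\<bar> \<le> 2 * indicator {c..d} y) \<or>
      (\<forall>x. \<bar>LINT y|lborel. F (Complex x y)\<bar> \<le> 2 * indicator {c..d} x)"
  shows "\<bar>LINT z|lborel. F z\<bar> \<le> 2 * (d - c)"
proof -
  have m: "(\<lambda>(x, y). Complex x y) \<in> borel_measurable (lborel \<Otimes>\<^sub>M lborel)"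
  proof -
    have "continuous_on UNIV (\<lambda>z :: real \<times> real. Complex (fst z) (snd z))"
      unfolding Complex_eq by (intro continuous_intros)
    then have "(\<lambda>z :: real \<times> real. Complex (fst z) (snd z)) \<in> borel_measurable borel"
      by (rule borel_measurable_continuous_onI)
    then show ?thesis by (simp add: lborel_prod case_prod_unfold)
  qed
  have Fm: "F \<in> borel_measurable borel" using F by (simp add: borel_measurable_integrable)
  have int: "integrable (lborel \<Otimes>\<^sub>M lborel) (\<lambda>(x, y). F (Complex x y))"
    using F integrable_distr_eq[OF m Fm] lborel_complex by (simp add: case_prod_unfold)
  have eq: "(LINT z|lborel. F z) = (LINT z|(lborel \<Otimes>\<^sub>M lborel). (case z of (x, y) \<Rightarrow> F (Complex x y)))"
    using integral_distr[OF m Fm] lborel_complex by (simp add: case_prod_unfold)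
  have bound: "\<bar>LINT y|lborel. h y\<bar> \<le> 2 * (d - c)" if h: "\<And>y. \<bar>h y\<bar> \<le> 2 * indicator {c..d} y" for h :: "real \<Rightarrow> real"
  proof -
    have "\<bar>LINT y|lborel. h y\<bar> \<le> (LINT y|lborel. \<bar>h y\<bar>)" by (rule integral_abs_bound)
    also have "\<dots> \<le> (LINT y|lborel. 2 * indicator {c..d} y)"
    proof (rule integral_mono')
      have "integrable lborel (indicator {c..d} :: real \<Rightarrow> real)"
        using cd by (intro integrable_real_indicator) auto
      then show "integrable lborel (\<lambda>y. 2 * indicator {c..d} y :: real)" by simp
    qed (use h in auto)
    also have "\<dots> = 2 * (d - c)" using cd by simp
    finally show ?thesis .
  qed
  from sl show ?thesis
  proof
    assume "\<forall>y. \<bar>LINT x|lborel. F (Complex x y)\<bar> \<le> 2 * indicator {c..d} y"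
    then have "\<bar>LINT y|lborel. LINT x|lborel. F (Complex x y)\<bar> \<le> 2 * (d - c)" by (intro bound) blast
    then show ?thesis unfolding eq lborel_pair.integral_snd[OF int] .
  next
    assume "\<forall>x. \<bar>LINT y|lborel. F (Complex x y)\<bar> \<le> 2 * indicator {c..d} x"
    then have "\<bar>LINT x|lborel. LINT y|lborel. F (Complex x y)\<bar> \<le> 2 * (d - c)" by (intro bound) blast
    then show ?thesis unfolding eq lborel_pair.integral_fst[OF int] .
  qed
qed

section \<open>Integrals of derivatives over convex sets\<close>

text \<open>\<open>g\<close> is a partial derivative of \<open>\<psi>\<close> in one coordinate
  direction. The divergence of a test field is the sum of two such functions, one for each
  direction. The support is left free, because the integrals are cut along rectangles that do not
  respect it.\<close>

definition partial_test :: "(complex \<Rightarrow> real) \<Rightarrow> (complex \<Rightarrow> real) \<Rightarrow> bool" where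
  "partial_test \<psi> g \<longleftrightarrow> continuous_on UNIV g \<and> (\<forall>z. \<bar>\<psi> z\<bar> \<le> 1) \<and>
     ((\<forall>x y. ((\<lambda>x. \<psi> (Complex x y)) has_real_derivative g (Complex x y)) (at x)) \<or>
      (\<forall>x y. ((\<lambda>y. \<psi> (Complex x y)) has_real_derivative g (Complex x y)) (at y)))"

text \<open>Half the perimeter of the rectangle with opposite corners \<open>a\<close> and
  \<open>b\<close>. The absolute values keep it nonnegative when the rectangle is empty.\<close>

definition perim :: "complex \<Rightarrow> complex \<Rightarrow> real" where
  "perim a b = \<bar>Re b - Re a\<bar> + \<bar>Im b - Im a\<bar>"

lemma continuous_set_integrable:
  fixes g :: "complex \<Rightarrow> real"
  assumes "continuous_on UNIV g" "E \<in> sets borel" "E \<subseteq> cbox a b"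
  shows "set_integrable lborel E g"
proof -
  have "set_integrable lborel (cbox a b) g" unfolding set_integrable_def
    using assms(1) by (intro borel_integrable_compact) (auto intro: continuous_on_subset)
  then show ?thesis by (rule set_integrable_subset) (use assms in auto)
qed

lemma linear_slice_convex:
  assumes "convex E"
  shows "convex {x. Complex x y \<in> E}" "convex {y. Complex x y \<in> E}"
proof -
  have "u *\<^sub>R Complex x1 y + v *\<^sub>R Complex x2 y = Complex (u * x1 + v * x2) y" if "u + v = 1" for u v x1 x2 :: real
    using that by (simp add: complex_eq_iff flip: distrib_right)
  then show "convex {x. Complex x y \<in> E}" using assms unfolding convex_def by (auto; metis)
  have "u *\<^sub>R Complex x y1 + v *\<^sub>R Complex x y2 = Complex x (u * y1 + v * y2)" if "u + v = 1" for u v y1 y2 :: real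
    using that by (simp add: complex_eq_iff flip: distrib_right)
  then show "convex {y. Complex x y \<in> E}" using assms unfolding convex_def by (auto; metis)
qed

lemma slice_borel:
  assumes "E \<in> sets (borel :: complex measure)"
  shows "{x. Complex x y \<in> E} \<in> sets borel" "{y. Complex x y \<in> E} \<in> sets borel"
proof -
  have "(\<lambda>x. Complex x y) \<in> borel_measurable borel" "(\<lambda>y. Complex x y) \<in> borel_measurable borel"
    unfolding Complex_eq by (intro borel_measurable_continuous_onI continuous_intros)+
  from measurable_sets[OF this(1) assms] measurable_sets[OF this(2) assms]
  show "{x. Complex x y \<in> E} \<in> sets borel" "{y. Complex x y \<in> E} \<in> sets borel"
    by (simp_all add: vimage_def)
qed

lemma real_slice_integral_bound:
  fixes \<psi> g :: "real \<Rightarrow> real"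
  assumes der: "\<And>x. (\<psi> has_real_derivative g x) (at x)" and bd: "\<And>x. \<bar>\<psi> x\<bar> \<le> 1" and g: "continuous_on UNIV g"
    and I: "convex I" "I \<subseteq> {a..b}" "I \<in> sets borel"
  shows "\<bar>LINT x|lborel. indicator I x *\<^sub>R g x\<bar> \<le> 2"
proof -
  have "set_integrable lborel {a..b} g" unfolding set_integrable_def
    using g by (intro borel_integrable_compact) (auto intro: continuous_on_subset)
  then have "set_integrable lborel I g" by (rule set_integrable_subset) (use I in auto)
  from set_borel_integral_eq_integral(2)[OF this]
  have "(LINT x|lborel. indicator I x *\<^sub>R g x) = integral I g" by (simp add: set_lebesgue_integral_def)
  moreover have "bounded I" using I(2) bounded_closed_interval bounded_subset by blast
  ultimately show ?thesis using interval_derivative_integral_bound[OF der bd I(1)] by simp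
qed

text \<open>A line in the direction of the derivative meets a convex set in an interval and
  contributes at most 2. Integration over the parallel lines that meet the rectangle gives twice one
  of its sides.\<close>

lemma convex_perimeter_bound:
  assumes t: "partial_test \<psi> g" and E: "convex E" "E \<in> sets borel" "E \<subseteq> cbox a b"
  shows "\<bar>integral E g\<bar> \<le> 2 * perim a b"
proof (cases "E = {}")
  case False
  then have ab: "Re a \<le> Re b" "Im a \<le> Im b" using E(3) by (auto simp: in_cbox_complex_iff subset_iff ex_in_conv[symmetric])
  have g: "continuous_on UNIV g" and bd: "\<And>z. \<bar>\<psi> z\<bar> \<le> 1" using t by (auto simp: partial_test_def)
  define F where "F z = indicator E z *\<^sub>R g z" for z
  have si: "set_integrable lborel E g" by (rule continuous_set_integrable[OF g E(2,3)])
  then have F: "integrable lborel F" by (simp add: F_def[abs_def] set_integrable_def)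
  have eq: "integral E g = (LINT z|lborel. F z)"
    using set_borel_integral_eq_integral(2)[OF si] by (simp add: F_def set_lebesgue_integral_def)
  have gx: "continuous_on UNIV (\<lambda>x. g (Complex x y))" "continuous_on UNIV (\<lambda>y. g (Complex x y))" for x y
    unfolding Complex_eq by (intro continuous_on_compose2[OF g] continuous_intros subset_UNIV)+
  from t have "(\<forall>x y. ((\<lambda>x. \<psi> (Complex x y)) has_real_derivative g (Complex x y)) (at x)) \<or>
      (\<forall>x y. ((\<lambda>y. \<psi> (Complex x y)) has_real_derivative g (Complex x y)) (at y))" by (simp add: partial_test_def)
  then show ?thesis
  proof
    assume der: "\<forall>x y. ((\<lambda>x. \<psi> (Complex x y)) has_real_derivative g (Complex x y)) (at x)"
    have "\<bar>LINT x|lborel. F (Complex x y)\<bar> \<le> 2 * indicator {Im a..Im b} y" for y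
    proof (cases "y \<in> {Im a..Im b}")
      case True
      have "\<bar>LINT x|lborel. indicator {x. Complex x y \<in> E} x *\<^sub>R g (Complex x y)\<bar> \<le> 2"
      proof (rule real_slice_integral_bound[where \<psi>="\<lambda>x. \<psi> (Complex x y)" and a="Re a" and b="Re b"])
        show "{x. Complex x y \<in> E} \<subseteq> {Re a..Re b}" using E(3) by (auto simp: in_cbox_complex_iff)
      qed (use der bd gx linear_slice_convex[OF E(1)] slice_borel[OF E(2)] in auto)
      then show ?thesis using True by (simp add: F_def indicator_def)
    next
      case False
      then have "F (Complex x y) = 0" for x using E(3) by (auto simp: F_def indicator_def in_cbox_complex_iff)
      then show ?thesis by simp
    qed
    then have "\<bar>LINT z|lborel. F z\<bar> \<le> 2 * (Im b - Im a)"
      using complex_integral_slice_bound[OF F ab(2)] by blast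
    then show ?thesis using ab by (simp add: eq perim_def)
  next
    assume der: "\<forall>x y. ((\<lambda>y. \<psi> (Complex x y)) has_real_derivative g (Complex x y)) (at y)"
    have "\<bar>LINT y|lborel. F (Complex x y)\<bar> \<le> 2 * indicator {Re a..Re b} x" for x
    proof (cases "x \<in> {Re a..Re b}")
      case True
      have "\<bar>LINT y|lborel. indicator {y. Complex x y \<in> E} y *\<^sub>R g (Complex x y)\<bar> \<le> 2"
      proof (rule real_slice_integral_bound[where \<psi>="\<lambda>y. \<psi> (Complex x y)" and a="Im a" and b="Im b"])
        show "{y. Complex x y \<in> E} \<subseteq> {Im a..Im b}" using E(3) by (auto simp: in_cbox_complex_iff)
      qed (use der bd gx linear_slice_convex[OF E(1)] slice_borel[OF E(2)] in auto)
      then show ?thesis using True by (simp add: F_def indicator_def)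
    next
      case False
      then have "F (Complex x y) = 0" for y using E(3) by (auto simp: F_def indicator_def in_cbox_complex_iff)
      then show ?thesis by simp
    qed
    then have "\<bar>LINT z|lborel. F z\<bar> \<le> 2 * (Re b - Re a)"
      using complex_integral_slice_bound[OF F ab(1)] by blast
    then show ?thesis using ab by (simp add: eq perim_def)
  qed
qed (simp add: perim_def)

section \<open>Integration over levels\<close>

text \<open>The sum counts the positive integers up to \<open>u\<close>, so it is the integer part
  of \<open>u\<close>.\<close>

lemma staircase_approx:
  fixes u :: real
  assumes "0 \<le> u" "u \<le> real n"
  shows "\<bar>u - (\<Sum>j\<in>{1..n}. if real j \<le> u then 1 else 0)\<bar> \<le> 1"
proof -
  have "{j \<in> {1..n}. real j \<le> u} = {1..nat \<lfloor>u\<rfloor>}"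
    using assms by (auto simp: le_nat_floor nat_le_iff le_floor_iff) linarith+
  then have "(\<Sum>j\<in>{1..n}. if real j \<le> u then 1 else 0) = real (nat \<lfloor>u\<rfloor>)"
    by (simp flip: sum.inter_filter)
  also have "\<dots> = of_int \<lfloor>u\<rfloor>" using assms by simp
  finally show ?thesis using of_int_floor_le[of u] real_of_int_floor_add_one_gt[of u] by linarith
qed

text \<open>\<open>v\<close> is replaced by a staircase of \<open>n\<close> steps of height
  \<open>W / n\<close> above \<open>m0\<close>. The steps contribute at most \<open>W * K\<close>
  together. The ground level contributes at most \<open>\<bar>m0\<bar> * K\<close>, since
  \<open>Q\<close> itself is the superlevel set of \<open>m0\<close>. The error is of order
  \<open>W / n\<close> and disappears in the limit.\<close>

lemma layer_cake_bound:
  fixes v g :: "'a::euclidean_space \<Rightarrow> real"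
  assumes vg: "(\<lambda>z. v z * g z) integrable_on Q" and g: "g absolutely_integrable_on Q"
    and W: "W > 0" "\<And>z. z \<in> Q \<Longrightarrow> m0 \<le> v z" "\<And>z. z \<in> Q \<Longrightarrow> v z \<le> m0 + W"
    and meas: "\<And>c. {z\<in>Q. c \<le> v z} \<in> sets lebesgue"
    and K: "\<And>c. \<bar>integral {z\<in>Q. c \<le> v z} g\<bar> \<le> K"
  shows "\<bar>integral Q (\<lambda>z. v z * g z)\<bar> \<le> (\<bar>m0\<bar> + W) * K"
proof -
  define G where "G = integral Q (\<lambda>z. \<bar>g z\<bar>)"
  have gi: "g integrable_on Q" "(\<lambda>z. \<bar>g z\<bar>) integrable_on Q"
    using g by (auto simp: absolutely_integrable_on_def)
  have G0: "G \<ge> 0" unfolding G_def by (rule integral_nonneg[OF gi(2)]) simp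
  have main: "\<bar>integral Q (\<lambda>z. v z * g z)\<bar> \<le> (\<bar>m0\<bar> + W) * K + W * G / real n" if n: "n > 0" for n :: nat
  proof -
    define U where "U j = {z\<in>Q. m0 + real j * W / real n \<le> v z}" for j :: nat
    define vn where "vn z = m0 + W / real n * (\<Sum>j\<in>{1..n}. if z \<in> U j then 1 else 0)" for z
    have gU: "(\<lambda>z. if z \<in> U j then g z else 0) integrable_on Q" for j
    proof -
      have "g absolutely_integrable_on U j"
        by (rule set_integrable_subset[OF g]) (use meas in \<open>auto simp: U_def\<close>)
      then have "g integrable_on U j" by (simp add: absolutely_integrable_on_def)
      moreover have "U j \<subseteq> Q" by (auto simp: U_def)
      ultimately show ?thesis by (simp add: integrable_restrict_Int Int_absorb2)
    qed
    have iU: "integral Q (\<lambda>z. if z \<in> U j then g z else 0) = integral (U j) g" for j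
    proof -
      have "U j \<subseteq> Q" by (auto simp: U_def)
      then show ?thesis by (simp add: integral_restrict_Int Int_absorb2)
    qed
    have vng: "vn z * g z = m0 * g z + W / real n * (\<Sum>j\<in>{1..n}. if z \<in> U j then g z else 0)" for z
    proof -
      have "(\<Sum>j\<in>{1..n}. if z \<in> U j then 1 else 0) * g z = (\<Sum>j\<in>{1..n}. if z \<in> U j then g z else 0)"
        unfolding sum_distrib_right by (rule sum.cong) auto
      then show ?thesis by (simp add: vn_def distrib_right mult.assoc)
    qed
    have vni: "(\<lambda>z. vn z * g z) integrable_on Q" unfolding vng
      by (intro integrable_add integrable_on_mult_right integrable_sum gi gU) auto
    have "integral Q (\<lambda>z. vn z * g z) = m0 * integral Q g + W / real n * (\<Sum>j\<in>{1..n}. integral (U j) g)"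
    proof -
      have "integral Q (\<lambda>z. vn z * g z) = integral Q (\<lambda>z. m0 * g z) +
          integral Q (\<lambda>z. W / real n * (\<Sum>j\<in>{1..n}. if z \<in> U j then g z else 0))"
        unfolding vng by (intro integral_add integrable_on_mult_right integrable_sum gi gU) auto
      also have "integral Q (\<lambda>z. W / real n * (\<Sum>j\<in>{1..n}. if z \<in> U j then g z else 0)) =
          W / real n * (\<Sum>j\<in>{1..n}. integral Q (\<lambda>z. if z \<in> U j then g z else 0))"
        unfolding integral_mult_right by (subst integral_sum) (use gU in auto)
      finally show ?thesis by (simp add: iU)
    qed
    moreover have "\<bar>m0 * integral Q g\<bar> \<le> \<bar>m0\<bar> * K"
    proof -
      have "{z\<in>Q. m0 \<le> v z} = Q" using W(2) by auto
      then show ?thesis using K[of m0] by (simp add: abs_mult mult_left_mono)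
    qed
    moreover have "\<bar>W / real n * (\<Sum>j\<in>{1..n}. integral (U j) g)\<bar> \<le> W * K"
    proof -
      have "\<bar>\<Sum>j\<in>{1..n}. integral (U j) g\<bar> \<le> (\<Sum>j\<in>{1..n}. \<bar>integral (U j) g\<bar>)" by (rule sum_abs)
      also have "\<dots> \<le> (\<Sum>j\<in>{1..n}. K)" by (rule sum_mono) (use K in \<open>auto simp: U_def\<close>)
      finally have "\<bar>\<Sum>j\<in>{1..n}. integral (U j) g\<bar> \<le> real n * K" by simp
      then have "W / real n * \<bar>\<Sum>j\<in>{1..n}. integral (U j) g\<bar> \<le> W / real n * (real n * K)"
        using W(1) n by (intro mult_left_mono) auto
      then show ?thesis using W(1) n by (simp add: abs_mult)
    qed
    ultimately have 1: "\<bar>integral Q (\<lambda>z. vn z * g z)\<bar> \<le> (\<bar>m0\<bar> + W) * K"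
      unfolding distrib_right by linarith
    have approx: "\<bar>v z - vn z\<bar> \<le> W / real n" if z: "z \<in> Q" for z
    proof -
      define u where "u = (v z - m0) * real n / W"
      have "0 \<le> (v z - m0) * real n" using W(2)[OF z] by (intro mult_nonneg_nonneg) auto
      moreover have "(v z - m0) * real n \<le> W * real n" using W(3)[OF z] by (intro mult_right_mono) auto
      ultimately have u: "0 \<le> u" "u \<le> real n" using W(1) by (simp_all add: u_def pos_divide_le_eq mult.commute)
      have "z \<in> U j \<longleftrightarrow> real j \<le> u" for j using z n W(1) by (auto simp: U_def u_def field_simps)
      then have "vn z = m0 + W / real n * (\<Sum>j\<in>{1..n}. if real j \<le> u then 1 else 0)" by (simp add: vn_def)
      moreover have "v z = m0 + W / real n * u" using W(1) n by (simp add: u_def)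
      ultimately have "v z - vn z = W / real n * (u - (\<Sum>j\<in>{1..n}. if real j \<le> u then 1 else 0))"
        by (simp add: right_diff_distrib)
      then have "\<bar>v z - vn z\<bar> = W / real n * \<bar>u - (\<Sum>j\<in>{1..n}. if real j \<le> u then 1 else 0)\<bar>"
        using W(1) n by (simp add: abs_mult)
      also have "\<dots> \<le> W / real n * 1" using staircase_approx[OF u] W(1) n by (intro mult_left_mono) auto
      finally show ?thesis by simp
    qed
    have "norm (integral Q (\<lambda>z. v z * g z - vn z * g z)) \<le> integral Q (\<lambda>z. W / real n * \<bar>g z\<bar>)"
    proof (rule integral_norm_bound_integral)
      show "(\<lambda>z. v z * g z - vn z * g z) integrable_on Q" by (rule integrable_diff[OF vg vni])
      show "(\<lambda>z. W / real n * \<bar>g z\<bar>) integrable_on Q" by (rule integrable_on_mult_right[OF gi(2)])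
      show "norm (v z * g z - vn z * g z) \<le> W / real n * \<bar>g z\<bar>" if "z \<in> Q" for z
        using mult_right_mono[OF approx[OF that], of "\<bar>g z\<bar>"] by (simp add: abs_mult flip: left_diff_distrib)
    qed
    also have "\<dots> = W * G / real n" by (simp add: G_def)
    finally have "\<bar>integral Q (\<lambda>z. v z * g z) - integral Q (\<lambda>z. vn z * g z)\<bar> \<le> W * G / real n"
      using integral_diff[OF vg vni] by simp
    with 1 show ?thesis by linarith
  qed
  show ?thesis
  proof (rule field_le_epsilon)
    fix e :: real assume e: "e > 0"
    obtain n :: nat where n: "W * G / e < real n" using reals_Archimedean2 by blast
    have "0 \<le> W * G / e" using W(1) G0 e by simp
    then have n0: "n > 0" using n by (cases n) auto
    have "W * G / real n \<le> e" using n n0 e by (simp add: field_simps)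
    then show "\<bar>integral Q (\<lambda>z. v z * g z)\<bar> \<le> (\<bar>m0\<bar> + W) * K + e" using main[OF n0] by linarith
  qed
qed

lemma negligible_Times_real:
  fixes K :: "real set" and a b :: real
  assumes "closed K" "negligible K"
  shows "negligible ({a..b} \<times> K)"
proof -
  have K: "K \<in> sets borel" using assms(1) by simp
  have "emeasure lborel K = 0"
    using assms(2) K by (simp add: negligible_iff_null_sets null_sets_completion_iff null_setsD1)
  then have "emeasure (lborel \<Otimes>\<^sub>M lborel) ({a..b} \<times> K) = 0"
    using K by (subst lborel.emeasure_pair_measure_Times) auto
  then have "emeasure lborel ({a..b} \<times> K) = 0" by (simp add: lborel_prod)
  moreover have "{a..b} \<times> K \<in> sets borel" using assms(1) by (intro borel_closed closed_Times) auto
  ultimately have "{a..b} \<times> K \<in> null_sets lborel" by (intro null_setsI) auto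
  then show ?thesis by (simp add: negligible_iff_null_sets null_sets_completionI)
qed

section \<open>Bounded variation\<close>

context oriented_lamination
begin

lemma open_off_lamination: "open (hyp_plane - lift_\<Lambda>)"
proof -
  have "p ` hyp_plane \<subseteq> M" using p_image by blast
  then have "closedin (top_of_set hyp_plane) {x\<in>hyp_plane. p x \<in> \<Lambda>}"
    by (rule lamination_closed_preimage[OF continuous_on_p[OF order.refl]])
  then have "openin (top_of_set hyp_plane) (hyp_plane - lift_\<Lambda>)"
    by (simp add: lamination_lift_def openin_diff)
  then show ?thesis using open_hyp_plane openin_open_eq by blast
qed

text \<open>Locally the set is the image under a box lift of an interval times a slice, which is
  null. The box lift is locally Lipschitz, because the chart is Lipschitz and
  \<open>p_expanding_ball\<close> bounds distances in the plane by distances in \<open>M\<close>;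
  hence null sets stay null.\<close>

lemma negligible_lamination_lift: "negligible lift_\<Lambda>"
proof (rule locally_negligible_alt[THEN iffD2], rule ballI)
  fix z assume z: "z \<in> lift_\<Lambda>"
  then have zH: "z \<in> hyp_plane" "p z \<in> \<Lambda>" by (auto simp: lamination_lift_def)
  obtain B where B: "oriented_flow_box p M \<Lambda> Or B" "p z \<in> chart B ` open_rect B"
    using lamination zH(2) by (auto simp: oriented_geodesic_lamination_def)
  have fb: "flow_box M \<Lambda> B" using B(1) by (simp add: oriented_flow_box_def)
  obtain x0 where x0: "x0 \<in> open_rect B" "p z = chart B x0" using B(2) by blast
  have x0r: "x0 \<in> rect B" using x0 open_rect_subset by blast
  obtain G where G: "box_lift B G" "G x0 = z" by (rule box_lift_exists[OF fb x0r zH(1) x0(2)]) (rule that)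
  have G': "continuous_on (rect B) G" "\<And>x. x \<in> rect B \<Longrightarrow> G x \<in> hyp_plane" "\<And>x. x \<in> rect B \<Longrightarrow> p (G x) = chart B x"
    using G(1) by (auto simp: box_lift_def)
  obtain C where C: "C > 0" "\<And>x y. x \<in> rect B \<Longrightarrow> y \<in> rect B \<Longrightarrow> dist (chart B x) (chart B y) \<le> C * dist x y"
    by (rule flow_box_bilipschitz[OF fb]) (rule that)
  define S where "S = {tmin B..tmax B} \<times> slice B"
  have SR: "S \<subseteq> rect B" using flow_box_slice[OF fb] by (force simp: S_def rect_def)
  have nS: "negligible S" unfolding S_def
    using fb by (intro negligible_Times_real flow_box_slice_negligible[OF fb]) (simp add: flow_box_def)
  have "negligible (G ` S)"
  proof (rule negligible_locally_Lipschitz_image[OF _ nS])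
    fix x assume x: "x \<in> S"
    then have xr: "x \<in> rect B" using SR by blast
    obtain r c where rc: "r > 0" "c > 0" "\<And>z w. z \<in> ball (G x) r \<Longrightarrow> w \<in> ball (G x) r \<Longrightarrow> cmod (z - w) \<le> c * dist (p z) (p w)"
      by (rule p_expanding_ball[OF G'(2)[OF xr]]) (rule that)
    obtain d where d: "d > 0" "\<forall>y\<in>rect B. dist y x < d \<longrightarrow> dist (G y) (G x) < r"
      using G'(1) xr rc(1) unfolding continuous_on_iff by blast
    show "\<exists>T L. open T \<and> x \<in> T \<and> (\<forall>y\<in>S \<inter> T. norm (G y - G x) \<le> L * norm (y - x))"
    proof (intro exI[of _ "ball x d"] exI[of _ "c * C"] conjI ballI)
      fix y assume "y \<in> S \<inter> ball x d"
      then have y: "y \<in> rect B" "dist y x < d" using SR by (auto simp: dist_commute)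
      have "dist (G y) (G x) < r" using d(2) y by blast
      then have "G y \<in> ball (G x) r" by (simp add: dist_commute)
      then have "cmod (G y - G x) \<le> c * dist (p (G y)) (p (G x))" using rc by simp
      also have "\<dots> \<le> c * (C * dist y x)"
        unfolding G'(3)[OF y(1)] G'(3)[OF xr] using C(2)[OF y(1) xr] rc(2) by (intro mult_left_mono) auto
      finally show "norm (G y - G x) \<le> c * C * norm (y - x)" by (simp add: dist_norm mult.assoc)
    qed (use d in auto)
  qed simp
  moreover have "lift_\<Lambda> \<inter> G ` open_rect B \<subseteq> G ` S"
  proof
    fix w assume w: "w \<in> lift_\<Lambda> \<inter> G ` open_rect B"
    then obtain t s where ts: "(t, s) \<in> open_rect B" "w = G (t, s)" by auto
    then have "(t, s) \<in> rect B" using open_rect_subset by blast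
    then have "(t, s) \<in> S" using box_lift_leaf_iff[OF fb G(1), of t s] w ts by (auto simp: S_def rect_iff)
    then show "w \<in> G ` S" using ts by blast
  qed
  ultimately have "negligible (lift_\<Lambda> \<inter> G ` open_rect B)" using negligible_subset by blast
  moreover have "openin (top_of_set lift_\<Lambda>) (lift_\<Lambda> \<inter> G ` open_rect B)"
    using box_lift_open_map[OF fb G(1) open_open_rect order.refl] by (rule openin_open_Int)
  moreover have "z \<in> lift_\<Lambda> \<inter> G ` open_rect B" using z G(2) x0(1) by blast
  ultimately show "\<exists>U. openin (top_of_set lift_\<Lambda>) U \<and> z \<in> U \<and> negligible U" by blast
qed

text \<open>On a vertical line the transverse coordinate is the parameter itself. The whole line
  crosses a single box, which is the situation in which a transverse measure can be
  evaluated.\<close>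

lemma vertical_positively_transverse:
  assumes B: "oriented_flow_box p M \<Lambda> Or B" and t: "t \<in> {tmin B<..<tmax B}"
    and s: "smin B < s" "s < s'" "s' < smax B" "s \<notin> slice B" "s' \<notin> slice B"
  shows "positively_transverse p M \<Lambda> Or s s' (\<lambda>\<tau>. chart B (t, \<tau>))" "crosses_box B (\<lambda>\<tau>. chart B (t, \<tau>)) {s..s'}"
proof -
  define f where "f \<tau> = chart B (t, \<tau>)" for \<tau>
  have fb: "flow_box M \<Lambda> B" using B by (simp add: oriented_flow_box_def)
  have rc: "(t, \<tau>) \<in> rect B" "(t, \<tau>) \<in> open_rect B" if "\<tau> \<in> {s..s'}" for \<tau>
    using that t s by (auto simp: rect_iff open_rect_iff)
  have T: "transverse_coord B f \<tau> = \<tau>" if "\<tau> \<in> {s..s'}" for \<tau>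
    using transverse_coord_chart[where f=f and \<tau>=\<tau>, OF fb rc(1)[OF that]] by (simp add: f_def)
  have hom: "homeomorphism I (transverse_coord B f ` I) (transverse_coord B f) (\<lambda>x. x)" if I: "I \<subseteq> {s..s'}" for I
  proof (rule homeomorphismI)
    have "continuous_on I (\<lambda>x. x)" by (rule continuous_on_id)
    then show "continuous_on I (transverse_coord B f)"
      by (rule continuous_on_eq) (use T I in auto)
    show "continuous_on (transverse_coord B f ` I) (\<lambda>x. x)" by (rule continuous_on_id)
  qed (use T I in auto)
  have fr: "f ` I \<subseteq> chart B ` rect B" if "I \<subseteq> {s..s'}" for I
    using rc(1) that unfolding f_def by blast
  have cb: "crosses_box B f I" if "I \<subseteq> {s..s'}" for I
    unfolding crosses_box_def using fr[OF that] hom[OF that] by blast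
  have mono: "strict_mono_on I (transverse_coord B f)" if "I \<subseteq> {s..s'}" for I
    using T that by (auto simp: monotone_on_def subset_iff)
  have near: "\<exists>\<eta>>0. {k - \<eta>..k + \<eta>} \<subseteq> {s..s'}" if k: "k \<in> {s..s'}" "f k \<in> \<Lambda>" for k
  proof -
    have "k \<in> slice B" using flow_box_leaf_iff[OF fb rc(1)[OF k(1)]] k(2) by (simp add: f_def)
    then have "s < k" "k < s'" using k(1) s by (auto simp: order_le_less)
    then show ?thesis by (intro exI[of _ "min (k - s) (s' - k)"]) auto
  qed
  have fc: "continuous_on {s..s'} f" unfolding f_def
    by (rule continuous_on_compose2[OF flow_box_continuous[OF fb]]) (use rc in \<open>auto intro!: continuous_intros\<close>)
  have fM: "f ` {s..s'} \<subseteq> M" using fr[of "{s..s'}"] fb by (auto simp: flow_box_def)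
  have off: "f s \<notin> \<Lambda>" "f s' \<notin> \<Lambda>"
    using flow_box_leaf_iff[OF fb rc(1)] s by (auto simp: f_def)
  have fo: "f k \<in> chart B ` open_rect B" if "k \<in> {s..s'}" for k using rc(2)[OF that] by (auto simp: f_def)
  have adm: "admissible_transversal M \<Lambda> s s' f" unfolding admissible_transversal_def
  proof (intro conjI ballI impI)
    fix k assume k: "k \<in> {s..s'}" "f k \<in> \<Lambda>"
    obtain \<eta> where e: "\<eta> > 0" "{k - \<eta>..k + \<eta>} \<subseteq> {s..s'}" using near[OF k] by blast
    show "\<exists>B. \<exists>\<eta>>0. flow_box M \<Lambda> B \<and> f k \<in> chart B ` open_rect B \<and>
           {k - \<eta>..k + \<eta>} \<subseteq> {s..s'} \<and> crosses_box B f {k - \<eta>..k + \<eta>}"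
      using fb fo[OF k(1)] e cb[OF e(2)] by (intro exI[of _ B] exI[of _ \<eta>] conjI)
  qed (rule s(2) fc fM off)+
  have "positively_transverse p M \<Lambda> Or s s' f" unfolding positively_transverse_def
  proof (intro conjI ballI impI)
    fix k assume k: "k \<in> {s..s'}" "f k \<in> \<Lambda>"
    obtain \<eta> where e: "\<eta> > 0" "{k - \<eta>..k + \<eta>} \<subseteq> {s..s'}" using near[OF k] by blast
    show "\<exists>B. \<exists>\<eta>>0. oriented_flow_box p M \<Lambda> Or B \<and> f k \<in> chart B ` open_rect B \<and>
           {k - \<eta>..k + \<eta>} \<subseteq> {s..s'} \<and> crosses_box B f {k - \<eta>..k + \<eta>} \<and>
           strict_mono_on {k - \<eta>..k + \<eta>} (transverse_coord B f)"
      using B fo[OF k(1)] e cb[OF e(2)] mono[OF e(2)] by (intro exI[of _ B] exI[of _ \<eta>] conjI)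
  qed (rule adm)
  then show "positively_transverse p M \<Lambda> Or s s' (\<lambda>\<tau>. chart B (t, \<tau>))" by (simp add: f_def[abs_def])
  show "crosses_box B (\<lambda>\<tau>. chart B (t, \<tau>)) {s..s'}" using cb[OF order.refl] by (simp add: f_def[abs_def])
qed

end

context plaque_function
begin

section \<open>Superlevel sets as sides of leaves\<close>

text \<open>The description is up to null sets because the values of \<open>v\<close> on the
  lamination itself are not controlled. Only left sides occur, since \<open>v\<close> does not
  decrease from right to left across a leaf.\<close>

definition level_sides :: "complex set \<Rightarrow> bool" where
  "level_sides Q \<longleftrightarrow> (\<forall>c. \<exists>A. negligible ({z\<in>Q. c \<le> v z} - A) \<and> negligible (A - {z\<in>Q. c \<le> v z}) \<and>
     (A = {} \<or> A = Q \<or> (\<exists>h \<Psi>. leaf_lift h \<and> geodesic_chart h \<Psi> \<and> A = Q \<inter> {z\<in>hyp_plane. 0 < Im (\<Psi> z)})))"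

lemma v_continuous: "continuous_on (hyp_plane - lift_\<Lambda>) v"
proof -
  have loc: "\<exists>r>0. \<forall>y. dist y z < r \<longrightarrow> v y = v z" if z: "z \<in> hyp_plane - lift_\<Lambda>" for z
  proof -
    obtain r where r: "r > 0" "ball z r \<subseteq> hyp_plane - lift_\<Lambda>"
      using open_off_lamination z open_contains_ball by blast
    then have "v y = v z" if "dist y z < r" for y
      using that by (intro v_connected[of "ball z r"]) (auto simp: dist_commute)
    then show ?thesis using r(1) by blast
  qed
  show ?thesis unfolding continuous_on_iff
  proof (intro ballI allI impI)
    fix z and e :: real assume z: "z \<in> hyp_plane - lift_\<Lambda>" and e: "e > 0"
    from loc[OF z] obtain r where r: "r > 0" "\<forall>y. dist y z < r \<longrightarrow> v y = v z"
      by (elim exE conjE) (rule that)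
    have "dist (v y) (v z) < e" if "dist y z < r" for y
      using e by (subst r(2)[rule_format, OF that]) simp
    then show "\<exists>d>0. \<forall>y\<in>hyp_plane - lift_\<Lambda>. dist y z < d \<longrightarrow> dist (v y) (v z) < e"
      using r(1) by blast
  qed
qed

text \<open>The jump along the vertical is a measure, hence nonnegative. This monotonicity is all
  that the bounded variation argument takes from the transverse measure.\<close>

lemma vertical_monotone:
  assumes ind: "induced_by p M \<Lambda> Or v \<nu>" and tm: "is_transverse_measure M \<Lambda> \<nu>"
    and B: "oriented_flow_box p M \<Lambda> Or B" and G: "box_lift B G" and t: "t \<in> {tmin B<..<tmax B}"
    and s: "smin B < s" "s < s'" "s' < smax B" "s \<notin> slice B" "s' \<notin> slice B"
  shows "v (G (t, s)) \<le> v (G (t, s'))"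
proof -
  define f where "f \<tau> = chart B (t, \<tau>)" for \<tau>
  have fb: "flow_box M \<Lambda> B" using B by (simp add: oriented_flow_box_def)
  have pos: "positively_transverse p M \<Lambda> Or s s' f" and cb: "crosses_box B f {s..s'}"
    using vertical_positively_transverse[OF B t s] by (simp_all add: f_def[abs_def])
  have adm: "admissible_transversal M \<Lambda> s s' f" using pos by (simp add: positively_transverse_def)
  have rc: "(t, \<tau>) \<in> rect B" if "\<tau> \<in> {s..s'}" for \<tau> using that t s by (auto simp: rect_iff)
  have Gc: "continuous_on (rect B) G" using G by (simp add: box_lift_def)
  have "path_lift p s s' f (\<lambda>\<tau>. G (t, \<tau>))" unfolding path_lift_def
  proof (intro conjI ballI)
    show "continuous_on {s..s'} (\<lambda>\<tau>. G (t, \<tau>))"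
      by (rule continuous_on_compose2[OF Gc]) (use rc in \<open>auto intro!: continuous_intros\<close>)
    show "(\<lambda>\<tau>. G (t, \<tau>)) ` {s..s'} \<subseteq> hyp_plane" using G rc by (auto simp: box_lift_def)
    show "p (G (t, \<tau>)) = f \<tau>" if "\<tau> \<in> {s..s'}" for \<tau> using G rc[OF that] by (simp add: box_lift_def f_def)
  qed
  then have "jump s s' f = v (G (t, s')) - v (G (t, s))" using s(2) by (simp add: jump_eq)
  then have "\<nu> s s' f = v (G (t, s')) - v (G (t, s))" using induced_signed(1)[OF ind pos] by simp
  moreover obtain \<mu> where "\<forall>B l m f. flow_box M \<Lambda> B \<and> admissible_transversal M \<Lambda> l m f \<and> crosses_box B f {l..m} \<longrightarrow>
           \<nu> l m f = measure (\<mu> B) (transverse_coord B f ` {l..m})"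
    using tm unfolding is_transverse_measure_def by blast
  then have "\<nu> s s' f = measure (\<mu> B) (transverse_coord B f ` {s..s'})" using fb adm cb by blast
  ultimately show ?thesis using measure_nonneg[of "\<mu> B" "transverse_coord B f ` {s..s'}"] by linarith
qed

text \<open>Near a point of the lamination \<open>v\<close> is, off the lamination, a nondecreasing
  function of the slice coordinate alone. A level that is neither empty nor full has a threshold in
  the slice, and the leaf at the threshold bounds the level. The ball is taken inside the small
  square of \<open>oriented_box_sides\<close>, where the coordinate order is the order of
  sides.\<close>

lemma level_sides_local:
  assumes ind: "induced_by p M \<Lambda> Or v \<nu>" and tm: "is_transverse_measure M \<Lambda> \<nu>" and z0: "z0 \<in> hyp_plane"
  obtains r where "r > 0" "ball z0 r \<subseteq> hyp_plane" "\<And>Q. Q \<subseteq> ball z0 r \<Longrightarrow> level_sides Q"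
proof (cases "z0 \<in> lift_\<Lambda>")
  case False
  obtain r where r: "r > 0" "ball z0 r \<subseteq> hyp_plane - lift_\<Lambda>"
    using open_off_lamination z0 False open_contains_ball by blast
  show thesis
  proof (rule that[OF r(1)])
    show "ball z0 r \<subseteq> hyp_plane" using r by blast
    fix Q assume Q: "Q \<subseteq> ball z0 r"
    have vQ: "v z = v z0" if "z \<in> Q" for z
      using that Q r by (intro v_connected[of "ball z0 r"]) auto
    show "level_sides Q" unfolding level_sides_def
    proof
      fix c
      have "{z\<in>Q. c \<le> v z} = {} \<or> {z\<in>Q. c \<le> v z} = Q" using vQ by auto
      then show "\<exists>A. negligible ({z\<in>Q. c \<le> v z} - A) \<and> negligible (A - {z\<in>Q. c \<le> v z}) \<and>
        (A = {} \<or> A = Q \<or> (\<exists>h \<Psi>. leaf_lift h \<and> geodesic_chart h \<Psi> \<and> A = Q \<inter> {z\<in>hyp_plane. 0 < Im (\<Psi> z)}))"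
        by (intro exI[of _ "{z\<in>Q. c \<le> v z}"]) auto
    qed
  qed
next
  case True
  then have pz: "p z0 \<in> \<Lambda>" by (simp add: lamination_lift_def)
  obtain B where B: "oriented_flow_box p M \<Lambda> Or B" "p z0 \<in> chart B ` open_rect B"
    using lamination pz by (auto simp: oriented_geodesic_lamination_def)
  have fb: "flow_box M \<Lambda> B" using B(1) by (simp add: oriented_flow_box_def)
  obtain t0 s0 where x0: "(t0, s0) \<in> open_rect B" "p z0 = chart B (t0, s0)" using B(2) by auto
  have x0r: "(t0, s0) \<in> rect B" using x0 open_rect_subset by blast
  obtain G where G: "box_lift B G" "G (t0, s0) = z0" by (rule box_lift_exists[OF fb x0r z0 x0(2)]) (rule that)
  obtain \<epsilon> where eps: "\<epsilon> > 0" "{t0 - \<epsilon>..t0 + \<epsilon>} \<times> {s0 - \<epsilon>..s0 + \<epsilon>} \<subseteq> open_rect B"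
    "\<And>s h \<Psi> t s'. s \<in> slice B \<Longrightarrow> \<bar>s - s0\<bar> < \<epsilon> \<Longrightarrow> leaf_lift h \<Longrightarrow> G (t0, s) \<in> range h \<Longrightarrow>
       geodesic_chart h \<Psi> \<Longrightarrow> \<bar>t - t0\<bar> \<le> \<epsilon> \<Longrightarrow> \<bar>s' - s0\<bar> \<le> \<epsilon> \<Longrightarrow>
       (s < s' \<longleftrightarrow> 0 < Im (\<Psi> (G (t, s')))) \<and> (s' < s \<longleftrightarrow> Im (\<Psi> (G (t, s'))) < 0)"
    by (rule oriented_box_sides[OF B(1) G(1) x0(1)]) (rule that)
  define I where "I = {s0 - \<epsilon><..<s0 + \<epsilon>}"
  define R where "R = {t0 - \<epsilon><..<t0 + \<epsilon>} \<times> I"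
  have Rsub: "R \<subseteq> open_rect B" using eps(2) by (auto simp: R_def I_def)
  have R_rect: "(t, s) \<in> rect B" if "t \<in> {t0 - \<epsilon><..<t0 + \<epsilon>}" "s \<in> I" for t s
    using that Rsub open_rect_subset by (force simp: R_def)
  have "open R" unfolding R_def I_def by (intro open_Times) auto
  then have "open (G ` R)" by (rule box_lift_open_map[OF fb G(1) _ Rsub])
  moreover have "z0 \<in> G ` R" using G(2) eps(1) by (intro image_eqI[of _ _ "(t0, s0)"]) (auto simp: R_def I_def)
  ultimately obtain r where r: "r > 0" "ball z0 r \<subseteq> G ` R" using open_contains_ball by blast
  have Gc: "continuous_on (rect B) G" and GH: "\<And>x. x \<in> rect B \<Longrightarrow> G x \<in> hyp_plane"
    using G(1) by (auto simp: box_lift_def)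
  define V where "V s = v (G (t0, s))" for s
  have off: "G (t, s) \<in> hyp_plane - lift_\<Lambda>" if "t \<in> {t0 - \<epsilon><..<t0 + \<epsilon>}" "s \<in> I" "s \<notin> slice B" for t s
    using box_lift_leaf_iff[OF fb G(1) R_rect[OF that(1,2)]] GH[OF R_rect[OF that(1,2)]] that(3) by blast
  have t0e: "t0 \<in> {t0 - \<epsilon><..<t0 + \<epsilon>}" using eps(1) by simp
  have vV: "v (G (t, s)) = V s" if ts: "t \<in> {t0 - \<epsilon><..<t0 + \<epsilon>}" "s \<in> I" "s \<notin> slice B" for t s
    unfolding V_def
  proof (rule v_connected[where S="(\<lambda>t. G (t, s)) ` {t0 - \<epsilon><..<t0 + \<epsilon>}"])
    show "connected ((\<lambda>t. G (t, s)) ` {t0 - \<epsilon><..<t0 + \<epsilon>})"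
      by (intro connected_continuous_image continuous_on_compose2[OF Gc])
        (use R_rect ts in \<open>auto intro!: continuous_intros\<close>)
    show "(\<lambda>t. G (t, s)) ` {t0 - \<epsilon><..<t0 + \<epsilon>} \<subseteq> hyp_plane - lift_\<Lambda>"
      using off ts(2,3) by (intro image_subsetI) blast
  qed (use ts t0e in auto)
  have vV_const: "V s = V s'" if J: "connected J" "J \<subseteq> I" "J \<inter> slice B = {}" "s \<in> J" "s' \<in> J" for J s s'
    unfolding V_def
  proof (rule v_connected[where S="(\<lambda>s. G (t0, s)) ` J"])
    show "connected ((\<lambda>s. G (t0, s)) ` J)"
      by (intro connected_continuous_image continuous_on_compose2[OF Gc])
        (use R_rect t0e J in \<open>auto intro!: continuous_intros\<close>)
    show "(\<lambda>s. G (t0, s)) ` J \<subseteq> hyp_plane - lift_\<Lambda>"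
      using off[OF t0e] J(2,3) by (intro image_subsetI) blast
  qed (use J in auto)
  have Isub: "smin B < s" "s < smax B" if "s \<in> I" for s
  proof -
    have "(t0, s) \<in> open_rect B" using Rsub that t0e by (auto simp: R_def)
    then show "smin B < s" "s < smax B" by (auto simp: open_rect_iff)
  qed
  have t0B: "t0 \<in> {tmin B<..<tmax B}" using x0(1) by (simp add: open_rect_iff)
  have Vmono: "V s \<le> V s'" if "s \<in> I" "s' \<in> I" "s \<notin> slice B" "s' \<notin> slice B" "s \<le> s'" for s s'
  proof (cases "s = s'")
    case False
    then show ?thesis unfolding V_def
      using vertical_monotone[OF ind tm B(1) G(1) t0B] Isub that by simp
  qed simp
  show thesis
  proof (rule that[OF r(1)])
    show "ball z0 r \<subseteq> hyp_plane" using r(2) GH R_rect by (force simp: R_def)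
    fix Q assume Q: "Q \<subseteq> ball z0 r"
    have QG: "\<exists>t s. t \<in> {t0 - \<epsilon><..<t0 + \<epsilon>} \<and> s \<in> I \<and> s \<notin> slice B \<and> z = G (t, s)" if "z \<in> Q" "z \<notin> lift_\<Lambda>" for z
    proof -
      have "z \<in> G ` R" using that Q r by blast
      then obtain t s where ts: "t \<in> {t0 - \<epsilon><..<t0 + \<epsilon>}" "s \<in> I" "z = G (t, s)" unfolding R_def by blast
      then have "s \<notin> slice B" using box_lift_leaf_iff[OF fb G(1) R_rect[OF ts(1,2)]] that(2) by simp
      then show ?thesis using ts by blast
    qed
    have nl: "negligible X" if "X \<subseteq> lift_\<Lambda>" for X
      using negligible_lamination_lift that negligible_subset by blast
    show "level_sides Q" unfolding level_sides_def
    proof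
      fix c
      define U where "U = {s\<in>I. s \<notin> slice B \<and> c \<le> V s}"
      have level: "c \<le> v z \<longleftrightarrow> s \<in> U" if "t \<in> {t0 - \<epsilon><..<t0 + \<epsilon>}" "s \<in> I" "s \<notin> slice B" "z = G (t, s)" for z t s
        using vV[OF that(1-3)] that by (simp add: U_def)
      consider "U = {}" | "\<forall>s\<in>I. s \<notin> slice B \<longrightarrow> s \<in> U" |
        "\<exists>a b. b \<in> U \<and> a \<in> I \<and> a \<notin> slice B \<and> a \<notin> U" by blast
      then show "\<exists>A. negligible ({z\<in>Q. c \<le> v z} - A) \<and> negligible (A - {z\<in>Q. c \<le> v z}) \<and>
        (A = {} \<or> A = Q \<or> (\<exists>h \<Psi>. leaf_lift h \<and> geodesic_chart h \<Psi> \<and> A = Q \<inter> {z\<in>hyp_plane. 0 < Im (\<Psi> z)}))"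
      proof cases
        case 1
        have "{z\<in>Q. c \<le> v z} - {} \<subseteq> lift_\<Lambda>" using QG level 1 by blast
        then show ?thesis using nl by (intro exI[of _ "{}"]) auto
      next
        case 2
        have "Q - {z\<in>Q. c \<le> v z} \<subseteq> lift_\<Lambda>" using QG level 2 by blast
        moreover have "{z\<in>Q. c \<le> v z} - Q = {}" by blast
        ultimately show ?thesis using nl by (intro exI[of _ Q]) auto
      next
        case 3
        then obtain a b where ab: "b \<in> U" "a \<in> I" "a \<notin> slice B" "a \<notin> U" by blast
        \<comment> \<open>The threshold of the level. It belongs to the slice: otherwise
          \<open>V\<close> would be constant around it, and points below it would belong to
          \<open>U\<close>.\<close>
        define \<sigma> where "\<sigma> = Inf U"
        have aU: "a < s" if "s \<in> U" for s
        proof (rule ccontr)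
          assume "\<not> a < s"
          then have "V s \<le> V a" using Vmono that ab by (auto simp: U_def)
          then show False using that ab by (auto simp: U_def)
        qed
        have bdd: "bdd_below U" using aU by (meson bdd_belowI less_imp_le)
        have sb: "\<sigma> \<le> b" unfolding \<sigma>_def by (rule cInf_lower[OF ab(1) bdd])
        have "a \<le> \<sigma>" unfolding \<sigma>_def by (rule cInf_greatest) (use ab(1) aU in \<open>auto intro: less_imp_le\<close>)
        then have sI: "\<sigma> \<in> I" using sb ab by (auto simp: U_def I_def)
        have s_slice: "\<sigma> \<in> slice B"
        proof (rule ccontr)
          assume ns: "\<sigma> \<notin> slice B"
          have "open (I - slice B)" using fb by (intro open_Diff) (auto simp: I_def flow_box_def)
          then obtain d where d: "d > 0" "ball \<sigma> d \<subseteq> I - slice B"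
            using sI ns open_contains_ball by (metis Diff_iff)
          obtain u where u: "u \<in> U" "u < \<sigma> + d" using cInf_lessD[of U "\<sigma> + d"] ab(1) d(1) by (auto simp: \<sigma>_def)
          have "\<sigma> \<le> u" unfolding \<sigma>_def by (rule cInf_lower[OF u(1) bdd])
          then have uJ: "u \<in> ball \<sigma> d" using u(2) by (auto simp: dist_real_def)
          have wJ: "\<sigma> - d / 2 \<in> ball \<sigma> d" using d(1) by (auto simp: dist_real_def)
          have "V u = V (\<sigma> - d / 2)"
            by (rule vV_const[OF _ _ _ uJ wJ]) (use d(2) in auto)
          moreover have "\<sigma> - d / 2 \<in> I - slice B" using wJ d(2) by (rule subsetD[rotated])
          ultimately have "\<sigma> - d / 2 \<in> U" using u(1) by (simp add: U_def)
          then have "\<sigma> \<le> \<sigma> - d / 2" unfolding \<sigma>_def by (rule cInf_lower[OF _ bdd])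
          then show False using d(1) by simp
        qed
        have thr: "s \<in> U \<longleftrightarrow> \<sigma> < s" if s: "s \<in> I" "s \<notin> slice B" for s
        proof
          assume sU: "s \<in> U"
          have "\<sigma> \<le> s" unfolding \<sigma>_def by (rule cInf_lower[OF sU bdd])
          moreover have "s \<noteq> \<sigma>" using s s_slice by blast
          ultimately show "\<sigma> < s" by simp
        next
          assume "\<sigma> < s"
          then obtain u where u: "u \<in> U" "u < s" using cInf_lessD[of U s] ab(1) by (auto simp: \<sigma>_def)
          then have "V u \<le> V s" using s by (intro Vmono) (auto simp: U_def)
          then show "s \<in> U" using u(1) s by (auto simp: U_def)
        qed
        have "G (t0, \<sigma>) \<in> lift_\<Lambda>" using box_lift_leaf_iff[OF fb G(1) R_rect[OF t0e sI]] s_slice by simp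
        then obtain h where h: "leaf_lift h" "G (t0, \<sigma>) \<in> range h" by (rule leaf_lift_through)
        obtain \<Psi> where P: "geodesic_chart h \<Psi>" using geodesic_chart_exists h by (auto simp: leaf_lift_def)
        have s\<epsilon>: "\<bar>\<sigma> - s0\<bar> < \<epsilon>" using sI by (auto simp: I_def abs_less_iff)
        define A where "A = Q \<inter> {z\<in>hyp_plane. 0 < Im (\<Psi> z)}"
        have eqv: "c \<le> v z \<longleftrightarrow> z \<in> A" if z: "z \<in> Q" "z \<notin> lift_\<Lambda>" for z
        proof -
          obtain t s where ts: "t \<in> {t0 - \<epsilon><..<t0 + \<epsilon>}" "s \<in> I" "s \<notin> slice B" "z = G (t, s)" using QG[OF z] by blast
          have "\<bar>t - t0\<bar> \<le> \<epsilon>" "\<bar>s - s0\<bar> \<le> \<epsilon>" using ts by (auto simp: I_def abs_le_iff)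
          then have "\<sigma> < s \<longleftrightarrow> 0 < Im (\<Psi> z)"
            using eps(3)[OF s_slice s\<epsilon> h P, of t s] ts(4) by simp
          moreover have "z \<in> hyp_plane" using GH[OF R_rect[OF ts(1,2)]] ts(4) by simp
          ultimately show ?thesis using level[OF ts] thr[OF ts(2,3)] z(1) by (simp add: A_def)
        qed
        have "{z\<in>Q. c \<le> v z} - A \<subseteq> lift_\<Lambda>" "A - {z\<in>Q. c \<le> v z} \<subseteq> lift_\<Lambda>"
          using eqv by (auto simp: A_def)
        then have "negligible ({z\<in>Q. c \<le> v z} - A)" "negligible (A - {z\<in>Q. c \<le> v z})" using nl by blast+
        then show ?thesis using h(1) P unfolding A_def by blast
      qed
    qed
  qed
qed

text \<open>If the left side of the leaf is convex, the bound is \<open>2 * perim a b\<close>. If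
  only the right side is, the left side is the rectangle without it up to a null set, and two such
  bounds add up to the factor 4.\<close>

lemma level_set_integral_bound:
  assumes ls: "level_sides (cbox a b)" and sub: "cbox a b \<subseteq> hyp_plane" and t: "partial_test \<psi> g"
  shows "\<bar>integral {z\<in>cbox a b. c \<le> v z} g\<bar> \<le> 4 * perim a b"
proof -
  obtain A where A: "negligible ({z\<in>cbox a b. c \<le> v z} - A)" "negligible (A - {z\<in>cbox a b. c \<le> v z})"
     "A = {} \<or> A = cbox a b \<or> (\<exists>h \<Psi>. leaf_lift h \<and> geodesic_chart h \<Psi> \<and> A = cbox a b \<inter> {z\<in>hyp_plane. 0 < Im (\<Psi> z)})"
    using ls unfolding level_sides_def by blast
  have eq: "integral {z\<in>cbox a b. c \<le> v z} g = integral A g"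
    by (rule integral_spike_set) (rule negligible_subset[OF A(1)] negligible_subset[OF A(2)]; blast)+
  have p0: "perim a b \<ge> 0" by (simp add: perim_def)
  have whole: "\<bar>integral (cbox a b) g\<bar> \<le> 2 * perim a b"
    by (rule convex_perimeter_bound[OF t]) auto
  from A(3) show ?thesis
  proof (elim disjE exE conjE)
    fix h \<Psi> assume h: "leaf_lift h" "geodesic_chart h \<Psi>" and AE: "A = cbox a b \<inter> {z\<in>hyp_plane. 0 < Im (\<Psi> z)}"
    define L where "L = cbox a b \<inter> {z\<in>hyp_plane. Im (\<Psi> z) < 0}"
    have hol: "continuous_on hyp_plane (\<lambda>z. Im (\<Psi> z))"
      using h(2) holomorphic_on_imp_continuous_on by (auto simp: geodesic_chart_def intro!: continuous_intros)
    have "{z\<in>hyp_plane. 0 < Im (\<Psi> z)} = hyp_plane \<inter> (\<lambda>z. Im (\<Psi> z)) -` {0<..}"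
      "{z\<in>hyp_plane. Im (\<Psi> z) < 0} = hyp_plane \<inter> (\<lambda>z. Im (\<Psi> z)) -` {..<0}" by auto
    then have "open {z\<in>hyp_plane. 0 < Im (\<Psi> z)}" "open {z\<in>hyp_plane. Im (\<Psi> z) < 0}"
      using continuous_open_preimage[OF hol open_hyp_plane] by (metis open_greaterThan, metis open_lessThan)
    then have bor: "A \<in> sets borel" "L \<in> sets borel" unfolding AE L_def by auto
    have sb: "A \<subseteq> cbox a b" "L \<subseteq> cbox a b" by (auto simp: AE L_def)
    have gc: "continuous_on UNIV g" using t by (simp add: partial_test_def)
    have int: "g integrable_on A" "g integrable_on L"
      using set_borel_integral_eq_integral(1)[OF continuous_set_integrable[OF gc bor(1) sb(1)]]
        set_borel_integral_eq_integral(1)[OF continuous_set_integrable[OF gc bor(2) sb(2)]] by auto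
    from h(2) have "convex {z\<in>hyp_plane. 0 < Im (\<Psi> z)} \<or> convex {z\<in>hyp_plane. Im (\<Psi> z) < 0}"
      by (simp add: geodesic_chart_def)
    then show ?thesis
    proof
      assume "convex {z\<in>hyp_plane. 0 < Im (\<Psi> z)}"
      then have "convex A" unfolding AE by (intro convex_Int) auto
      then have "\<bar>integral A g\<bar> \<le> 2 * perim a b" using convex_perimeter_bound[OF t _ bor(1) sb(1)] by simp
      then show ?thesis using eq p0 by linarith
    next
      assume "convex {z\<in>hyp_plane. Im (\<Psi> z) < 0}"
      then have "convex L" unfolding L_def by (intro convex_Int) auto
      then have bL: "\<bar>integral L g\<bar> \<le> 2 * perim a b" using convex_perimeter_bound[OF t _ bor(2) sb(2)] by simp
      have "cbox a b - (A \<union> L) \<subseteq> lift_\<Lambda>"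
      proof
        fix z assume z: "z \<in> cbox a b - (A \<union> L)"
        then have "z \<in> hyp_plane" "Im (\<Psi> z) = 0" using sub by (auto simp: AE L_def)
        then have "z \<in> range h" using h(2) by (simp add: geodesic_chart_def)
        then show "z \<in> lift_\<Lambda>" using leaf_lift_in(1)[OF h(1)] by blast
      qed
      then have n: "negligible (cbox a b - (A \<union> L))" using negligible_lamination_lift negligible_subset by blast
      have "integral (cbox a b) g = integral (A \<union> L) g"
      proof (rule integral_spike_set)
        show "negligible {x \<in> cbox a b - (A \<union> L). g x \<noteq> 0}" by (rule negligible_subset[OF n]) auto
        have "{x \<in> A \<union> L - cbox a b. g x \<noteq> 0} = {}" using sb by blast
        then show "negligible {x \<in> A \<union> L - cbox a b. g x \<noteq> 0}" by (simp only: negligible_empty)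
      qed
      also have "\<dots> = integral A g + integral L g"
      proof (rule integral_Un[OF int])
        have "A \<inter> L = {}" by (auto simp: AE L_def)
        then show "negligible (A \<inter> L)" by simp
      qed
      finally show ?thesis using eq whole bL by linarith
    qed
  qed (use eq whole p0 in auto)
qed

section \<open>Integrability and the gluing of rectangles\<close>

text \<open>Off the lamination \<open>v\<close> is locally constant, hence continuous. On it, every
  subset is measurable because Lebesgue measure is complete.\<close>

lemma v_measurable_parts:
  assumes Q: "Q \<in> sets borel" "Q \<subseteq> hyp_plane"
  shows "{z\<in>Q. c \<le> v z} \<in> sets lebesgue" "v \<in> borel_measurable (lebesgue_on (Q - lift_\<Lambda>))" "Q - lift_\<Lambda> \<in> sets lebesgue"
    "negligible (Q \<inter> lift_\<Lambda>)"
proof -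
  have eq: "Q - lift_\<Lambda> = Q \<inter> (hyp_plane - lift_\<Lambda>)" using Q(2) by blast
  have "Q - lift_\<Lambda> \<in> sets borel" unfolding eq using Q(1) open_off_lamination by auto
  then show l: "Q - lift_\<Lambda> \<in> sets lebesgue" by (simp add: sets_completionI_sets)
  have cont: "continuous_on (Q - lift_\<Lambda>) v" by (rule continuous_on_subset[OF v_continuous]) (auto simp: eq)
  show m: "v \<in> borel_measurable (lebesgue_on (Q - lift_\<Lambda>))"
    by (rule continuous_imp_measurable_on_sets_lebesgue[OF cont l])
  show n: "negligible (Q \<inter> lift_\<Lambda>)" using negligible_lamination_lift negligible_subset by blast
  have "{z\<in>Q - lift_\<Lambda>. c \<le> v z} \<in> sets (lebesgue_on (Q - lift_\<Lambda>))"
    using measurable_sets[OF m, of "{c..}"] by (simp add: vimage_def Int_def conj_commute)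
  then have "{z\<in>Q - lift_\<Lambda>. c \<le> v z} \<in> sets lebesgue" using l by (auto simp: sets_restrict_space_iff)
  moreover have "{z\<in>Q \<inter> lift_\<Lambda>. c \<le> v z} \<in> sets lebesgue"
    by (rule negligible_imp_sets) (rule negligible_subset[OF n], auto)
  moreover have "{z\<in>Q. c \<le> v z} = {z\<in>Q - lift_\<Lambda>. c \<le> v z} \<union> {z\<in>Q \<inter> lift_\<Lambda>. c \<le> v z}" by auto
  ultimately show "{z\<in>Q. c \<le> v z} \<in> sets lebesgue" by simp
qed

lemma v_absolutely_integrable_cbox:
  assumes sub: "cbox a b \<subseteq> hyp_plane" and bd: "\<And>z. z \<in> cbox a b \<Longrightarrow> \<bar>v z\<bar> \<le> D"
  shows "v absolutely_integrable_on (cbox a b)"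
proof -
  have bor: "cbox a b \<in> sets borel" by simp
  note m = v_measurable_parts[OF bor sub]
  have "(\<lambda>_. D) integrable_on (cbox a b - lift_\<Lambda>)"
  proof -
    have "cbox a b - lift_\<Lambda> \<in> lmeasurable"
      by (rule fmeasurableI2[OF lmeasurable_cbox[of a b] _ m(3)]) auto
    then show ?thesis using integrable_on_const by blast
  qed
  then have "v absolutely_integrable_on (cbox a b - lift_\<Lambda>)"
    using bd by (intro measurable_bounded_by_integrable_imp_absolutely_integrable[OF m(2,3)]) auto
  moreover have "negligible {x \<in> (cbox a b - lift_\<Lambda>) - cbox a b. v x \<noteq> 0}" by (rule negligible_subset[of "{}"]) auto
  moreover have "negligible {x \<in> cbox a b - (cbox a b - lift_\<Lambda>). v x \<noteq> 0}" by (rule negligible_subset[OF m(4)]) auto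
  ultimately show ?thesis using absolutely_integrable_spike_set_eq by blast
qed

lemma continuous_times_absolutely_integrable:
  fixes g w :: "complex \<Rightarrow> real"
  assumes "compact Q" "continuous_on UNIV g" "w absolutely_integrable_on Q"
  shows "(\<lambda>z. w z * g z) absolutely_integrable_on Q"
proof -
  have gQ: "continuous_on Q g" using assms(2) continuous_on_subset by blast
  have "(\<lambda>z. g z * w z) absolutely_integrable_on Q"
  proof (rule absolutely_integrable_bounded_measurable_product[where h="(*)" and f=g and g=w])
    show "bilinear ((*) :: real \<Rightarrow> real \<Rightarrow> real)" by (rule bilinear_times)
    show Ql: "Q \<in> sets lebesgue" using assms(1) by (simp add: lmeasurable_compact fmeasurableD)
    show "g \<in> borel_measurable (lebesgue_on Q)" by (rule continuous_imp_measurable_on_sets_lebesgue[OF gQ Ql])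
    show "bounded (g ` Q)" by (rule compact_imp_bounded[OF compact_continuous_image[OF gQ assms(1)]])
  qed (rule assms(3))
  then show ?thesis by (simp add: mult.commute)
qed

text \<open>The property is shaped for bisection: it holds for the empty set and passes to
  nonoverlapping unions. Null frontiers make the overlap of two such sets null, and compactness
  keeps the products with \<open>g\<close> integrable.\<close>

definition bv_set :: "complex set \<Rightarrow> bool" where
  "bv_set Q \<longleftrightarrow> compact Q \<and> negligible (frontier Q) \<and> v absolutely_integrable_on Q \<and>
     (\<exists>K. \<forall>\<psi> g. partial_test \<psi> g \<longrightarrow> \<bar>integral Q (\<lambda>z. v z * g z)\<bar> \<le> K)"

lemma bv_set_Un:
  assumes S: "bv_set S" and T: "bv_set T" and i: "interior S \<inter> interior T = {}"
  shows "bv_set (S \<union> T)"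
proof -
  obtain K1 K2 where K: "\<And>\<psi> g. partial_test \<psi> g \<Longrightarrow> \<bar>integral S (\<lambda>z. v z * g z)\<bar> \<le> K1"
      "\<And>\<psi> g. partial_test \<psi> g \<Longrightarrow> \<bar>integral T (\<lambda>z. v z * g z)\<bar> \<le> K2"
    using S T unfolding bv_set_def by blast
  have c: "compact S" "compact T" using S T by (auto simp: bv_set_def)
  have n: "negligible (frontier S \<union> frontier T)" using S T by (simp add: bv_set_def)
  have "S \<inter> T \<subseteq> frontier S \<union> frontier T"
    using i closure_subset[of S] closure_subset[of T] by (auto simp: frontier_def)
  then have ST: "negligible (S \<inter> T)" using n negligible_subset by blast
  have "\<bar>integral (S \<union> T) (\<lambda>z. v z * g z)\<bar> \<le> K1 + K2" if t: "partial_test \<psi> g" for \<psi> g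
  proof -
    have gc: "continuous_on UNIV g" using t by (simp add: partial_test_def)
    have "(\<lambda>z. v z * g z) integrable_on S" "(\<lambda>z. v z * g z) integrable_on T"
      using continuous_times_absolutely_integrable[OF c(1) gc, of v] continuous_times_absolutely_integrable[OF c(2) gc, of v] S T
      by (auto simp: bv_set_def absolutely_integrable_on_def)
    then have "integral (S \<union> T) (\<lambda>z. v z * g z) = integral S (\<lambda>z. v z * g z) + integral T (\<lambda>z. v z * g z)"
      using ST by (rule integral_Un)
    then show ?thesis using K(1)[OF t] K(2)[OF t] by linarith
  qed
  moreover have "negligible (frontier (S \<union> T))" using frontier_Un_subset n negligible_subset by blast
  moreover have "v absolutely_integrable_on (S \<union> T)"
    using S T by (intro absolutely_integrable_Un) (auto simp: bv_set_def)
  ultimately show ?thesis using c by (auto simp: bv_set_def compact_Un)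
qed

text \<open>Bisection of a rectangle that fails would produce arbitrarily small failing rectangles
  around one point. Near this point \<open>v\<close> is bounded and its levels are sides of leaves,
  so small rectangles do not fail.\<close>

lemma bv_set_cbox:
  assumes ind: "induced_by p M \<Lambda> Or v \<nu>" and tm: "is_transverse_measure M \<Lambda> \<nu>"
    and lb: "locally_bounded_on hyp_plane v" and sub: "cbox a b \<subseteq> hyp_plane"
  shows "bv_set (cbox a b)"
proof (rule ccontr)
  assume neg: "\<not> bv_set (cbox a b)"
  have emp: "bv_set {}" unfolding bv_set_def by (auto intro!: exI[of _ 0])
  obtain x where x: "x \<in> cbox a b"
    "\<forall>e>0. \<exists>c d. x \<in> cbox c d \<and> cbox c d \<subseteq> ball x e \<and> cbox c d \<subseteq> cbox a b \<and> \<not> bv_set (cbox c d)"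
    by (rule interval_bisection[of bv_set, OF emp bv_set_Un neg]) (auto intro: that)
  have xH: "x \<in> hyp_plane" using x(1) sub by blast
  obtain r where r: "r > 0" "ball x r \<subseteq> hyp_plane" "\<And>Q. Q \<subseteq> ball x r \<Longrightarrow> level_sides Q"
    by (rule level_sides_local[OF ind tm xH]) (rule that)
  obtain U where U: "open U" "x \<in> U" "bounded (v ` (U \<inter> hyp_plane))"
    using lb xH unfolding locally_bounded_on_def by blast
  obtain r' where r': "r' > 0" "ball x r' \<subseteq> U" using U open_contains_ball by blast
  obtain c d where cd: "x \<in> cbox c d" "cbox c d \<subseteq> ball x (min r r')" "cbox c d \<subseteq> cbox a b" "\<not> bv_set (cbox c d)"
  proof -
    have "min r r' > 0" using r(1) r'(1) by simp
    with x(2) show thesis using that by blast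
  qed
  have "ball x (min r r') \<subseteq> ball x r" "ball x (min r r') \<subseteq> ball x r'" by auto
  then have cr: "cbox c d \<subseteq> ball x r" "cbox c d \<subseteq> U" "cbox c d \<subseteq> hyp_plane"
    using cd(2) r(2) r'(2) by blast+
  obtain D where D: "D > 0" "\<forall>y\<in>v ` (U \<inter> hyp_plane). norm y \<le> D" using U(3) bounded_pos by blast
  have vD: "\<bar>v z\<bar> \<le> D" if "z \<in> cbox c d" for z using D(2) cr that by auto
  have vi: "v absolutely_integrable_on (cbox c d)" by (rule v_absolutely_integrable_cbox[OF cr(3) vD])
  \<comment> \<open>The values of \<open>v\<close> lie between \<open>- D\<close> and
    \<open>D\<close>, so the ground level is \<open>- D\<close> and the total height is
    \<open>2 * D\<close>.\<close>
  have "\<bar>integral (cbox c d) (\<lambda>z. v z * g z)\<bar> \<le> (\<bar>- D\<bar> + 2 * D) * (4 * perim c d)" if t: "partial_test \<psi> g" for \<psi> g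
  proof (rule layer_cake_bound)
    have gc: "continuous_on UNIV g" using t by (simp add: partial_test_def)
    show "(\<lambda>z. v z * g z) integrable_on cbox c d"
      using continuous_times_absolutely_integrable[OF compact_cbox gc vi] by (simp add: absolutely_integrable_on_def)
    show "g absolutely_integrable_on cbox c d"
      by (rule absolutely_integrable_continuous) (rule continuous_on_subset[OF gc], simp)
    show "0 < 2 * D" using D(1) by simp
    show "- D \<le> v z" "v z \<le> - D + 2 * D" if "z \<in> cbox c d" for z using vD[OF that] by auto
    show "{z \<in> cbox c d. e \<le> v z} \<in> sets lebesgue" for e by (rule v_measurable_parts(1)) (use cr in auto)
    show "\<bar>integral {z \<in> cbox c d. e \<le> v z} g\<bar> \<le> 4 * perim c d" for e
      by (rule level_set_integral_bound[OF r(3)[OF cr(1)] cr(3) t])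
  qed
  then have "bv_set (cbox c d)" unfolding bv_set_def
    using vi negligible_convex_frontier[of "cbox c d"] by auto
  then show False using cd(4) by blast
qed

lemma transverse_measure_bounded_variation:
  assumes ind: "induced_by p M \<Lambda> Or v \<nu>" and tm: "is_transverse_measure M \<Lambda> \<nu>"
    and lb: "locally_bounded_on hyp_plane v"
  shows "locally_bounded_variation_on hyp_plane v"
  unfolding locally_bounded_variation_on_def
proof (intro allI impI; elim conjE)
  fix C assume C: "compact C" "C \<subseteq> hyp_plane"
  show "v absolutely_integrable_on C \<and> (\<exists>V. \<forall>(\<phi> :: complex \<Rightarrow> complex) D.
           (\<forall>z. (\<phi> has_derivative D z) (at z)) \<and>
           continuous_on UNIV (\<lambda>z. D z 1) \<and> continuous_on UNIV (\<lambda>z. D z \<i>) \<and>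
           (\<forall>z. z \<notin> C \<longrightarrow> \<phi> z = 0) \<and> (\<forall>z. cmod (\<phi> z) \<le> 1) \<longrightarrow>
           \<bar>LINT z:C|lebesgue. v z * (Re (D z 1) + Im (D z \<i>))\<bar> \<le> V)"
  proof -
    obtain y0 where y0: "y0 > 0" "\<And>z. z \<in> C \<Longrightarrow> y0 \<le> Im z"
    proof (cases "C = {}")
      case True
      then show thesis using that[of 1] by auto
    next
      case False
      have "continuous_on C Im" by (intro continuous_intros)
      then obtain w where "w \<in> C" "\<forall>z\<in>C. Im w \<le> Im z" using continuous_attains_inf[OF C(1) False] by blast
      then show thesis using that[of "Im w"] C(2) by (auto simp: hyp_plane_def)
    qed
    obtain R where R: "\<And>z. z \<in> C \<Longrightarrow> cmod z \<le> R" using compact_imp_bounded[OF C(1)] bounded_iff by blast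
    define a b where "a = Complex (- R) y0" and "b = Complex R R"
    have Cab: "C \<subseteq> cbox a b"
    proof
      fix z assume z: "z \<in> C"
      have "\<bar>Re z\<bar> \<le> R" "\<bar>Im z\<bar> \<le> R" using R[OF z] abs_Re_le_cmod[of z] abs_Im_le_cmod[of z] by linarith+
      then show "z \<in> cbox a b" using y0(2)[OF z] by (auto simp: a_def b_def in_cbox_complex_iff)
    qed
    have sub: "cbox a b \<subseteq> hyp_plane" using y0(1) by (auto simp: a_def in_cbox_complex_iff hyp_plane_def)
    have bv: "bv_set (cbox a b)" by (rule bv_set_cbox[OF ind tm lb sub])
    then have vi: "v absolutely_integrable_on cbox a b" by (simp add: bv_set_def)
    obtain K where K: "\<And>\<psi> g. partial_test \<psi> g \<Longrightarrow> \<bar>integral (cbox a b) (\<lambda>z. v z * g z)\<bar> \<le> K"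
      using bv unfolding bv_set_def by blast
    have Cl: "C \<in> sets lebesgue" using C(1) by (simp add: lmeasurable_compact fmeasurableD)
    have viC: "v absolutely_integrable_on C" by (rule set_integrable_subset[OF vi Cl Cab])
    have "\<bar>LINT z:C|lebesgue. v z * (Re (D z 1) + Im (D z \<i>))\<bar> \<le> K + K"
      if der: "\<And>z. (\<phi> has_derivative D z) (at z)"
        and cD: "continuous_on UNIV (\<lambda>z. D z 1)" "continuous_on UNIV (\<lambda>z. D z \<i>)"
        and out: "\<And>z. z \<notin> C \<Longrightarrow> \<phi> z = 0" and one: "\<And>z. cmod (\<phi> z) \<le> 1"
      for \<phi> :: "complex \<Rightarrow> complex" and D
    proof -
      \<comment> \<open>The complement of \<open>C\<close> is open, so the derivative of the test
        field vanishes there as well. This permits replacing \<open>C\<close>, whose shape is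
        unknown, by the rectangle.\<close>
      have D0: "D z = (\<lambda>_. 0)" if "z \<notin> C" for z
      proof -
        have "open (- C)" using C(1) by (simp add: compact_imp_closed open_Compl)
        then have "(\<phi> has_derivative (\<lambda>_. 0)) (at z)"
          using that out by (intro has_derivative_transform_within_open[OF has_derivative_const[of 0]]) auto
        then show ?thesis using has_derivative_unique[OF der[of z]] by blast
      qed
      \<comment> \<open>The divergence splits into the derivative of \<open>Re \<phi>\<close> along
        the real axis and that of \<open>Im \<phi>\<close> along the imaginary axis. Each part is
        bounded by \<open>K\<close>, hence the bound \<open>K + K\<close>.\<close>
      have t1: "partial_test (\<lambda>z. Re (\<phi> z)) (\<lambda>z. Re (D z 1))" unfolding partial_test_def
      proof (intro conjI disjI1 allI)
        show "continuous_on UNIV (\<lambda>z. Re (D z 1))" by (intro continuous_intros cD)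
        show "\<bar>Re (\<phi> z)\<bar> \<le> 1" for z using one[of z] abs_Re_le_cmod[of "\<phi> z"] by linarith
        fix x y
        have "((\<lambda>x. Complex x y) has_derivative (\<lambda>h. of_real h)) (at x)"
          unfolding Complex_eq by (auto intro!: derivative_eq_intros)
        from has_derivative_compose[OF this der]
        have "((\<lambda>x. Re (\<phi> (Complex x y))) has_derivative (\<lambda>h. Re (D (Complex x y) (of_real h)))) (at x)"
          by (intro derivative_intros)
        moreover have "(\<lambda>h. Re (D (Complex x y) (of_real h))) = (\<lambda>h. Re (D (Complex x y) 1) * h)"
        proof
          fix h :: real
          have "linear (D (Complex x y))" using der has_derivative_linear by blast
          from linear_cmul[OF this, of h 1] show "Re (D (Complex x y) (of_real h)) = Re (D (Complex x y) 1) * h"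
            by (simp add: scaleR_conv_of_real)
        qed
        ultimately show "((\<lambda>x. Re (\<phi> (Complex x y))) has_real_derivative Re (D (Complex x y) 1)) (at x)"
          by (simp add: has_field_derivative_def)
      qed
      have t2: "partial_test (\<lambda>z. Im (\<phi> z)) (\<lambda>z. Im (D z \<i>))" unfolding partial_test_def
      proof (intro conjI disjI2 allI)
        show "continuous_on UNIV (\<lambda>z. Im (D z \<i>))" by (intro continuous_intros cD)
        show "\<bar>Im (\<phi> z)\<bar> \<le> 1" for z using one[of z] abs_Im_le_cmod[of "\<phi> z"] by linarith
        fix x y
        have "((\<lambda>y. Complex x y) has_derivative (\<lambda>h. \<i> * of_real h)) (at y)"
          unfolding Complex_eq by (auto intro!: derivative_eq_intros)
        from has_derivative_compose[OF this der]
        have "((\<lambda>y. Im (\<phi> (Complex x y))) has_derivative (\<lambda>h. Im (D (Complex x y) (\<i> * of_real h)))) (at y)"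
          by (intro derivative_intros)
        moreover have "(\<lambda>h. Im (D (Complex x y) (\<i> * of_real h))) = (\<lambda>h. Im (D (Complex x y) \<i>) * h)"
        proof
          fix h :: real
          have "linear (D (Complex x y))" using der has_derivative_linear by blast
          from linear_cmul[OF this, of h \<i>] show "Im (D (Complex x y) (\<i> * of_real h)) = Im (D (Complex x y) \<i>) * h"
            by (simp add: scaleR_conv_of_real mult.commute)
        qed
        ultimately show "((\<lambda>y. Im (\<phi> (Complex x y))) has_real_derivative Im (D (Complex x y) \<i>)) (at y)"
          by (simp add: has_field_derivative_def)
      qed
      have ai: "(\<lambda>z. v z * Re (D z 1)) absolutely_integrable_on cbox a b"
        "(\<lambda>z. v z * Im (D z \<i>)) absolutely_integrable_on cbox a b"
        by (intro continuous_times_absolutely_integrable vi compact_cbox continuous_intros cD)+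
      have g: "continuous_on UNIV (\<lambda>z. Re (D z 1) + Im (D z \<i>))" by (intro continuous_intros cD)
      have "(LINT z:C|lebesgue. v z * (Re (D z 1) + Im (D z \<i>))) = integral C (\<lambda>z. v z * (Re (D z 1) + Im (D z \<i>)))"
        by (rule set_lebesgue_integral_eq_integral(2)) (rule continuous_times_absolutely_integrable[OF C(1) g viC])
      also have "\<dots> = integral (cbox a b) (\<lambda>z. v z * (Re (D z 1) + Im (D z \<i>)))"
      proof (rule integral_spike_set)
        have "{z \<in> C - cbox a b. v z * (Re (D z 1) + Im (D z \<i>)) \<noteq> 0} = {}" using Cab by blast
        then show "negligible {z \<in> C - cbox a b. v z * (Re (D z 1) + Im (D z \<i>)) \<noteq> 0}"
          by (simp only: negligible_empty)
        have "v z * (Re (D z 1) + Im (D z \<i>)) = 0" if "z \<notin> C" for z by (subst (1 2) D0[OF that]) simp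
        then have "{z \<in> cbox a b - C. v z * (Re (D z 1) + Im (D z \<i>)) \<noteq> 0} = {}" by blast
        then show "negligible {z \<in> cbox a b - C. v z * (Re (D z 1) + Im (D z \<i>)) \<noteq> 0}"
          by (simp only: negligible_empty)
      qed
      also have "\<dots> = integral (cbox a b) (\<lambda>z. v z * Re (D z 1)) + integral (cbox a b) (\<lambda>z. v z * Im (D z \<i>))"
        unfolding distrib_left using ai by (intro integral_add) (auto simp: absolutely_integrable_on_def)
      finally show ?thesis using K[OF t1] K[OF t2] by linarith
    qed
    then show ?thesis using viC by blast
  qed
qed

end

theorem theorem1p4:
  fixes M :: "'m::metric_space set" and p :: "complex \<Rightarrow> 'm"
    and \<Lambda> :: "'m set" and Or :: "(real \<Rightarrow> 'm) set"
    and v :: "complex \<Rightarrow> real" and \<alpha> :: "(complex \<Rightarrow> complex) \<Rightarrow> real"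
  assumes "closed_oriented_hyperbolic_surface p M"
    and "oriented_geodesic_lamination p M \<Lambda> Or"
    and "period_homomorphism p \<alpha>"
    and "\<forall>\<gamma>\<in>deck_group p. \<forall>z\<in>hyp_plane. v (\<gamma> z) = v z + \<alpha> \<gamma>"
    and "\<forall>S\<in>components (hyp_plane - lamination_lift p \<Lambda>). v constant_on S"
    and "locally_bounded_on hyp_plane v"
  shows "(\<exists>\<nu>. induced_by p M \<Lambda> Or v \<nu>) \<and>
    (\<forall>\<nu>. induced_by p M \<Lambda> Or v \<nu> \<longrightarrow>
       transverse_cocycle M \<Lambda> \<nu> \<and>
       (is_transverse_measure M \<Lambda> \<nu> \<longrightarrow> locally_bounded_variation_on hyp_plane v))"
proof -
  interpret plaque_function p M \<Lambda> Or v \<alpha>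
    by unfold_locales (rule assms)+
  show ?thesis
    by (intro conjI allI impI) (rule induced_exists, erule induced_transverse_cocycle,
      rule transverse_measure_bounded_variation[OF _ _ assms(6)])
qed

end
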